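(* Let $\sigma\in\mathcal{S}(\mathbb{R}^d_+)$ and let $\sigma_0(\rho)=\sigma(2\rho)$, $\rho\in\mathbb{R}^d_+$, and $\tilde\sigma_0=\sigma_0\circ v\in\mathcal{S}(\mathbb{R}^{2d})$. Then the Weyl pseudo-differential operator $W_{\tilde\sigma_0}$ extends to a continuous mapping $W_{\tilde\sigma_0}:(\mathcal{S}(\mathbb{R}^d))'\to\mathcal{S}(\mathbb{R}^d)$. If $f,g\in(\mathcal{S}(\mathbb{R}^d))'$ and $$f_k=\langle f,h_k\rangle,\quad g_k=\langle g,h_k\rangle,\quad\sigma_k=(2\pi)^{d/2}(-1)^{|k|}2^{-d}\int_{\mathbb{R}^d_+}\sigma(\rho)\mathcal{L}_k(\rho)\,d\rho,\qquad k\in\mathbb{N}_0^d,$$ then $(W_{\tilde\sigma_0}f)(g)=(2\pi)^{-d/2}\sum_{k\in\mathbb{N}_0^d}f_kg_k\sigma_k$. Moreover, if $\sigma_j\in\mathcal{S}(\mathbb{R}^d_+)$, $\sigma_{0,j}(\rho)=\sigma_j(2\rho)$, $\tilde\sigma_{0,j}=\sigma_{0,j}\circ v$ for $j\in\mathbb{N}$, and $\sigma_{0,j}\to\sigma_0$ in $\mathcal{S}(\mathbb{R}^d_+)$ as $j\to\infty$, then $W_{\tilde\sigma_{0,j}}\to W_{\tilde\sigma_0}$ in the strong topology of $\mathcal{L}((\mathcal{S}(\mathbb{R}^d))',\mathcal{S}(\mathbb{R}^d))$.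
   Context: $\mathbb{R}^d_+=(0,\infty)^d$, $\mathbb{N}_0=\{0,1,2,\dots\}$, $|k|=k_1+\dots+k_d$. The map $v:\mathbb{R}^{2d}\to[0,\infty)^d$ is $v(x,\xi)=(x_1^2+\xi_1^2,\dots,x_d^2+\xi_d^2)$. $\mathcal{S}(\mathbb{R}^d_+)$ is the Fréchet space of all $f\in C^\infty(\mathbb{R}^d_+)$ all of whose derivatives extend continuously to $[0,\infty)^d$ and with $\sup_{x\in\mathbb{R}^d_+}x^k|D^pf(x)|<\infty$ for all $k,p\in\mathbb{N}_0^d$ (these are the defining seminorms). $\mathcal{S}(\mathbb{R}^d)$ is the Schwartz space and $(\mathcal{S}(\mathbb{R}^d))'$ its strong dual. $h_k$ are the Hermite functions: $h_j(t)=(2^jj!\sqrt\pi)^{-1/2}e^{-t^2/2}H_j(t)$, $H_j(t)=(-1)^je^{t^2}\frac{d^j}{dt^j}e^{-t^2}$, $h_k(x)=\prod_lh_{k_l}(x_l)$. Laguerre functions: $\mathcal{L}_k(t)=\prod_lL_{k_l}(t_l)e^{-t_l/2}$, $L_j(t)=\frac{e^t}{j!}\frac{d^j}{dt^j}(e^{-t}t^j)$. For $\tau\in\mathcal{S}(\mathbb{R}^{2d})$ the Weyl pseudo-differential operator with symbol $\tau$ is $(W_\tau f)(x)=(2\pi)^{-d}\int_{\mathbb{R}^d}\int_{\mathbb{R}^d}e^{i(x-y)\cdot\xi}\tau\left(\frac{x+y}2,\xi\right)f(y)\,dy\,d\xi$, $f\in\mathcal{S}(\mathbb{R}^d)$.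 When $W_\tau f\in\mathcal{S}(\mathbb{R}^d)$ and $g\in(\mathcal{S}(\mathbb{R}^d))'$, $(W_\tau f)(g)$ denotes the (bilinear) dual pairing $\langle g,W_\tau f\rangle$. $\mathcal{L}(E,F)$ is the space of continuous linear maps $E\to F$; its strong topology is that of uniform convergence on bounded subsets of $E$. *)

theory Defs
  imports "HOL-Analysis.Analysis"
begin

section \<open>Locally convex spaces of functions\<close>

definition seminorm_topology :: "'v::minus set \<Rightarrow> ('v \<Rightarrow> real) set \<Rightarrow> 'v topology" where
  "seminorm_topology V P =
     topology_generated_by {{g \<in> V. p (g - f) < e} | f p e. f \<in> V \<and> p \<in> P \<and> e > 0}"

text \<open>Empty sets are left out only because the supremum of the empty set of reals is unspecified.\<close>

definition bounded_sets :: "'v set \<Rightarrow> ('v \<Rightarrow> real) set \<Rightarrow> 'v set set" where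
  "bounded_sets V P = {B. B \<subseteq> V \<and> B \<noteq> {} \<and> (\<forall>p\<in>P. bdd_above (p ` B))}"

definition continuous_linear_maps ::
  "('x \<Rightarrow> complex) topology \<Rightarrow> ('y \<Rightarrow> complex) topology \<Rightarrow> (('x \<Rightarrow> complex) \<Rightarrow> 'y \<Rightarrow> complex) set" where
  "continuous_linear_maps X Y = {T. continuous_map X Y T \<and>
     (\<forall>f\<in>topspace X. \<forall>g\<in>topspace X. \<forall>a. T (\<lambda>x. a * f x + g x) = (\<lambda>y. a * T f y + T g y))}"

definition strong_operator_topology ::
  "('x \<Rightarrow> complex) set \<Rightarrow> (('x \<Rightarrow> complex) \<Rightarrow> real) set \<Rightarrow>
   ('y \<Rightarrow> complex) set \<Rightarrow> (('y \<Rightarrow> complex) \<Rightarrow> real) set \<Rightarrow>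
   (('x \<Rightarrow> complex) \<Rightarrow> 'y \<Rightarrow> complex) topology" where
  "strong_operator_topology E P F Q =
     seminorm_topology (continuous_linear_maps (seminorm_topology E P) (seminorm_topology F Q))
       {\<lambda>T. SUP u\<in>B. q (T u) | B q. B \<in> bounded_sets E P \<and> q \<in> Q}"

section \<open>Smooth functions and Schwartz spaces\<close>

text \<open>A derivative \<open>D\<^sup>p\<close> is given by a list of basis vectors in which the \<open>i\<close>-th basis vector
  occurs \<open>p\<^sub>i\<close> times; for smooth functions the order of the list is irrelevant. Ranging over all
  lists of basis vectors thus amounts to ranging over all multi-indices \<open>p\<close>.\<close>

fun partial_derivs :: "'a::euclidean_space list \<Rightarrow> ('a \<Rightarrow> complex) \<Rightarrow> 'a \<Rightarrow> complex" where
  "partial_derivs [] f = f"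
| "partial_derivs (b # bs) f = (\<lambda>x. frechet_derivative (partial_derivs bs f) (at x) b)"

text \<open>To be used for open \<open>\<Omega>\<close> only.\<close>

definition smooth_on :: "'a::euclidean_space set \<Rightarrow> ('a \<Rightarrow> complex) \<Rightarrow> bool" where
  "smooth_on \<Omega> f \<longleftrightarrow> (\<forall>bs. set bs \<subseteq> Basis \<longrightarrow> (\<forall>x\<in>\<Omega>. partial_derivs bs f differentiable (at x)))"

definition monomial :: "('a::euclidean_space \<Rightarrow> nat) \<Rightarrow> 'a \<Rightarrow> real" where
  "monomial k x = (\<Prod>b\<in>Basis. (x \<bullet> b) ^ k b)"

definition weighted_deriv ::
  "('a::euclidean_space \<Rightarrow> nat) \<Rightarrow> 'a list \<Rightarrow> ('a \<Rightarrow> complex) \<Rightarrow> 'a \<Rightarrow> real" where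
  "weighted_deriv k bs f x = \<bar>monomial k x\<bar> * norm (partial_derivs bs f x)"

definition schwartz_seminorms :: "'a::euclidean_space set \<Rightarrow> (('a \<Rightarrow> complex) \<Rightarrow> real) set" where
  "schwartz_seminorms \<Omega> = {\<lambda>f. SUP x\<in>\<Omega>. weighted_deriv k bs f x | k bs. set bs \<subseteq> Basis}"

definition schwartz_bounds :: "'a::euclidean_space set \<Rightarrow> ('a \<Rightarrow> complex) \<Rightarrow> bool" where
  "schwartz_bounds \<Omega> f \<longleftrightarrow>
     (\<forall>k bs. set bs \<subseteq> Basis \<longrightarrow> bdd_above (weighted_deriv k bs f ` \<Omega>))"

definition schwartz :: "('a::euclidean_space \<Rightarrow> complex) set" where
  "schwartz = {f. smooth_on UNIV f \<and> schwartz_bounds UNIV f}"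

definition schwartz_topology :: "('a::euclidean_space \<Rightarrow> complex) topology" where
  "schwartz_topology = seminorm_topology schwartz (schwartz_seminorms UNIV)"

definition pos_orthant :: "(real ^ 'n::finite) set" where
  "pos_orthant = {x. \<forall>i. 0 < x $ i}"

definition closed_orthant :: "(real ^ 'n::finite) set" where
  "closed_orthant = {x. \<forall>i. 0 \<le> x $ i}"

text \<open>A function on the open orthant is represented by a total function whose values off the
  open orthant are arbitrary; nothing below depends on those values.\<close>

definition schwartz_orthant :: "(real ^ 'n::finite \<Rightarrow> complex) set" where
  "schwartz_orthant = {f. smooth_on pos_orthant f \<and>
     (\<forall>bs. set bs \<subseteq> Basis \<longrightarrow>
        (\<exists>g. continuous_on closed_orthant g \<and> (\<forall>x\<in>pos_orthant. g x = partial_derivs bs f x))) \<and>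
     schwartz_bounds pos_orthant f}"

definition schwartz_orthant_topology :: "(real ^ 'n::finite \<Rightarrow> complex) topology" where
  "schwartz_orthant_topology = seminorm_topology schwartz_orthant (schwartz_seminorms pos_orthant)"

section \<open>Tempered distributions\<close>

text \<open>A functional on \<open>schwartz\<close> is represented by the total function that vanishes off
  \<open>schwartz\<close>, so that each distribution has exactly one representative.\<close>

definition tempered :: "(('a::euclidean_space \<Rightarrow> complex) \<Rightarrow> complex) set" where
  "tempered = {u. continuous_map schwartz_topology euclidean u \<and>
     (\<forall>f\<in>schwartz. \<forall>g\<in>schwartz. \<forall>a. u (\<lambda>x. a * f x + g x) = a * u f + u g) \<and>
     (\<forall>f. f \<notin> schwartz \<longrightarrow> u f = 0)}"

definition strong_dual_seminorms ::
  "((('a::euclidean_space \<Rightarrow> complex) \<Rightarrow> complex) \<Rightarrow> real) set" where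
  "strong_dual_seminorms =
     {\<lambda>u. SUP \<phi>\<in>B. norm (u \<phi>) | B. B \<in> bounded_sets schwartz (schwartz_seminorms UNIV)}"

definition strong_dual_topology :: "(('a::euclidean_space \<Rightarrow> complex) \<Rightarrow> complex) topology" where
  "strong_dual_topology = seminorm_topology tempered strong_dual_seminorms"

definition distribution_of :: "('a::euclidean_space \<Rightarrow> complex) \<Rightarrow> ('a \<Rightarrow> complex) \<Rightarrow> complex" where
  "distribution_of f = (\<lambda>\<phi>. if \<phi> \<in> schwartz then LINT x|lborel. f x * \<phi> x else 0)"

text \<open>The strong topology on the continuous linear maps from the strong dual to \<open>schwartz\<close>.\<close>

definition dual_to_schwartz_topology ::
  "((('a::euclidean_space \<Rightarrow> complex) \<Rightarrow> complex) \<Rightarrow> 'a \<Rightarrow> complex) topology" where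
  "dual_to_schwartz_topology =
     strong_operator_topology tempered strong_dual_seminorms schwartz (schwartz_seminorms UNIV)"

section \<open>Hermite and Laguerre functions\<close>

definition hermite_poly :: "nat \<Rightarrow> real \<Rightarrow> real" where
  "hermite_poly j t = (-1) ^ j * exp (t\<^sup>2) * (deriv ^^ j) (\<lambda>s. exp (- (s\<^sup>2))) t"

definition hermite_fun1 :: "nat \<Rightarrow> real \<Rightarrow> real" where
  "hermite_fun1 j t = exp (- (t\<^sup>2) / 2) * hermite_poly j t / sqrt (2 ^ j * fact j * sqrt pi)"

definition hermite_fun :: "nat ^ 'n::finite \<Rightarrow> real ^ 'n \<Rightarrow> complex" where
  "hermite_fun k x = complex_of_real (\<Prod>l\<in>UNIV. hermite_fun1 (k $ l) (x $ l))"

definition laguerre_poly :: "nat \<Rightarrow> real \<Rightarrow> real" where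
  "laguerre_poly j t = exp t / fact j * (deriv ^^ j) (\<lambda>s. exp (- s) * s ^ j) t"

definition laguerre_fun :: "nat ^ 'n::finite \<Rightarrow> real ^ 'n \<Rightarrow> complex" where
  "laguerre_fun k t =
     complex_of_real (\<Prod>l\<in>UNIV. laguerre_poly (k $ l) (t $ l) * exp (- (t $ l) / 2))"

definition laguerre_coeff :: "(real ^ 'n::finite \<Rightarrow> complex) \<Rightarrow> nat ^ 'n \<Rightarrow> complex" where
  "laguerre_coeff \<sigma> k =
     complex_of_real ((2 * pi) powr (real CARD('n) / 2) * (-1) ^ (\<Sum>l\<in>UNIV. k $ l) / 2 ^ CARD('n)) *
     (LINT \<rho>:pos_orthant|lborel. \<sigma> \<rho> * laguerre_fun k \<rho>)"

section \<open>Weyl operators\<close>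

definition weyl :: "((real ^ 'n::finite) \<times> (real ^ 'n) \<Rightarrow> complex) \<Rightarrow>
    (real ^ 'n \<Rightarrow> complex) \<Rightarrow> real ^ 'n \<Rightarrow> complex" where
  "weyl \<tau> f x = complex_of_real (1 / (2 * pi) ^ CARD('n)) *
     (LINT \<xi>|lborel. LINT y|lborel.
        exp (\<i> * complex_of_real ((x - y) \<bullet> \<xi>)) * \<tau> ((1 / 2) *\<^sub>R (x + y), \<xi>) * f y)"

text \<open>\<open>weyl_extension \<tau> W\<close>: the restriction of \<open>W\<close> to the tempered distributions is a continuous
  linear extension of \<open>weyl \<tau>\<close>, with \<open>schwartz\<close> embedded in its dual by \<open>distribution_of\<close>.\<close>

definition weyl_extension :: "((real ^ 'n::finite) \<times> (real ^ 'n) \<Rightarrow> complex) \<Rightarrow>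
    (((real ^ 'n \<Rightarrow> complex) \<Rightarrow> complex) \<Rightarrow> real ^ 'n \<Rightarrow> complex) \<Rightarrow> bool" where
  "weyl_extension \<tau> W \<longleftrightarrow>
     W \<in> continuous_linear_maps strong_dual_topology schwartz_topology \<and>
     (\<forall>f\<in>schwartz. W (distribution_of f) = weyl \<tau> f)"

definition square_moduli :: "(real ^ 'n::finite) \<times> (real ^ 'n) \<Rightarrow> real ^ 'n" where
  "square_moduli = (\<lambda>(x, \<xi>). \<chi> j. (x $ j)\<^sup>2 + (\<xi> $ j)\<^sup>2)"

text \<open>\<open>square_moduli\<close> takes values on the boundary of the orthant, where a function in
  \<open>schwartz_orthant\<close> has to be read as its continuous extension.\<close>

definition orthant_extension :: "(real ^ 'n::finite \<Rightarrow> complex) \<Rightarrow> real ^ 'n \<Rightarrow> complex" where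
  "orthant_extension f x = Lim (at x within pos_orthant) f"

definition dilate2 :: "(real ^ 'n::finite \<Rightarrow> complex) \<Rightarrow> real ^ 'n \<Rightarrow> complex" where
  "dilate2 \<sigma> \<rho> = \<sigma> (2 *\<^sub>R \<rho>)"

definition radial_symbol ::
  "(real ^ 'n::finite \<Rightarrow> complex) \<Rightarrow> (real ^ 'n) \<times> (real ^ 'n) \<Rightarrow> complex" where
  "radial_symbol \<sigma> = orthant_extension (dilate2 \<sigma>) \<circ> square_moduli"

end

theory Submission
  imports Defs "HOL-Probability.Probability" "HOL-Computational_Algebra.Polynomial"
begin

text \<open>A radial symbol \<open>\<tau>\<close> is even in \<open>\<xi>\<close> and invariant under the rotations of each phase plane
  \<open>(x\<^sub>j, \<xi>\<^sub>j)\<close>. The pairing of \<open>weyl \<tau> f\<close> with \<open>g\<close> is \<open>(2\<pi>)\<^sup>-\<^sup>n\<close> times the integral of \<open>\<tau>\<close> against the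
  Wigner function of \<open>f\<close> and \<open>g\<close>. The Wigner function of two different Hermite functions picks up a
  nontrivial phase under some rotation, so its integral against \<open>\<tau>\<close> vanishes; that of \<open>h\<^sub>k\<close> with itself is, by
  its three-term recurrence, a Laguerre function of the squared moduli. Hence \<open>h\<^sub>k\<close> is an eigenfunction of
  \<open>weyl \<tau>\<close> whose eigenvalue is the normalised Laguerre coefficient of \<open>\<sigma>\<close>. Integration by
  parts against the Laguerre equation bounds these eigenvalues, with any polynomial weight in \<open>k\<close>, by
  seminorms of \<open>\<sigma>\<close>, so that the operator with these eigenvalues maps distributions to Schwartz functions.
  Density of the Hermite functions in the strong dual gives its uniqueness and the bilinear formula.\<close>

text \<open>\<open>weyl \<tau> f\<close> is first known only as a bounded continuous function whose
  Hermite coefficients are Wigner integrals. It is recognised as a Schwartz function because a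
  bounded continuous function with rapidly decreasing Hermite coefficients equals its Hermite
  series. So completeness of the Hermite functions is proved for bounded continuous functions, by
  Gaussian moments. Integration by parts is done by differentiating along flows: translations on the
  whole space, coordinate dilations on the orthant. Dilations preserve the orthant, so the Laguerre
  operator, which degenerates at the boundary, leaves no boundary term. As to constants, with n the
  dimension: a diagonal Wigner function carries \<open>2 ^ n\<close>, the squared moduli push
  phase-space measure to \<open>pi ^ n\<close> times Lebesgue measure on the orthant, and the
  product cancels the prefactor \<open>1 / (2 * pi) ^ n\<close>. The profile left over is exp(-r)
  L_k(2r); the dilation by 2 turns it into the Laguerre function, and its Jacobian is the
  \<open>2 ^ n\<close> divided out in \<open>laguerre_coeff\<close>.\<close>

type_synonym 'n phase = "(real ^ 'n) \<times> (real ^ 'n)"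

section \<open>Seminorm topologies\<close>

text \<open>Just what balls defined through differences require, so that it also covers spaces of
  operators under the strong topology. A nonempty \<open>P\<close> guarantees that the balls cover
  \<open>V\<close>; with no balls the generated topology would live on the empty set.\<close>

definition pseudometric_family :: "'v::minus set \<Rightarrow> ('v \<Rightarrow> real) set \<Rightarrow> bool" where
  "pseudometric_family V P \<longleftrightarrow> P \<noteq> {} \<and> (\<forall>p\<in>P. \<forall>a\<in>V. p (a - a) = 0) \<and>
     (\<forall>p\<in>P. \<forall>a\<in>V. \<forall>b\<in>V. \<forall>c\<in>V. p (a - c) \<le> p (a - b) + p (b - c))"

lemma openin_seminorm_ball:
  assumes "f \<in> V" "p \<in> P" "e > 0"
  shows "openin (seminorm_topology V P) {g \<in> V. p (g - f) < e}" unfolding seminorm_topology_def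
  by (rule topology_generated_by_Basis) (use assms in blast)

lemma topspace_seminorm_topology:
  assumes "pseudometric_family V P"
  shows "topspace (seminorm_topology V P) = V"
proof -
  obtain p where p: "p \<in> P" using assms by (auto simp: pseudometric_family_def)
  have "V \<subseteq> topspace (seminorm_topology V P)"
  proof
    fix f assume f: "f \<in> V"
    have "f \<in> {g \<in> V. p (g - f) < 1}" using assms p f by (auto simp: pseudometric_family_def)
    then show "f \<in> topspace (seminorm_topology V P)" using openin_subset[OF openin_seminorm_ball[OF f p zero_less_one]] by blast
  qed
  then show ?thesis unfolding seminorm_topology_def topology_generated_by_topspace by auto
qed

text \<open>The generating balls have arbitrary centres in \<open>V\<close>; the triangle inequality
  recentres each one at \<open>x\<close> at the price of the radius \<open>e - p (x - f)\<close>,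
  and finite intersections only take unions of seminorm sets and minima of radii.\<close>

lemma seminorm_topology_nbhd:
  fixes V :: "'v::minus set"
  assumes pm: "pseudometric_family V P"
    and U: "openin (seminorm_topology V P) U" and x: "x \<in> U"
  obtains F d where "finite F" "F \<subseteq> P" "d > 0" "\<forall>g\<in>V. (\<forall>p\<in>F. p (g - x) < d) \<longrightarrow> g \<in> U"
proof -
  define nb where "nb = (\<lambda>(F :: ('v \<Rightarrow> real) set) d x U. \<forall>g\<in>V. (\<forall>p\<in>F. p (g - x) < d) \<longrightarrow> g \<in> U)"
  have "generate_topology_on {{g \<in> V. p (g - f) < e} | f p e. f \<in> V \<and> p \<in> P \<and> e > 0} U"
    using U unfolding seminorm_topology_def by (rule openin_topology_generated_by)
  then have "\<forall>x\<in>U. \<exists>F d. finite F \<and> F \<subseteq> P \<and> d > 0 \<and> nb F d x U"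
  proof (induction rule: generate_topology_on.induct)
    case (Int a b)
    show ?case
    proof
      fix x assume "x \<in> a \<inter> b"
      then have x: "x \<in> a" "x \<in> b" by auto
      obtain F d where F: "finite F" "F \<subseteq> P" "d > 0" "nb F d x a" using bspec[OF Int.IH(1) x(1)] by metis
      obtain F' d' where F': "finite F'" "F' \<subseteq> P" "d' > 0" "nb F' d' x b" using bspec[OF Int.IH(2) x(2)] by metis
      have "nb (F \<union> F') (min d d') x (a \<inter> b)" using F(4) F'(4) unfolding nb_def by (metis IntI UnCI min_less_iff_conj)
      then show "\<exists>F d. finite F \<and> F \<subseteq> P \<and> d > 0 \<and> nb F d x (a \<inter> b)"
        using F F' by (intro exI[of _ "F \<union> F'"] exI[of _ "min d d'"]) simp
    qed
  next
    case (UN K)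
    show ?case
    proof
      fix x assume "x \<in> \<Union>K"
      then obtain k where k: "k \<in> K" "x \<in> k" by blast
      obtain F d where F: "finite F" "F \<subseteq> P" "d > 0" "nb F d x k" using bspec[OF UN.IH[OF k(1)] k(2)] by metis
      have "nb F d x (\<Union>K)" using F(4) k(1) unfolding nb_def by (metis UnionI)
      then show "\<exists>F d. finite F \<and> F \<subseteq> P \<and> d > 0 \<and> nb F d x (\<Union>K)"
        using F by (intro exI[of _ F] exI[of _ d]) simp
    qed
  next
    case (Basis s)
    then obtain f p e where s: "s = {g \<in> V. p (g - f) < e}" "f \<in> V" "p \<in> P" "e > 0" by blast
    show ?case
    proof
      fix x assume x: "x \<in> s"
      have "g \<in> s" if "g \<in> V" "p (g - x) < e - p (x - f)" for g
      proof -
        have "x \<in> V" using x s by simp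
        then have "p (g - f) \<le> p (g - x) + p (x - f)" using pm s(2,3) that(1) unfolding pseudometric_family_def by simp
        with that s show ?thesis by simp
      qed
      then have "nb {p} (e - p (x - f)) x s" unfolding nb_def by simp
      moreover have "e - p (x - f) > 0" using x s by simp
      ultimately show "\<exists>F d. finite F \<and> F \<subseteq> P \<and> d > 0 \<and> nb F d x s"
        using s(3) by (intro exI[of _ "{p}"] exI[of _ "e - p (x - f)"]) simp
    qed
  qed simp
  from bspec[OF this x] obtain F d where "finite F" "F \<subseteq> P" "d > 0" "nb F d x U" by metis
  then show ?thesis unfolding nb_def by (rule that)
qed

lemma openin_seminorm_topologyI:
  assumes pm: "pseudometric_family V P" and "U \<subseteq> V"
    and nb: "\<And>x. x \<in> U \<Longrightarrow> \<exists>F d. finite F \<and> F \<subseteq> P \<and> d > 0 \<and> (\<forall>g\<in>V. (\<forall>p\<in>F. p (g - x) < d) \<longrightarrow> g \<in> U)"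
  shows "openin (seminorm_topology V P) U"
proof (subst openin_subopen, intro ballI)
  fix x assume x: "x \<in> U"
  then obtain F d where F: "finite F" "F \<subseteq> P" "d > 0" "\<forall>g\<in>V. (\<forall>p\<in>F. p (g - x) < d) \<longrightarrow> g \<in> U"
    using nb[OF x] by (elim exE conjE) (rule that)
  have xV: "x \<in> V" using x \<open>U \<subseteq> V\<close> by (rule subsetD[rotated])
  have "openin (seminorm_topology V P) {g \<in> V. \<forall>p\<in>F. p (g - x) < d}" using F(1,2)
  proof induction
    case empty
    show ?case using openin_topspace[of "seminorm_topology V P"] by (simp add: topspace_seminorm_topology[OF pm])
  next
    case (insert p F)
    have "{g \<in> V. \<forall>p\<in>insert p F. p (g - x) < d} = {g \<in> V. p (g - x) < d} \<inter> {g \<in> V. \<forall>p\<in>F. p (g - x) < d}"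
      by auto
    with insert show ?case using openin_seminorm_ball[OF xV, of p P d] F(3) by (auto intro!: openin_Int)
  qed
  moreover have "x \<in> {g \<in> V. \<forall>p\<in>F. p (g - x) < d}"
  proof -
    have "p (x - x) = 0" if "p \<in> F" for p using subsetD[OF F(2) that] xV pm unfolding pseudometric_family_def by simp
    then have "p (x - x) < d" if "p \<in> F" for p using F(3) that by metis
    then show ?thesis by (intro CollectI conjI ballI xV)
  qed
  moreover have "{g \<in> V. \<forall>p\<in>F. p (g - x) < d} \<subseteq> U" using F(4) by auto
  ultimately show "\<exists>T. openin (seminorm_topology V P) T \<and> x \<in> T \<and> T \<subseteq> U" by (intro exI conjI)
qed

lemma limitin_seminormI:
  assumes pm: "pseudometric_family V P" and "x \<in> V" and "eventually (\<lambda>n. xs n \<in> V) G"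
    and lim: "\<And>p. p \<in> P \<Longrightarrow> ((\<lambda>n. p (xs n - x)) \<longlongrightarrow> 0) G"
  shows "limitin (seminorm_topology V P) xs x G" unfolding limitin_def topspace_seminorm_topology[OF pm]
proof (intro conjI allI impI)
  fix U assume "openin (seminorm_topology V P) U \<and> x \<in> U"
  then have U: "openin (seminorm_topology V P) U" "x \<in> U" by auto
  obtain F d where F: "finite F" "F \<subseteq> P" "d > 0"
    "\<forall>g\<in>V. (\<forall>p\<in>F. p (g - x) < d) \<longrightarrow> g \<in> U" by (rule seminorm_topology_nbhd[OF pm U]) (rule that)
  have "eventually (\<lambda>n. \<forall>p\<in>F. p (xs n - x) < d) G" using F(1)
  proof (rule eventually_ball_finite, intro ballI)
    fix p assume "p \<in> F"
    then have "((\<lambda>n. p (xs n - x)) \<longlongrightarrow> 0) G" using lim F by blast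
    then show "eventually (\<lambda>n. p (xs n - x) < d) G" using F(3) by (rule order_tendstoD)
  qed
  with assms(3) show "eventually (\<lambda>n. xs n \<in> U) G" by eventually_elim (rule F(4)[rule_format], auto)
qed fact

lemma limitin_seminormD:
  assumes lim: "limitin (seminorm_topology V P) xs x G" and x: "x \<in> V" and p: "p \<in> P" "p (x - x) = 0"
    and nonneg: "\<And>n. p (xs n - x) \<ge> 0"
  shows "((\<lambda>n. p (xs n - x)) \<longlongrightarrow> 0) G"
proof (rule order_tendstoI)
  fix e :: real assume "0 < e"
  then have "eventually (\<lambda>n. xs n \<in> {g \<in> V. p (g - x) < e}) G"
    using lim openin_seminorm_ball[OF x p(1), of e] x p unfolding limitin_def by auto
  then show "eventually (\<lambda>n. p (xs n - x) < e) G" by eventually_elim simp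
qed (use nonneg in \<open>auto intro!: always_eventually intro: less_le_trans\<close>)

text \<open>The linear structure is written pointwise, so that the same facts apply to
  \<open>schwartz\<close>, whose members are functions of points, and to \<open>tempered\<close>,
  whose members are functions of functions.\<close>

definition seminorm_space :: "('x \<Rightarrow> complex) set \<Rightarrow> (('x \<Rightarrow> complex) \<Rightarrow> real) set \<Rightarrow> bool" where
  "seminorm_space V P \<longleftrightarrow> P \<noteq> {} \<and> (\<lambda>x. 0) \<in> V \<and>
     (\<forall>f\<in>V. \<forall>g\<in>V. \<forall>a. (\<lambda>x. a * f x + g x) \<in> V) \<and>
     (\<forall>p\<in>P. \<forall>f\<in>V. \<forall>a. p (\<lambda>x. a * f x) = norm a * p f) \<and>
     (\<forall>p\<in>P. \<forall>f\<in>V. \<forall>g\<in>V. p (\<lambda>x. f x + g x) \<le> p f + p g)"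

text \<open>Suprema directly give only the upper estimate. The reverse one follows by applying it to
  the multiple by \<open>a\<close> with the factor \<open>1 / a\<close>; for \<open>a = 0\<close>
  nonnegativity suffices.\<close>

lemma homogeneous_of_le:
  fixes p :: "('x \<Rightarrow> complex) \<Rightarrow> real"
  assumes le: "\<And>c g. g \<in> V \<Longrightarrow> p (\<lambda>x. c * g x) \<le> norm c * p g"
    and V: "\<And>c. (\<lambda>x. c * f x) \<in> V" and nonneg: "0 \<le> p (\<lambda>x. a * f x)"
  shows "p (\<lambda>x. a * f x) = norm a * p f"
proof (rule antisym)
  show "p (\<lambda>x. a * f x) \<le> norm a * p f" using le[OF V[of 1], of a] by simp
  show "norm a * p f \<le> p (\<lambda>x. a * f x)" using le[OF V[of a], of "1 / a"] nonneg
    by (cases "a = 0") (simp_all add: norm_divide field_simps)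
qed

section \<open>Algebra in seminorm spaces and domination by finitely many seminorms\<close>

context
  fixes V :: "('x \<Rightarrow> complex) set" and P
  assumes V: "seminorm_space V P"
begin

lemma seminorm_space_zero: "(\<lambda>x. 0) \<in> V" using V by (simp add: seminorm_space_def)

lemma seminorm_space_lin: "f \<in> V \<Longrightarrow> g \<in> V \<Longrightarrow> (\<lambda>x. a * f x + g x) \<in> V"
  using V by (simp add: seminorm_space_def)

lemma seminorm_space_scale: "f \<in> V \<Longrightarrow> (\<lambda>x. a * f x) \<in> V"
  using seminorm_space_lin[of f "\<lambda>x. 0" a] seminorm_space_zero by simp

lemma seminorm_space_add: "f \<in> V \<Longrightarrow> g \<in> V \<Longrightarrow> (\<lambda>x. f x + g x) \<in> V"
  using seminorm_space_lin[of f g 1] by simp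

lemma seminorm_space_diff: "f \<in> V \<Longrightarrow> g \<in> V \<Longrightarrow> f - g \<in> V"
  using seminorm_space_lin[of g f "-1"] by (simp add: fun_diff_def)

lemma seminorm_space_sum: "finite I \<Longrightarrow> (\<And>i. i \<in> I \<Longrightarrow> f i \<in> V) \<Longrightarrow> (\<lambda>x. \<Sum>i\<in>I. f i x) \<in> V"
  by (induction I rule: finite_induct) (auto simp: seminorm_space_zero seminorm_space_add)

lemma seminorm_scale: "p \<in> P \<Longrightarrow> f \<in> V \<Longrightarrow> p (\<lambda>x. a * f x) = norm a * p f"
  using V by (simp add: seminorm_space_def)

lemma seminorm_add: "p \<in> P \<Longrightarrow> f \<in> V \<Longrightarrow> g \<in> V \<Longrightarrow> p (\<lambda>x. f x + g x) \<le> p f + p g"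
  using V by (simp add: seminorm_space_def)

lemma seminorm_zero: "p \<in> P \<Longrightarrow> p (\<lambda>x. 0) = 0" using seminorm_scale[of p "\<lambda>x. 0" 0] seminorm_space_zero by simp

lemma seminorm_nonneg: "p \<in> P \<Longrightarrow> f \<in> V \<Longrightarrow> 0 \<le> p f"
  using seminorm_add[of p f "\<lambda>x. - 1 * f x"] seminorm_scale[of p f "-1"] seminorm_space_scale[of f "-1"]
    seminorm_zero[of p] by simp

lemma pseudometric_seminorm_space: "pseudometric_family V P" unfolding pseudometric_family_def
proof (intro conjI ballI)
  show "P \<noteq> {}" using V by (simp add: seminorm_space_def)
next
  fix p a assume "p \<in> P" "a \<in> V"
  then show "p (a - a) = 0" using seminorm_zero by (simp add: fun_diff_def)
next
  fix p a b c assume *: "p \<in> P" "a \<in> V" "b \<in> V" "c \<in> V"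
  have "a - c = (\<lambda>x. (a - b) x + (b - c) x)" by auto
  then show "p (a - c) \<le> p (a - b) + p (b - c)" using seminorm_add[of p "a - b" "b - c"] seminorm_space_diff * by simp
qed

lemma topspace_seminorm_space: "topspace (seminorm_topology V P) = V" by (rule topspace_seminorm_topology[OF pseudometric_seminorm_space])

text \<open>Scaling argument: \<open>f\<close> is shrunk until it lies in the basic neighbourhood of
  0 contained in \<open>U\<close>, where \<open>r < 1\<close>, and homogeneity undoes the
  shrinking.\<close>

lemma seminorm_bound_of_nbhd:
  assumes hom: "\<And>f a. f \<in> V \<Longrightarrow> r (\<lambda>x. a * f x) = norm a * r f"
    and U: "openin (seminorm_topology V P) U" "(\<lambda>x. 0) \<in> U" "\<And>f. f \<in> U \<Longrightarrow> r f < (1::real)"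
  obtains F C where "finite F" "F \<subseteq> P" "0 \<le> C" "\<And>f. f \<in> V \<Longrightarrow> r f \<le> C * (\<Sum>p\<in>F. p f)"
proof -
  obtain F d where F: "finite F" "F \<subseteq> P" "d > 0"
    "\<forall>g\<in>V. (\<forall>p\<in>F. p (g - (\<lambda>x. 0)) < d) \<longrightarrow> g \<in> U"
    by (rule seminorm_topology_nbhd[OF pseudometric_seminorm_space U(1,2)]) (rule that)
  have "r f \<le> 2 / d * (\<Sum>p\<in>F. p f)" if f: "f \<in> V" for f
  proof (rule field_le_epsilon)
    fix e :: real assume e: "e > 0"
    define s where "s = (\<Sum>p\<in>F. p f)"
    have pn: "0 \<le> p f" if "p \<in> F" for p using seminorm_nonneg F(2) f that by blast
    then have s0: "0 \<le> s" unfolding s_def by (simp add: sum_nonneg)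
    \<comment> \<open>Chosen so that \<open>t * s < d\<close> and
      \<open>1 / t = 2 / d * s + e\<close>. The term with \<open>e\<close> keeps the denominator
      positive when all seminorms of \<open>f\<close> vanish.\<close>
    define t where "t = d / (2 * (s + e * d / 2))"
    have pos: "s + e * d / 2 > 0" using s0 e F(3) by (simp add: add_nonneg_pos)
    then have t: "t > 0" unfolding t_def using F(3) by simp
    have "(\<lambda>x. of_real t * f x) \<in> U"
    proof (rule F(4)[rule_format])
      show "(\<lambda>x. of_real t * f x) \<in> V" using f by (rule seminorm_space_scale)
      fix p assume p: "p \<in> F"
      have "p f \<le> s" unfolding s_def using member_le_sum[of p F "\<lambda>p. p f"] p F(1) pn by simp
      then have "t * p f \<le> t * s" using t by simp
      also have "\<dots> < d" unfolding t_def using pos F(3) e s0 by (simp add: field_simps) (smt (verit) mult_nonneg_nonneg mult_pos_pos)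
      finally have "t * p f < d" .
      then show "p ((\<lambda>x. complex_of_real t * f x) - (\<lambda>x. 0)) < d"
        using seminorm_scale[of p f "of_real t"] p F(2) f t by (auto simp: fun_diff_def)
    qed
    then have "r (\<lambda>x. of_real t * f x) < 1" by (rule U(3))
    then have "t * r f < 1" using hom[OF f, of "of_real t"] t by simp
    then have "r f < 1 / t" using t by (simp add: field_simps)
    also have "1 / t = 2 / d * s + e" unfolding t_def using F(3) pos by (simp add: field_simps)
    finally show "r f \<le> 2 / d * (\<Sum>p\<in>F. p f) + e" unfolding s_def by simp
  qed
  then show ?thesis using that[of F "2/d"] F by simp
qed

lemma bdd_above_bounded_sets:
  assumes "B \<in> bounded_sets V P" "finite F" "F \<subseteq> P" "0 \<le> C" "\<And>f. f \<in> V \<Longrightarrow> r f \<le> C * (\<Sum>p\<in>F. p f)"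
  shows "bdd_above (r ` B)"
proof -
  have "\<forall>p\<in>F. \<exists>c. \<forall>f\<in>B. p f \<le> c" using assms(1,3) unfolding bounded_sets_def bdd_above_def by blast
  then obtain c where c: "\<And>p f. p \<in> F \<Longrightarrow> f \<in> B \<Longrightarrow> p f \<le> c p" by metis
  have "r f \<le> C * (\<Sum>p\<in>F. c p)" if "f \<in> B" for f
  proof -
    have "f \<in> V" using that assms(1) by (auto simp: bounded_sets_def)
    then have "r f \<le> C * (\<Sum>p\<in>F. p f)" using assms(5) by blast
    also have "\<dots> \<le> C * (\<Sum>p\<in>F. c p)" using c that assms(4) by (intro mult_left_mono sum_mono) auto
    finally show ?thesis .
  qed
  then show ?thesis by (auto simp: bdd_above_def)
qed

end

section \<open>Continuity of linear functionals and linear maps in terms of seminorm bounds\<close>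

context
  fixes V :: "('x \<Rightarrow> complex) set" and P
  assumes V: "seminorm_space V P"
begin

lemmas [simp] = topspace_seminorm_space[OF V]

lemma continuous_functional_bound:
  assumes c: "continuous_map (seminorm_topology V P) euclidean u"
    and lin: "\<And>f g a. f \<in> V \<Longrightarrow> g \<in> V \<Longrightarrow> u (\<lambda>x. a * f x + g x) = a * u f + (u g :: complex)"
  obtains F C where "finite F" "F \<subseteq> P" "0 \<le> C" "\<And>f. f \<in> V \<Longrightarrow> norm (u f) \<le> C * (\<Sum>p\<in>F. p f)"
proof (rule seminorm_bound_of_nbhd[OF V, of "\<lambda>f. norm (u f)" "{f \<in> V. u f \<in> ball 0 1}"])
  have u0: "u (\<lambda>x. 0) = 0" using lin[OF seminorm_space_zero[OF V] seminorm_space_zero[OF V], of 1] by simp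
  show "norm (u (\<lambda>x. a * f x)) = norm a * norm (u f)" if "f \<in> V" for f a
    using lin[OF that seminorm_space_zero[OF V], of a] u0 by (simp add: norm_mult)
  show "openin (seminorm_topology V P) {f \<in> V. u f \<in> ball 0 1}" using openin_continuous_map_preimage[OF c, of "ball 0 1"] by simp
  show "(\<lambda>x. 0) \<in> {f \<in> V. u f \<in> ball 0 1}" using u0 seminorm_space_zero[OF V] by simp
qed (use that in auto)

lemma continuous_linear_map_bound:
  assumes W: "seminorm_space W Q" and q: "q \<in> Q"
    and T: "T \<in> continuous_linear_maps (seminorm_topology V P) (seminorm_topology W Q)"
  obtains F C where "finite F" "F \<subseteq> P" "0 \<le> C" "\<And>f. f \<in> V \<Longrightarrow> q (T f) \<le> C * (\<Sum>p\<in>F. p f)"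
proof (rule seminorm_bound_of_nbhd[OF V, of "\<lambda>f. q (T f)" "{f \<in> V. T f \<in> {g \<in> W. q (g - (\<lambda>x. 0)) < 1}}"])
  have lin: "T (\<lambda>x. a * f x + g x) = (\<lambda>y. a * T f y + T g y)" if "f \<in> V" "g \<in> V" for f g a
    using T that unfolding continuous_linear_maps_def by simp
  have c: "continuous_map (seminorm_topology V P) (seminorm_topology W Q) T" using T unfolding continuous_linear_maps_def by simp
  have W': "topspace (seminorm_topology W Q) = W" by (rule topspace_seminorm_topology) (rule pseudometric_seminorm_space[OF W])
  have TW: "T f \<in> W" if "f \<in> V" for f using c that W' unfolding continuous_map_def by auto
  have T0: "T (\<lambda>x. 0) = (\<lambda>x. 0)" using lin[OF seminorm_space_zero[OF V] seminorm_space_zero[OF V], of "1"] by (auto simp: fun_eq_iff)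
  show "q (T (\<lambda>x. a * f x)) = norm a * q (T f)" if "f \<in> V" for f a
    using lin[OF that seminorm_space_zero[OF V], of a] T0 W q TW[OF that] by (simp add: seminorm_space_def)
  show "openin (seminorm_topology V P) {f \<in> V. T f \<in> {g \<in> W. q (g - (\<lambda>x. 0)) < 1}}"
    using openin_continuous_map_preimage[OF c openin_seminorm_ball[of "\<lambda>x. 0" W q Q 1]] W q by (simp add: seminorm_space_def)
  have "q (\<lambda>x. 0) = 0" by (rule seminorm_zero[OF W q])
  then show "(\<lambda>x. 0) \<in> {f \<in> V. T f \<in> {g \<in> W. q (g - (\<lambda>x. 0)) < 1}}"
    using T0 seminorm_space_zero[OF V] seminorm_space_zero[OF W] by (simp add: fun_diff_def)
qed (use that in \<open>auto simp: fun_diff_def\<close>)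

lemma continuous_functionalI:
  assumes lin: "\<And>f g a. f \<in> V \<Longrightarrow> g \<in> V \<Longrightarrow> u (\<lambda>x. a * f x + g x) = a * u f + (u g :: complex)"
    and F: "finite F" "F \<subseteq> P" "0 \<le> C" "\<And>f. f \<in> V \<Longrightarrow> norm (u f) \<le> C * (\<Sum>p\<in>F. p f)"
  shows "continuous_map (seminorm_topology V P) euclidean u" unfolding continuous_map_def
proof (intro conjI allI impI)
  fix U :: "complex set" assume "openin euclidean U"
  then have "open U" by simp
  show "openin (seminorm_topology V P) {x \<in> topspace (seminorm_topology V P). u x \<in> U}"
  proof (rule openin_seminorm_topologyI[OF pseudometric_seminorm_space[OF V]])
    fix x assume "x \<in> {x \<in> topspace (seminorm_topology V P). u x \<in> U}"
    then have x: "x \<in> V" "u x \<in> U" by auto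
    then obtain e where e: "e > 0" "ball (u x) e \<subseteq> U" using \<open>open U\<close> open_contains_ball by blast
    define d where "d = e / (C * card F + 1)"
    have pos: "0 < C * card F + 1" using F(3) by (simp add: add_nonneg_pos)
    then have d: "d > 0" unfolding d_def using e by simp
    have "C * card F * d = e - d" unfolding d_def using pos by (simp add: field_simps)
    with d have "C * card F * d < e" by simp
    note d = d this
    have "u g \<in> U" if g: "g \<in> V" "\<forall>p\<in>F. p (g - x) < d" for g
    proof -
      have eq: "g - x = (\<lambda>y. (-1) * x y + g y)" by auto
      have "norm (u g - u x) = norm (u (g - x))" using lin[OF x(1) g(1), of "-1"] unfolding eq by simp
      also have "\<dots> \<le> C * (\<Sum>p\<in>F. p (g - x))" using F(4) seminorm_space_diff[OF V] x g by blast
      also have "\<dots> \<le> C * (\<Sum>p\<in>F. d)" using F(3) g(2) by (intro mult_left_mono sum_mono) (auto intro: less_imp_le)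
      also have "\<dots> < e" using d by (simp add: mult.assoc)
      finally show ?thesis using e by (auto simp: dist_norm norm_minus_commute)
    qed
    then show "\<exists>F d. finite F \<and> F \<subseteq> P \<and> d > 0 \<and> (\<forall>g\<in>V. (\<forall>p\<in>F. p (g - x) < d) \<longrightarrow>
        g \<in> {x \<in> topspace (seminorm_topology V P). u x \<in> U})"
      using F(1,2) d(1) by (intro exI[of _ F] exI[of _ d] conjI ballI impI) simp_all
  qed auto
qed auto

lemma continuous_linear_mapI:
  assumes W: "seminorm_space W Q"
    and lin: "\<And>f g a. f \<in> V \<Longrightarrow> g \<in> V \<Longrightarrow> T (\<lambda>x. a * f x + g x) = (\<lambda>y. a * T f y + T g y)"
    and TW: "\<And>f. f \<in> V \<Longrightarrow> T f \<in> W"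
    and bd: "\<And>q. q \<in> Q \<Longrightarrow> \<exists>F C. finite F \<and> F \<subseteq> P \<and> 0 \<le> C \<and> (\<forall>f\<in>V. q (T f) \<le> C * (\<Sum>p\<in>F. p f))"
  shows "T \<in> continuous_linear_maps (seminorm_topology V P) (seminorm_topology W Q)"
proof -
  have pW: "pseudometric_family W Q" by (rule pseudometric_seminorm_space[OF W])
  have "continuous_map (seminorm_topology V P) (seminorm_topology W Q) T" unfolding continuous_map_def topspace_seminorm_topology[OF pW]
  proof (intro conjI allI impI)
    fix U assume U: "openin (seminorm_topology W Q) U"
    show "openin (seminorm_topology V P) {x \<in> topspace (seminorm_topology V P). T x \<in> U}"
    proof (rule openin_seminorm_topologyI[OF pseudometric_seminorm_space[OF V]])
      fix x assume "x \<in> {x \<in> topspace (seminorm_topology V P). T x \<in> U}"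
      then have x: "x \<in> V" "T x \<in> U" by auto
      obtain G e where G: "finite G" "G \<subseteq> Q" "e > 0"
        "\<forall>g\<in>W. (\<forall>q\<in>G. q (g - T x) < e) \<longrightarrow> g \<in> U" by (rule seminorm_topology_nbhd[OF pW U x(2)]) (rule that)
      have "\<forall>q\<in>G. \<exists>F C. finite F \<and> F \<subseteq> P \<and> 0 \<le> C \<and> (\<forall>f\<in>V. q (T f) \<le> C * (\<Sum>p\<in>F. p f))"
        using bd G(2) by blast
      then obtain F C where F: "\<And>q. q \<in> G \<Longrightarrow> finite (F q) \<and> F q \<subseteq> P \<and> 0 \<le> C q \<and> (\<forall>f\<in>V. q (T f) \<le> C q * (\<Sum>p\<in>F q. p f))"
        by metis
      \<comment> \<open>A single radius \<open>e / K\<close> has to serve all \<open>q\<close> in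
        \<open>G\<close>; the summand 1 makes the final estimate strict and \<open>K\<close>
        positive.\<close>
      define K where "K = (\<Sum>q\<in>G. C q * card (F q)) + 1"
      have K: "K \<ge> 1" unfolding K_def using F by (auto intro!: sum_nonneg)
      have Kq: "C q * card (F q) < K" if "q \<in> G" for q
        unfolding K_def using member_le_sum[of q G "\<lambda>q. C q * card (F q)"] that G(1) F by fastforce
      have "T g \<in> U" if g: "g \<in> V" "\<forall>p\<in>(\<Union>q\<in>G. F q). p (g - x) < e / K" for g
      proof (rule G(4)[rule_format])
        show "T g \<in> W" using TW g by blast
        fix q assume q: "q \<in> G"
        have eq: "g - x = (\<lambda>y. (-1) * x y + g y)" by auto
        have "T (g - x) = T g - T x" unfolding eq lin[OF x(1) g(1)] by auto
        then have "q (T g - T x) \<le> C q * (\<Sum>p\<in>F q. p (g - x))"  using F[OF q] seminorm_space_diff[OF V g(1) x(1)] by metis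
        also have "\<dots> \<le> C q * (\<Sum>p\<in>F q. e / K)" using F[OF q] g(2) q by (intro mult_left_mono sum_mono) (auto intro: less_imp_le)
        also have "\<dots> = (C q * card (F q)) * (e / K)" by simp
        also have "\<dots> < K * (e / K)" using Kq[OF q] K G(3) by (intro mult_strict_right_mono) auto
        finally show "q (T g - T x) < e" using K by simp
      qed
      moreover have "finite (\<Union>q\<in>G. F q)" "(\<Union>q\<in>G. F q) \<subseteq> P" using F G by auto
      moreover have "e / K > 0" using K G by simp
      ultimately show "\<exists>F d. finite F \<and> F \<subseteq> P \<and> d > 0 \<and> (\<forall>g\<in>V. (\<forall>p\<in>F. p (g - x) < d) \<longrightarrow>
          g \<in> {x \<in> topspace (seminorm_topology V P). T x \<in> U})"
        by (intro exI[of _ "\<Union>q\<in>G. F q"] exI[of _ "e / K"] conjI ballI impI) simp_all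
    qed auto
  qed (use TW in auto)
  then show ?thesis using lin by (auto simp: continuous_linear_maps_def)
qed

end

section \<open>Differential operators with polynomial coefficients\<close>

lemma frechet_derivative_cong_open:
  assumes "open \<Omega>" "x \<in> \<Omega>" "\<And>y. y \<in> \<Omega> \<Longrightarrow> f y = g y"
  shows "frechet_derivative f (at x) = frechet_derivative g (at x)"
    and "f differentiable (at x) \<longleftrightarrow> g differentiable (at x)"
proof -
  have "(f has_derivative D) (at x) \<longleftrightarrow> (g has_derivative D) (at x)" for D
    using has_derivative_transform_within_open[of f D x UNIV \<Omega> g]
      has_derivative_transform_within_open[of g D x UNIV \<Omega> f] assms by auto
  then show "frechet_derivative f (at x) = frechet_derivative g (at x)"
    and "f differentiable (at x) \<longleftrightarrow> g differentiable (at x)" by (simp_all add: frechet_derivative_def differentiable_def)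
qed

lemma frechet_derivative_eqI: "(f has_derivative D) (at x) \<Longrightarrow> frechet_derivative f (at x) = D"
  by (rule frechet_derivative_at[symmetric])

lemma smooth_onD:
  "smooth_on \<Omega> f \<Longrightarrow> set bs \<subseteq> Basis \<Longrightarrow> x \<in> \<Omega> \<Longrightarrow> partial_derivs bs f differentiable (at x)"
  by (simp add: smooth_on_def)

text \<open>Replaces formulas for iterated derivatives: it suffices to exhibit a class of
  differentiable functions that contains, up to equality on \<Omega>, the partial derivatives of its
  members. Since \<Omega> is open, equality on \<Omega> passes to derivatives.\<close>

lemma smooth_on_closed_class:
  assumes "open \<Omega>" and u: "u \<in> \<C>"
    and diff: "\<And>u x. u \<in> \<C> \<Longrightarrow> x \<in> \<Omega> \<Longrightarrow> u differentiable (at x)"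
    and step: "\<And>u b. u \<in> \<C> \<Longrightarrow> b \<in> Basis \<Longrightarrow> \<exists>w\<in>\<C>. \<forall>x\<in>\<Omega>. frechet_derivative u (at x) b = w x"
  shows "smooth_on \<Omega> u" and "set bs \<subseteq> Basis \<Longrightarrow> \<exists>w\<in>\<C>. \<forall>x\<in>\<Omega>. partial_derivs bs u x = w x"
proof -
  have *: "\<exists>w\<in>\<C>. \<forall>x\<in>\<Omega>. partial_derivs bs u x = w x" if "set bs \<subseteq> Basis" for bs using that
  proof (induction bs)
    case Nil
    then show ?case using u by auto
  next
    case (Cons b bs)
    then obtain w where w: "w \<in> \<C>" "\<forall>x\<in>\<Omega>. partial_derivs bs u x = w x" by auto
    obtain w' where w': "w' \<in> \<C>" "\<forall>x\<in>\<Omega>. frechet_derivative w (at x) b = w' x" using step[OF w(1), of b] Cons.prems by auto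
    have "partial_derivs (b # bs) u x = w' x" if x: "x \<in> \<Omega>" for x
      using frechet_derivative_cong_open(1)[OF \<open>open \<Omega>\<close> x, of "partial_derivs bs u" w] w(2) w'(2) x by simp
    with w'(1) show ?case by auto
  qed
  show "smooth_on \<Omega> u" unfolding smooth_on_def
  proof (intro allI impI ballI)
    fix bs x assume "set bs \<subseteq> (Basis :: 'a set)" and x: "x \<in> \<Omega>"
    with *[of bs] obtain w where w: "w \<in> \<C>" "\<forall>x\<in>\<Omega>. partial_derivs bs u x = w x" by auto
    show "partial_derivs bs u differentiable (at x)"
      using frechet_derivative_cong_open(2)[OF \<open>open \<Omega>\<close> x, of "partial_derivs bs u" w] w diff x by auto
  qed
  show "\<exists>w\<in>\<C>. \<forall>x\<in>\<Omega>. partial_derivs bs u x = w x" if "set bs \<subseteq> Basis" using * that .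
qed

lemma schwartz_closed_class:
  assumes u: "u \<in> \<C>"
    and diff: "\<And>u x. u \<in> \<C> \<Longrightarrow> u differentiable (at x)"
    and step: "\<And>u b. u \<in> \<C> \<Longrightarrow> b \<in> Basis \<Longrightarrow> \<exists>w\<in>\<C>. \<forall>x. frechet_derivative u (at x) b = w x"
    and bd: "\<And>u k. u \<in> \<C> \<Longrightarrow> \<exists>c. \<forall>x. \<bar>monomial k x\<bar> * norm (u x) \<le> c"
  shows "u \<in> schwartz"
proof -
  have step': "\<exists>w\<in>\<C>. \<forall>x\<in>UNIV. frechet_derivative u (at x) b = w x" if "u \<in> \<C>" "b \<in> Basis" for u b
    using step[OF that] by simp
  have "smooth_on UNIV u" using smooth_on_closed_class(1)[of UNIV, OF open_UNIV u diff step'] by auto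
  moreover have "schwartz_bounds UNIV u" unfolding schwartz_bounds_def
  proof (intro allI impI)
    fix k and bs :: "'a list" assume bs: "set bs \<subseteq> Basis"
    have "\<exists>w\<in>\<C>. \<forall>x\<in>UNIV. partial_derivs bs u x = w x"
      using smooth_on_closed_class(2)[of UNIV, OF open_UNIV u diff step' bs] by auto
    then obtain w where w: "w \<in> \<C>" "\<forall>x. partial_derivs bs u x = w x" by auto
    obtain c where "\<forall>x. \<bar>monomial k x\<bar> * norm (w x) \<le> c" using bd[OF w(1)] by blast
    then show "bdd_above (range (weighted_deriv k bs u))" using w(2) by (intro bdd_aboveI[of _ c]) (auto simp: weighted_deriv_def)
  qed
  ultimately show ?thesis by (simp add: schwartz_def)
qed

section \<open>Linearity of iterated derivatives and of the Schwartz seminorms\<close>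

lemma has_derivative_lin_comb:
  assumes "(f has_derivative D) (at x)" "(g has_derivative E) (at x)"
  shows "((\<lambda>x. a * f x + (g x :: complex)) has_derivative (\<lambda>h. a * D h + E h)) (at x)" using assms by (intro derivative_intros) auto

lemma partial_derivs_lin_comb:
  assumes "open \<Omega>" "smooth_on \<Omega> f" "smooth_on \<Omega> g" "set bs \<subseteq> Basis" "x \<in> \<Omega>"
  shows "partial_derivs bs (\<lambda>x. a * f x + g x) x = a * partial_derivs bs f x + partial_derivs bs g x" using assms(4,5)
proof (induction bs arbitrary: x)
  case (Cons b bs)
  have 1: "partial_derivs bs f differentiable (at x)" "partial_derivs bs g differentiable (at x)" using Cons.prems assms by (auto intro!: smooth_onD)
  have "frechet_derivative (partial_derivs bs (\<lambda>x. a * f x + g x)) (at x)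
      = frechet_derivative (\<lambda>x. a * partial_derivs bs f x + partial_derivs bs g x) (at x)"
    by (rule frechet_derivative_cong_open(1)[OF assms(1) Cons.prems(2)]) (use Cons in auto)
  also have "\<dots> = (\<lambda>h. a * frechet_derivative (partial_derivs bs f) (at x) h + frechet_derivative (partial_derivs bs g) (at x) h)"
    by (rule frechet_derivative_eqI[OF has_derivative_lin_comb])
      (use 1 in \<open>auto simp: frechet_derivative_works[symmetric]\<close>)
  finally show ?case by simp
qed simp

lemma smooth_on_lin_comb:
  assumes "open \<Omega>" "smooth_on \<Omega> f" "smooth_on \<Omega> g"
  shows "smooth_on \<Omega> (\<lambda>x. a * f x + g x)" unfolding smooth_on_def
proof (intro allI impI ballI)
  fix bs x assume bs: "set bs \<subseteq> (Basis :: 'a set)" and x: "x \<in> \<Omega>"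
  have "partial_derivs bs f differentiable (at x)" "partial_derivs bs g differentiable (at x)" using bs x assms by (auto intro!: smooth_onD)
  then have "(\<lambda>x. a * partial_derivs bs f x + partial_derivs bs g x) differentiable (at x)" by (intro derivative_intros) auto
  then show "partial_derivs bs (\<lambda>x. a * f x + g x) differentiable (at x)"
    using frechet_derivative_cong_open(2)[OF assms(1) x, of "partial_derivs bs (\<lambda>x. a * f x + g x)"
        "\<lambda>x. a * partial_derivs bs f x + partial_derivs bs g x"] partial_derivs_lin_comb[OF assms bs] by auto
qed

lemma weighted_deriv_nonneg: "0 \<le> weighted_deriv k bs f x" by (simp add: weighted_deriv_def)

lemma weighted_deriv_lin_comb:
  assumes "open \<Omega>" "smooth_on \<Omega> f" "smooth_on \<Omega> g" "set bs \<subseteq> Basis" "x \<in> \<Omega>"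
  shows "weighted_deriv k bs (\<lambda>x. a * f x + g x) x \<le> norm a * weighted_deriv k bs f x + weighted_deriv k bs g x"
proof -
  have "norm (a * partial_derivs bs f x + partial_derivs bs g x) \<le> norm a * norm (partial_derivs bs f x) + norm (partial_derivs bs g x)"
    by (metis norm_mult norm_triangle_ineq)
  then have "\<bar>monomial k x\<bar> * norm (a * partial_derivs bs f x + partial_derivs bs g x)
      \<le> \<bar>monomial k x\<bar> * (norm a * norm (partial_derivs bs f x) + norm (partial_derivs bs g x))" by (rule mult_left_mono) simp
  then show ?thesis unfolding weighted_deriv_def partial_derivs_lin_comb[OF assms] by (simp add: algebra_simps)
qed

lemma schwartz_bounds_lin_comb:
  assumes "open \<Omega>" "smooth_on \<Omega> f" "smooth_on \<Omega> g" "schwartz_bounds \<Omega> f" "schwartz_bounds \<Omega> g"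
  shows "schwartz_bounds \<Omega> (\<lambda>x. a * f x + g x)" unfolding schwartz_bounds_def
proof (intro allI impI)
  fix k and bs :: "'a list" assume bs: "set bs \<subseteq> Basis"
  obtain c d where c: "\<And>x. x \<in> \<Omega> \<Longrightarrow> weighted_deriv k bs f x \<le> c" "\<And>x. x \<in> \<Omega> \<Longrightarrow> weighted_deriv k bs g x \<le> d"
    using assms(4,5) bs unfolding schwartz_bounds_def bdd_above_def by (meson imageI)
  show "bdd_above (weighted_deriv k bs (\<lambda>x. a * f x + g x) ` \<Omega>)"
  proof (rule bdd_aboveI2)
    fix x assume x: "x \<in> \<Omega>"
    show "weighted_deriv k bs (\<lambda>x. a * f x + g x) x \<le> norm a * c + d"
      using weighted_deriv_lin_comb[OF assms(1-3) bs x, of k a] mult_left_mono[OF c(1)[OF x], of "norm a"] c(2)[OF x] by simp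
  qed
qed

lemma schwartz_seminorm_upper:
  assumes "schwartz_bounds \<Omega> f" "set bs \<subseteq> Basis" "x \<in> \<Omega>"
  shows "weighted_deriv k bs f x \<le> (SUP x\<in>\<Omega>. weighted_deriv k bs f x)"
  using assms by (intro cSUP_upper) (auto simp: schwartz_bounds_def)

lemma schwartz_seminorm_nonneg:
  assumes "schwartz_bounds \<Omega> f" "p \<in> schwartz_seminorms \<Omega>" "\<Omega> \<noteq> {}"
  shows "0 \<le> p f"
proof -
  obtain k bs where p: "p = (\<lambda>f. SUP x\<in>\<Omega>. weighted_deriv k bs f x)" "set bs \<subseteq> Basis"
    using assms(2) by (auto simp: schwartz_seminorms_def)
  obtain x where "x \<in> \<Omega>" using assms(3) by auto
  then show ?thesis using schwartz_seminorm_upper[OF assms(1) p(2), of x k] weighted_deriv_nonneg[of k bs f x] p(1) by simp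
qed

lemma schwartz_seminorms_nonempty: "schwartz_seminorms \<Omega> \<noteq> {}" unfolding schwartz_seminorms_def by (auto intro!: exI[of _ "[]"])

lemma partial_derivs_zero: "partial_derivs bs (\<lambda>x. 0) = (\<lambda>x. 0)"
  by (induction bs) (simp_all add: frechet_derivative_eqI[OF has_derivative_const])

lemma smooth_on_zero: "smooth_on \<Omega> (\<lambda>x. 0)" by (simp add: smooth_on_def partial_derivs_zero)

lemma schwartz_bounds_zero: "schwartz_bounds \<Omega> (\<lambda>x. 0)"
  by (auto simp: schwartz_bounds_def weighted_deriv_def partial_derivs_zero intro!: bdd_aboveI[of _ 0])

lemma schwartz_zero: "(\<lambda>x. 0) \<in> schwartz" by (simp add: schwartz_def smooth_on_zero schwartz_bounds_zero)

lemma schwartz_lin_comb: "f \<in> schwartz \<Longrightarrow> g \<in> schwartz \<Longrightarrow> (\<lambda>x. a * f x + g x) \<in> schwartz"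
  by (simp add: schwartz_def smooth_on_lin_comb schwartz_bounds_lin_comb)

lemma schwartz_seminorm_scale:
  assumes "open \<Omega>" "\<Omega> \<noteq> {}" "smooth_on \<Omega> f" "schwartz_bounds \<Omega> f" "p \<in> schwartz_seminorms \<Omega>"
  shows "p (\<lambda>x. a * f x) \<le> norm a * p f"
proof -
  obtain k bs where p: "p = (\<lambda>f. SUP x\<in>\<Omega>. weighted_deriv k bs f x)" "set bs \<subseteq> Basis"
    using assms(5) by (auto simp: schwartz_seminorms_def)
  have "weighted_deriv k bs (\<lambda>x. a * f x) x \<le> norm a * (SUP x\<in>\<Omega>. weighted_deriv k bs f x)" if x: "x \<in> \<Omega>" for x
    using weighted_deriv_lin_comb[OF assms(1,3) smooth_on_zero p(2) x, of k a]
      mult_left_mono[OF schwartz_seminorm_upper[OF assms(4) p(2) x, of k], of "norm a"] by (simp add: weighted_deriv_def partial_derivs_zero)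
  then show ?thesis unfolding p(1) by (intro cSUP_least assms(2))
qed

lemma schwartz_seminorm_add:
  assumes "open \<Omega>" "\<Omega> \<noteq> {}" "smooth_on \<Omega> f" "schwartz_bounds \<Omega> f" "smooth_on \<Omega> g" "schwartz_bounds \<Omega> g"
    "p \<in> schwartz_seminorms \<Omega>"
  shows "p (\<lambda>x. f x + g x) \<le> p f + p g"
proof -
  obtain k bs where p: "p = (\<lambda>f. SUP x\<in>\<Omega>. weighted_deriv k bs f x)" "set bs \<subseteq> Basis"
    using assms(7) by (auto simp: schwartz_seminorms_def)
  have "weighted_deriv k bs (\<lambda>x. f x + g x) x \<le> (SUP x\<in>\<Omega>. weighted_deriv k bs f x) + (SUP x\<in>\<Omega>. weighted_deriv k bs g x)"
    if x: "x \<in> \<Omega>" for x using weighted_deriv_lin_comb[OF assms(1,3,5) p(2) x, of k 1]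
      schwartz_seminorm_upper[OF assms(4) p(2) x, of k] schwartz_seminorm_upper[OF assms(6) p(2) x, of k] by simp
  then show ?thesis unfolding p(1) by (intro cSUP_least assms(2))
qed

text \<open>Differential operators with polynomial coefficients, kept abstract. All that matters is
  closure under differentiation and the bound of every member by finitely many Schwartz seminorms;
  the operators produced by repeated integration by parts then never have to be computed.\<close>

inductive_set diffops :: "(('a::euclidean_space \<Rightarrow> complex) \<Rightarrow> 'a \<Rightarrow> complex) set" where
  deriv: "set bs \<subseteq> Basis \<Longrightarrow> partial_derivs bs \<in> diffops"
| add: "P \<in> diffops \<Longrightarrow> Q \<in> diffops \<Longrightarrow> (\<lambda>f x. P f x + Q f x) \<in> diffops"
| scale: "P \<in> diffops \<Longrightarrow> (\<lambda>f x. c * P f x) \<in> diffops"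
| coord: "P \<in> diffops \<Longrightarrow> b \<in> Basis \<Longrightarrow> (\<lambda>f x. complex_of_real (x \<bullet> b) * P f x) \<in> diffops"

lemma diffops_id: "(\<lambda>f :: 'a::euclidean_space \<Rightarrow> complex. f) \<in> diffops"
proof -
  have "partial_derivs [] = (\<lambda>f :: 'a \<Rightarrow> complex. f)" by (simp add: fun_eq_iff)
  then show ?thesis using diffops.deriv[of "[] :: 'a list"] by simp
qed

text \<open>The operator \<open>Q\<close> is fixed before \<Omega> and \<open>f\<close>. This
  uniformity is what later turns identities for single functions into estimates by fixed finite sets
  of seminorms.\<close>

lemma diffops_derivative:
  assumes "P \<in> diffops" "b \<in> Basis"
  shows "\<exists>Q\<in>diffops. \<forall>\<Omega> f. smooth_on \<Omega> f \<longrightarrow>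
    (\<forall>x\<in>\<Omega>. P f differentiable (at x) \<and> frechet_derivative (P f) (at x) b = Q f x)" using assms(1)
proof induction
  case (deriv bs)
  then show ?case using assms(2) by (intro bexI[of _ "partial_derivs (b # bs)"] diffops.deriv) (auto simp: smooth_on_def)
next
  case (add P Q)
  then obtain P' Q' where P': "P' \<in> diffops" "Q' \<in> diffops"
    "\<And>\<Omega> f x. smooth_on \<Omega> f \<Longrightarrow> x \<in> \<Omega> \<Longrightarrow> P f differentiable (at x) \<and> frechet_derivative (P f) (at x) b = P' f x"
    "\<And>\<Omega> f x. smooth_on \<Omega> f \<Longrightarrow> x \<in> \<Omega> \<Longrightarrow> Q f differentiable (at x) \<and> frechet_derivative (Q f) (at x) b = Q' f x"
    by metis
  show ?case
  proof (intro bexI[of _ "\<lambda>f x. P' f x + Q' f x"] allI impI ballI)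
    fix \<Omega> x and f :: "'a \<Rightarrow> complex" assume "smooth_on \<Omega> f" "x \<in> \<Omega>"
    note 1 = P'(3)[OF this] P'(4)[OF this]
    have "((\<lambda>x. P f x + Q f x) has_derivative (\<lambda>h. frechet_derivative (P f) (at x) h + frechet_derivative (Q f) (at x) h)) (at x)"
      using 1 by (intro derivative_intros) (auto simp: frechet_derivative_works[symmetric])
    with 1 show "(\<lambda>x. P f x + Q f x) differentiable at x \<and> frechet_derivative (\<lambda>x. P f x + Q f x) (at x) b = P' f x + Q' f x"
      by (auto simp: frechet_derivative_eqI differentiable_def)
  qed (intro diffops.add P')
next
  case (scale P c)
  then obtain P' where P': "P' \<in> diffops"
    "\<And>\<Omega> f x. smooth_on \<Omega> f \<Longrightarrow> x \<in> \<Omega> \<Longrightarrow> P f differentiable (at x) \<and> frechet_derivative (P f) (at x) b = P' f x"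
    by metis
  show ?case
  proof (intro bexI[of _ "\<lambda>f x. c * P' f x"] allI impI ballI)
    fix \<Omega> x and f :: "'a \<Rightarrow> complex" assume "smooth_on \<Omega> f" "x \<in> \<Omega>"
    note 1 = P'(2)[OF this]
    have "((\<lambda>x. c * P f x) has_derivative (\<lambda>h. c * frechet_derivative (P f) (at x) h)) (at x)"
      using 1 by (intro derivative_intros) (auto simp: frechet_derivative_works[symmetric])
    with 1 show "(\<lambda>x. c * P f x) differentiable at x \<and> frechet_derivative (\<lambda>x. c * P f x) (at x) b = c * P' f x"
      by (auto simp: frechet_derivative_eqI differentiable_def)
  qed (intro diffops.scale P')
next
  case (coord P a)
  then obtain P' where P': "P' \<in> diffops"
    "\<And>\<Omega> f x. smooth_on \<Omega> f \<Longrightarrow> x \<in> \<Omega> \<Longrightarrow> P f differentiable (at x) \<and> frechet_derivative (P f) (at x) b = P' f x"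
    by metis
  show ?case
  proof (intro bexI[of _ "\<lambda>f x. of_real (b \<bullet> a) * P f x + of_real (x \<bullet> a) * P' f x"] allI impI ballI)
    fix \<Omega> x and f :: "'a \<Rightarrow> complex" assume "smooth_on \<Omega> f" "x \<in> \<Omega>"
    note 1 = P'(2)[OF this]
    have "((\<lambda>x. of_real (x \<bullet> a) * P f x) has_derivative
        (\<lambda>h. of_real (x \<bullet> a) * frechet_derivative (P f) (at x) h + of_real (h \<bullet> a) * P f x)) (at x)"
      using 1 by (intro has_derivative_mult derivative_intros) (auto simp: frechet_derivative_works[symmetric])
    with 1 show "(\<lambda>x. of_real (x \<bullet> a) * P f x) differentiable at x \<and>
        frechet_derivative (\<lambda>x. of_real (x \<bullet> a) * P f x) (at x) b = of_real (b \<bullet> a) * P f x + of_real (x \<bullet> a) * P' f x"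
      by (auto simp: frechet_derivative_eqI differentiable_def)
  qed (intro diffops.add diffops.scale[of _ "of_real (b \<bullet> a)"] diffops.coord P' coord)
qed

lemma diffops_differentiable:
  assumes "P \<in> diffops" "smooth_on \<Omega> f" "x \<in> \<Omega>"
  shows "P f differentiable (at x)"
proof -
  obtain b :: 'a where "b \<in> Basis" using nonempty_Basis by blast
  from diffops_derivative[OF assms(1) this] assms(2,3) show ?thesis by blast
qed

lemma diffops_continuous:
  assumes "P \<in> diffops" "smooth_on \<Omega> f"
  shows "continuous_on \<Omega> (P f)" using diffops_differentiable[OF assms] differentiable_imp_continuous_within
  by (auto intro!: continuous_at_imp_continuous_on)

lemma monomial_Suc: "b \<in> Basis \<Longrightarrow> monomial k x * (x \<bullet> b) = monomial (k(b := Suc (k b))) x"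
  unfolding monomial_def by (simp add: prod.remove[of _ b])

lemma monomial_zero [simp]: "monomial (\<lambda>_. 0) x = 1" by (simp add: monomial_def)

abbreviation monomial_bound where
  "monomial_bound \<Omega> k P F C \<equiv> \<forall>f x. schwartz_bounds \<Omega> f \<longrightarrow> x \<in> \<Omega> \<longrightarrow> \<bar>monomial k x\<bar> * norm (P f x) \<le> (C :: real) * (\<Sum>p\<in>F. p f)"

text \<open>The induction has to run over all weights \<open>k\<close> at once: a coordinate factor
  in front of the operator is absorbed into the monomial, which raises one exponent.\<close>

lemma diffops_bound_monomial:
  assumes "P \<in> diffops"
  shows "\<exists>F C. finite F \<and> F \<subseteq> schwartz_seminorms \<Omega> \<and> 0 \<le> C \<and>
    (monomial_bound \<Omega> k P F C)"
  using assms
proof (induction arbitrary: k)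
  case (deriv bs)
  have "(\<lambda>f. SUP x\<in>\<Omega>. weighted_deriv k bs f x) \<in> schwartz_seminorms \<Omega>"
    using deriv by (auto simp: schwartz_seminorms_def)
  moreover have "\<bar>monomial k x\<bar> * norm (partial_derivs bs f x) \<le> (SUP x\<in>\<Omega>. weighted_deriv k bs f x)"
    if "schwartz_bounds \<Omega> f" "x \<in> \<Omega>" for f x
    using schwartz_seminorm_upper[OF that(1) deriv that(2), of k] by (simp add: weighted_deriv_def)
  ultimately show ?case by (intro exI[of _ "{\<lambda>f. SUP x\<in>\<Omega>. weighted_deriv k bs f x}"] exI[of _ 1]) simp
next
  case (add P Q)
  obtain F C where F: "finite F" "F \<subseteq> schwartz_seminorms \<Omega>" "0 \<le> C"
    "monomial_bound \<Omega> k P F C"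
    using add.IH(1)[of k] by (elim exE conjE) (rule that)
  obtain G D where G: "finite G" "G \<subseteq> schwartz_seminorms \<Omega>" "0 \<le> D"
    "monomial_bound \<Omega> k Q G D"
    using add.IH(2)[of k] by (elim exE conjE) (rule that)
  have "\<bar>monomial k x\<bar> * norm (P f x + Q f x) \<le> (C + D) * (\<Sum>p\<in>F \<union> G. p f)"
    if f: "schwartz_bounds \<Omega> f" and x: "x \<in> \<Omega>" for f x
  proof -
    have nn: "0 \<le> p f" if "p \<in> F \<union> G" for p using that F(2) G(2) f x by (intro schwartz_seminorm_nonneg[of \<Omega>]) auto
    have "\<bar>monomial k x\<bar> * norm (P f x + Q f x) \<le> \<bar>monomial k x\<bar> * norm (P f x) + \<bar>monomial k x\<bar> * norm (Q f x)"
      unfolding distrib_left[symmetric] by (intro mult_left_mono norm_triangle_ineq) simp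
    also have "\<dots> \<le> C * (\<Sum>p\<in>F. p f) + D * (\<Sum>p\<in>G. p f)" using F(4) G(4) f x by (intro add_mono) auto
    also have "\<dots> \<le> C * (\<Sum>p\<in>F \<union> G. p f) + D * (\<Sum>p\<in>F \<union> G. p f)"
      using F G nn by (intro add_mono mult_left_mono sum_mono2) auto
    finally show ?thesis by (simp add: algebra_simps)
  qed
  then show ?case using F(1-3) G(1-3) by (intro exI[of _ "F \<union> G"] exI[of _ "C + D"]) simp
next
  case (scale P c)
  obtain F C where F: "finite F" "F \<subseteq> schwartz_seminorms \<Omega>" "0 \<le> C"
    "monomial_bound \<Omega> k P F C"
    using scale.IH[of k] by (elim exE conjE) (rule that)
  have "\<bar>monomial k x\<bar> * norm (c * P f x) \<le> (norm c * C) * (\<Sum>p\<in>F. p f)"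
    if f: "schwartz_bounds \<Omega> f" and x: "x \<in> \<Omega>" for f x
    using mult_left_mono[OF F(4)[rule_format, OF f x], of "norm c"] by (simp add: norm_mult mult_ac)
  then show ?case using F(1-3) by (intro exI[of _ F] exI[of _ "norm c * C"]) simp
next
  case (coord P b)
  obtain F C where F: "finite F" "F \<subseteq> schwartz_seminorms \<Omega>" "0 \<le> C"
    "monomial_bound \<Omega> (k(b := Suc (k b))) P F C"
    using coord.IH[of "k(b := Suc (k b))"] by (elim exE conjE) (rule that)
  have "\<bar>monomial k x\<bar> * norm (complex_of_real (x \<bullet> b) * P f x) = \<bar>monomial (k(b := Suc (k b))) x\<bar> * norm (P f x)" for f x
    unfolding monomial_Suc[OF coord.hyps(2), symmetric] by (simp add: norm_mult abs_mult)
  then show ?case using F by (intro exI[of _ F] exI[of _ C]) simp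
qed

lemma diffops_bound:
  assumes "P \<in> diffops"
  obtains F C where "finite F" "F \<subseteq> schwartz_seminorms \<Omega>" "0 \<le> C"
    "\<And>f x. schwartz_bounds \<Omega> f \<Longrightarrow> x \<in> \<Omega> \<Longrightarrow> norm (P f x) \<le> C * (\<Sum>p\<in>F. p f)"
proof -
  obtain F C where F: "finite F" "F \<subseteq> schwartz_seminorms \<Omega>" "0 \<le> C"
    "\<forall>f x. schwartz_bounds \<Omega> f \<longrightarrow> x \<in> \<Omega> \<longrightarrow> \<bar>monomial (\<lambda>_. 0) x\<bar> * norm (P f x) \<le> C * (\<Sum>p\<in>F. p f)"
    using diffops_bound_monomial[OF assms, of \<Omega> "\<lambda>_. 0"] by (elim exE conjE) (rule that)
  show ?thesis by (rule that[OF F(1-3)]) (use F(4) in auto)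
qed

text \<open>A product over coordinates: its reciprocal is a tensor product of integrable functions
  of one variable, and on product spaces it factorises (\<open>poly_weight_Pair\<close>).\<close>

definition poly_weight :: "'a::euclidean_space \<Rightarrow> real" where
  "poly_weight x = (\<Prod>b\<in>Basis. 1 + (x \<bullet> b)\<^sup>2)"

lemma poly_weight_ge_1: "1 \<le> poly_weight x" unfolding poly_weight_def by (rule prod_ge_1) simp

lemma poly_weight_pos: "0 < poly_weight x" using poly_weight_ge_1[of x] by linarith

lemma diffops_poly_weight:
  assumes P: "P \<in> diffops"
  shows "(\<lambda>f x. complex_of_real (poly_weight x) * P f x) \<in> diffops"
proof -
  have "(\<lambda>f x. complex_of_real (\<Prod>b\<in>I. 1 + (x \<bullet> b)\<^sup>2) * P f x) \<in> diffops" if "finite I" "I \<subseteq> Basis" for I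
    using that
  proof induction
    case empty
    then show ?case using P by simp
  next
    case (insert b I)
    define Q where "Q = (\<lambda>f x. complex_of_real (\<Prod>b\<in>I. 1 + (x \<bullet> b)\<^sup>2) * P f x)"
    have Q: "Q \<in> diffops" unfolding Q_def using insert by auto
    have "(\<lambda>f x. Q f x + complex_of_real (x \<bullet> b) * (complex_of_real (x \<bullet> b) * Q f x)) \<in> diffops"
      using insert.prems by (intro diffops.add diffops.coord Q) auto
    also have "(\<lambda>f x. Q f x + complex_of_real (x \<bullet> b) * (complex_of_real (x \<bullet> b) * Q f x))
        = (\<lambda>f x. complex_of_real (\<Prod>b\<in>insert b I. 1 + (x \<bullet> b)\<^sup>2) * P f x)"
      using insert.hyps by (intro ext) (simp add: Q_def algebra_simps power2_eq_square)
    finally show ?case .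
  qed
  from this[of Basis] show ?thesis by (simp add: poly_weight_def)
qed

lemma diffops_poly_weight_power:
  "P \<in> diffops \<Longrightarrow> (\<lambda>f x. complex_of_real (poly_weight x ^ m) * P f x) \<in> diffops"
proof (induction m)
  case (Suc m)
  from diffops_poly_weight[OF Suc.IH[OF Suc.prems]] show ?case by (simp add: mult.assoc)
qed simp

lemma schwartz_decay:
  assumes "f \<in> schwartz" "P \<in> diffops"
  obtains C where "0 < C" "\<And>x. norm (P f x) \<le> C / poly_weight x ^ m"
proof -
  obtain F C where F: "\<And>g x. schwartz_bounds UNIV g \<Longrightarrow> x \<in> UNIV \<Longrightarrow>
      norm (complex_of_real (poly_weight x ^ m) * P g x) \<le> C * (\<Sum>p\<in>F. p g)"
    by (rule diffops_bound[OF diffops_poly_weight_power[OF assms(2), of m], of UNIV]) (rule that)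
  have "poly_weight x ^ m * norm (P f x) \<le> max 1 (C * (\<Sum>p\<in>F. p f))" for x
    using F[of f x] assms(1) poly_weight_pos[of x] by (simp add: schwartz_def norm_mult norm_power)
  then have "norm (P f x) \<le> max 1 (C * (\<Sum>p\<in>F. p f)) / poly_weight x ^ m" for x using poly_weight_pos[of x] by (simp add: field_simps)
  then show ?thesis by (intro that[of "max 1 (C * (\<Sum>p\<in>F. p f))"]) auto
qed

section \<open>Integration on Euclidean spaces\<close>

lemma Basis_vec_eq_image: "(Basis :: (real ^ 'n) set) = (\<lambda>i. axis i 1) ` UNIV" by (auto simp: Basis_vec_def)

lemma inj_axis_one: "inj (\<lambda>i. axis i (1::real))" by (auto simp: inj_on_def axis_eq_axis)

lemma prod_Basis_vec: "(\<Prod>b\<in>(Basis :: (real ^ 'n) set). g b) = (\<Prod>i\<in>UNIV. g (axis i 1))"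
  unfolding Basis_vec_eq_image by (subst prod.reindex) (auto simp: inj_axis_one)

lemma sum_Basis_vec: "(\<Sum>b\<in>(Basis :: (real ^ 'n) set). g b) = (\<Sum>i\<in>UNIV. g (axis i 1))"
  unfolding Basis_vec_eq_image by (subst sum.reindex) (auto simp: inj_axis_one)

lemma
  fixes f :: "'a::euclidean_space \<Rightarrow> real \<Rightarrow> complex"
  assumes f: "\<And>b. b \<in> Basis \<Longrightarrow> integrable lborel (f b)"
  shows integrable_lborel_prod: "integrable lborel (\<lambda>x. \<Prod>b\<in>Basis. f b (x \<bullet> b))"
    and integral_lborel_prod: "(LINT x|lborel. (\<Prod>b\<in>Basis. f b (x \<bullet> b))) = (\<Prod>b\<in>Basis. LINT x|lborel. f b x)"
proof -
  interpret product_sigma_finite "\<lambda>_::'a. lborel :: real measure" ..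
  define T where "T = (\<lambda>g. \<Sum>b\<in>(Basis :: 'a set). g b *\<^sub>R b)"
  have [measurable]: "T \<in> measurable (\<Pi>\<^sub>M b\<in>Basis. lborel) borel" unfolding T_def by measurable
  have [measurable]: "f b \<in> borel_measurable borel" if "b \<in> Basis" for b using f[OF that] by (simp add: borel_measurable_integrable)
  have [measurable]: "(\<lambda>x. \<Prod>b\<in>Basis. f b (x \<bullet> b)) \<in> borel_measurable borel" by measurable
  have T: "(\<Prod>b\<in>Basis. f b (T g \<bullet> b)) = (\<Prod>b\<in>Basis. f b (g b))" for g
    unfolding T_def by (intro prod.cong refl) (simp add: inner_sum_left inner_Basis if_distrib cong: if_cong)
  have eq: "(lborel :: 'a measure) = distr (\<Pi>\<^sub>M b\<in>Basis. lborel) borel T" unfolding T_def by (rule lborel_eq)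
  show "integrable lborel (\<lambda>x. \<Prod>b\<in>Basis. f b (x \<bullet> b))"
    unfolding eq by (subst integrable_distr_eq) (auto simp: T intro!: product_integrable_prod f)
  show "(LINT x|lborel. (\<Prod>b\<in>Basis. f b (x \<bullet> b))) = (\<Prod>b\<in>Basis. LINT x|lborel. f b x)"
    unfolding eq by (subst integral_distr) (auto simp: T intro!: product_integral_prod f)
qed

lemma
  fixes f :: "'n::finite \<Rightarrow> real \<Rightarrow> complex"
  assumes f: "\<And>i. integrable lborel (f i)"
  shows integrable_lborel_vec_prod: "integrable lborel (\<lambda>x :: real ^ 'n. \<Prod>i\<in>UNIV. f i (x $ i))"
    and integral_lborel_vec_prod: "(LINT x|lborel. (\<Prod>i\<in>UNIV. f i (x $ i))) = (\<Prod>i\<in>UNIV. LINT x|lborel. f i x)"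
proof -
  \<comment> \<open>The product formula is indexed by basis vectors; inverting \<open>axis\<close>
    recovers the coordinate index from the basis vector.\<close>
  define g where "g = (\<lambda>b :: real ^ 'n. f (the_inv (\<lambda>i. axis i (1::real)) b))"
  have g: "g (axis i 1) = f i" for i unfolding g_def by (simp add: the_inv_f_f[OF inj_axis_one])
  have gi: "integrable lborel (g b)" for b unfolding g_def by (rule f)
  show "integrable lborel (\<lambda>x :: real ^ 'n. \<Prod>i\<in>UNIV. f i (x $ i))"
    using integrable_lborel_prod[of g, OF gi] by (simp add: prod_Basis_vec g inner_axis)
  show "(LINT x|lborel. (\<Prod>i\<in>UNIV. f i (x $ i))) = (\<Prod>i\<in>UNIV. LINT x|lborel. f i x)"
    using integral_lborel_prod[of g, OF gi] by (simp add: prod_Basis_vec g inner_axis)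
qed

lemma integrable_inverse_1_plus_square': "integrable lborel (\<lambda>x::real. 1 / (1 + x\<^sup>2))"
proof -
  have "set_integrable lborel (einterval (-\<infinity>) \<infinity>) (\<lambda>x. inverse (1 + x^2))" by (rule integrable_inverse_1_plus_square)
  then show ?thesis by (simp add: set_integrable_def einterval_def divide_inverse)
qed

lemma integrable_inverse_weight:
  "integrable lborel (\<lambda>x :: 'a::euclidean_space. 1 / (\<Prod>b\<in>Basis. 1 + (x \<bullet> b)\<^sup>2))"
proof -
  have 1: "integrable lborel (\<lambda>x. complex_of_real (1 / (1 + x\<^sup>2)))" using integrable_inverse_1_plus_square' by (rule integrable_of_real)
  have "integrable lborel (\<lambda>x :: 'a. \<Prod>b\<in>Basis. complex_of_real (1 / (1 + (x \<bullet> b)\<^sup>2)))"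
    by (rule integrable_lborel_prod[of "\<lambda>_ x. complex_of_real (1 / (1 + x\<^sup>2))"]) (rule 1)
  then have "integrable lborel (\<lambda>x :: 'a. Re (\<Prod>b\<in>Basis. complex_of_real (1 / (1 + (x \<bullet> b)\<^sup>2))))"
    by (rule integrable_Re)
  also have "(\<lambda>x :: 'a. Re (\<Prod>b\<in>Basis. complex_of_real (1 / (1 + (x \<bullet> b)\<^sup>2)))) = (\<lambda>x. 1 / (\<Prod>b\<in>Basis. 1 + (x \<bullet> b)\<^sup>2))"
    by (simp only: of_real_prod[symmetric] Re_complex_of_real prod_dividef prod.neutral_const)
  finally show ?thesis .
qed

section \<open>Affine and coordinatewise changes of variables\<close>

lemma integrable_affine_euclidean:
  fixes f :: "'a::euclidean_space \<Rightarrow> complex" and c :: "'a \<Rightarrow> real" and t :: 'a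
  defines "T x \<equiv> t + (\<Sum>j\<in>Basis. (c j * (x \<bullet> j)) *\<^sub>R j)"
  assumes c: "\<And>j. j \<in> Basis \<Longrightarrow> c j \<noteq> 0" and f: "integrable lborel f"
  shows "integrable lborel (\<lambda>x. f (T x))"
    and "(LINT x|lborel. f x) = (\<Prod>j\<in>Basis. \<bar>c j\<bar>) *\<^sub>R (LINT x|lborel. f (T x))"
proof -
  have [measurable]: "f \<in> borel_measurable borel" using f by (simp add: borel_measurable_integrable)
  have [measurable]: "T \<in> borel \<rightarrow>\<^sub>M borel" by (simp add: T_def[abs_def])
  have eq: "lborel = density (distr lborel borel T) (\<lambda>_. ennreal (\<Prod>j\<in>Basis. \<bar>c j\<bar>))"
    unfolding T_def by (rule lborel_affine_euclidean[OF c])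
  have pos: "(\<Prod>j\<in>Basis. \<bar>c j\<bar>) > 0" using c by (intro prod_pos) auto
  have "integrable (density (distr lborel borel T) (\<lambda>_. ennreal (\<Prod>j\<in>Basis. \<bar>c j\<bar>))) f" using f eq by simp
  then have "integrable (distr lborel borel T) (\<lambda>x. (\<Prod>j\<in>Basis. \<bar>c j\<bar>) *\<^sub>R f x)"
    by (subst (asm) integrable_density) (use pos in \<open>auto intro: less_imp_le\<close>)
  then have "integrable (distr lborel borel T) f"
    using pos integrable_scaleR_right[of "1 / (\<Prod>j\<in>Basis. \<bar>c j\<bar>)" "distr lborel borel T"
        "\<lambda>x. (\<Prod>j\<in>Basis. \<bar>c j\<bar>) *\<^sub>R f x"] c by auto
  then show "integrable lborel (\<lambda>x. f (T x))" by (subst (asm) integrable_distr_eq) auto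
  have "(LINT x|lborel. f x) = (LINT x|density (distr lborel borel T) (\<lambda>_. ennreal (\<Prod>j\<in>Basis. \<bar>c j\<bar>)). f x)"
    using eq by simp
  also have "\<dots> = (LINT x|distr lborel borel T. (\<Prod>j\<in>Basis. \<bar>c j\<bar>) *\<^sub>R f x)"
    by (subst integral_density) (use pos in \<open>auto intro: less_imp_le\<close>)
  also have "\<dots> = (\<Prod>j\<in>Basis. \<bar>c j\<bar>) *\<^sub>R (LINT x|lborel. f (T x))" by (subst integral_distr) auto
  finally show "(LINT x|lborel. f x) = (\<Prod>j\<in>Basis. \<bar>c j\<bar>) *\<^sub>R (LINT x|lborel. f (T x))" .
qed

lemma
  fixes f :: "'a::euclidean_space \<Rightarrow> complex"
  assumes "c \<noteq> 0" and f: "integrable lborel f"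
  shows integrable_scale_shift: "integrable lborel (\<lambda>x. f (t + c *\<^sub>R x))"
    and integral_scale_shift: "(LINT x|lborel. f x) = \<bar>c\<bar> ^ DIM('a) *\<^sub>R (LINT x|lborel. f (t + c *\<^sub>R x))"
proof -
  have "(\<Sum>j\<in>Basis. (c * (x \<bullet> j)) *\<^sub>R j) = c *\<^sub>R x" for x :: 'a
    unfolding scaleR_scaleR[symmetric] scaleR_sum_right[symmetric] euclidean_representation ..
  then show "integrable lborel (\<lambda>x. f (t + c *\<^sub>R x))"
    "(LINT x|lborel. f x) = \<bar>c\<bar> ^ DIM('a) *\<^sub>R (LINT x|lborel. f (t + c *\<^sub>R x))"
    using integrable_affine_euclidean[of "\<lambda>_. c" f t] assms by (simp_all add: prod_constant)
qed

lemma
  fixes f :: "'a::euclidean_space \<Rightarrow> complex"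
  assumes "c \<noteq> 0" and b: "b \<in> Basis" and f: "integrable lborel f"
  shows integrable_scale_coord: "integrable lborel (\<lambda>x. f (x + ((c - 1) * (x \<bullet> b)) *\<^sub>R b))"
    and integral_scale_coord: "(LINT x|lborel. f x) = \<bar>c\<bar> *\<^sub>R (LINT x|lborel. f (x + ((c - 1) * (x \<bullet> b)) *\<^sub>R b))"
proof -
  have eq: "(\<Sum>j\<in>Basis. ((if j = b then c else 1) * (x \<bullet> j)) *\<^sub>R j) = x + ((c - 1) * (x \<bullet> b)) *\<^sub>R b" for x :: 'a
  proof -
    have "(\<Sum>j\<in>Basis. ((if j = b then c else 1) * (x \<bullet> j)) *\<^sub>R j)
        = (\<Sum>j\<in>Basis. (x \<bullet> j) *\<^sub>R j + (if j = b then ((c - 1) * (x \<bullet> b)) *\<^sub>R b else 0))"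
      by (intro sum.cong refl) (auto simp: algebra_simps)
    also have "\<dots> = x + ((c - 1) * (x \<bullet> b)) *\<^sub>R b" using b by (simp add: sum.distrib euclidean_representation)
    finally show ?thesis .
  qed
  have pr: "(\<Prod>j\<in>Basis. \<bar>if j = b then c else 1\<bar>) = \<bar>c\<bar>" using b by (subst prod.remove[of _ b]) auto
  show "integrable lborel (\<lambda>x. f (x + ((c - 1) * (x \<bullet> b)) *\<^sub>R b))"
    "(LINT x|lborel. f x) = \<bar>c\<bar> *\<^sub>R (LINT x|lborel. f (x + ((c - 1) * (x \<bullet> b)) *\<^sub>R b))"
    using integrable_affine_euclidean[of "\<lambda>j. if j = b then c else 1" f 0] assms(1) f unfolding eq pr by auto
qed

lemma
  fixes f :: "'a::euclidean_space \<Rightarrow> real"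
  assumes c: "c \<noteq> 0" and f: "integrable lborel f"
  shows integrable_scale_shift_real: "integrable lborel (\<lambda>x. f (t + c *\<^sub>R x))"
    and integral_scale_shift_real: "(LINT x|lborel. f x) = \<bar>c\<bar> ^ DIM('a) * (LINT x|lborel. f (t + c *\<^sub>R x))"
proof -
  have i: "integrable lborel (\<lambda>x. complex_of_real (f x))" using f by (rule integrable_of_real)
  have "integrable lborel (\<lambda>x. Re (complex_of_real (f (t + c *\<^sub>R x))))" by (rule integrable_Re[OF integrable_scale_shift[OF c i]])
  then show "integrable lborel (\<lambda>x. f (t + c *\<^sub>R x))" by (simp only: Re_complex_of_real)
  from integral_scale_shift[OF c i, of t]
  have "complex_of_real (LINT x|lborel. f x) = complex_of_real (\<bar>c\<bar> ^ DIM('a) * (LINT x|lborel. f (t + c *\<^sub>R x)))"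
    by (simp only: integral_complex_of_real scaleR_conv_of_real of_real_mult)
  then show "(LINT x|lborel. f x) = \<bar>c\<bar> ^ DIM('a) * (LINT x|lborel. f (t + c *\<^sub>R x))" by (simp only: of_real_eq_iff)
qed

text \<open>If the integral of \<open>\<Phi> s\<close> does not depend on \<open>s\<close> and \<open>\<Phi>\<close> is the \<open>s\<close>-derivative of a quantity
  whose endpoint values have the same integral, then that integral is \<open>0\<close>.\<close>

lemma integral_flow_eq_zero:
  fixes \<Phi> :: "real \<Rightarrow> 'a::euclidean_space \<Rightarrow> complex"
  assumes meas: "case_prod \<Phi> \<in> borel_measurable (lborel \<Otimes>\<^sub>M lborel)"
    and int: "\<And>s. s \<in> {0..1} \<Longrightarrow> integrable lborel (\<Phi> s)"
    and I: "\<And>s. s \<in> {0..1} \<Longrightarrow> (LINT x|lborel. \<Phi> s x) = I"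
    and J: "\<And>s. s \<in> {0..1} \<Longrightarrow> (LINT x|lborel. norm (\<Phi> s x)) = J"
    and ftc: "\<And>x. (LINT s|lborel. indicator {0..1} s *\<^sub>R \<Phi> s x) = \<Psi>\<^sub>1 x - \<Psi>\<^sub>0 x"
    and \<Psi>: "integrable lborel \<Psi>\<^sub>1" "integrable lborel \<Psi>\<^sub>0" "(LINT x|lborel. \<Psi>\<^sub>1 x) = (LINT x|lborel. \<Psi>\<^sub>0 x)"
  shows "I = 0"
proof -
  have [measurable]: "(\<lambda>p. indicator {0..1::real} (fst p) *\<^sub>R \<Phi> (fst p) (snd p)) \<in> borel_measurable (lborel \<Otimes>\<^sub>M lborel)"
    using meas by (simp add: case_prod_beta) measurable
  have i01: "indicator {0..1} s *\<^sub>R (LINT x|lborel. \<Phi> s x) = indicator {0..1} s *\<^sub>R I"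
    "(LINT x|lborel. norm (indicator {0..1} s *\<^sub>R \<Phi> s x)) = indicator {0..1} s * J" for s :: real
    using I[of s] J[of s] by (auto simp: indicator_def)
  have ind: "integrable lborel (\<lambda>s::real. indicator {0..1} s *\<^sub>R c)" for c :: "'z::{banach, second_countable_topology}"
    by (rule integrable_real_indicator[THEN integrable_scaleR_left]) auto
  \<comment> \<open>Absolute integrability on the strip over [0,1], needed to exchange the two
    integrals: the inner integral of the norm has the constant value \<open>J\<close> there.\<close>
  have P: "integrable (lborel \<Otimes>\<^sub>M lborel) (\<lambda>p. indicator {0..1::real} (fst p) *\<^sub>R \<Phi> (fst p) (snd p))"
  proof (rule lborel_pair.Fubini_integrable)
    show "integrable lborel (\<lambda>x. LINT y|lborel. norm (indicator {0..1::real} (fst (x, y)) *\<^sub>R \<Phi> (fst (x, y)) (snd (x, y))))"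
      using ind[of J] by (simp add: i01(2) del: norm_scaleR)
    show "AE x in lborel. integrable lborel (\<lambda>y. indicator {0..1::real} (fst (x, y)) *\<^sub>R \<Phi> (fst (x, y)) (snd (x, y)))"
      using int by (intro AE_I2) (auto simp: indicator_def)
  qed measurable
  have "I = (LINT s|lborel. indicator {0..1::real} s *\<^sub>R I)" by (simp add: )
  also have "\<dots> = (LINT s|lborel. LINT x|lborel. indicator {0..1::real} s *\<^sub>R \<Phi> s x)" by (simp add: i01(1))
  also have "\<dots> = (LINT x|lborel. LINT s|lborel. indicator {0..1::real} s *\<^sub>R \<Phi> s x)"
  proof (rule lborel_pair.Fubini_integral[symmetric])
    have "(\<lambda>(s, x). indicator {0..1::real} s *\<^sub>R \<Phi> s x)
        = (\<lambda>p. indicator {0..1::real} (fst p) *\<^sub>R \<Phi> (fst p) (snd p))" by auto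
    then show "integrable (lborel \<Otimes>\<^sub>M lborel) (\<lambda>(s, x). indicator {0..1::real} s *\<^sub>R \<Phi> s x)" using P by (simp only:)
  qed
  also have "\<dots> = (LINT x|lborel. \<Psi>\<^sub>1 x - \<Psi>\<^sub>0 x)" by (simp add: ftc)
  also have "\<dots> = 0" using \<Psi> by (simp add: Bochner_Integration.integral_diff)
  finally show ?thesis .
qed

text \<open>The flow is translation along \<open>b\<close>. It carries \<Psi> to its translate with
  derivative \<open>D\<close>, and translation invariance equates the integrals at the two
  endpoints.\<close>

lemma integral_dir_derivative_eq_zero:
  fixes \<Psi> :: "'a::euclidean_space \<Rightarrow> complex"
  assumes diff: "\<And>x. \<Psi> differentiable (at x)"
    and D: "\<And>x. frechet_derivative \<Psi> (at x) b = D x"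
    and cont: "continuous_on UNIV D" and int: "integrable lborel \<Psi>" "integrable lborel D"
  shows "(LINT x|lborel. D x) = 0"
proof (rule integral_flow_eq_zero[where \<Phi> = "\<lambda>s x. D (s *\<^sub>R b + x)" and \<Psi>\<^sub>1 = "\<lambda>x. \<Psi> (b + x)" and \<Psi>\<^sub>0 = \<Psi>])
  have [measurable]: "D \<in> borel_measurable borel" using cont by (rule borel_measurable_continuous_onI)
  show "case_prod (\<lambda>s x. D (s *\<^sub>R b + x)) \<in> borel_measurable (lborel \<Otimes>\<^sub>M lborel)" by measurable
  have sh: "integrable lborel (\<lambda>x. f (a + x))" "(LINT x|lborel. f (a + x)) = (LINT x|lborel. f x)"
    if "integrable lborel f" for f :: "'a \<Rightarrow> complex" and a
    using integrable_scale_shift[of 1 f a] integral_scale_shift[of 1 f a] that by simp_all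
  have nsh: "(LINT x|lborel. norm (D (a + x))) = (LINT x|lborel. norm (D x))" for a
  proof -
    have "complex_of_real (LINT x|lborel. norm (D (a + x))) = complex_of_real (LINT x|lborel. norm (D x))"
      using sh(2)[of "\<lambda>x. complex_of_real (norm (D x))" a] int(2) by (simp add: integrable_of_real integrable_norm)
    then show ?thesis by (simp only: of_real_eq_iff)
  qed
  fix s :: real
  show "integrable lborel (\<lambda>x. D (s *\<^sub>R b + x))" "(LINT x|lborel. D (s *\<^sub>R b + x)) = (LINT x|lborel. D x)"
    "(LINT x|lborel. norm (D (s *\<^sub>R b + x))) = (LINT x|lborel. norm (D x))" using sh int nsh by auto
  show "integrable lborel (\<lambda>x. \<Psi> (b + x))" "integrable lborel \<Psi>"
    "(LINT x|lborel. \<Psi> (b + x)) = (LINT x|lborel. \<Psi> x)" using sh int by auto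
  fix x
  have "(LINT s|lborel. indicator {0..1} s *\<^sub>R D (s *\<^sub>R b + x)) = \<Psi> (1 *\<^sub>R b + x) - \<Psi> (0 *\<^sub>R b + x)"
  proof (rule integral_FTC_atLeastAtMost)
    fix s :: real
    have "(\<Psi> has_derivative frechet_derivative \<Psi> (at (s *\<^sub>R b + x))) (at (s *\<^sub>R b + x))"
      using diff frechet_derivative_works by blast
    then have "((\<lambda>s. \<Psi> (s *\<^sub>R b + x)) has_derivative (\<lambda>h. frechet_derivative \<Psi> (at (s *\<^sub>R b + x)) (h *\<^sub>R b))) (at s within {0..1})"
      by (intro has_derivative_compose[of "\<lambda>s. s *\<^sub>R b + x" _ s _ \<Psi>]) (auto intro!: derivative_eq_intros)
    moreover have "frechet_derivative \<Psi> (at (s *\<^sub>R b + x)) (h *\<^sub>R b) = h *\<^sub>R D (s *\<^sub>R b + x)" for h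
      using linear_frechet_derivative[OF diff] D by (simp add: linear_scale)
    ultimately show "((\<lambda>s. \<Psi> (s *\<^sub>R b + x)) has_vector_derivative D (s *\<^sub>R b + x)) (at s within {0..1})"
      unfolding has_vector_derivative_def by simp
  next
    show "continuous_on {0..1} (\<lambda>s. D (s *\<^sub>R b + x))" by (intro continuous_on_compose2[OF cont] continuous_intros) auto
  qed simp
  then show "(LINT s|lborel. indicator {0..1} s *\<^sub>R D (s *\<^sub>R b + x)) = \<Psi> (b + x) - \<Psi> x" by simp
qed

text \<open>On \<Omega>, \<open>D\<close> is the derivative in direction \<open>b\<close> of the
  product of \<open>x \<bullet> b\<close> and \<Psi>. The flow multiplies the coordinate along
  \<open>b\<close> by \<open>exp s\<close>; weighted with its Jacobian \<open>exp s\<close> it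
  preserves integrals, and the weighted pullback of \<Psi> has \<open>s\<close>-derivative the
  weighted pullback of \<open>D\<close>. Invariance of \<Omega> takes the place of boundary
  conditions.\<close>

lemma integral_scaling_derivative_eq_zero:
  fixes \<Psi> :: "'a::euclidean_space \<Rightarrow> complex"
  assumes b: "b \<in> Basis" and \<Omega>: "open \<Omega>" and inv: "\<And>s x. x + ((exp s - 1) * (x \<bullet> b)) *\<^sub>R b \<in> \<Omega> \<longleftrightarrow> x \<in> \<Omega>"
    and diff: "\<And>x. x \<in> \<Omega> \<Longrightarrow> \<Psi> differentiable (at x)"
    and D: "\<And>x. x \<in> \<Omega> \<Longrightarrow> D x = \<Psi> x + of_real (x \<bullet> b) * frechet_derivative \<Psi> (at x) b"
    and cont: "continuous_on \<Omega> D" and int: "set_integrable lborel \<Omega> \<Psi>" "set_integrable lborel \<Omega> D"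
  shows "(LINT x:\<Omega>|lborel. D x) = 0" unfolding set_lebesgue_integral_def
proof (rule integral_flow_eq_zero)
  define T where "T s x = x + ((exp s - 1) * (x \<bullet> b)) *\<^sub>R b" for s x
  define D' where "D' = (\<lambda>x. indicator \<Omega> x *\<^sub>R D x)"
  define \<Psi>' where "\<Psi>' = (\<lambda>x. indicator \<Omega> x *\<^sub>R \<Psi> x)"
  have D'i: "integrable lborel D'" and \<Psi>'i: "integrable lborel \<Psi>'" using int by (auto simp: D'_def \<Psi>'_def set_integrable_def)
  have [measurable]: "D' \<in> borel_measurable borel" using D'i by (simp add: borel_measurable_integrable)
  show "(\<lambda>(s, x). exp s *\<^sub>R D' (T s x)) \<in> borel_measurable (lborel \<Otimes>\<^sub>M lborel)" unfolding T_def by measurable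
  have sc: "integrable lborel (\<lambda>x. exp s *\<^sub>R f (T s x))" "(LINT x|lborel. exp s *\<^sub>R f (T s x)) = (LINT x|lborel. f x)"
    if "integrable lborel f" for f :: "'a \<Rightarrow> complex" and s
    using integrable_scale_coord[of "exp s" b f] integral_scale_coord[of "exp s" b f] that b by (simp_all add: T_def scaleR_conv_of_real)
  have nsc: "(LINT x|lborel. norm (exp s *\<^sub>R D' (T s x))) = (LINT x|lborel. norm (D' x))" for s
  proof -
    have "complex_of_real (LINT x|lborel. norm (exp s *\<^sub>R D' (T s x))) = complex_of_real (LINT x|lborel. norm (D' x))"
      using sc(2)[of "\<lambda>x. complex_of_real (norm (D' x))" s] D'i
      by (simp add: integrable_of_real integrable_norm scaleR_conv_of_real norm_mult flip: of_real_mult)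
    then show ?thesis by (simp only: of_real_eq_iff)
  qed
  fix s :: real
  show "integrable lborel (\<lambda>x. exp s *\<^sub>R D' (T s x))" by (rule sc(1)[OF D'i])
  show "(LINT x|lborel. exp s *\<^sub>R D' (T s x)) = (LINT x|lborel. indicator \<Omega> x *\<^sub>R D x)"
    using sc(2)[OF D'i, of s] unfolding D'_def .
  show "(LINT x|lborel. norm (exp s *\<^sub>R D' (T s x))) = (LINT x|lborel. norm (D' x))" by (rule nsc)
  show "integrable lborel (\<lambda>x. exp 1 *\<^sub>R \<Psi>' (T 1 x))" "integrable lborel \<Psi>'"
    "(LINT x|lborel. exp 1 *\<^sub>R \<Psi>' (T 1 x)) = (LINT x|lborel. \<Psi>' x)" using sc \<Psi>'i by auto
  fix x
  have T\<Omega>: "T s x \<in> \<Omega> \<longleftrightarrow> x \<in> \<Omega>" for s unfolding T_def by (rule inv)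
  have T0: "T 0 x = x" by (simp add: T_def)
  show "(LINT s|lborel. indicator {0..1} s *\<^sub>R (exp s *\<^sub>R D' (T s x))) = exp 1 *\<^sub>R \<Psi>' (T 1 x) - \<Psi>' x"
  proof (cases "x \<in> \<Omega>")
    case True
    have "(LINT s|lborel. indicator {0..1} s *\<^sub>R (exp s *\<^sub>R D (T s x))) = exp 1 *\<^sub>R \<Psi> (T 1 x) - exp 0 *\<^sub>R \<Psi> (T 0 x)"
    proof (rule integral_FTC_atLeastAtMost)
      fix s :: real
      have TO: "T s x \<in> \<Omega>" using T\<Omega> True by simp
      define L where "L = frechet_derivative \<Psi> (at (T s x))"
      have L: "(\<Psi> has_derivative L) (at (T s x))" unfolding L_def using diff[OF TO] frechet_derivative_works by blast
      have "(T' has_derivative (\<lambda>h. (h * exp s * (x \<bullet> b)) *\<^sub>R b)) (at s within {0..1})" if "T' = (\<lambda>s. T s x)" for T'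
        unfolding that T_def by (auto intro!: derivative_eq_intros simp: algebra_simps)
      then have "((\<lambda>s. \<Psi> (T s x)) has_derivative (\<lambda>h. L ((h * exp s * (x \<bullet> b)) *\<^sub>R b))) (at s within {0..1})"
        by (intro has_derivative_compose[of "\<lambda>s. T s x" _ s _ \<Psi>] L) auto
      moreover have "L ((h * exp s * (x \<bullet> b)) *\<^sub>R b) = (h * exp s * (x \<bullet> b)) *\<^sub>R L b" for h
        using linear_frechet_derivative[OF diff[OF TO]] by (simp add: linear_scale L_def)
      ultimately have "((\<lambda>s. exp s *\<^sub>R \<Psi> (T s x)) has_derivative
          (\<lambda>h. exp s *\<^sub>R ((h * exp s * (x \<bullet> b)) *\<^sub>R L b) + (h * exp s) *\<^sub>R \<Psi> (T s x))) (at s within {0..1})"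
        by (auto intro!: derivative_eq_intros)
      moreover have "exp s *\<^sub>R ((h * exp s * (x \<bullet> b)) *\<^sub>R L b) + (h * exp s) *\<^sub>R \<Psi> (T s x) = h *\<^sub>R (exp s *\<^sub>R D (T s x))" for h
        unfolding D[OF TO] L_def[symmetric] using b by (simp add: T_def algebra_simps inner_simps scaleR_conv_of_real)
      ultimately show "((\<lambda>s. exp s *\<^sub>R \<Psi> (T s x)) has_vector_derivative exp s *\<^sub>R D (T s x)) (at s within {0..1})"
        unfolding has_vector_derivative_def by simp
    next
      show "continuous_on {0..1} (\<lambda>s. exp s *\<^sub>R D (T s x))" unfolding T_def
        by (intro continuous_on_scaleR continuous_on_exp continuous_on_id continuous_on_compose2[OF cont] continuous_intros)
          (use T\<Omega> True in \<open>auto simp: T_def\<close>)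
    qed simp
    then show ?thesis using True T\<Omega> by (simp add: D'_def \<Psi>'_def T0)
  qed (use T\<Omega> in \<open>simp add: D'_def \<Psi>'_def\<close>)
qed

lemma schwartz_seminorm_scale_eq:
  assumes f: "f \<in> schwartz" and p: "p \<in> schwartz_seminorms UNIV"
  shows "p (\<lambda>x. a * f x) = norm a * p f"
proof (rule homogeneous_of_le[where p = p and f = f and V = schwartz])
  show V: "(\<lambda>x. c * f x) \<in> schwartz" for c using schwartz_lin_comb[OF f schwartz_zero, of c] by simp
  show "0 \<le> p (\<lambda>x. a * f x)" using V schwartz_seminorm_nonneg[OF _ p] by (simp add: schwartz_def)
qed (use schwartz_seminorm_scale[OF open_UNIV UNIV_not_empty _ _ p] in \<open>auto simp: schwartz_def\<close>)

lemma sup_seminorm: "(\<lambda>g. SUP x. weighted_deriv (\<lambda>_. 0) [] g x) \<in> schwartz_seminorms UNIV"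
  by (auto simp: schwartz_seminorms_def intro!: exI[of _ "[]"])

lemma norm_le_sup_seminorm: "g \<in> schwartz \<Longrightarrow> norm (g x) \<le> (SUP x. weighted_deriv (\<lambda>_. 0) [] g x)"
  using schwartz_seminorm_upper[of UNIV g "[]" x "\<lambda>_. 0"] by (simp add: schwartz_def weighted_deriv_def)

lemma seminorm_schwartz:
  "seminorm_space (schwartz :: ('a::euclidean_space \<Rightarrow> complex) set) (schwartz_seminorms UNIV)" unfolding seminorm_space_def
proof (intro conjI ballI allI)
  fix p :: "('a \<Rightarrow> complex) \<Rightarrow> real" and f g :: "'a \<Rightarrow> complex"
  assume *: "p \<in> schwartz_seminorms UNIV" "f \<in> schwartz" "g \<in> schwartz"
  show "p (\<lambda>x. f x + g x) \<le> p f + p g"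
    by (rule schwartz_seminorm_add[OF open_UNIV UNIV_not_empty]) (use * in \<open>auto simp: schwartz_def\<close>)
qed (simp_all add: schwartz_seminorms_nonempty schwartz_zero schwartz_lin_comb schwartz_seminorm_scale_eq)

lemma monomial_induct:
  assumes 1: "\<And>x. m0 x = (1::real)" "P m0" and step: "\<And>m b. b \<in> Basis \<Longrightarrow> P m \<Longrightarrow> P (\<lambda>x. (x \<bullet> b) * m x)"
  shows "P (monomial k)"
proof -
  have pow: "P (\<lambda>x. (x \<bullet> b) ^ n * m x)" if "b \<in> Basis" "P m" for b n m
    using step[OF that(1)] that(2) by (induction n) (simp_all add: mult.assoc)
  have "P (\<lambda>x. \<Prod>b\<in>I. (x \<bullet> b) ^ k b)" if "finite I" "I \<subseteq> Basis" for I using that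
  proof induction
    case empty
    have "m0 = (\<lambda>_. 1)" using 1 by auto
    then show ?case using 1 by simp
  next
    case (insert b I)
    then show ?case using pow[of b "\<lambda>x. \<Prod>b\<in>I. (x \<bullet> b) ^ k b" "k b"] by simp
  qed
  from this[of Basis] show ?thesis by (simp add: monomial_def[abs_def])
qed

section \<open>Hermite functions\<close>

text \<open>The Hermite polynomials by their three-term recurrence; \<open>hermite_poly_eq\<close>
  identifies them with the definition by iterated derivatives of the Gaussian.\<close>

fun hermite_rec :: "nat \<Rightarrow> real \<Rightarrow> real" where
  "hermite_rec 0 t = 1"
| "hermite_rec (Suc 0) t = 2 * t"
| "hermite_rec (Suc (Suc j)) t = 2 * t * hermite_rec (Suc j) t - 2 * real (Suc j) * hermite_rec j t"

text \<open>For \<open>j = 0\<close> the truncated index \<open>j - 1\<close> is harmless because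
  its coefficient vanishes. The same convention is used for all lowering formulas below.\<close>

lemma hermite_rec_Suc: "hermite_rec (Suc j) t = 2 * t * hermite_rec j t - 2 * real j * hermite_rec (j - 1) t" by (cases j) auto

lemma hermite_rec_deriv: "(hermite_rec j has_field_derivative 2 * real j * hermite_rec (j - 1) t) (at t)"
proof (induction j t rule: hermite_rec.induct)
  case (3 j t)
  have eq: "hermite_rec (Suc (Suc j)) = (\<lambda>t. 2 * t * hermite_rec (Suc j) t - 2 * real (Suc j) * hermite_rec j t)" by (rule ext) simp
  show ?case unfolding eq by (rule derivative_eq_intros refl 3)+ (simp add: hermite_rec_Suc[of j] algebra_simps)
next
  case (1 t)
  have "hermite_rec 0 = (\<lambda>_. 1)" by (rule ext) simp
  then show ?case by simp
next
  case (2 t)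
  have "hermite_rec (Suc 0) = (\<lambda>t. 2 * t)" by (rule ext) simp
  then show ?case by (auto intro!: derivative_eq_intros)
qed

lemma iter_deriv_gaussian:
  "(deriv ^^ j) (\<lambda>s. exp (- (s\<^sup>2))) = (\<lambda>t. (-1) ^ j * hermite_rec j t * exp (- (t\<^sup>2)) :: real)"
proof (induction j)
  case (Suc j)
  have "((\<lambda>t. (-1) ^ j * hermite_rec j t * exp (- (t\<^sup>2))) has_field_derivative
      (-1) ^ Suc j * hermite_rec (Suc j) t * exp (- (t\<^sup>2))) (at t)" for t
    by (rule derivative_eq_intros refl hermite_rec_deriv)+ (simp add: hermite_rec_Suc[of j] algebra_simps)
  then have "deriv (\<lambda>t. (-1) ^ j * hermite_rec j t * exp (- (t\<^sup>2))) = (\<lambda>t. (-1) ^ Suc j * hermite_rec (Suc j) t * exp (- (t\<^sup>2)))"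
    by (intro ext DERIV_imp_deriv)
  with Suc show ?case by simp
qed simp

lemma hermite_poly_eq: "hermite_poly j t = hermite_rec j t"
proof -
  have "(-1) ^ j * (-1) ^ j = (1::real)" "exp (t\<^sup>2) * exp (- (t\<^sup>2)) = 1" by (simp_all flip: power_mult_distrib exp_add)
  moreover have "hermite_poly j t = ((-1) ^ j * (-1) ^ j) * (exp (t\<^sup>2) * exp (- (t\<^sup>2))) * hermite_rec j t"
    unfolding hermite_poly_def iter_deriv_gaussian by (simp only: mult_ac)
  ultimately show ?thesis by simp
qed

definition hermite_norm :: "nat \<Rightarrow> real" where "hermite_norm j = sqrt (2 ^ j * fact j * sqrt pi)"

lemma hermite_norm_pos: "0 < hermite_norm j" by (simp add: hermite_norm_def)

lemma hermite_norm_Suc: "hermite_norm (Suc j) = sqrt (2 * real (Suc j)) * hermite_norm j"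
  unfolding hermite_norm_def real_sqrt_mult[symmetric] by (simp add: algebra_simps)

lemma hermite_fun1_eq: "hermite_fun1 j t = exp (- (t\<^sup>2) / 2) * hermite_rec j t / hermite_norm j"
  by (simp add: hermite_fun1_def hermite_poly_eq hermite_norm_def)

lemma sqrt_half_mult: "0 \<le> r \<Longrightarrow> sqrt (r / 2) * sqrt (2 * r) = r" unfolding real_sqrt_mult[symmetric] by simp

lemma hermite_fun1_lower:
  "sqrt (real j / 2) * hermite_fun1 (j - 1) t = exp (- (t\<^sup>2) / 2) * (real j * hermite_rec (j - 1) t) / hermite_norm j"
proof (cases j)
  case (Suc i)
  define A where "A = sqrt (real (Suc i) / 2)"
  define B where "B = sqrt (2 * real (Suc i))"
  have AB: "A * B = real (Suc i)" unfolding A_def B_def by (rule sqrt_half_mult) simp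
  have nz: "B \<noteq> 0" "hermite_norm i \<noteq> 0" using hermite_norm_pos[of i] by (auto simp: B_def)
  have "sqrt (real j / 2) * hermite_fun1 (j - 1) t = A * (exp (- (t\<^sup>2) / 2) * hermite_rec i t / hermite_norm i)"
    unfolding Suc A_def hermite_fun1_eq by simp
  also have "\<dots> = exp (- (t\<^sup>2) / 2) * ((A * B) * hermite_rec i t) / (B * hermite_norm i)" using nz by (simp add: field_simps)
  also have "\<dots> = exp (- (t\<^sup>2) / 2) * (real (Suc i) * hermite_rec i t) / (B * hermite_norm i)" unfolding AB ..
  finally show ?thesis unfolding Suc hermite_norm_Suc B_def by simp
qed simp

text \<open>Normalisation makes the recurrence symmetric: multiplication by \<open>t\<close> is the
  sum of a raising and a lowering operator. \<open>hermite_fun1_deriv\<close> shows that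
  differentiation is the difference, lowering minus raising, with the same coefficients.\<close>

lemma hermite_fun1_mult:
  "t * hermite_fun1 j t = sqrt (real (Suc j) / 2) * hermite_fun1 (Suc j) t + sqrt (real j / 2) * hermite_fun1 (j - 1) t"
proof -
  define e where "e = exp (- (t\<^sup>2) / 2)"
  have 1: "sqrt (real (Suc j) / 2) * hermite_fun1 (Suc j) t = e * hermite_rec (Suc j) t / (2 * hermite_norm j)"
  proof -
    have "real (Suc j) / 2 = 2 * real (Suc j) / 2\<^sup>2" by (simp add: power2_eq_square)
    then have "sqrt (real (Suc j) / 2) = sqrt (2 * real (Suc j)) / 2" by (simp only: real_sqrt_divide real_sqrt_abs abs_numeral)
    then show ?thesis using hermite_norm_pos[of j] by (simp add: hermite_fun1_eq hermite_norm_Suc e_def field_simps)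
  qed
  have 2: "sqrt (real j / 2) * hermite_fun1 (j - 1) t = e * (real j * hermite_rec (j - 1) t) / hermite_norm j"
    unfolding e_def by (rule hermite_fun1_lower)
  show ?thesis unfolding 1 2 using hermite_norm_pos[of j] by (simp add: hermite_fun1_eq hermite_rec_Suc[of j] e_def field_simps)
qed

lemma hermite_fun1_deriv:
  "(hermite_fun1 j has_field_derivative
     sqrt (real j / 2) * hermite_fun1 (j - 1) t - sqrt (real (Suc j) / 2) * hermite_fun1 (Suc j) t) (at t)"
proof -
  have eq: "hermite_fun1 j = (\<lambda>t. exp (- (t\<^sup>2) / 2) * hermite_rec j t / hermite_norm j)" by (rule ext) (rule hermite_fun1_eq)
  have "(hermite_fun1 j has_field_derivative
      exp (- (t\<^sup>2) / 2) * (2 * real j * hermite_rec (j - 1) t) / hermite_norm j - t * hermite_fun1 j t) (at t)"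
  proof -
    have "((\<lambda>t. exp (- (t\<^sup>2) / 2)) has_field_derivative - t * exp (- (t\<^sup>2) / 2)) (at t)" by (auto intro!: derivative_eq_intros)
    from DERIV_cdivide[OF DERIV_mult[OF this hermite_rec_deriv[of j]], of "hermite_norm j"]
    show ?thesis unfolding eq by (rule DERIV_cong) (use hermite_norm_pos[of j] in \<open>simp add: field_simps\<close>)
  qed
  also have "exp (- (t\<^sup>2) / 2) * (2 * real j * hermite_rec (j - 1) t) / hermite_norm j
      = 2 * (sqrt (real j / 2) * hermite_fun1 (j - 1) t)" unfolding hermite_fun1_lower by simp
  finally show ?thesis unfolding hermite_fun1_mult by (simp add: algebra_simps)
qed

lemma continuous_on_hermite_fun1 [continuous_intros]:
  "continuous_on S f \<Longrightarrow> continuous_on S (\<lambda>x. hermite_fun1 j (f x))" by (rule continuous_on_compose2[of UNIV])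
    (auto intro!: continuous_at_imp_continuous_on DERIV_isCont hermite_fun1_deriv)

lemma borel_measurable_hermite_fun1 [measurable]: "hermite_fun1 j \<in> borel_measurable borel"
  by (intro borel_measurable_continuous_onI continuous_on_hermite_fun1 continuous_on_id)

text \<open>The \<open>i\<close>-th power of \<open>r / i \<le> exp (r / i)\<close>; for
  \<open>i = 0\<close> it reads \<open>1 \<le> exp r\<close>.\<close>

lemma power_le_exp:
  assumes "0 \<le> (r :: real)"
  shows "r ^ i \<le> real i ^ i * exp r"
proof (cases "i = 0")
  case False
  have "r ^ i = real i ^ i * (r / real i) ^ i" using False by (simp add: power_divide)
  also have "\<dots> \<le> real i ^ i * exp (r / real i) ^ i" using assms order_trans[OF _ exp_ge_add_one_self[of "r / real i"], of "r / real i"]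
    by (intro mult_left_mono power_mono) auto
  also have "exp (r / real i) ^ i = exp r" using False by (intro exp_divide_power_eq) simp
  finally show ?thesis .
qed (use assms in simp)

text \<open>Solving the ladder identity for the raised function costs a factor
  \<open>\<bar>t\<bar> \<le> 1 + t\<^sup>2\<close>, hence one more power in the hypothesis for the
  preceding index. The induction therefore covers all \<open>m\<close> simultaneously.\<close>

lemma hermite_fun1_decay: "\<exists>C. \<forall>t. \<bar>hermite_fun1 j t\<bar> \<le> C / (1 + t\<^sup>2) ^ m"
proof -
  have "\<exists>C. \<forall>t. \<bar>hermite_fun1 j t\<bar> * (1 + t\<^sup>2) ^ m \<le> C"
  proof (induction j arbitrary: m rule: less_induct)
    case (less j)
    show ?case
    proof (cases j)
      case 0
      have "\<bar>hermite_fun1 j t\<bar> * (1 + t\<^sup>2) ^ m \<le> 2 ^ m * real m ^ m * exp (1 / 2) / hermite_norm 0" for t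
      proof -
        have "(1 + t\<^sup>2) ^ m * exp (- (t\<^sup>2) / 2) = 2 ^ m * ((1 + t\<^sup>2) / 2) ^ m * exp (- (t\<^sup>2) / 2)" by (simp add: power_divide)
        also have "\<dots> \<le> 2 ^ m * (real m ^ m * exp ((1 + t\<^sup>2) / 2)) * exp (- (t\<^sup>2) / 2)"
          by (intro mult_right_mono mult_left_mono power_le_exp) auto
        also have "\<dots> = 2 ^ m * real m ^ m * exp (1 / 2)" unfolding mult.assoc exp_add[symmetric] by (simp add: field_simps)
        finally show ?thesis using hermite_norm_pos[of 0] 0 by (simp add: hermite_fun1_eq abs_mult divide_right_mono mult.commute)
      qed
      then show ?thesis by blast
    next
      case (Suc i)
      define s where "s = sqrt (real (Suc i) / 2)"
      have s: "0 < s" unfolding s_def by simp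
      obtain A where A: "\<And>t. \<bar>hermite_fun1 i t\<bar> * (1 + t\<^sup>2) ^ Suc m \<le> A" using less Suc by blast
      obtain B where B: "\<And>t. \<bar>hermite_fun1 (i - 1) t\<bar> * (1 + t\<^sup>2) ^ m \<le> B"
        using less Suc by (metis diff_le_self le_imp_less_Suc)
      have "\<bar>hermite_fun1 j t\<bar> * (1 + t\<^sup>2) ^ m \<le> (A + sqrt (real i / 2) * B) / s" for t
      proof -
        have t: "\<bar>t\<bar> \<le> 1 + t\<^sup>2" using sum_squares_bound[of 1 "\<bar>t\<bar>"] by (simp add: power2_eq_square abs_mult[symmetric])
        have "s * \<bar>hermite_fun1 j t\<bar> = \<bar>t * hermite_fun1 i t - sqrt (real i / 2) * hermite_fun1 (i - 1) t\<bar>"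
          unfolding hermite_fun1_mult Suc s_def[symmetric] using s by (simp add: abs_mult)
        also have "\<dots> \<le> \<bar>t\<bar> * \<bar>hermite_fun1 i t\<bar> + sqrt (real i / 2) * \<bar>hermite_fun1 (i - 1) t\<bar>"
          by (rule order_trans[OF abs_triangle_ineq4]) (simp add: abs_mult)
        also have "\<dots> \<le> (1 + t\<^sup>2) * \<bar>hermite_fun1 i t\<bar> + sqrt (real i / 2) * \<bar>hermite_fun1 (i - 1) t\<bar>"
          using t by (intro add_right_mono mult_right_mono) auto
        finally have "s * \<bar>hermite_fun1 j t\<bar> * (1 + t\<^sup>2) ^ m
            \<le> ((1 + t\<^sup>2) * \<bar>hermite_fun1 i t\<bar> + sqrt (real i / 2) * \<bar>hermite_fun1 (i - 1) t\<bar>) * (1 + t\<^sup>2) ^ m"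
          by (rule mult_right_mono) simp
        also have "\<dots> = \<bar>hermite_fun1 i t\<bar> * (1 + t\<^sup>2) ^ Suc m + sqrt (real i / 2) * (\<bar>hermite_fun1 (i - 1) t\<bar> * (1 + t\<^sup>2) ^ m)"
          by (simp add: algebra_simps)
        also have "\<dots> \<le> A + sqrt (real i / 2) * B" by (intro add_mono mult_left_mono A B) simp
        finally show ?thesis using s by (simp add: field_simps)
      qed
      then show ?thesis by blast
    qed
  qed
  then obtain C where C: "\<And>t. \<bar>hermite_fun1 j t\<bar> * (1 + t\<^sup>2) ^ m \<le> C" by blast
  have "0 < (1 + t\<^sup>2) ^ m" for t :: real by (intro zero_less_power) (simp add: add_pos_nonneg)
  with C show ?thesis by (intro exI[of _ C]) (simp add: pos_le_divide_eq)
qed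

lemma integrable_hermite_fun1_mult:
  "integrable lborel (\<lambda>t. hermite_fun1 i t * hermite_fun1 j t)"
proof -
  obtain C where C: "\<And>t. \<bar>hermite_fun1 i t\<bar> \<le> C / (1 + t\<^sup>2) ^ 1" using hermite_fun1_decay by blast
  obtain D where D: "\<And>t. \<bar>hermite_fun1 j t\<bar> \<le> D / (1 + t\<^sup>2) ^ 0" using hermite_fun1_decay by blast
  have "integrable lborel (\<lambda>t::real. C * D * (1 / (1 + t\<^sup>2)))" by (rule integrable_mult_right) (rule integrable_inverse_1_plus_square')
  then show ?thesis
  proof (rule Bochner_Integration.integrable_bound)
    show "AE t in lborel. norm (hermite_fun1 i t * hermite_fun1 j t) \<le> norm (C * D * (1 / (1 + t\<^sup>2)))"
    proof (rule AE_I2)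
      fix t :: real
      have "\<bar>hermite_fun1 i t\<bar> * \<bar>hermite_fun1 j t\<bar> \<le> C / (1 + t\<^sup>2) * D"
        using C[of t] D[of t] by (intro mult_mono) (auto intro: order_trans[OF abs_ge_zero])
      also have "\<dots> = C * D * (1 / (1 + t\<^sup>2))" by simp
      also have "\<dots> \<le> \<bar>C * D * (1 / (1 + t\<^sup>2))\<bar>" by (rule abs_ge_self)
      finally show "norm (hermite_fun1 i t * hermite_fun1 j t) \<le> norm (C * D * (1 / (1 + t\<^sup>2)))"
        by (simp only: real_norm_def abs_mult[of "hermite_fun1 i t"])
    qed
  qed measurable
qed

text \<open>Adjointness of raising and lowering, read off from the vanishing integral of the
  derivative of the product h_i h_j. The multiplication identity is used to rewrite the derivative
  so that only the terms that raise \<open>i\<close> or lower \<open>j\<close> remain; the two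
  products with \<open>t\<close> cancel.\<close>

lemma integral_hermite_fun1_lower:
  "sqrt (2 * real (Suc i)) * (LINT t|lborel. hermite_fun1 (Suc i) t * hermite_fun1 j t)
    = sqrt (2 * real j) * (LINT t|lborel. hermite_fun1 i t * hermite_fun1 (j - 1) t)"
proof -
  let ?h = hermite_fun1
  define D where "D = (\<lambda>t. sqrt (2 * real j) * (?h i t * ?h (j - 1) t) - sqrt (2 * real (Suc i)) * (?h (Suc i) t * ?h j t))"
  have s2: "2 * sqrt (r / 2) = sqrt (2 * r)" for r :: real using real_sqrt_mult[of 4 "r / 2"] by simp
  have d: "((\<lambda>t. ?h i t * ?h j t) has_field_derivative D t) (at t)" for t
  proof -
    have "((\<lambda>t. ?h i t * ?h j t) has_field_derivative
       (sqrt (real i / 2) * ?h (i - 1) t - sqrt (real (Suc i) / 2) * ?h (Suc i) t) * ?h j t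
       + (sqrt (real j / 2) * ?h (j - 1) t - sqrt (real (Suc j) / 2) * ?h (Suc j) t) * ?h i t) (at t)"
      by (rule DERIV_mult[OF hermite_fun1_deriv hermite_fun1_deriv])
    also have "(sqrt (real i / 2) * ?h (i - 1) t - sqrt (real (Suc i) / 2) * ?h (Suc i) t) * ?h j t
       + (sqrt (real j / 2) * ?h (j - 1) t - sqrt (real (Suc j) / 2) * ?h (Suc j) t) * ?h i t
      = (t * ?h i t - 2 * sqrt (real (Suc i) / 2) * ?h (Suc i) t) * ?h j t
       + (2 * sqrt (real j / 2) * ?h (j - 1) t - t * ?h j t) * ?h i t"
      using hermite_fun1_mult[of t i] hermite_fun1_mult[of t j] by (simp add: algebra_simps)
    also have "\<dots> = D t" unfolding s2 D_def by (simp add: algebra_simps)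
    finally show ?thesis .
  qed
  have Di: "integrable lborel D" unfolding D_def by (intro Bochner_Integration.integrable_diff integrable_mult_right integrable_hermite_fun1_mult)
  have "(LINT t|lborel. complex_of_real (D t)) = 0"
  proof (rule integral_dir_derivative_eq_zero[where \<Psi> = "\<lambda>t. complex_of_real (?h i t * ?h j t)" and b = "1::real"])
    have hd: "((\<lambda>t. complex_of_real (?h i t * ?h j t)) has_derivative (\<lambda>x. complex_of_real (D t * x))) (at t)" for t
      using d[of t] unfolding has_field_derivative_def by (rule has_derivative_of_real)
    show "(\<lambda>t. complex_of_real (?h i t * ?h j t)) differentiable (at t)" for t using hd unfolding differentiable_def by blast
    show "frechet_derivative (\<lambda>t. complex_of_real (?h i t * ?h j t)) (at t) 1 = complex_of_real (D t)" for t
      using frechet_derivative_eqI[OF hd] by simp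
    show "continuous_on UNIV (\<lambda>t. complex_of_real (D t))" unfolding D_def by (intro continuous_intros)
  qed (use Di in \<open>auto intro!: integrable_of_real integrable_hermite_fun1_mult simp del: of_real_mult\<close>)
  then have "(LINT t|lborel. D t) = 0" by simp
  then show ?thesis unfolding D_def
    by (subst (asm) Bochner_Integration.integral_diff) (auto intro!: integrable_mult_right integrable_hermite_fun1_mult)
qed

text \<open>The square of the ground state is the density of the centred normal distribution with
  variance 1/2.\<close>

lemma integral_hermite_fun1_0: "(LINT t|lborel. hermite_fun1 0 t * hermite_fun1 0 t) = 1"
proof -
  have "(LINT t|lborel. normal_density 0 (1 / sqrt 2) t) = 1" by (rule integral_normal_density) simp
  moreover have "normal_density 0 (1 / sqrt 2) t = hermite_fun1 0 t * hermite_fun1 0 t" for t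
  proof -
    have "hermite_fun1 0 t * hermite_fun1 0 t = (exp (- (t\<^sup>2) / 2) * exp (- (t\<^sup>2) / 2)) / (hermite_norm 0 * hermite_norm 0)"
      by (simp add: hermite_fun1_eq)
    also have "exp (- (t\<^sup>2) / 2) * exp (- (t\<^sup>2) / 2) = exp (- t\<^sup>2)" unfolding exp_add[symmetric] by simp
    also have "hermite_norm 0 * hermite_norm 0 = sqrt pi" by (simp add: hermite_norm_def)
    finally show ?thesis by (simp add: normal_density_def power_divide)
  qed
  ultimately show ?thesis by simp
qed

text \<open>The adjointness identity lowers both indices at once; as soon as exactly one of them is
  0, its right-hand coefficient kills the integral.\<close>

lemma hermite_fun1_orthonormal:
  "(LINT t|lborel. hermite_fun1 i t * hermite_fun1 j t) = (if i = j then 1 else 0)"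
proof (induction i arbitrary: j)
  case 0
  show ?case
  proof (cases j)
    case (Suc j')
    have "sqrt (2 * real (Suc j')) * (LINT t|lborel. hermite_fun1 (Suc j') t * hermite_fun1 0 t) = 0"
      using integral_hermite_fun1_lower[of j' 0] by simp
    then show ?thesis using Suc by (simp add: mult.commute)
  qed (simp add: integral_hermite_fun1_0)
next
  case (Suc i)
  show ?case
  proof (cases j)
    case 0
    then show ?thesis using integral_hermite_fun1_lower[of i 0] by simp
  next
    case (Suc j')
    with integral_hermite_fun1_lower[of i j] Suc.IH[of j'] show ?thesis by (cases "i = j'") auto
  qed
qed

text \<open>A Sobolev estimate. The square of h_j varies by at most the integral of
  \<open>2 * \<bar>h * h'\<bar>\<close>, hence by at most that of the sum of the squares of h_j and
  its derivative, which the ladder formula and orthonormality evaluate to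
  \<open>j + 3 / 2\<close>.\<close>

lemma hermite_fun1_bound: "\<bar>hermite_fun1 j t\<bar> \<le> 2 * (1 + real j)"
proof -
  let ?h = hermite_fun1
  define d where "d = (\<lambda>t. sqrt (real j / 2) * ?h (j - 1) t - sqrt (real (Suc j) / 2) * ?h (Suc j) t)"
  have dd: "(?h j has_field_derivative d t) (at t)" for t unfolding d_def by (rule hermite_fun1_deriv)
  have d2: "d t * d t = (real j / 2) * (?h (j - 1) t * ?h (j - 1) t) + (real (Suc j) / 2) * (?h (Suc j) t * ?h (Suc j) t)
      - (2 * sqrt (real j / 2) * sqrt (real (Suc j) / 2)) * (?h (j - 1) t * ?h (Suc j) t)" for t
  proof -
    define A where "A = sqrt (real j / 2)"
    define B where "B = sqrt (real (Suc j) / 2)"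
    have AB: "real j / 2 = A * A" "real (Suc j) / 2 = B * B" unfolding A_def B_def by simp_all
    show ?thesis unfolding d_def A_def[symmetric] B_def[symmetric] unfolding AB by (simp add: algebra_simps)
  qed
  have d2i: "integrable lborel (\<lambda>t. d t * d t)"
    unfolding d2 by (intro Bochner_Integration.integrable_add Bochner_Integration.integrable_diff integrable_mult_right integrable_hermite_fun1_mult)
  have "(LINT t|lborel. d t * d t) = real j / 2 + real (Suc j) / 2" unfolding d2
    by (simp add: Bochner_Integration.integral_add Bochner_Integration.integral_diff integrable_mult_right integrable_hermite_fun1_mult
        hermite_fun1_orthonormal) auto
  have E: "(LINT t|lborel. ?h j t * ?h j t + d t * d t) = real j + 3 / 2" using \<open>(LINT t|lborel. d t * d t) = _\<close>
    by (simp add: Bochner_Integration.integral_add integrable_hermite_fun1_mult d2i hermite_fun1_orthonormal field_simps)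
  have Ei: "integrable lborel (\<lambda>t. ?h j t * ?h j t + d t * d t)"
    by (intro Bochner_Integration.integrable_add integrable_hermite_fun1_mult d2i)
  have cd: "continuous_on S (\<lambda>t. d t)" for S unfolding d_def by (intro continuous_intros)
  have b: "(?h j t)\<^sup>2 \<le> (?h j a)\<^sup>2 + (real j + 3 / 2)" if "a \<le> t" for a
  proof -
    have "(LINT s|lborel. indicator {a..t} s *\<^sub>R (2 * (?h j s * d s))) = (?h j t)\<^sup>2 - (?h j a)\<^sup>2"
    proof (rule integral_FTC_atLeastAtMost[OF that])
      show "((\<lambda>s. (?h j s)\<^sup>2) has_vector_derivative 2 * (?h j s * d s)) (at s within {a..t})" for s
        unfolding has_real_derivative_iff_has_vector_derivative[symmetric]
        by (rule has_field_derivative_at_within) (auto intro!: derivative_eq_intros dd)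
      show "continuous_on {a..t} (\<lambda>s. 2 * (?h j s * d s))" by (intro continuous_intros cd)
    qed
    moreover have "(LINT s|lborel. indicator {a..t} s *\<^sub>R (2 * (?h j s * d s))) \<le> (LINT t|lborel. ?h j t * ?h j t + d t * d t)"
    proof (rule integral_mono')
      fix s
      show "indicator {a..t} s *\<^sub>R (2 * (?h j s * d s)) \<le> ?h j s * ?h j s + d s * d s"
        using sum_squares_bound[of "?h j s" "d s"] by (auto simp: indicator_def power2_eq_square)
    qed (use Ei in auto)
    ultimately show ?thesis using E by simp
  qed
  obtain C where C: "\<And>t. \<bar>?h j t\<bar> \<le> C / (1 + t\<^sup>2) ^ 1" using hermite_fun1_decay by blast
  have "(?h j t)\<^sup>2 \<le> real j + 3 / 2 + 1 / 4"
  proof -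
    \<comment> \<open>A starting point left of \<open>t\<close> and so far out that the decay
      estimate gives a value of at most 1/2.\<close>
    define a where "a = min t (- (2 * \<bar>C\<bar>))"
    have "\<bar>C\<bar> * 2 \<le> 1 + a\<^sup>2"
    proof -
      have "2 * \<bar>C\<bar> \<le> \<bar>a\<bar>" unfolding a_def by auto
      also have "\<dots> \<le> 1 + a\<^sup>2" using sum_squares_bound[of 1 "\<bar>a\<bar>"] by (simp add: power2_eq_square abs_mult[symmetric])
      finally show ?thesis by simp
    qed
    moreover have pos: "0 < 1 + a\<^sup>2" by (simp add: add_pos_nonneg)
    ultimately have "C / (1 + a\<^sup>2) ^ 1 \<le> 1 / 2" by (simp add: field_simps)
    with C[of a] have "\<bar>?h j a\<bar> \<le> 1 / 2" by linarith
    then have "(?h j a)\<^sup>2 \<le> (1 / 2)\<^sup>2" by (metis abs_ge_zero power2_abs power_mono)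
    with b[of a] show ?thesis by (simp add: a_def power2_eq_square)
  qed
  also have "\<dots> \<le> (2 * (1 + real j))\<^sup>2" by (simp add: power2_eq_square algebra_simps)
  finally show ?thesis by (simp add: abs_le_square_iff[symmetric])
qed

section \<open>Hermite series\<close>

text \<open>The sequence-side analogue of \<open>poly_weight\<close>: a product over coordinates, so
  that sums over boxes of indices factorise.\<close>

definition weight :: "nat ^ 'n::finite \<Rightarrow> real" where
  "weight k = (\<Prod>i\<in>UNIV. 1 + real (k $ i))"

lemma weight_ge_1: "1 \<le> weight k" unfolding weight_def by (rule prod_ge_1) simp

lemma weight_pos: "0 < weight k" using weight_ge_1[of k] by linarith

lemma component_le_weight: "1 + real (k $ i) \<le> weight k"
proof -
  have "(1 + real (k $ i)) * 1 \<le> (1 + real (k $ i)) * (\<Prod>j\<in>UNIV - {i}. 1 + real (k $ j))" by (intro mult_left_mono prod_ge_1) auto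
  then show ?thesis by (simp add: weight_def prod.remove[of UNIV i])
qed

definition index_up :: "'n \<Rightarrow> nat ^ 'n::finite \<Rightarrow> nat ^ 'n" where
  "index_up i k = (\<chi> j. if j = i then Suc (k $ j) else k $ j)"

definition index_down :: "'n \<Rightarrow> nat ^ 'n::finite \<Rightarrow> nat ^ 'n" where
  "index_down i k = (\<chi> j. if j = i then k $ j - 1 else k $ j)"

lemma weight_up: "weight (index_up i k) \<le> 2 * weight k"
proof -
  have "(2 + real (k $ i)) * (\<Prod>j\<in>UNIV - {i}. 1 + real (k $ j)) \<le> (2 * (1 + real (k $ i))) * (\<Prod>j\<in>UNIV - {i}. 1 + real (k $ j))"
    by (intro mult_right_mono prod_nonneg) auto
  moreover have "(\<Prod>j\<in>UNIV - {i}. 1 + real (index_up i k $ j)) = (\<Prod>j\<in>UNIV - {i}. 1 + real (k $ j))"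
    by (intro prod.cong) (auto simp: index_up_def)
  ultimately show ?thesis by (simp only: weight_def prod.remove[of UNIV i, OF finite UNIV_I] mult.assoc) (simp add: index_up_def)
qed

lemma weight_down: "weight (index_down i k) \<le> weight k" unfolding weight_def index_down_def by (intro prod_mono) auto

lemma finite_index_box: "finite {k :: nat ^ 'n::finite. \<forall>i. k $ i < N}"
proof -
  have "{k :: nat ^ 'n. \<forall>i. k $ i < N} \<subseteq> vec_lambda ` (\<Pi>\<^sub>E i\<in>UNIV. {..<N})"
  proof
    fix k :: "nat ^ 'n" assume "k \<in> {k. \<forall>i. k $ i < N}"
    then have "(\<lambda>i. k $ i) \<in> (\<Pi>\<^sub>E i\<in>UNIV. {..<N})" by auto
    then show "k \<in> vec_lambda ` (\<Pi>\<^sub>E i\<in>UNIV. {..<N})" by (rule rev_image_eqI) simp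
  qed
  then show ?thesis by (rule finite_subset) (intro finite_imageI finite_PiE, auto)
qed

text \<open>Every finite set of indices lies in a box, and over a box the sum is a power of a
  partial sum of the convergent one-dimensional series.\<close>

lemma summable_weight: "(\<lambda>k :: nat ^ 'n::finite. 1 / weight k ^ 2) summable_on UNIV"
proof (rule nonneg_bdd_above_summable_on)
  define c where "c = (\<Sum>j. 1 / (1 + real j)\<^sup>2)"
  have s: "summable (\<lambda>j. 1 / (1 + real j)\<^sup>2)"
    using inverse_power_summable[of 2, where ?'a = real] summable_Suc_iff[of "\<lambda>n. inverse ((real n)\<^sup>2)"] by (simp add: divide_inverse)
  have "(\<Sum>k\<in>F. 1 / weight k ^ 2) \<le> c ^ CARD('n)" if "finite F" for F :: "(nat ^ 'n) set"
  proof -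
    define N where "N = Suc (Max (insert 0 ((\<lambda>(k, i). k $ i) ` (F \<times> UNIV))))"
    have N: "k $ i < N" if "k \<in> F" for k i
    proof -
      have "k $ i \<le> Max (insert 0 ((\<lambda>(k, i). k $ i) ` (F \<times> UNIV)))"
        using that \<open>finite F\<close> by (intro Max_ge) (auto intro!: image_eqI[of _ _ "(k, i)"])
      then show ?thesis by (simp add: N_def)
    qed
    have sub: "F \<subseteq> vec_lambda ` (\<Pi>\<^sub>E i\<in>UNIV. {..<N})"
    proof
      fix k assume "k \<in> F"
      then have "(\<lambda>i. k $ i) \<in> (\<Pi>\<^sub>E i\<in>UNIV. {..<N})" using N by auto
      then show "k \<in> vec_lambda ` (\<Pi>\<^sub>E i\<in>UNIV. {..<N})" by (rule rev_image_eqI) simp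
    qed
    have "(\<Sum>k\<in>F. 1 / weight k ^ 2) \<le> (\<Sum>k\<in>vec_lambda ` (\<Pi>\<^sub>E i\<in>(UNIV :: 'n set). {..<N}). 1 / weight k ^ 2)"
      by (rule sum_mono2) (use sub in \<open>auto intro!: finite_PiE\<close>)
    also have "\<dots> = (\<Sum>g\<in>(\<Pi>\<^sub>E i\<in>(UNIV :: 'n set). {..<N}). 1 / weight (vec_lambda g) ^ 2)"
      by (subst sum.reindex) (auto simp: inj_on_def vec_lambda_inject)
    also have "\<dots> = (\<Sum>g\<in>(\<Pi>\<^sub>E i\<in>(UNIV :: 'n set). {..<N}). \<Prod>i\<in>UNIV. 1 / (1 + real (g i)) ^ 2)"
      by (intro sum.cong refl) (simp add: weight_def prod_dividef prod_power_distrib)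
    also have "\<dots> = (\<Prod>i\<in>(UNIV :: 'n set). \<Sum>j<N. 1 / (1 + real j) ^ 2)" by (subst prod_sum_PiE) auto
    also have "\<dots> = (\<Sum>j<N. 1 / (1 + real j) ^ 2) ^ CARD('n)" by simp
    also have "\<dots> \<le> c ^ CARD('n)" unfolding c_def by (intro power_mono sum_le_suminf s sum_nonneg) auto
    finally show ?thesis .
  qed
  then show "bdd_above (sum (\<lambda>k. 1 / weight k ^ 2) ` {F. F \<subseteq> (UNIV :: (nat ^ 'n) set) \<and> finite F})"
    by (intro bdd_aboveI[of _ "c ^ CARD('n)"]) auto
qed (simp add: weight_pos less_imp_le)

text \<open>\<open>poly_growth\<close> and \<open>rapid\<close> are the conditions on Hermite
  coefficients that hold for tempered distributions and for Schwartz functions,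
  respectively.\<close>

definition poly_growth :: "(nat ^ 'n::finite \<Rightarrow> complex) \<Rightarrow> bool" where
  "poly_growth a \<longleftrightarrow> (\<exists>C M. \<forall>k. norm (a k) \<le> C * weight k ^ M)"

definition rapid :: "(nat ^ 'n::finite \<Rightarrow> complex) \<Rightarrow> bool" where
  "rapid a \<longleftrightarrow> (\<forall>M. \<exists>C. \<forall>k. norm (a k) * weight k ^ M \<le> C)"

text \<open>Changes of index that cost only a constant factor in the weight. The notion is stable
  under composition, so arbitrary words in raising and lowering of indices are covered.\<close>

definition index_map :: "(nat ^ 'n::finite \<Rightarrow> nat ^ 'n) \<Rightarrow> bool" where
  "index_map s \<longleftrightarrow> (\<exists>C. \<forall>k. weight (s k) \<le> C * weight k)"

lemma poly_growthE:
  assumes "poly_growth a"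
  obtains C M where "0 \<le> C" "\<And>k. norm (a k) \<le> C * weight k ^ M"
proof -
  obtain C M where C: "\<And>k. norm (a k) \<le> C * weight k ^ M" using assms by (auto simp: poly_growth_def)
  have "0 \<le> C * weight (0 :: nat ^ 'a) ^ M" using C[of 0] norm_ge_zero order_trans by blast
  then have "0 \<le> C" using zero_less_power[OF weight_pos[of "0 :: nat ^ 'a"], of M] by (simp add: zero_le_mult_iff)
  with C show ?thesis using that by blast
qed

lemma poly_growth_mult:
  assumes "poly_growth a" "poly_growth b"
  shows "poly_growth (\<lambda>k. a k * b k)"
proof -
  obtain C M where C: "0 \<le> C" "\<And>k. norm (a k) \<le> C * weight k ^ M" using poly_growthE[OF assms(1)] by blast
  obtain D L where D: "0 \<le> D" "\<And>k. norm (b k) \<le> D * weight k ^ L" using poly_growthE[OF assms(2)] by blast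
  have "norm (a k * b k) \<le> (C * D) * weight k ^ (M + L)" for k
  proof -
    have "norm (a k) * norm (b k) \<le> (C * weight k ^ M) * (D * weight k ^ L)"
      using C D weight_pos[of k] by (intro mult_mono) auto
    then show ?thesis by (simp add: norm_mult power_add mult_ac)
  qed
  then show ?thesis unfolding poly_growth_def by blast
qed

lemma index_map_compose: "index_map s \<Longrightarrow> index_map t \<Longrightarrow> index_map (\<lambda>k. s (t k))"
proof -
  assume "index_map s" "index_map t"
  then obtain C D where C: "\<And>k. weight (s k) \<le> C * weight k" and D: "\<And>k. weight (t k) \<le> D * weight k"
    by (auto simp: index_map_def)
  have "0 \<le> C * weight (0 :: nat ^ 'a)" using C[of 0] weight_pos[of "s 0"] by linarith
  then have C0: "0 \<le> C" using weight_pos[of "0 :: nat ^ 'a"] by (simp add: zero_le_mult_iff)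
  have "weight (s (t k)) \<le> (C * D) * weight k" for k using C[of "t k"] mult_left_mono[OF D[of k] C0] by (simp add: mult.assoc)
  then show ?thesis unfolding index_map_def by blast
qed

lemma index_map_up: "index_map (index_up i)" using weight_up unfolding index_map_def by blast

lemma index_map_down: "index_map (index_down i)" unfolding index_map_def by (rule exI[of _ 1]) (simp add: weight_down)

lemma index_map_id: "index_map (\<lambda>k. k)" unfolding index_map_def by (rule exI[of _ 1]) simp

lemma poly_growth_compose:
  assumes "poly_growth a" "index_map s"
  shows "poly_growth (\<lambda>k. a (s k))"
proof -
  obtain C M where C: "0 \<le> C" "\<And>k. norm (a k) \<le> C * weight k ^ M" using poly_growthE[OF assms(1)] by blast
  obtain D where D: "\<And>k. weight (s k) \<le> D * weight k" using assms(2) by (auto simp: index_map_def)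
  have "norm (a (s k)) \<le> (C * D ^ M) * weight k ^ M" for k
  proof -
    have "norm (a (s k)) \<le> C * weight (s k) ^ M" by (rule C)
    also have "\<dots> \<le> C * (D * weight k) ^ M" using C D weight_pos[of "s k"] by (intro mult_left_mono power_mono) auto
    finally show ?thesis by (simp add: power_mult_distrib mult.assoc)
  qed
  then show ?thesis unfolding poly_growth_def by blast
qed

section \<open>Ladder operators on multi-indexed Hermite functions\<close>

definition raise_coeff :: "'n \<Rightarrow> nat ^ 'n::finite \<Rightarrow> complex" where
  "raise_coeff i k = complex_of_real (sqrt (real (Suc (k $ i)) / 2))"

definition lower_coeff :: "'n \<Rightarrow> nat ^ 'n::finite \<Rightarrow> complex" where
  "lower_coeff i k = complex_of_real (sqrt (real (k $ i) / 2))"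

lemma sqrt_le_self: "1 \<le> r \<Longrightarrow> sqrt r \<le> r"
  using real_sqrt_le_mono[of r "r * r"] mult_left_mono[of 1 r r] by (simp add: real_sqrt_mult)

lemma poly_growth_raise_coeff:
  fixes i :: "'n::finite"
  shows "poly_growth (raise_coeff i)" unfolding poly_growth_def
proof (intro exI allI)
  fix k :: "nat ^ 'n"
  have "sqrt (real (Suc (k $ i)) / 2) \<le> sqrt (1 + real (k $ i))" by (intro real_sqrt_le_mono) simp
  also have "\<dots> \<le> 1 + real (k $ i)" by (rule sqrt_le_self) simp
  also have "\<dots> \<le> weight k" by (rule component_le_weight)
  finally show "norm (raise_coeff i k) \<le> 1 * weight k ^ 1" by (simp add: raise_coeff_def)
qed

lemma poly_growth_lower_coeff:
  fixes i :: "'n::finite"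
  shows "poly_growth (lower_coeff i)" unfolding poly_growth_def
proof (intro exI allI)
  fix k :: "nat ^ 'n"
  have "sqrt (real (k $ i) / 2) \<le> sqrt (1 + real (k $ i))" by (intro real_sqrt_le_mono) simp
  also have "\<dots> \<le> 1 + real (k $ i)" by (rule sqrt_le_self) simp
  also have "\<dots> \<le> weight k" by (rule component_le_weight)
  finally show "norm (lower_coeff i k) \<le> 1 * weight k ^ 1" by (simp add: lower_coeff_def)
qed

lemma hermite_fun_split:
  "hermite_fun k x = of_real (hermite_fun1 (k $ i) (x $ i)) * of_real (\<Prod>j\<in>UNIV - {i}. hermite_fun1 (k $ j) (x $ j))"
  by (simp add: hermite_fun_def prod.remove[of UNIV i])

lemma hermite_fun_up:
  "hermite_fun (index_up i k) x = of_real (hermite_fun1 (Suc (k $ i)) (x $ i)) * of_real (\<Prod>j\<in>UNIV - {i}. hermite_fun1 (k $ j) (x $ j))"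
proof -
  have "(\<Prod>j\<in>UNIV - {i}. hermite_fun1 (index_up i k $ j) (x $ j)) = (\<Prod>j\<in>UNIV - {i}. hermite_fun1 (k $ j) (x $ j))"
    by (intro prod.cong) (auto simp: index_up_def)
  then show ?thesis unfolding hermite_fun_split[of _ x i] by (simp add: index_up_def)
qed

lemma hermite_fun_down:
  "hermite_fun (index_down i k) x = of_real (hermite_fun1 (k $ i - 1) (x $ i)) * of_real (\<Prod>j\<in>UNIV - {i}. hermite_fun1 (k $ j) (x $ j))"
proof -
  have "(\<Prod>j\<in>UNIV - {i}. hermite_fun1 (index_down i k $ j) (x $ j)) = (\<Prod>j\<in>UNIV - {i}. hermite_fun1 (k $ j) (x $ j))"
    by (intro prod.cong) (auto simp: index_down_def)
  then show ?thesis unfolding hermite_fun_split[of _ x i] by (simp add: index_down_def)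
qed

lemma hermite_fun_mult_component:
  "of_real (x $ i) * hermite_fun k x
    = raise_coeff i k * hermite_fun (index_up i k) x + lower_coeff i k * hermite_fun (index_down i k) x"
proof -
  have "of_real (x $ i) * hermite_fun k x
      = of_real (x $ i * hermite_fun1 (k $ i) (x $ i)) * of_real (\<Prod>j\<in>UNIV - {i}. hermite_fun1 (k $ j) (x $ j))"
    unfolding hermite_fun_split[of k x i] by simp
  then show ?thesis unfolding hermite_fun1_mult hermite_fun_up hermite_fun_down raise_coeff_def lower_coeff_def
    by (simp only: of_real_add of_real_mult distrib_right mult.assoc)
qed

lemma has_derivative_hermite_fun:
  "(hermite_fun k has_derivative
     (\<lambda>v. \<Sum>i\<in>UNIV. of_real (v $ i) * (lower_coeff i k * hermite_fun (index_down i k) x - raise_coeff i k * hermite_fun (index_up i k) x))) (at x)"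
proof -
  define d where "d i = sqrt (real (k $ i) / 2) * hermite_fun1 (k $ i - 1) (x $ i) - sqrt (real (Suc (k $ i)) / 2) * hermite_fun1 (Suc (k $ i)) (x $ i)" for i
  have "((\<lambda>x. hermite_fun1 (k $ i) (x $ i)) has_derivative (\<lambda>v. d i * (v $ i))) (at x)" for i
  proof -
    have "(hermite_fun1 (k $ i) has_derivative (\<lambda>h. d i * h)) (at (x $ i))"
      using hermite_fun1_deriv[of "k $ i" "x $ i"] unfolding has_field_derivative_def d_def .
    moreover have "((\<lambda>x. x $ i) has_derivative (\<lambda>v. v $ i)) (at x)"
      by (rule bounded_linear_imp_has_derivative[OF bounded_linear_vec_nth])
    ultimately show ?thesis by (rule has_derivative_compose[rotated])
  qed
  then have "((\<lambda>x. \<Prod>i\<in>UNIV. hermite_fun1 (k $ i) (x $ i)) has_derivative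
      (\<lambda>v. \<Sum>i\<in>UNIV. (d i * (v $ i)) * (\<Prod>j\<in>UNIV - {i}. hermite_fun1 (k $ j) (x $ j)))) (at x)"
    by (intro has_derivative_prod) auto
  then have "((\<lambda>x. complex_of_real (\<Prod>i\<in>UNIV. hermite_fun1 (k $ i) (x $ i))) has_derivative
      (\<lambda>v. of_real (\<Sum>i\<in>UNIV. (d i * (v $ i)) * (\<Prod>j\<in>UNIV - {i}. hermite_fun1 (k $ j) (x $ j))))) (at x)"
    by (rule has_derivative_of_real)
  moreover have "of_real (\<Sum>i\<in>UNIV. (d i * (v $ i)) * (\<Prod>j\<in>UNIV - {i}. hermite_fun1 (k $ j) (x $ j)))
    = (\<Sum>i\<in>UNIV. of_real (v $ i) * (lower_coeff i k * hermite_fun (index_down i k) x - raise_coeff i k * hermite_fun (index_up i k) x))" for v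
    unfolding of_real_sum
  proof (intro sum.cong refl)
    fix i
    show "complex_of_real ((d i * (v $ i)) * (\<Prod>j\<in>UNIV - {i}. hermite_fun1 (k $ j) (x $ j)))
      = of_real (v $ i) * (lower_coeff i k * hermite_fun (index_down i k) x - raise_coeff i k * hermite_fun (index_up i k) x)"
      unfolding hermite_fun_up hermite_fun_down raise_coeff_def lower_coeff_def d_def
      by (simp only: of_real_diff of_real_mult) (simp only: algebra_simps)
  qed
  ultimately show ?thesis unfolding hermite_fun_def[abs_def] by simp
qed

lemma frechet_derivative_hermite_fun:
  fixes i :: "'n::finite"
  shows "frechet_derivative (hermite_fun k) (at x) (axis i 1)
    = lower_coeff i k * hermite_fun (index_down i k) x - raise_coeff i k * hermite_fun (index_up i k) x"
proof -
  have "(\<Sum>j\<in>UNIV. of_real ((axis i 1 :: real ^ 'n) $ j) * g j) = (g i :: complex)" for g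
    by (simp add: axis_def if_distrib if_distribR cong: if_cong)
  then show ?thesis unfolding frechet_derivative_eqI[OF has_derivative_hermite_fun] .
qed

lemma differentiable_hermite_fun: "hermite_fun k differentiable (at x)" using has_derivative_hermite_fun unfolding differentiable_def by blast

lemma hermite_fun_bound: "norm (hermite_fun k x) \<le> 2 ^ CARD('n) * weight (k :: nat ^ 'n::finite)"
proof -
  have "norm (hermite_fun k x) = (\<Prod>i\<in>UNIV. \<bar>hermite_fun1 (k $ i) (x $ i)\<bar>)"
    unfolding hermite_fun_def norm_of_real by (simp add: abs_prod)
  also have "\<dots> \<le> (\<Prod>i\<in>(UNIV :: 'n set). 2 * (1 + real (k $ i)))" by (intro prod_mono conjI abs_ge_zero hermite_fun1_bound)
  also have "\<dots> = 2 ^ CARD('n) * weight k" by (simp only: weight_def prod.distrib prod_constant)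
  finally show ?thesis .
qed

text \<open>Families of functions indexed by \<open>k\<close> that are finite combinations of
  shifted Hermite functions with coefficients of polynomial growth. The class is stable under
  coordinates and derivatives and each member is bounded by a power of \<open>weight k\<close>
  uniformly in \<open>x\<close>. Thus all Schwartz seminorms of \<open>hermite_fun k\<close> grow at
  most polynomially in \<open>k\<close>.\<close>

inductive_set hermite_families :: "(nat ^ 'n::finite \<Rightarrow> real ^ 'n \<Rightarrow> complex) set" where
  base: "poly_growth a \<Longrightarrow> index_map s \<Longrightarrow> (\<lambda>k x. a k * hermite_fun (s k) x) \<in> hermite_families"
| add: "U \<in> hermite_families \<Longrightarrow> V \<in> hermite_families \<Longrightarrow> (\<lambda>k x. U k x + V k x) \<in> hermite_families"

lemma poly_growth_const: "poly_growth (\<lambda>k. c)" unfolding poly_growth_def by (intro exI[of _ "norm c"] exI[of _ 0]) simp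

lemma hermite_fun_in_families: "hermite_fun \<in> hermite_families" using hermite_families.base[OF poly_growth_const[of 1] index_map_id] by simp

lemma hermite_families_component:
  assumes "U \<in> hermite_families"
  shows "(\<lambda>k x. of_real (x $ i) * U k x) \<in> hermite_families" using assms
proof induction
  case (base a s)
  have rc: "poly_growth (\<lambda>k. raise_coeff i (s k))" by (rule poly_growth_compose[OF poly_growth_raise_coeff base(2)])
  have lc: "poly_growth (\<lambda>k. lower_coeff i (s k))" by (rule poly_growth_compose[OF poly_growth_lower_coeff base(2)])
  note up = index_map_compose[OF index_map_up base(2), of i] and dn = index_map_compose[OF index_map_down base(2), of i]
  have "(\<lambda>k x. of_real (x $ i) * (a k * hermite_fun (s k) x))
    = (\<lambda>k x. (a k * raise_coeff i (s k)) * hermite_fun (index_up i (s k)) x + (a k * lower_coeff i (s k)) * hermite_fun (index_down i (s k)) x)"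
  proof (intro ext)
    fix k x
    have "of_real (x $ i) * (a k * hermite_fun (s k) x) = a k * (of_real (x $ i) * hermite_fun (s k) x)" by simp
    then show "of_real (x $ i) * (a k * hermite_fun (s k) x) = (a k * raise_coeff i (s k)) * hermite_fun (index_up i (s k)) x + (a k * lower_coeff i (s k)) * hermite_fun (index_down i (s k)) x"
      unfolding hermite_fun_mult_component by (simp add: algebra_simps)
  qed
  also have "\<dots> \<in> hermite_families"
    by (intro hermite_families.add hermite_families.base poly_growth_mult base(1) rc lc up dn poly_growth_const)
  finally show ?case .
next
  case (add U V)
  then show ?case using hermite_families.add[OF add.IH] by (simp add: distrib_left)
qed

lemma Basis_vecE:
  assumes "b \<in> (Basis :: (real ^ 'n) set)"
  obtains i where "b = axis i 1" using assms unfolding Basis_vec_eq_image by auto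

lemma hermite_families_coord:
  assumes "U \<in> hermite_families" "b \<in> Basis"
  shows "(\<lambda>k x. of_real (x \<bullet> b) * U k x) \<in> hermite_families"
proof -
  obtain i where "b = axis i 1" using Basis_vecE[OF assms(2)] .
  then show ?thesis using hermite_families_component[OF assms(1), of i] by (simp add: inner_axis)
qed

lemma hermite_families_monomial:
  assumes "U \<in> hermite_families"
  shows "(\<lambda>k x. of_real (monomial m x) * U k x) \<in> hermite_families"
proof (rule monomial_induct[where P = "\<lambda>m. (\<lambda>k x. of_real (m x) * U k x) \<in> hermite_families" and ?m0.0 = "\<lambda>_. 1"])
  fix m :: "real ^ 'a \<Rightarrow> real" and b :: "real ^ 'a"
  assume "b \<in> Basis" "(\<lambda>k x. complex_of_real (m x) * U k x) \<in> hermite_families"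
  from hermite_families_coord[OF this(2,1)]
  show "(\<lambda>k x. complex_of_real (x \<bullet> b * m x) * U k x) \<in> hermite_families" by (simp add: mult.assoc)
qed (use assms in simp_all)

lemma hermite_families_derivative:
  assumes "U \<in> hermite_families" "b \<in> Basis"
  shows "\<exists>W\<in>hermite_families. \<forall>k x. U k differentiable (at x) \<and> frechet_derivative (U k) (at x) b = W k x" using assms(1)
proof induction
  case (base a s)
  obtain i where b: "b = axis i 1" using Basis_vecE[OF assms(2)] .
  have rc: "poly_growth (\<lambda>k. raise_coeff i (s k))" by (rule poly_growth_compose[OF poly_growth_raise_coeff base(2)])
  have lc: "poly_growth (\<lambda>k. lower_coeff i (s k))" by (rule poly_growth_compose[OF poly_growth_lower_coeff base(2)])
  note up = index_map_compose[OF index_map_up base(2), of i] and dn = index_map_compose[OF index_map_down base(2), of i]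
  show ?case
  proof (intro bexI allI)
    fix k x
    have hd: "((\<lambda>x. a k * hermite_fun (s k) x) has_derivative (\<lambda>h. a k * frechet_derivative (hermite_fun (s k)) (at x) h)) (at x)"
      using differentiable_hermite_fun[of "s k" x] by (intro has_derivative_mult_right) (simp add: frechet_derivative_works)
    show "(\<lambda>x. a k * hermite_fun (s k) x) differentiable at x \<and>
        frechet_derivative (\<lambda>x. a k * hermite_fun (s k) x) (at x) b
        = (a k * lower_coeff i (s k)) * hermite_fun (index_down i (s k)) x + ((a k * raise_coeff i (s k)) * (-1)) * hermite_fun (index_up i (s k)) x"
      using frechet_derivative_eqI[OF hd] hd by (auto simp: differentiable_def b frechet_derivative_hermite_fun algebra_simps)
  next
    show "(\<lambda>k x. (a k * lower_coeff i (s k)) * hermite_fun (index_down i (s k)) x + ((a k * raise_coeff i (s k)) * (-1)) * hermite_fun (index_up i (s k)) x) \<in> hermite_families"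
      by (intro hermite_families.add hermite_families.base poly_growth_mult base(1) rc lc up dn poly_growth_const)
  qed
next
  case (add U V)
  then obtain U' V' where W: "U' \<in> hermite_families" "V' \<in> hermite_families"
    "\<And>k x. U k differentiable (at x) \<and> frechet_derivative (U k) (at x) b = U' k x"
    "\<And>k x. V k differentiable (at x) \<and> frechet_derivative (V k) (at x) b = V' k x" by blast
  show ?case
  proof (intro bexI allI)
    fix k x
    have hd: "((\<lambda>x. U k x + V k x) has_derivative (\<lambda>h. frechet_derivative (U k) (at x) h + frechet_derivative (V k) (at x) h)) (at x)"
      using W(3,4)[of k x] by (intro has_derivative_add) (simp_all add: frechet_derivative_works)
    show "(\<lambda>x. U k x + V k x) differentiable at x \<and> frechet_derivative (\<lambda>x. U k x + V k x) (at x) b = U' k x + V' k x"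
      using frechet_derivative_eqI[OF hd] hd W(3,4)[of k x] by (auto simp: differentiable_def)
  qed (intro hermite_families.add W)
qed

lemma hermite_families_bound:
  assumes "U \<in> hermite_families"
  obtains C M where "0 \<le> C" "\<And>k x. norm (U k x) \<le> C * weight k ^ M"
proof -
  have "\<exists>C M. 0 \<le> C \<and> (\<forall>k x. norm (U k x) \<le> C * weight k ^ M)" using assms
  proof induction
    case (base a s)
    obtain C M where C: "0 \<le> C" "\<And>k. norm (a k) \<le> C * weight k ^ M" using poly_growthE[OF base(1)] by blast
    obtain D where D: "\<And>k. weight (s k) \<le> D * weight k" using base(2) by (auto simp: index_map_def)
    have "norm (a k * hermite_fun (s k) x) \<le> (C * 2 ^ CARD('a) * \<bar>D\<bar>) * weight k ^ Suc M" for k x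
    proof -
      have "norm (hermite_fun (s k) x) \<le> 2 ^ CARD('a) * weight (s k)" by (rule hermite_fun_bound)
      also have "\<dots> \<le> 2 ^ CARD('a) * (\<bar>D\<bar> * weight k)"
        using D[of k] mult_right_mono[OF abs_ge_self[of D] less_imp_le[OF weight_pos[of k]]] by (intro mult_left_mono) (linarith, simp)
      finally have "norm (a k) * norm (hermite_fun (s k) x) \<le> (C * weight k ^ M) * (2 ^ CARD('a) * (\<bar>D\<bar> * weight k))"
        using C weight_pos[of k] by (intro mult_mono) auto
      then show ?thesis by (simp add: norm_mult mult_ac)
    qed
    moreover have "0 \<le> C * 2 ^ CARD('a) * \<bar>D\<bar>" using C by simp
    ultimately show ?case by blast
  next
    case (add U V)
    then obtain C M D L where C: "0 \<le> C" "\<And>k x. norm (U k x) \<le> C * weight k ^ M"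
      and D: "0 \<le> D" "\<And>k x. norm (V k x) \<le> D * weight k ^ L" by blast
    have "norm (U k x + V k x) \<le> (C + D) * weight k ^ (M + L)" for k x
    proof -
      have "norm (U k x + V k x) \<le> C * weight k ^ M + D * weight k ^ L"
        using C(2)[of k x] D(2)[of k x] norm_triangle_ineq[of "U k x" "V k x"] by linarith
      also have "\<dots> \<le> C * weight k ^ (M + L) + D * weight k ^ (M + L)"
        using C D weight_ge_1[of k] by (intro add_mono mult_left_mono power_increasing) auto
      finally show ?thesis by (simp add: algebra_simps)
    qed
    moreover have "0 \<le> C + D" using C D by simp
    ultimately show ?case by blast
  qed
  then show ?thesis using that by blast
qed

text \<open>Boxes exhaust the index set, which turns an unconditional sum into the limit of a
  sequence, the form required for differentiating limits.\<close>

lemma filterlim_index_box: "filterlim (\<lambda>N. {k :: nat ^ 'n::finite. \<forall>i. k $ i < N}) (finite_subsets_at_top UNIV) sequentially"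
  unfolding filterlim_finite_subsets_at_top
proof (intro allI impI)
  fix X :: "(nat ^ 'n) set" assume X: "finite X \<and> X \<subseteq> UNIV"
  define N where "N = Suc (Max (insert 0 ((\<lambda>(k, i). k $ i) ` (X \<times> UNIV))))"
  have N: "k $ i < N" if "k \<in> X" for k i
  proof -
    have "k $ i \<le> Max (insert 0 ((\<lambda>(k, i). k $ i) ` (X \<times> UNIV)))"
      using that X by (intro Max_ge) (auto intro!: image_eqI[of _ _ "(k, i)"])
    then show ?thesis by (simp add: N_def)
  qed
  show "eventually (\<lambda>M. finite {k :: nat ^ 'n. \<forall>i. k $ i < M} \<and> X \<subseteq> {k. \<forall>i. k $ i < M} \<and> {k :: nat ^ 'n. \<forall>i. k $ i < M} \<subseteq> UNIV) sequentially"
    using eventually_ge_at_top[of N] by eventually_elim (use N in \<open>auto simp: finite_index_box intro: less_le_trans\<close>)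
qed

lemma rapid_summable:
  assumes "rapid a"
  shows "(\<lambda>k. norm (a k) * weight k ^ M) summable_on UNIV"
proof -
  obtain C where C: "\<And>k. norm (a k) * weight k ^ (M + 2) \<le> C" using assms unfolding rapid_def by meson
  show ?thesis
  proof (rule summable_on_comparison_test)
    show "(\<lambda>k. C * (1 / weight k ^ 2)) summable_on (UNIV :: (nat ^ 'a) set)" by (intro summable_on_cmult_right summable_weight)
    fix k
    show "norm (a k) * weight k ^ M \<le> C * (1 / weight k ^ 2)"
      using C[of k] weight_pos[of k] by (simp add: field_simps power_add power2_eq_square)
  qed (simp add: weight_pos less_imp_le)
qed

abbreviation weighted_sum :: "(nat ^ 'n::finite \<Rightarrow> complex) \<Rightarrow> nat \<Rightarrow> real" where
  "weighted_sum a M \<equiv> \<Sum>\<^sub>\<infinity>k. norm (a k) * weight k ^ M"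

lemma rapid_abs_summable:
  assumes "rapid a" "\<And>k. norm (b k) \<le> C * weight k ^ M"
  shows "(\<lambda>k. norm (a k * b k)) summable_on UNIV"
    and "(\<Sum>\<^sub>\<infinity>k. norm (a k * b k)) \<le> C * weighted_sum a M"
proof -
  have s: "(\<lambda>k. C * (norm (a k) * weight k ^ M)) summable_on UNIV"
    by (intro summable_on_cmult_right rapid_summable assms(1))
  have b: "norm (a k * b k) \<le> C * (norm (a k) * weight k ^ M)" for k
    using mult_left_mono[OF assms(2)[of k], of "norm (a k)"] by (simp add: norm_mult mult_ac)
  show sb: "(\<lambda>k. norm (a k * b k)) summable_on UNIV" by (rule summable_on_comparison_test[OF s]) (use b in auto)
  have "(\<Sum>\<^sub>\<infinity>k. norm (a k * b k)) \<le> (\<Sum>\<^sub>\<infinity>k. C * (norm (a k) * weight k ^ M))"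
    by (rule infsum_mono[OF sb s]) (use b in simp)
  also have "\<dots> = C * weighted_sum a M"
    by (rule infsum_cmult_right) (rule rapid_summable[OF assms(1)])
  finally show "(\<Sum>\<^sub>\<infinity>k. norm (a k * b k)) \<le> C * weighted_sum a M" .
qed

text \<open>The tail is controlled by the majorant alone, so the estimate is uniform over all
  families dominated by the same \<open>G\<close>.\<close>

lemma infsum_minus_sum_bound:
  fixes u :: "'i \<Rightarrow> complex"
  assumes "\<And>k. norm (u k) \<le> G k" and G: "G summable_on UNIV" and F: "finite F"
  shows "norm ((\<Sum>\<^sub>\<infinity>k. u k) - (\<Sum>k\<in>F. u k)) \<le> (\<Sum>\<^sub>\<infinity>k. G k) - (\<Sum>k\<in>F. G k)"
proof -
  have nu: "(\<lambda>k. norm (u k)) summable_on UNIV" by (rule summable_on_comparison_test[OF G]) (use assms in auto)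
  then have u: "u summable_on UNIV" by (rule Infinite_Sum.abs_summable_summable)
  have nu': "(\<lambda>k. norm (u k)) summable_on (UNIV - F)" "G summable_on (UNIV - F)"
    by (rule summable_on_subset_banach[OF nu], simp, rule summable_on_subset_banach[OF G], simp)
  have "(\<Sum>\<^sub>\<infinity>k. u k) - (\<Sum>k\<in>F. u k) = (\<Sum>\<^sub>\<infinity>k\<in>UNIV - F. u k)"
    using infsum_Diff[of u UNIV F] u F by simp
  also have "norm \<dots> \<le> (\<Sum>\<^sub>\<infinity>k\<in>UNIV - F. norm (u k))" by (rule norm_infsum_bound) (rule nu')
  also have "\<dots> \<le> (\<Sum>\<^sub>\<infinity>k\<in>UNIV - F. G k)" by (rule infsum_mono[OF nu']) (rule assms)
  also have "\<dots> = (\<Sum>\<^sub>\<infinity>k. G k) - (\<Sum>k\<in>F. G k)" using infsum_Diff[of G UNIV F] G F by simp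
  finally show ?thesis .
qed

lemma norm_infsum_le:
  fixes u :: "'i \<Rightarrow> complex"
  assumes "(\<lambda>k. norm (u k)) summable_on A"
  shows "norm (\<Sum>\<^sub>\<infinity>k\<in>A. u k) \<le> (\<Sum>\<^sub>\<infinity>k\<in>A. norm (u k))" using assms by (rule norm_infsum_bound)

section \<open>Termwise differentiation and Schwartz seminorms of Hermite series\<close>

lemma hermite_families_frechet_bound:
  assumes W: "W \<in> hermite_families"
  obtains C M where "0 \<le> C" "\<And>k x h. norm (frechet_derivative (W k) (at x) h) \<le> C * weight k ^ M * norm h"
proof -
  have "\<forall>b\<in>Basis. \<exists>C M. 0 \<le> C \<and> (\<forall>k x. norm (frechet_derivative (W k) (at x) b) \<le> C * weight k ^ M)"
  proof
    fix b :: "real ^ 'a" assume "b \<in> Basis"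
    then obtain V where V: "V \<in> hermite_families" "\<And>k x. frechet_derivative (W k) (at x) b = V k x"
      using hermite_families_derivative[OF W] by blast
    obtain C M where "0 \<le> C" "\<And>k x. norm (V k x) \<le> C * weight k ^ M" using hermite_families_bound[OF V(1)] by blast
    then show "\<exists>C M. 0 \<le> C \<and> (\<forall>k x. norm (frechet_derivative (W k) (at x) b) \<le> C * weight k ^ M)"
      using V(2) by auto
  qed
  then obtain C M where C: "\<And>b. b \<in> Basis \<Longrightarrow> 0 \<le> C b"
    "\<And>b k x. b \<in> Basis \<Longrightarrow> norm (frechet_derivative (W k) (at x) b) \<le> C b * weight k ^ M b" by metis
  have diff: "W k differentiable (at x)" for k x
  proof -
    obtain b :: "real ^ 'a" where "b \<in> Basis" using nonempty_Basis by blast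
    then show ?thesis using hermite_families_derivative[OF W] by blast
  qed
  have "norm (frechet_derivative (W k) (at x) h) \<le> (\<Sum>b\<in>Basis. C b) * weight k ^ (\<Sum>b\<in>Basis. M b) * norm h" for k x h
  proof -
    have lin: "linear (frechet_derivative (W k) (at x))" using diff by (rule linear_frechet_derivative)
    have "frechet_derivative (W k) (at x) h = frechet_derivative (W k) (at x) (\<Sum>b\<in>Basis. (h \<bullet> b) *\<^sub>R b)"
      by (simp add: euclidean_representation)
    also have "\<dots> = (\<Sum>b\<in>Basis. (h \<bullet> b) *\<^sub>R frechet_derivative (W k) (at x) b)"
      using lin by (simp add: linear_sum linear_scale)
    also have "norm \<dots> \<le> (\<Sum>b\<in>Basis. norm h * (C b * weight k ^ (\<Sum>b\<in>Basis. M b)))"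
    proof (rule sum_norm_le)
      fix b :: "real ^ 'a" assume b: "b \<in> Basis"
      have "C b * weight k ^ M b \<le> C b * weight k ^ (\<Sum>b\<in>Basis. M b)"
        using C(1)[OF b] weight_ge_1[of k] b by (intro mult_left_mono power_increasing member_le_sum) auto
      then have "norm (frechet_derivative (W k) (at x) b) \<le> C b * weight k ^ (\<Sum>b\<in>Basis. M b)" using C(2)[OF b, of k x] by linarith
      then show "norm ((h \<bullet> b) *\<^sub>R frechet_derivative (W k) (at x) b) \<le> norm h * (C b * weight k ^ (\<Sum>b\<in>Basis. M b))"
        unfolding norm_scaleR using Basis_le_norm[OF b, of h] by (intro mult_mono) auto
    qed
    also have "\<dots> = (\<Sum>b\<in>Basis. C b) * weight k ^ (\<Sum>b\<in>Basis. M b) * norm h"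
      by (simp add: sum_distrib_right sum_distrib_left mult_ac)
    finally show ?thesis .
  qed
  moreover have "0 \<le> (\<Sum>b\<in>Basis. C b)" using C(1) by (intro sum_nonneg)
  ultimately show ?thesis using that by blast
qed

lemma hermite_families_differentiable: "W \<in> hermite_families \<Longrightarrow> W k differentiable (at x)"
proof -
  assume W: "W \<in> hermite_families"
  obtain b :: "real ^ 'a" where "b \<in> Basis" using nonempty_Basis by blast
  then show ?thesis using hermite_families_derivative[OF W] by blast
qed

lemma infsum_box_tendsto:
  "u summable_on UNIV \<Longrightarrow> (\<lambda>N. \<Sum>k\<in>{k :: nat ^ 'n::finite. \<forall>i. k $ i < N}. u k) \<longlonglongrightarrow> (\<Sum>\<^sub>\<infinity>k. u k)"
  using filterlim_compose[OF infsum_tendsto filterlim_index_box] .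

text \<open>Rapid coefficients beat the polynomial growth of the family and of its derivatives. The
  resulting majorant \<open>G\<close> does not depend on the point, so the derivatives of the
  partial sums over boxes converge uniformly.\<close>

lemma has_derivative_hermite_family_series:
  assumes a: "rapid a" and W: "W \<in> hermite_families"
  shows "((\<lambda>x. \<Sum>\<^sub>\<infinity>k. a k * W k x) has_derivative (\<lambda>h. \<Sum>\<^sub>\<infinity>k. a k * frechet_derivative (W k) (at x) h)) (at x)"
proof -
  define B where "B N = {k :: nat ^ 'a. \<forall>i. k $ i < N}" for N
  define f where "f N x = (\<Sum>k\<in>B N. a k * W k x)" for N x
  define f' where "f' N x h = (\<Sum>k\<in>B N. a k * frechet_derivative (W k) (at x) h)" for N x h
  define g' where "g' x h = (\<Sum>\<^sub>\<infinity>k. a k * frechet_derivative (W k) (at x) h)" for x h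
  obtain C M where C: "0 \<le> C" "\<And>k x h. norm (frechet_derivative (W k) (at x) h) \<le> C * weight k ^ M * norm h"
    using hermite_families_frechet_bound[OF W] by blast
  obtain D L where "0 \<le> D" and D: "\<And>k x. norm (W k x) \<le> D * weight k ^ L" using hermite_families_bound[OF W] by blast
  have sW: "(\<lambda>k. a k * W k x) summable_on UNIV" for x
    by (rule Infinite_Sum.abs_summable_summable[OF rapid_abs_summable(1)[OF a D]])
  define G where "G k = norm (a k) * (C * weight k ^ M)" for k
  have Gs: "G summable_on UNIV" using summable_on_cmult_right[OF rapid_summable[OF a, of M], of C] by (simp add: G_def[abs_def] mult_ac)
  have tail: "norm (f' N x h - g' x h) \<le> ((\<Sum>\<^sub>\<infinity>k. G k) - (\<Sum>k\<in>B N. G k)) * norm h" for N x h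
  proof -
    have "norm ((\<Sum>\<^sub>\<infinity>k. a k * frechet_derivative (W k) (at x) h) - (\<Sum>k\<in>B N. a k * frechet_derivative (W k) (at x) h))
        \<le> (\<Sum>\<^sub>\<infinity>k. G k * norm h) - (\<Sum>k\<in>B N. G k * norm h)"
    proof (rule infsum_minus_sum_bound)
      show "norm (a k * frechet_derivative (W k) (at x) h) \<le> G k * norm h" for k
        using mult_left_mono[OF C(2)[of k x h], of "norm (a k)"] by (simp add: G_def norm_mult mult_ac)
      show "(\<lambda>k. G k * norm h) summable_on UNIV" by (intro summable_on_cmult_left Gs)
      show "finite (B N)" unfolding B_def by (rule finite_index_box)
    qed
    also have "\<dots> = ((\<Sum>\<^sub>\<infinity>k. G k) - (\<Sum>k\<in>B N. G k)) * norm h"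
      by (simp add: infsum_cmult_left Gs sum_distrib_right left_diff_distrib)
    finally show ?thesis unfolding f'_def g'_def by (simp add: norm_minus_commute)
  qed
  have "(\<lambda>N. (\<Sum>\<^sub>\<infinity>k. G k) - (\<Sum>k\<in>B N. G k)) \<longlonglongrightarrow> (\<Sum>\<^sub>\<infinity>k. G k) - (\<Sum>\<^sub>\<infinity>k. G k)"
    unfolding B_def by (intro tendsto_intros infsum_box_tendsto Gs)
  then have lim: "(\<lambda>N. (\<Sum>\<^sub>\<infinity>k. G k) - (\<Sum>k\<in>B N. G k)) \<longlonglongrightarrow> 0" by simp
  have "\<exists>g. \<forall>x\<in>UNIV. (\<lambda>N. f N x) \<longlonglongrightarrow> g x \<and> (g has_derivative g' x) (at x within UNIV)"
  proof (rule has_derivative_sequence)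
    show "(f N has_derivative f' N x) (at x within UNIV)" for N x unfolding f_def f'_def by (intro has_derivative_sum has_derivative_mult_right)
        (use hermite_families_differentiable[OF W] in \<open>simp add: frechet_derivative_works\<close>)
    show "\<forall>\<^sub>F N in sequentially. \<forall>x\<in>UNIV. \<forall>h. norm (f' N x h - g' x h) \<le> e * norm h" if "e > 0" for e
      using order_tendstoD(2)[OF lim that]
    proof eventually_elim
      case (elim N)
      show ?case
      proof (intro ballI allI)
        fix x h :: "real ^ 'a"
        have "((\<Sum>\<^sub>\<infinity>k. G k) - (\<Sum>k\<in>B N. G k)) * norm h \<le> e * norm h" using elim by (intro mult_right_mono) auto
        with tail[of N x h] show "norm (f' N x h - g' x h) \<le> e * norm h" by linarith
      qed
    qed
    show "(\<lambda>N. f N 0) \<longlonglongrightarrow> (\<Sum>\<^sub>\<infinity>k. a k * W k 0)"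
      unfolding f_def B_def by (rule infsum_box_tendsto) (rule sW)
  qed auto
  then obtain g where g: "\<And>x. (\<lambda>N. f N x) \<longlonglongrightarrow> g x" "\<And>x. (g has_derivative g' x) (at x)" by auto
  have "g x = (\<Sum>\<^sub>\<infinity>k. a k * W k x)" for x
  proof (rule LIMSEQ_unique[OF g(1)])
    show "(\<lambda>N. f N x) \<longlonglongrightarrow> (\<Sum>\<^sub>\<infinity>k. a k * W k x)"
      unfolding f_def B_def by (rule infsum_box_tendsto) (rule sW)
  qed
  then have "g = (\<lambda>x. \<Sum>\<^sub>\<infinity>k. a k * W k x)" by auto
  with g(2)[of x] show ?thesis by (simp add: g'_def[abs_def])
qed

definition hermite_series :: "(nat ^ 'n::finite \<Rightarrow> complex) \<Rightarrow> real ^ 'n \<Rightarrow> complex" where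
  "hermite_series a x = (\<Sum>\<^sub>\<infinity>k. a k * hermite_fun k x)"

text \<open>One family \<open>W\<close> serves all coefficient sequences. This is why the constants
  in the seminorm estimates below are independent of \<open>a\<close>.\<close>

lemma hermite_series_partial_derivs:
  assumes "set bs \<subseteq> Basis"
  shows "\<exists>W\<in>hermite_families. \<forall>a. rapid a \<longrightarrow> partial_derivs bs (hermite_series a) = (\<lambda>x. \<Sum>\<^sub>\<infinity>k. a k * W k x)"
  using assms
proof (induction bs)
  case Nil
  show ?case by (rule bexI[OF _ hermite_fun_in_families]) (simp add: hermite_series_def[abs_def])
next
  case (Cons b bs)
  then obtain W where W: "W \<in> hermite_families"
    "\<And>a. rapid a \<Longrightarrow> partial_derivs bs (hermite_series a) = (\<lambda>x. \<Sum>\<^sub>\<infinity>k. a k * W k x)" by auto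
  obtain V where V: "V \<in> hermite_families" "\<And>k x. frechet_derivative (W k) (at x) b = V k x"
    using hermite_families_derivative[OF W(1), of b] Cons.prems by auto
  have "partial_derivs (b # bs) (hermite_series a) x = (\<Sum>\<^sub>\<infinity>k. a k * V k x)" if a: "rapid a" for a x
    using frechet_derivative_eqI[OF has_derivative_hermite_family_series[OF a W(1), of x]] by (simp add: W(2)[OF a] V(2))
  with V(1) show ?case by blast
qed

lemma hermite_series_weighted_deriv:
  fixes bs :: "(real ^ 'n::finite) list"
  assumes "set bs \<subseteq> Basis"
  obtains C M where "0 \<le> C" "\<And>a x. rapid a \<Longrightarrow>
    weighted_deriv m bs (hermite_series a) x \<le> C * weighted_sum a M"
proof -
  obtain W :: "nat ^ 'n \<Rightarrow> real ^ 'n \<Rightarrow> complex" where W: "W \<in> hermite_families"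
    "\<And>a. rapid a \<Longrightarrow> partial_derivs bs (hermite_series a) = (\<lambda>x. \<Sum>\<^sub>\<infinity>k. a k * W k x)"
    using hermite_series_partial_derivs[OF assms] by blast
  obtain C M where C: "0 \<le> C" "\<And>k x. norm (of_real (monomial m x) * W k x) \<le> C * weight k ^ M"
    using hermite_families_bound[OF hermite_families_monomial[OF W(1), of m]] by blast
  have "weighted_deriv m bs (hermite_series a) x \<le> C * weighted_sum a M"
    if a: "rapid a" for a x
  proof -
    note s = rapid_abs_summable[OF a C(2)[of x]]
    have "weighted_deriv m bs (hermite_series a) x = norm (of_real (monomial m x) * (\<Sum>\<^sub>\<infinity>k. a k * W k x))"
      by (simp add: weighted_deriv_def W(2)[OF a] norm_mult)
    also have "of_real (monomial m x) * (\<Sum>\<^sub>\<infinity>k. a k * W k x) = (\<Sum>\<^sub>\<infinity>k. of_real (monomial m x) * (a k * W k x))"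
      by (rule infsum_cmult_right'[symmetric])
    also have "\<dots> = (\<Sum>\<^sub>\<infinity>k. a k * (of_real (monomial m x) * W k x))" by (simp add: mult_ac)
    also have "norm \<dots> \<le> (\<Sum>\<^sub>\<infinity>k. norm (a k * (of_real (monomial m x) * W k x)))" by (rule norm_infsum_le) (rule s(1))
    also have "\<dots> \<le> C * weighted_sum a M" by (rule s(2))
    finally show ?thesis .
  qed
  with C(1) show ?thesis using that by blast
qed

lemma hermite_series_schwartz:
  assumes a: "rapid a"
  shows "hermite_series a \<in> schwartz" unfolding schwartz_def
proof (intro CollectI conjI)
  show "smooth_on UNIV (hermite_series a)" unfolding smooth_on_def
  proof (intro allI impI ballI)
    fix bs :: "(real ^ 'a) list" and x assume "set bs \<subseteq> Basis"
    then obtain W :: "nat ^ 'a \<Rightarrow> real ^ 'a \<Rightarrow> complex" where W: "W \<in> hermite_families"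
      "partial_derivs bs (hermite_series a) = (\<lambda>x. \<Sum>\<^sub>\<infinity>k. a k * W k x)" using hermite_series_partial_derivs a by blast
    show "partial_derivs bs (hermite_series a) differentiable (at x)"
      unfolding W(2) differentiable_def using has_derivative_hermite_family_series[OF a W(1)] by blast
  qed
  show "schwartz_bounds UNIV (hermite_series a)" unfolding schwartz_bounds_def
  proof (intro allI impI)
    fix m and bs :: "(real ^ 'a) list" assume bs: "set bs \<subseteq> Basis"
    obtain C M where "0 \<le> C" and C: "\<And>a x. rapid a \<Longrightarrow>
        weighted_deriv m bs (hermite_series a) x \<le> C * weighted_sum a M"
      using hermite_series_weighted_deriv[OF bs, of m] by blast
    from C[OF a] show "bdd_above (range (weighted_deriv m bs (hermite_series a)))" by (intro bdd_aboveI2)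
  qed
qed

lemma hermite_series_seminorm:
  fixes p :: "(real ^ 'n::finite \<Rightarrow> complex) \<Rightarrow> real"
  assumes "p \<in> schwartz_seminorms UNIV"
  obtains C M where "0 \<le> C" "\<And>a. rapid a \<Longrightarrow> p (hermite_series a) \<le> C * weighted_sum a M"
proof -
  obtain m bs where p: "p = (\<lambda>f. SUP x. weighted_deriv m bs f x)" "set bs \<subseteq> Basis"
    using assms by (auto simp: schwartz_seminorms_def)
  obtain C M where C: "0 \<le> C" "\<And>a x. rapid a \<Longrightarrow>
      weighted_deriv m bs (hermite_series a) x \<le> C * weighted_sum a M"
    using hermite_series_weighted_deriv[OF p(2), of m] by blast
  have "p (hermite_series a) \<le> C * weighted_sum a M" if "rapid a" for a
    unfolding p(1) using C(2)[OF that] by (intro cSUP_least) auto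
  with C(1) show ?thesis using that by blast
qed

lemma rapid_finite:
  assumes "finite F" "\<And>k. k \<notin> F \<Longrightarrow> a k = 0"
  shows "rapid a" unfolding rapid_def
proof
  fix M
  have "norm (a k) * weight k ^ M \<le> (\<Sum>k\<in>F. norm (a k) * weight k ^ M)" for k
  proof (cases "k \<in> F")
    case True
    show ?thesis
      by (rule member_le_sum[OF True]) (use assms(1) in \<open>auto intro!: mult_nonneg_nonneg zero_le_power less_imp_le[OF weight_pos]\<close>)
  next
    case False
    then show ?thesis using assms(2) by (auto intro!: sum_nonneg mult_nonneg_nonneg zero_le_power less_imp_le[OF weight_pos])
  qed
  then show "\<exists>C. \<forall>k. norm (a k) * weight k ^ M \<le> C" by blast
qed

lemma hermite_series_finite:
  assumes F: "finite F" "\<And>k. k \<notin> F \<Longrightarrow> a k = 0"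
  shows "hermite_series a x = (\<Sum>k\<in>F. a k * hermite_fun k x)"
proof -
  have "hermite_series a x = (\<Sum>\<^sub>\<infinity>k\<in>F. a k * hermite_fun k x)"
    unfolding hermite_series_def by (rule infsum_cong_neutral) (use F in auto)
  then show ?thesis using F by simp
qed

lemma hermite_fun_eq_series: "hermite_fun k = hermite_series (\<lambda>j. if j = k then 1 else 0)"
  by (rule ext) (subst hermite_series_finite[of "{k}"], auto)

lemma hermite_fun_schwartz: "hermite_fun k \<in> schwartz" unfolding hermite_fun_eq_series
  by (rule hermite_series_schwartz, rule rapid_finite[of "{k}"]) auto

lemma hermite_fun_seminorm:
  fixes p :: "(real ^ 'n::finite \<Rightarrow> complex) \<Rightarrow> real"
  assumes "p \<in> schwartz_seminorms UNIV"
  obtains C M where "0 \<le> C" "\<And>k. p (hermite_fun k) \<le> C * weight k ^ M"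
proof -
  obtain C M where C: "0 \<le> C" "\<And>a. rapid a \<Longrightarrow> p (hermite_series a) \<le> C * weighted_sum a M"
    using hermite_series_seminorm[OF assms] by blast
  have "p (hermite_fun k) \<le> C * weight k ^ M" for k
  proof -
    have "p (hermite_fun k) \<le> C * (\<Sum>\<^sub>\<infinity>j. norm (if j = k then 1 else 0 :: complex) * weight j ^ M)"
      unfolding hermite_fun_eq_series[of k] by (rule C(2), rule rapid_finite[of "{k}"]) auto
    also have "(\<Sum>\<^sub>\<infinity>j. norm (if j = k then 1 else 0 :: complex) * weight j ^ M) = (\<Sum>\<^sub>\<infinity>j\<in>{k}. weight j ^ M)"
      by (rule infsum_cong_neutral) auto
    finally show ?thesis by simp
  qed
  with C(1) show ?thesis using that by blast
qed

lemma rapid_le: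
  assumes "rapid a" "\<And>k. norm (b k) \<le> norm (a k)"
  shows "rapid b" unfolding rapid_def
proof
  fix M
  obtain C where C: "\<And>k. norm (a k) * weight k ^ M \<le> C" using assms(1) unfolding rapid_def by blast
  have "norm (b k) * weight k ^ M \<le> C" for k
    using mult_right_mono[OF assms(2) zero_le_power[OF less_imp_le[OF weight_pos]], of k k M] C[of k] by linarith
  then show "\<exists>C. \<forall>k. norm (b k) * weight k ^ M \<le> C" by blast
qed

lemma rapid_mult:
  assumes "rapid a" "poly_growth b"
  shows "rapid (\<lambda>k. a k * b k)" unfolding rapid_def
proof
  fix M
  obtain D L where D: "0 \<le> D" "\<And>k. norm (b k) \<le> D * weight k ^ L" using poly_growthE[OF assms(2)] by blast
  obtain C where C: "\<And>k. norm (a k) * weight k ^ (L + M) \<le> C" using assms(1) unfolding rapid_def by blast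
  have "norm (a k * b k) * weight k ^ M \<le> C * D" for k
  proof -
    have "norm (a k * b k) * weight k ^ M \<le> norm (a k) * (D * weight k ^ L) * weight k ^ M"
      unfolding norm_mult using D weight_pos[of k] by (intro mult_right_mono mult_left_mono) auto
    also have "\<dots> = (norm (a k) * weight k ^ (L + M)) * D" by (simp add: power_add)
    also have "\<dots> \<le> C * D" using C D by (intro mult_right_mono)
    finally show ?thesis .
  qed
  then show "\<exists>C. \<forall>k. norm (a k * b k) * weight k ^ M \<le> C" by blast
qed

lemma hermite_series_summable:
  assumes "rapid a"
  shows "(\<lambda>k. a k * hermite_fun k x) summable_on UNIV"
proof -
  have "norm (hermite_fun k x) \<le> 2 ^ CARD('a) * weight k ^ 1" for k :: "nat ^ 'a" using hermite_fun_bound[of k x] by simp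
  from rapid_abs_summable(1)[OF assms this] show ?thesis by (rule Infinite_Sum.abs_summable_summable)
qed

lemma hermite_series_lin_comb:
  assumes "rapid a" "rapid b"
  shows "hermite_series (\<lambda>k. c * a k + b k) x = c * hermite_series a x + hermite_series b x"
proof -
  have "hermite_series (\<lambda>k. c * a k + b k) x = (\<Sum>\<^sub>\<infinity>k. c * (a k * hermite_fun k x) + b k * hermite_fun k x)"
    unfolding hermite_series_def by (simp add: algebra_simps)
  also have "\<dots> = (\<Sum>\<^sub>\<infinity>k. c * (a k * hermite_fun k x)) + (\<Sum>\<^sub>\<infinity>k. b k * hermite_fun k x)"
    by (intro infsum_add summable_on_cmult_right hermite_series_summable assms)
  finally show ?thesis by (simp add: hermite_series_def infsum_cmult_right')
qed

lemma hermite_series_diff: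
  assumes "rapid a" "rapid b"
  shows "hermite_series a - hermite_series b = hermite_series (\<lambda>k. a k - b k)"
  using hermite_series_lin_comb[OF assms(2,1), of "-1"] by (auto simp: fun_eq_iff)

text \<open>The error of a partial sum is itself a Hermite series, with coefficients cut off on
  \<open>F\<close>, so the seminorm estimate bounds it by the tail of a convergent sum.\<close>

lemma hermite_series_limit:
  assumes a: "rapid a"
  shows "limitin schwartz_topology (\<lambda>F x. \<Sum>k\<in>F. a k * hermite_fun k x) (hermite_series a) (finite_subsets_at_top UNIV)"
  unfolding schwartz_topology_def
proof (rule limitin_seminormI[OF pseudometric_seminorm_space[OF seminorm_schwartz]])
  show "hermite_series a \<in> schwartz" by (rule hermite_series_schwartz[OF a])
  show "\<forall>\<^sub>F F in finite_subsets_at_top UNIV. (\<lambda>x. \<Sum>k\<in>F. a k * hermite_fun k x) \<in> schwartz"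
    using eventually_finite_subsets_at_top_weakI[of UNIV finite] by (rule eventually_mono)
      (auto intro!: seminorm_space_sum[OF seminorm_schwartz] seminorm_space_scale[OF seminorm_schwartz] hermite_fun_schwartz)
  fix p :: "(real ^ 'a \<Rightarrow> complex) \<Rightarrow> real" assume p: "p \<in> schwartz_seminorms UNIV"
  obtain C M where C: "0 \<le> C" "\<And>a. rapid a \<Longrightarrow> p (hermite_series a) \<le> C * weighted_sum a M"
    using hermite_series_seminorm[OF p] by blast
  define G where "G k = norm (a k) * weight k ^ M" for k
  have Gs: "G summable_on UNIV" unfolding G_def by (rule rapid_summable[OF a])
  have bd: "p ((\<lambda>x. \<Sum>k\<in>F. a k * hermite_fun k x) - hermite_series a) \<le> C * ((\<Sum>\<^sub>\<infinity>k. G k) - sum G F) \<and>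
      0 \<le> p ((\<lambda>x. \<Sum>k\<in>F. a k * hermite_fun k x) - hermite_series a)" if F: "finite F" for F
  proof -
    define b where "b k = (if k \<in> F then a k else 0)" for k
    \<comment> \<open>The sign is that of partial sum minus full series.\<close>
    define c where "c k = (if k \<in> F then 0 else - a k)" for k
    have b: "rapid b" and c: "rapid c" by (auto intro!: rapid_le[OF a] simp: b_def c_def)
    have "(\<lambda>x. \<Sum>k\<in>F. a k * hermite_fun k x) = hermite_series b" by (rule ext) (subst hermite_series_finite[OF F], auto simp: b_def)
    then have eq: "(\<lambda>x. \<Sum>k\<in>F. a k * hermite_fun k x) - hermite_series a = hermite_series c"
    proof -
      have "(\<lambda>k. b k - a k) = c" by (auto simp: b_def c_def fun_eq_iff)
      with \<open>_ = hermite_series b\<close> show ?thesis using hermite_series_diff[OF b a] by simp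
    qed
    have "p (hermite_series c) \<le> C * (\<Sum>\<^sub>\<infinity>k. norm (c k) * weight k ^ M)" by (rule C(2)[OF c])
    also have "(\<Sum>\<^sub>\<infinity>k. norm (c k) * weight k ^ M) = (\<Sum>\<^sub>\<infinity>k\<in>UNIV - F. G k)"
      by (rule infsum_cong_neutral) (auto simp: c_def G_def)
    also have "\<dots> = (\<Sum>\<^sub>\<infinity>k. G k) - sum G F" using infsum_Diff[of G UNIV F] Gs F by simp
    finally show ?thesis unfolding eq using seminorm_nonneg[OF seminorm_schwartz p hermite_series_schwartz[OF c]] by simp
  qed
  have "((\<lambda>F. C * ((\<Sum>\<^sub>\<infinity>k. G k) - sum G F)) \<longlongrightarrow> C * ((\<Sum>\<^sub>\<infinity>k. G k) - (\<Sum>\<^sub>\<infinity>k. G k))) (finite_subsets_at_top UNIV)"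
    by (intro tendsto_intros infsum_tendsto Gs)
  then have lim: "((\<lambda>F. C * ((\<Sum>\<^sub>\<infinity>k. G k) - sum G F)) \<longlongrightarrow> 0) (finite_subsets_at_top UNIV)" by simp
  show "((\<lambda>F. p ((\<lambda>x. \<Sum>k\<in>F. a k * hermite_fun k x) - hermite_series a)) \<longlongrightarrow> 0) (finite_subsets_at_top UNIV)"
    by (rule tendsto_sandwich[OF _ _ tendsto_const lim])
      (use bd in \<open>auto intro!: eventually_finite_subsets_at_top_weakI\<close>)
qed

section \<open>Tempered distributions evaluated on Hermite series\<close>

lemma temperedD:
  assumes "u \<in> tempered"
  shows "continuous_map (seminorm_topology schwartz (schwartz_seminorms UNIV)) euclidean u"
    and "f \<in> schwartz \<Longrightarrow> g \<in> schwartz \<Longrightarrow> u (\<lambda>x. a * f x + g x) = a * u f + u g"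
  using assms by (auto simp: tempered_def schwartz_topology_def)

lemma tempered_sum:
  assumes u: "u \<in> tempered" and "finite F" "\<And>k. k \<in> F \<Longrightarrow> f k \<in> schwartz"
  shows "u (\<lambda>x. \<Sum>k\<in>F. a k * f k x) = (\<Sum>k\<in>F. a k * u (f k))" using assms(2,3)
proof induction
  case empty
  have "u (\<lambda>x. 0) = 0" using temperedD(2)[OF u schwartz_zero schwartz_zero, of 1] by simp
  then show ?case by simp
next
  case (insert k F)
  have "(\<lambda>x. \<Sum>k\<in>F. a k * f k x) \<in> schwartz"
    using insert by (intro seminorm_space_sum[OF seminorm_schwartz] seminorm_space_scale[OF seminorm_schwartz]) auto
  then show ?case using insert temperedD(2)[OF u, of "f k" "\<lambda>x. \<Sum>k\<in>F. a k * f k x" "a k"] by simp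
qed

lemma tempered_hermite_series:
  assumes u: "u \<in> tempered" and a: "rapid a"
  shows "((\<lambda>k. a k * u (hermite_fun k)) has_sum u (hermite_series a)) UNIV"
proof -
  have "limitin euclidean (u \<circ> (\<lambda>F x. \<Sum>k\<in>F. a k * hermite_fun k x)) (u (hermite_series a)) (finite_subsets_at_top UNIV)"
    by (rule continuous_map_limit[OF temperedD(1)[OF u]]) (use hermite_series_limit[OF a] in \<open>simp add: schwartz_topology_def\<close>)
  then have "((\<lambda>F. u (\<lambda>x. \<Sum>k\<in>F. a k * hermite_fun k x)) \<longlongrightarrow> u (hermite_series a)) (finite_subsets_at_top UNIV)"
    by (simp add: limitin_canonical_iff o_def)
  moreover have "\<forall>\<^sub>F F in finite_subsets_at_top UNIV. u (\<lambda>x. \<Sum>k\<in>F. a k * hermite_fun k x) = (\<Sum>k\<in>F. a k * u (hermite_fun k))"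
    by (rule eventually_finite_subsets_at_top_weakI) (rule tempered_sum[OF u _ hermite_fun_schwartz])
  ultimately show ?thesis unfolding has_sum_def by (rule Lim_transform_eventually)
qed

text \<open>Continuity bounds \<open>u\<close> by finitely many seminorms, and each of them grows
  polynomially on the Hermite functions. The sum of the finitely many exponents is a common one
  since \<open>weight k \<ge> 1\<close>.\<close>

lemma poly_growth_tempered:
  assumes u: "u \<in> tempered"
  shows "poly_growth (\<lambda>k. u (hermite_fun k))"
proof -
  obtain F C where F: "finite F" "F \<subseteq> schwartz_seminorms UNIV" "0 \<le> C"
    "\<And>f. f \<in> schwartz \<Longrightarrow> norm (u f) \<le> C * (\<Sum>p\<in>F. p f)"
    by (rule continuous_functional_bound[OF seminorm_schwartz temperedD[OF u]]) (assumption+, rule that)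
  have "\<forall>p\<in>F. \<exists>D M. 0 \<le> D \<and> (\<forall>k. p (hermite_fun k) \<le> D * weight k ^ M)"
    using hermite_fun_seminorm F(2) by (metis subsetD)
  then obtain D M where D: "\<And>p. p \<in> F \<Longrightarrow> 0 \<le> D p" "\<And>p k. p \<in> F \<Longrightarrow> p (hermite_fun k) \<le> D p * weight k ^ M p"
    by metis
  have "norm (u (hermite_fun k)) \<le> (C * (\<Sum>p\<in>F. D p)) * weight k ^ (\<Sum>p\<in>F. M p)" for k
  proof -
    have "norm (u (hermite_fun k)) \<le> C * (\<Sum>p\<in>F. p (hermite_fun k))" by (rule F(4)[OF hermite_fun_schwartz])
    also have "\<dots> \<le> C * (\<Sum>p\<in>F. D p * weight k ^ (\<Sum>p\<in>F. M p))"
    proof (intro mult_left_mono sum_mono F)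
      fix p assume p: "p \<in> F"
      have "D p * weight k ^ M p \<le> D p * weight k ^ (\<Sum>p\<in>F. M p)"
        using D(1)[OF p] weight_ge_1[of k] p F(1) by (intro mult_left_mono power_increasing member_le_sum) auto
      with D(2)[OF p, of k] show "p (hermite_fun k) \<le> D p * weight k ^ (\<Sum>p\<in>F. M p)" by linarith
    qed
    finally show ?thesis by (simp add: sum_distrib_right sum_distrib_left mult_ac)
  qed
  then show ?thesis unfolding poly_growth_def by blast
qed

section \<open>Completeness of the Hermite functions\<close>

abbreviation gauss :: "real \<Rightarrow> 'a::euclidean_space \<Rightarrow> real" where
  "gauss a x \<equiv> exp (- a * (x \<bullet> x))"

text \<open>Coordinatewise \<open>1 + u \<le> exp u\<close>; the factor \<open>min 1 a\<close>
  compares \<open>1 + a t\<^sup>2\<close> with \<open>1 + t\<^sup>2\<close>.\<close>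

lemma exp_neg_inner_le_weight:
  fixes x :: "'a::euclidean_space"
  assumes "0 < a"
  shows "gauss a x \<le> (1 / min 1 a) ^ DIM('a) * (1 / poly_weight x)"
proof -
  have "gauss a x = (\<Prod>b\<in>Basis. exp (- a * (x \<bullet> b)\<^sup>2))"
    unfolding exp_sum[OF finite_Basis, symmetric] by (subst euclidean_inner) (simp add: sum_distrib_left power2_eq_square)
  also have "\<dots> \<le> (\<Prod>b\<in>(Basis :: 'a set). 1 / min 1 a * (1 / (1 + (x \<bullet> b)\<^sup>2)))"
  proof (intro prod_mono conjI exp_ge_zero)
    fix b :: 'a
    have pos: "0 < min 1 a" "0 < 1 + (x \<bullet> b)\<^sup>2" using assms by (auto intro: add_pos_nonneg)
    have "min 1 a * (1 + (x \<bullet> b)\<^sup>2) \<le> 1 + a * (x \<bullet> b)\<^sup>2"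
      unfolding distrib_left by (intro add_mono mult_right_mono) auto
    also have "\<dots> \<le> exp (a * (x \<bullet> b)\<^sup>2)" by (rule exp_ge_add_one_self)
    finally have "1 / exp (a * (x \<bullet> b)\<^sup>2) \<le> 1 / (min 1 a * (1 + (x \<bullet> b)\<^sup>2))"
      using pos by (intro divide_left_mono mult_pos_pos) auto
    then show "exp (- a * (x \<bullet> b)\<^sup>2) \<le> 1 / min 1 a * (1 / (1 + (x \<bullet> b)\<^sup>2))" by (simp add: exp_minus divide_inverse)
  qed
  also have "\<dots> = (1 / min 1 a) ^ DIM('a) * (1 / poly_weight x)" unfolding prod.distrib by (simp add: poly_weight_def prod_dividef)
  finally show ?thesis .
qed

lemma integrable_inverse_poly_weight: "integrable lborel (\<lambda>x :: 'a::euclidean_space. 1 / poly_weight x)"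
  unfolding poly_weight_def by (rule integrable_inverse_weight)

lemma integrable_gaussian:
  assumes "0 < a"
  shows "integrable lborel (\<lambda>x :: 'a::euclidean_space. gauss a x)"
proof (rule Bochner_Integration.integrable_bound)
  show "integrable lborel (\<lambda>x :: 'a. (1 / min 1 a) ^ DIM('a) * (1 / poly_weight x))"
    by (intro integrable_mult_right integrable_inverse_poly_weight)
  show "AE x :: 'a in lborel. norm (gauss a x) \<le> norm ((1 / min 1 a) ^ DIM('a) * (1 / poly_weight x))"
    using order_trans[OF exp_neg_inner_le_weight[OF assms] abs_ge_self] by (intro AE_I2) simp
qed measurable

text \<open>The rate \<open>c\<close> stays arbitrary in the induction because a product has to
  split it into two halves.\<close>

lemma real_polynomial_function_exp_bound:
  assumes "real_polynomial_function p" "0 < c"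
  shows "\<exists>D\<ge>0. \<forall>x. \<bar>p x\<bar> \<le> D * exp (c * (x \<bullet> x))" using assms
proof (induction arbitrary: c rule: real_polynomial_function.induct)
  case (linear f)
  obtain K where K: "K > 0" "\<And>x. norm (f x) \<le> norm x * K" using bounded_linear.pos_bounded[OF linear(1)] by blast
  have "\<bar>f x\<bar> \<le> (K * (1 + 1 / c)) * exp (c * (x \<bullet> x))" for x
  proof -
    have "norm x \<le> 1 + x \<bullet> x" unfolding power2_norm_eq_inner[symmetric]
      using sum_squares_bound[of 1 "norm x"] norm_ge_zero[of x] by (simp only: power_one mult_1_right)
    also have "\<dots> \<le> (1 + 1 / c) * (1 + c * (x \<bullet> x))" using linear(2) by (simp add: field_simps)
    also have "\<dots> \<le> (1 + 1 / c) * exp (c * (x \<bullet> x))" using linear(2) by (intro mult_left_mono exp_ge_add_one_self) auto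
    finally have "norm x * K \<le> (1 + 1 / c) * exp (c * (x \<bullet> x)) * K" using K by (intro mult_right_mono) auto
    with K(2)[of x] show ?thesis by (simp add: mult_ac)
  qed
  moreover have "0 \<le> K * (1 + 1 / c)" using K linear by simp
  ultimately show ?case by blast
next
  case (const d)
  have "\<bar>d\<bar> \<le> \<bar>d\<bar> * exp (c * (x \<bullet> x))" for x :: 'a
    using const mult_left_mono[of 1 "exp (c * (x \<bullet> x))" "\<bar>d\<bar>"] by simp
  then show ?case by (intro exI[of _ "\<bar>d\<bar>"]) auto
next
  case (add f g)
  then obtain D E where D: "D \<ge> 0" "E \<ge> 0" "\<And>x. \<bar>f x\<bar> \<le> D * exp (c * (x \<bullet> x))" "\<And>x. \<bar>g x\<bar> \<le> E * exp (c * (x \<bullet> x))" by blast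
  have "\<bar>f x + g x\<bar> \<le> (D + E) * exp (c * (x \<bullet> x))" for x using D(3,4)[of x] by (simp add: distrib_right)
  then show ?case using D(1,2) by (intro exI[of _ "D + E"]) auto
next
  case (mult f g)
  obtain D where D: "D \<ge> 0" "\<And>x. \<bar>f x\<bar> \<le> D * exp (c / 2 * (x \<bullet> x))" using mult.IH(1)[of "c/2"] mult.prems by auto
  obtain E where E: "E \<ge> 0" "\<And>x. \<bar>g x\<bar> \<le> E * exp (c / 2 * (x \<bullet> x))" using mult.IH(2)[of "c/2"] mult.prems by auto
  have "\<bar>f x * g x\<bar> \<le> (D * E) * exp (c * (x \<bullet> x))" for x
  proof -
    have "\<bar>f x\<bar> * \<bar>g x\<bar> \<le> (D * exp (c / 2 * (x \<bullet> x))) * (E * exp (c / 2 * (x \<bullet> x)))"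
      using D E by (intro mult_mono) auto
    also have "\<dots> = (D * E) * (exp (c / 2 * (x \<bullet> x)) * exp (c / 2 * (x \<bullet> x)))" by simp
    also have "exp (c / 2 * (x \<bullet> x)) * exp (c / 2 * (x \<bullet> x)) = exp (c * (x \<bullet> x))"
      unfolding exp_add[symmetric] by (simp add: algebra_simps)
    finally show ?thesis by (simp add: abs_mult)
  qed
  then show ?case using D E by (intro exI[of _ "D * E"]) auto
qed

lemma real_polynomial_function_measurable:
  "real_polynomial_function (p :: 'a::euclidean_space \<Rightarrow> real) \<Longrightarrow> p \<in> borel_measurable borel"
  by (intro borel_measurable_continuous_onI continuous_on_polymonial_function) (simp add: real_polynomial_function_eq)

lemma integrable_gaussian_bound:
  fixes \<phi> :: "'a::euclidean_space \<Rightarrow> complex"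
  assumes \<phi>: "\<phi> \<in> borel_measurable borel" "\<And>x. norm (\<phi> x) \<le> C"
    and f: "f \<in> borel_measurable borel" "\<And>x. \<bar>f x\<bar> \<le> D * gauss a x" and "0 < a"
  shows "integrable lborel (\<lambda>x. \<phi> x * of_real (f x))"
proof (rule Bochner_Integration.integrable_bound)
  show "integrable lborel (\<lambda>x :: 'a. C * (D * gauss a x))"
    by (intro integrable_mult_right integrable_gaussian \<open>0 < a\<close>)
  show "AE x in lborel. norm (\<phi> x * of_real (f x)) \<le> norm (C * (D * gauss a x))"
  proof (rule AE_I2)
    fix x
    have "norm (\<phi> x) * \<bar>f x\<bar> \<le> C * (D * gauss a x)"
      using \<phi>(2)[of x] f(2)[of x] by (intro mult_mono) (auto intro: order_trans[OF norm_ge_zero])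
    also have "\<dots> \<le> \<bar>C * (D * gauss a x)\<bar>" by (rule abs_ge_self)
    finally show "norm (\<phi> x * of_real (f x)) \<le> norm (C * (D * gauss a x))"
      by (simp only: norm_mult norm_of_real real_norm_def)
  qed
qed (use \<phi> f in measurable)

lemma abs_exp_partial_sum_le: "\<bar>\<Sum>m<M. q ^ m / fact m\<bar> \<le> exp \<bar>q :: real\<bar>"
proof -
  have "\<bar>\<Sum>m<M. q ^ m / fact m\<bar> \<le> (\<Sum>m<M. \<bar>q\<bar> ^ m / fact m)" by (rule order_trans[OF sum_abs]) (simp add: power_abs)
  also have "\<dots> \<le> (\<Sum>m. \<bar>q\<bar> ^ m / fact m)"
    using summable_exp_generic[of "\<bar>q\<bar>"] by (intro sum_le_suminf) (auto simp: divide_inverse mult.commute)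
  also have "\<dots> = exp \<bar>q\<bar>" by (simp add: exp_def divide_inverse mult.commute)
  finally show ?thesis .
qed

text \<open>Expanding \<open>exp q\<close> into its power series only produces further polynomial factors.\<close>

lemma gaussian_moments_exp:
  fixes \<phi> :: "'a::euclidean_space \<Rightarrow> complex"
  assumes \<phi>: "\<phi> \<in> borel_measurable borel" "\<And>x. norm (\<phi> x) \<le> C" and a: "0 < a"
    and mom: "\<And>p. real_polynomial_function p \<Longrightarrow> (LINT x|lborel. \<phi> x * of_real (p x * gauss a x)) = 0"
    and q: "real_polynomial_function q" "\<And>x. \<bar>q x\<bar> \<le> a / 2 * (x \<bullet> x) + B"
    and p: "real_polynomial_function p"
  shows "(LINT x|lborel. \<phi> x * of_real (p x * gauss a x * exp (q x))) = 0"
proof -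
  define S where "S M x = (\<Sum>m<M. q x ^ m / fact m)" for M x
  \<comment> \<open>The Gaussian rate \<open>a\<close> is divided up: a quarter pays for
    \<open>p\<close>, a half for \<open>exp q\<close>, and the last quarter remains as an integrable
    majorant for dominated convergence.\<close>
  obtain D where D: "D \<ge> 0" "\<And>x. \<bar>p x\<bar> \<le> D * exp (a / 4 * (x \<bullet> x))"
    using real_polynomial_function_exp_bound[OF p, of "a / 4"] a by auto
  have Sp: "real_polynomial_function (\<lambda>x. p x * S M x)" for M unfolding S_def divide_inverse
    by (intro real_polynomial_function.intros(4) p real_polynomial_function_sum real_polynomial_function_power q real_polynomial_function.intros(2)) auto
  have meas [measurable]: "\<phi> \<in> borel_measurable borel" "p \<in> borel_measurable borel" "q \<in> borel_measurable borel"
    using \<phi>(1) p q(1) by (auto intro: real_polynomial_function_measurable)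
  have bd: "\<bar>p x\<bar> * gauss a x * exp \<bar>q x\<bar> \<le> D * exp B * gauss (a / 4) x" for x
  proof -
    have "\<bar>p x\<bar> * gauss a x * exp \<bar>q x\<bar> \<le> (D * exp (a / 4 * (x \<bullet> x))) * gauss a x * exp (a / 2 * (x \<bullet> x) + B)"
      using D q(2)[of x] by (intro mult_mono) auto
    also have "\<dots> = D * (exp (a / 4 * (x \<bullet> x)) * gauss a x * exp (a / 2 * (x \<bullet> x) + B))" by simp
    also have "exp (a / 4 * (x \<bullet> x)) * gauss a x * exp (a / 2 * (x \<bullet> x) + B) = exp B * gauss (a / 4) x"
      unfolding exp_add[symmetric] by (simp add: algebra_simps)
    finally show ?thesis by (simp add: mult_ac)
  qed
  have "(\<lambda>M. LINT x|lborel. \<phi> x * of_real (p x * gauss a x * S M x))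
      \<longlonglongrightarrow> (LINT x|lborel. \<phi> x * of_real (p x * gauss a x * exp (q x)))"
  proof (rule integral_dominated_convergence)
    show "integrable lborel (\<lambda>x :: 'a. C * (D * exp B * gauss (a / 4) x))"
      using a by (intro integrable_mult_right integrable_gaussian) auto
    show "AE x in lborel. (\<lambda>M. \<phi> x * of_real (p x * gauss a x * S M x)) \<longlonglongrightarrow> \<phi> x * of_real (p x * gauss a x * exp (q x))"
    proof (rule AE_I2)
      fix x
      have "(\<lambda>M. S M x) \<longlonglongrightarrow> exp (q x)"
        using exp_converges[of "q x"] unfolding S_def sums_def by (simp add: divide_inverse mult.commute)
      then show "(\<lambda>M. \<phi> x * of_real (p x * gauss a x * S M x)) \<longlonglongrightarrow> \<phi> x * of_real (p x * gauss a x * exp (q x))"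
        by (intro tendsto_intros)
    qed
    show "AE x in lborel. norm (\<phi> x * of_real (p x * gauss a x * S M x)) \<le> C * (D * exp B * gauss (a / 4) x)" for M
    proof (rule AE_I2)
      fix x
      have "\<bar>p x\<bar> * gauss a x * \<bar>S M x\<bar> \<le> \<bar>p x\<bar> * gauss a x * exp \<bar>q x\<bar>"
        unfolding S_def by (intro mult_left_mono abs_exp_partial_sum_le) auto
      also note bd
      finally have 1: "\<bar>p x * gauss a x * S M x\<bar> \<le> D * exp B * gauss (a / 4) x" by (simp add: abs_mult)
      show "norm (\<phi> x * of_real (p x * gauss a x * S M x)) \<le> C * (D * exp B * gauss (a / 4) x)"
        unfolding norm_mult norm_of_real by (intro mult_mono \<phi>(2) 1) (auto intro: order_trans[OF norm_ge_zero \<phi>(2)])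
    qed
  qed (unfold S_def, measurable)
  moreover have "(LINT x|lborel. \<phi> x * of_real (p x * gauss a x * S M x)) = 0" for M
    using mom[OF Sp[of M]] by (simp add: mult_ac)
  ultimately have "(\<lambda>M::nat. 0) \<longlonglongrightarrow> (LINT x|lborel. \<phi> x * of_real (p x * gauss a x * exp (q x)))" by simp
  then show ?thesis unfolding LIMSEQ_const_iff by (rule sym)
qed

text \<open>The exponent \<open>q = - (a / 2) * (x \<bullet> x)\<close> is just within the
  admissible size, so one application raises the rate from \<open>a\<close> to
  \<open>3 / 2 * a\<close>. Expanding the exponential at once for a large rate would not be
  dominated; iteration reaches arbitrarily concentrated Gaussians.\<close>

lemma gaussian_moments_scale:
  fixes \<phi> :: "'a::euclidean_space \<Rightarrow> complex"
  assumes \<phi>: "\<phi> \<in> borel_measurable borel" "\<And>x. norm (\<phi> x) \<le> C"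
    and mom: "\<And>p. real_polynomial_function p \<Longrightarrow> (LINT x|lborel. \<phi> x * of_real (p x * gauss (1 / 2) x)) = 0"
    and p: "real_polynomial_function p"
  shows "(LINT x|lborel. \<phi> x * of_real (p x * gauss ((3 / 2) ^ n / 2) x)) = 0" using p
proof (induction n arbitrary: p)
  case 0
  then show ?case using mom by simp
next
  case (Suc n)
  define a :: real where "a = (3 / 2) ^ n / 2"
  have a: "0 < a" by (simp add: a_def)
  have q: "real_polynomial_function (\<lambda>x :: 'a. - (a / 2) * (x \<bullet> x))"
  proof -
    have "real_polynomial_function (\<lambda>x :: 'a. - (a / 2) * (\<Sum>b\<in>Basis. (x \<bullet> b) * (x \<bullet> b)))"
      by (intro real_polynomial_function.intros(4) real_polynomial_function.intros(2) real_polynomial_function_sum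
          real_polynomial_function.intros(1) bounded_linear_inner_left) auto
    then show ?thesis by (simp only: euclidean_inner[symmetric])
  qed
  have 1: "(LINT x|lborel. \<phi> x * of_real (p x * gauss a x * gauss (a / 2) x)) = 0"
  proof (rule gaussian_moments_exp[OF \<phi> a _ q _ Suc.prems])
    show "(LINT x|lborel. \<phi> x * of_real (p x * gauss a x)) = 0" if "real_polynomial_function p" for p
      using Suc.IH[OF that] by (simp add: a_def)
    show "\<bar>- (a / 2) * (x \<bullet> x)\<bar> \<le> a / 2 * (x \<bullet> x) + 0" for x :: 'a using a by (simp add: abs_mult)
  qed
  have 2: "p x * gauss a x * gauss (a / 2) x = p x * gauss ((3 / 2) ^ Suc n / 2) x" for x :: 'a
    unfolding mult.assoc exp_add[symmetric] by (simp add: a_def algebra_simps)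
  show ?case using 1 unfolding 2 .
qed

text \<open>A linear exponent moves the centre of the Gaussian to \<open>y\<close>, and the rates
  \<open>a n\<close> tend to infinity. Vanishing against an approximate identity at \<open>y\<close>
  forces the continuous function \<phi> to vanish there.\<close>

lemma gaussian_polynomials_complete:
  fixes \<phi> :: "'a::euclidean_space \<Rightarrow> complex"
  assumes cont: "continuous_on UNIV \<phi>" and bd: "\<And>x. norm (\<phi> x) \<le> C"
    and mom: "\<And>p. real_polynomial_function p \<Longrightarrow> (LINT x|lborel. \<phi> x * of_real (p x * gauss (1 / 2) x)) = 0"
  shows "\<phi> y = 0"
proof -
  have [measurable]: "\<phi> \<in> borel_measurable borel" using cont by (rule borel_measurable_continuous_onI)
  define a :: "nat \<Rightarrow> real" where "a n = (3 / 2) ^ n / 2" for n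
  have a: "0 < a n" for n by (simp add: a_def)
  have zero: "(LINT x|lborel. \<phi> x * of_real (exp (- a n * ((x - y) \<bullet> (x - y))))) = 0" for n
  proof -
    have 1: "(LINT x|lborel. \<phi> x * of_real (gauss (a n) y * gauss (a n) x * exp (2 * a n * (x \<bullet> y)))) = 0"
    proof (rule gaussian_moments_exp[where \<phi> = \<phi> and p = "\<lambda>x. gauss (a n) y" and q = "\<lambda>x. 2 * a n * (x \<bullet> y)", OF _ bd a])
      show "(LINT x|lborel. \<phi> x * of_real (p x * gauss (a n) x)) = 0" if "real_polynomial_function p" for p unfolding a_def
      proof (rule gaussian_moments_scale)
        show "\<phi> \<in> borel_measurable borel" by measurable
        show "norm (\<phi> x) \<le> C" for x by (rule bd)
        show "(LINT x|lborel. \<phi> x * of_real (p x * gauss (1 / 2) x)) = 0" if "real_polynomial_function p" for p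
          by (rule mom[OF that])
      qed (rule that)
      show "real_polynomial_function (\<lambda>x. 2 * a n * (x \<bullet> y))"
        by (intro real_polynomial_function.intros(4) real_polynomial_function.intros(2) real_polynomial_function.intros(1) bounded_linear_inner_left)
      show "\<bar>2 * a n * (x \<bullet> y)\<bar> \<le> a n / 2 * (x \<bullet> x) + 2 * a n * (y \<bullet> y)" for x
      proof -
        have "\<bar>x \<bullet> y\<bar> \<le> norm x * norm y" by (rule Cauchy_Schwarz_ineq2)
        moreover have "2 * (norm x * norm y) \<le> (x \<bullet> x) / 2 + 2 * (y \<bullet> y)"
          using sum_squares_bound[of "norm x" "2 * norm y"] by (simp add: power_mult_distrib power2_norm_eq_inner)
        ultimately have "a n * (2 * \<bar>x \<bullet> y\<bar>) \<le> a n * ((x \<bullet> x) / 2 + 2 * (y \<bullet> y))"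
          using a[of n] by (intro mult_left_mono) auto
        then show ?thesis using a[of n] by (simp add: abs_mult algebra_simps)
      qed
      show "real_polynomial_function (\<lambda>x::'a. gauss (a n) y)" by (rule real_polynomial_function.intros(2))
    qed measurable
    have 2: "gauss (a n) y * gauss (a n) x * exp (2 * a n * (x \<bullet> y)) = exp (- a n * ((x - y) \<bullet> (x - y)))" for x
      unfolding exp_add[symmetric] by (simp add: inner_diff_left inner_diff_right inner_commute algebra_simps)
    show ?thesis using 1 unfolding 2 .
  qed
  define c where "c n = sqrt (a n)" for n
  have c: "0 < c n" "c n * c n = a n" for n using a[of n] by (auto simp: c_def)
  \<comment> \<open>Substituting \<open>x = y + (1 / c n) *\<^sub>R z\<close> fixes the Gaussian and
    moves the dependence on \<open>n\<close> into the argument of \<phi>, which is bounded.\<close>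
  have zero': "(LINT z|lborel. \<phi> (y + (1 / c n) *\<^sub>R z) * of_real (gauss 1 z)) = 0" for n
  proof -
    define f where "f x = \<phi> x * of_real (exp (- a n * ((x - y) \<bullet> (x - y))))" for x
    have fi: "integrable lborel f"
    proof -
      have 1: "integrable lborel (\<lambda>x. \<phi> (x + y) * of_real (gauss (a n) x))"
        by (rule integrable_gaussian_bound[where C = C and D = 1 and a = "a n"]) (use bd a in auto)
      show ?thesis using integrable_scale_shift[of 1 _ "- y", OF _ 1] by (simp add: f_def[abs_def])
    qed
    have "(LINT x|lborel. f x) = \<bar>1 / c n\<bar> ^ DIM('a) *\<^sub>R (LINT z|lborel. f (y + (1 / c n) *\<^sub>R z))"
      by (rule integral_scale_shift) (use c fi in \<open>auto simp: less_imp_neq[symmetric]\<close>)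
    moreover have "(LINT x|lborel. f x) = 0" unfolding f_def by (rule zero)
    ultimately have "(LINT z|lborel. f (y + (1 / c n) *\<^sub>R z)) = 0" using c(1)[of n] by simp
    moreover have "f (y + (1 / c n) *\<^sub>R z) = \<phi> (y + (1 / c n) *\<^sub>R z) * of_real (gauss 1 z)" for z
      using c(1)[of n] unfolding f_def c(2)[symmetric] by (simp add: field_simps)
    ultimately show ?thesis by simp
  qed
  have "(\<lambda>n. LINT z|lborel. \<phi> (y + (1 / c n) *\<^sub>R z) * of_real (gauss 1 z))
      \<longlonglongrightarrow> (LINT z|lborel. \<phi> y * of_real (gauss 1 (z :: 'a)))"
  proof (rule integral_dominated_convergence)
    show "integrable lborel (\<lambda>z :: 'a. C * gauss 1 z)" by (intro integrable_mult_right integrable_gaussian) simp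
    have "(\<lambda>n. sqrt (2 * (2 / 3) ^ n)) \<longlonglongrightarrow> sqrt (2 * 0)"
      by (intro tendsto_real_sqrt tendsto_mult tendsto_const LIMSEQ_realpow_zero) auto
    moreover have "sqrt (2 * (2 / 3) ^ n) = 1 / c n" for n
    proof -
      have "2 * (2 / 3) ^ n = 1 / a n" by (simp add: a_def power_divide)
      then show ?thesis by (simp add: c_def real_sqrt_divide)
    qed
    ultimately have "(\<lambda>n. 1 / c n) \<longlonglongrightarrow> 0" by simp
    then have "(\<lambda>n. y + (1 / c n) *\<^sub>R z) \<longlonglongrightarrow> y + 0 *\<^sub>R z" for z by (intro tendsto_intros)
    then have "(\<lambda>n. \<phi> (y + (1 / c n) *\<^sub>R z)) \<longlonglongrightarrow> \<phi> y" for z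
      using cont by (intro isCont_tendsto_compose[of y \<phi>]) (auto simp: continuous_on_eq_continuous_at)
    then show "AE z in lborel. (\<lambda>n. \<phi> (y + (1 / c n) *\<^sub>R z) * of_real (gauss 1 z)) \<longlonglongrightarrow> \<phi> y * of_real (gauss 1 z)"
      by (intro AE_I2 tendsto_mult_right)
    show "AE z in lborel. norm (\<phi> (y + (1 / c n) *\<^sub>R z) * of_real (gauss 1 z)) \<le> C * gauss 1 z" for n
      by (intro AE_I2) (simp add: norm_mult bd mult_right_mono)
  qed measurable
  then have "(LINT z|lborel. \<phi> y * of_real (gauss 1 (z :: 'a))) = 0" unfolding zero' LIMSEQ_const_iff by (rule sym)
  then have *: "\<phi> y * of_real (LINT z|lborel. gauss 1 (z :: 'a)) = 0"
    by (simp only: integral_mult_right_zero integral_complex_of_real)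
  have "(LINT z|lborel. gauss 1 (z :: 'a)) \<noteq> 0"
  proof
    assume "(LINT z|lborel. gauss 1 (z :: 'a)) = 0"
    then have "AE z :: 'a in lborel. gauss 1 z = 0"
      by (subst (asm) integral_nonneg_eq_0_iff_AE) (auto intro!: integrable_gaussian[of 1, simplified])
    then have "AE z :: 'a in lborel. False" by eventually_elim simp
    then show False by (simp add: AE_iff_null null_sets_def emeasure_lborel_UNIV)
  qed
  with * show ?thesis by simp
qed

section \<open>Hermite coefficients and the completeness theorem\<close>

lemma schwartz_measurable [measurable_dest]: "f \<in> schwartz \<Longrightarrow> f \<in> borel_measurable borel"
  using diffops_continuous[OF diffops_id, of UNIV f] by (intro borel_measurable_continuous_onI) (simp add: schwartz_def)

lemma schwartz_continuous: "f \<in> schwartz \<Longrightarrow> continuous_on UNIV f"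
  using diffops_continuous[OF diffops_id, of UNIV f] by (simp add: schwartz_def)

lemma diffops_schwartz_measurable: "P \<in> diffops \<Longrightarrow> f \<in> schwartz \<Longrightarrow> P f \<in> borel_measurable borel"
  using diffops_continuous[of P UNIV f] by (intro borel_measurable_continuous_onI) (simp add: schwartz_def)

lemma schwartz_bounded:
  assumes "f \<in> schwartz" "P \<in> diffops"
  obtains C where "\<And>x. norm (P f x) \<le> C" using schwartz_decay[OF assms, of 0] by auto

lemma integrable_weight_bound:
  fixes f :: "'a::euclidean_space \<Rightarrow> complex"
  assumes "f \<in> borel_measurable borel" "\<And>x. norm (f x) \<le> C / poly_weight x"
  shows "integrable lborel f" "norm (LINT x|lborel. f x) \<le> C * (LINT x|lborel. 1 / poly_weight (x :: 'a))"
proof -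
  have i: "integrable lborel (\<lambda>x :: 'a. C * (1 / poly_weight x))" by (intro integrable_mult_right integrable_inverse_poly_weight)
  show f: "integrable lborel f" by (rule Bochner_Integration.integrable_bound[OF i])
      (use assms order_trans[OF assms(2) abs_ge_self] in \<open>auto intro!: AE_I2\<close>)
  have "norm (LINT x|lborel. f x) \<le> (LINT x|lborel. norm (f x))" by (rule integral_norm_bound)
  also have "\<dots> \<le> (LINT x|lborel. C * (1 / poly_weight (x :: 'a)))" by (rule integral_mono) (use f i assms in auto)
  also have "\<dots> = C * (LINT x|lborel. 1 / poly_weight (x :: 'a))" by (rule integral_mult_right_zero)
  finally show "norm (LINT x|lborel. f x) \<le> C * (LINT x|lborel. 1 / poly_weight (x :: 'a))" .
qed

lemma integrable_mult_schwartz: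
  assumes "g \<in> borel_measurable borel" "\<And>x. norm (g x) \<le> C" "f \<in> schwartz" "P \<in> diffops"
  shows "integrable lborel (\<lambda>x. g x * P f x)"
proof -
  obtain D where D: "\<And>x. norm (P f x) \<le> D / poly_weight x ^ 1" using schwartz_decay[OF assms(3,4), of 1] by blast
  have [measurable]: "P f \<in> borel_measurable borel" "g \<in> borel_measurable borel" using diffops_schwartz_measurable assms by auto
  show ?thesis
  proof (rule integrable_weight_bound(1))
    fix x
    have "norm (g x) * norm (P f x) \<le> C * (D / poly_weight x)"
      using D[of x] by (intro mult_mono assms(2)) (auto intro: order_trans[OF norm_ge_zero assms(2)])
    then show "norm (g x * P f x) \<le> C * D / poly_weight x" by (simp add: norm_mult)
  qed measurable
qed

lemma integral_inverse_poly_weight_nonneg: "0 \<le> (LINT x|lborel. 1 / poly_weight (x :: 'a::euclidean_space))"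
  by (rule Bochner_Integration.integral_nonneg) (simp add: less_imp_le[OF poly_weight_pos])

text \<open>Bilinear, without conjugation: the Hermite functions are real and the pairing with
  distributions is bilinear as well.\<close>

definition hermite_coeff :: "(real ^ 'n::finite \<Rightarrow> complex) \<Rightarrow> nat ^ 'n \<Rightarrow> complex" where
  "hermite_coeff f k = (LINT x|lborel. f x * hermite_fun k x)"

inductive_set hermite_span :: "(real ^ 'n::finite \<Rightarrow> complex) set" where
  base: "hermite_fun k \<in> hermite_span"
| add: "f \<in> hermite_span \<Longrightarrow> g \<in> hermite_span \<Longrightarrow> (\<lambda>x. f x + g x) \<in> hermite_span"
| scale: "f \<in> hermite_span \<Longrightarrow> (\<lambda>x. c * f x) \<in> hermite_span"

lemma hermite_span_component:
  assumes "f \<in> hermite_span"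
  shows "(\<lambda>x. of_real (x $ i) * f x) \<in> hermite_span" using assms
proof induction
  case (base k)
  show ?case unfolding hermite_fun_mult_component by (intro hermite_span.intros)
next
  case (add f g)
  then show ?case using hermite_span.add[OF add.IH] by (simp add: distrib_left)
next
  case (scale f c)
  then show ?case using hermite_span.scale[OF scale.IH, of c] by (simp add: mult_ac)
qed

lemma hermite_span_sum:
  assumes "finite I" "\<And>i. i \<in> I \<Longrightarrow> f i \<in> hermite_span"
  shows "(\<lambda>x. \<Sum>i\<in>I. f i x) \<in> hermite_span" using assms
proof induction
  case empty
  show ?case using hermite_span.scale[OF hermite_span.base, of 0] by simp
next
  case (insert i I)
  then show ?case using hermite_span.add[of "f i" "\<lambda>x. \<Sum>i\<in>I. f i x"] by simp
qed

text \<open>Coordinates act on Hermite functions through the ladder identity. Together with the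
  Gaussian as a multiple of \<open>hermite_fun 0\<close>, this puts every polynomial times the
  Gaussian into the span.\<close>

lemma hermite_span_polynomial:
  fixes f :: "real ^ 'n::finite \<Rightarrow> complex"
  assumes "real_polynomial_function p" "f \<in> hermite_span"
  shows "(\<lambda>x. of_real (p x) * f x) \<in> hermite_span" using assms
proof (induction arbitrary: f rule: real_polynomial_function.induct)
  case (linear p)
  have px: "p x = (\<Sum>i\<in>UNIV. x $ i * p (axis i 1))" for x
  proof -
    have "p x = p (\<Sum>i\<in>UNIV. x $ i *\<^sub>R axis i 1)" using basis_expansion[of x] by (simp add: scalar_mult_eq_scaleR)
    also have "\<dots> = (\<Sum>i\<in>UNIV. x $ i * p (axis i 1))" using bounded_linear.linear[OF linear(1)] by (simp add: linear_sum linear_scale)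
    finally show ?thesis .
  qed
  have "(\<lambda>x. of_real (p x) * f x) = (\<lambda>x. \<Sum>i\<in>UNIV. of_real (p (axis i 1)) * (of_real (x $ i) * f x))"
  proof
    fix x
    show "of_real (p x) * f x = (\<Sum>i\<in>UNIV. of_real (p (axis i 1)) * (of_real (x $ i) * f x))"
      by (subst px) (simp add: sum_distrib_right sum_distrib_left mult_ac)
  qed
  also have "\<dots> \<in> hermite_span" by (intro hermite_span_sum hermite_span.scale hermite_span_component linear.prems) auto
  finally show ?case .
next
  case (const c)
  then show ?case by (intro hermite_span.scale)
next
  case (add p q)
  then show ?case using hermite_span.add[OF add.IH(1)[OF add.prems] add.IH(2)[OF add.prems]] by (simp add: distrib_right)
next
  case (mult p q)
  then show ?case using mult.IH(1)[OF mult.IH(2)[OF mult.prems]] by (simp add: mult_ac)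
qed

lemma gaussian_in_hermite_span:
  "(\<lambda>x :: real ^ 'n::finite. complex_of_real (exp (- (1 / 2) * (x \<bullet> x)))) \<in> hermite_span"
proof -
  have "hermite_fun 0 x = of_real (1 / hermite_norm 0 ^ CARD('n)) * of_real (exp (- (1 / 2) * (x \<bullet> x)))" for x :: "real ^ 'n"
  proof -
    have "(\<Prod>l\<in>(UNIV :: 'n set). hermite_fun1 0 (x $ l)) = (\<Prod>l\<in>UNIV. exp (- ((x $ l)\<^sup>2) / 2)) / hermite_norm 0 ^ CARD('n)"
      by (simp add: hermite_fun1_eq prod_dividef)
    also have "(\<Prod>l\<in>UNIV. exp (- ((x $ l)\<^sup>2) / 2)) = exp (- (1 / 2) * (x \<bullet> x))"
      unfolding exp_sum[OF finite, symmetric] inner_vec_def by (simp add: sum_negf sum_divide_distrib power2_eq_square)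
    finally show ?thesis by (simp add: hermite_fun_def del: of_real_prod)
  qed
  then have "(\<lambda>x :: real ^ 'n. complex_of_real (exp (- (1 / 2) * (x \<bullet> x)))) = (\<lambda>x. of_real (hermite_norm 0 ^ CARD('n)) * hermite_fun 0 x)"
    using hermite_norm_pos[of 0] by (auto simp: fun_eq_iff)
  then show ?thesis using hermite_span.scale[OF hermite_span.base[of 0]] by simp
qed

text \<open>Stated for bounded continuous functions because it will be applied to
  \<open>weyl \<tau> f\<close> minus a Hermite series, before any decay of
  \<open>weyl \<tau> f\<close> is known.\<close>

lemma hermite_complete:
  fixes \<phi> :: "real ^ 'n::finite \<Rightarrow> complex"
  assumes cont: "continuous_on UNIV \<phi>" and bd: "\<And>x. norm (\<phi> x) \<le> C"
    and zero: "\<And>k. hermite_coeff \<phi> k = 0"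
  shows "\<phi> = (\<lambda>x. 0)"
proof
  fix y
  have meas: "\<phi> \<in> borel_measurable borel" using cont by (rule borel_measurable_continuous_onI)
  have span: "integrable lborel (\<lambda>x. \<phi> x * f x) \<and> (LINT x|lborel. \<phi> x * f x) = 0" if "f \<in> hermite_span" for f using that
  proof induction
    case (base k)
    show ?case using integrable_mult_schwartz[OF meas bd hermite_fun_schwartz diffops_id, of k] zero[of k] by (simp add: hermite_coeff_def)
  next
    case (add f g)
    then show ?case by (simp add: distrib_left)
  next
    case (scale f c)
    have "(\<lambda>x. \<phi> x * (c * f x)) = (\<lambda>x. c * (\<phi> x * f x))" by (simp add: fun_eq_iff)
    with scale.IH show ?case by simp
  qed
  show "\<phi> y = 0"
  proof (rule gaussian_polynomials_complete[OF cont bd])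
    fix p :: "real ^ 'n \<Rightarrow> real" assume "real_polynomial_function p"
    from span[OF hermite_span_polynomial[OF this gaussian_in_hermite_span]]
    show "(LINT x|lborel. \<phi> x * of_real (p x * exp (- (1 / 2) * (x \<bullet> x)))) = 0" by simp
  qed
qed

text \<open>The common scheme of the decay proofs for Hermite and for Laguerre coefficients. If each
  factor \<open>1 + k $ i\<close> can be moved into a differential operator, then so can any power
  of the weight, and a crude bound for the resulting operator becomes decay.\<close>

lemma spectral_decay:
  fixes \<Lambda> :: "nat ^ 'n::finite \<Rightarrow> (real ^ 'n \<Rightarrow> complex) \<Rightarrow> complex"
  assumes step: "\<And>P i. P \<in> diffops \<Longrightarrow> \<exists>Q\<in>diffops. \<forall>f\<in>V. \<forall>k. \<Lambda> k (Q f) = of_real (1 + real (k $ i)) * \<Lambda> k (P f)"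
    and bound: "\<And>P. P \<in> diffops \<Longrightarrow> \<exists>F C. finite F \<and> F \<subseteq> schwartz_seminorms \<Omega> \<and> 0 \<le> C \<and>
      (\<forall>f\<in>V. \<forall>k. norm (\<Lambda> k (P f)) \<le> C * (\<Sum>p\<in>F. p f) * weight k ^ m)"
  shows "\<exists>F C. finite F \<and> F \<subseteq> schwartz_seminorms \<Omega> \<and> 0 \<le> C \<and>
    (\<forall>f\<in>V. \<forall>k. norm (\<Lambda> k f) * weight k ^ M \<le> C * (\<Sum>p\<in>F. p f))"
proof -
  have 1: "\<exists>Q\<in>diffops. \<forall>f\<in>V. \<forall>k. \<Lambda> k (Q f) = of_real (\<Prod>i\<in>I. 1 + real (k $ i)) * \<Lambda> k (P f)"
    if P: "P \<in> diffops" and "finite I" for I P using that(2)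
  proof induction
    case empty
    show ?case by (rule bexI[OF _ P]) simp
  next
    case (insert i I)
    then obtain Q where Q: "Q \<in> diffops" "\<And>f k. f \<in> V \<Longrightarrow> \<Lambda> k (Q f) = of_real (\<Prod>i\<in>I. 1 + real (k $ i)) * \<Lambda> k (P f)" by blast
    obtain R where R: "R \<in> diffops" "\<And>f k. f \<in> V \<Longrightarrow> \<Lambda> k (R f) = of_real (1 + real (k $ i)) * \<Lambda> k (Q f)"
      using step[OF Q(1), of i] by blast
    show ?case by (rule bexI[OF _ R(1)]) (use insert Q(2) R(2) in simp)
  qed
  have 2: "\<exists>Q\<in>diffops. \<forall>f\<in>V. \<forall>k. \<Lambda> k (Q f) = of_real (weight k ^ j) * \<Lambda> k f" for j
  proof (induction j)
    case 0
    show ?case by (rule bexI[OF _ diffops_id]) simp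
  next
    case (Suc j)
    then obtain Q where Q: "Q \<in> diffops" "\<And>f k. f \<in> V \<Longrightarrow> \<Lambda> k (Q f) = of_real (weight k ^ j) * \<Lambda> k f" by blast
    obtain R where R: "R \<in> diffops" "\<And>f k. f \<in> V \<Longrightarrow> \<Lambda> k (R f) = of_real (weight k) * \<Lambda> k (Q f)"
      using 1[OF Q(1) finite[of UNIV]] unfolding weight_def by blast
    show ?case by (rule bexI[OF _ R(1)]) (simp add: Q(2) R(2))
  qed
  \<comment> \<open>The extra \<open>m\<close> powers compensate the growth
    \<open>weight k ^ m\<close> permitted in the crude bound.\<close>
  obtain Q where Q: "Q \<in> diffops" "\<And>f k. f \<in> V \<Longrightarrow> \<Lambda> k (Q f) = of_real (weight k ^ (M + m)) * \<Lambda> k f"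
    using 2[of "M + m"] by blast
  obtain F C where F: "finite F" "F \<subseteq> schwartz_seminorms \<Omega>" "0 \<le> C"
    "\<forall>f\<in>V. \<forall>k. norm (\<Lambda> k (Q f)) \<le> C * (\<Sum>p\<in>F. p f) * weight k ^ m"
    using bound[OF Q(1)] by (elim exE conjE) (rule that)
  have "norm (\<Lambda> k f) * weight k ^ M \<le> C * (\<Sum>p\<in>F. p f)" if f: "f \<in> V" for f k
  proof -
    have pos: "0 < weight k ^ m" by (intro zero_less_power weight_pos)
    have "norm (\<Lambda> k f) * weight k ^ M * weight k ^ m = norm (\<Lambda> k (Q f))" unfolding Q(2)[OF f] norm_mult norm_of_real
      using weight_pos[of k] by (simp add: power_add)
    also have "\<dots> \<le> C * (\<Sum>p\<in>F. p f) * weight k ^ m" using F(4) f by blast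
    finally show ?thesis using pos by simp
  qed
  with F(1-3) show ?thesis by (intro exI[of _ F] exI[of _ C]) simp
qed

lemma index_down_up: "index_down i (index_up i k) = k" by (simp add: vec_eq_iff index_down_def index_up_def)

lemma index_up_down: "k $ i \<noteq> 0 \<Longrightarrow> index_up i (index_down i k) = k" by (simp add: vec_eq_iff index_down_def index_up_def)

lemma raise_lower_coeff: "raise_coeff i k * lower_coeff i (index_up i k) = of_real (real (Suc (k $ i)) / 2)"
  by (simp add: raise_coeff_def lower_coeff_def index_up_def flip: of_real_mult)

lemma lower_raise_coeff: "lower_coeff i k * raise_coeff i (index_down i k) * hermite_fun (index_up i (index_down i k)) x
    = of_real (real (k $ i) / 2) * hermite_fun k x"
proof (cases "k $ i = 0")
  case False
  have "index_down i k $ i = k $ i - 1" by (simp add: index_down_def)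
  then show ?thesis using False by (simp add: raise_coeff_def lower_coeff_def index_up_down flip: of_real_mult)
qed (simp add: lower_coeff_def)

definition hermite_deriv :: "'n \<Rightarrow> nat ^ 'n::finite \<Rightarrow> real ^ 'n \<Rightarrow> complex" where
  "hermite_deriv i k x = lower_coeff i k * hermite_fun (index_down i k) x - raise_coeff i k * hermite_fun (index_up i k) x"

lemma hermite_deriv_schwartz: "hermite_deriv i k \<in> schwartz" unfolding hermite_deriv_def[abs_def]
  using schwartz_lin_comb[OF hermite_fun_schwartz schwartz_lin_comb[OF hermite_fun_schwartz schwartz_zero, of "- raise_coeff i k" "index_up i k"],
      of "lower_coeff i k" "index_down i k"] by simp

lemma hermite_deriv_differentiable: "hermite_deriv i k differentiable (at x)"
  unfolding hermite_deriv_def[abs_def] by (intro derivative_intros differentiable_hermite_fun)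

text \<open>The harmonic oscillator equation in the \<open>i\<close>-th variable. Applying the
  ladder identities twice, the mixed terms \<open>?C\<close> and \<open>?D\<close> occur with
  opposite signs in the second derivative and in multiplication by the squared coordinate; twice
  their sum is the eigenvalue term.\<close>

lemma hermite_deriv_deriv:
  "frechet_derivative (hermite_deriv i k) (at x) (axis i 1)
    = of_real ((x $ i)\<^sup>2) * hermite_fun k x - of_real (2 * real (k $ i) + 1) * hermite_fun k x"
proof -
  let ?A = "lower_coeff i k * (lower_coeff i (index_down i k) * hermite_fun (index_down i (index_down i k)) x)"
  let ?B = "raise_coeff i k * (raise_coeff i (index_up i k) * hermite_fun (index_up i (index_up i k)) x)"
  let ?C = "lower_coeff i k * raise_coeff i (index_down i k) * hermite_fun (index_up i (index_down i k)) x"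
  let ?D = "raise_coeff i k * lower_coeff i (index_up i k) * hermite_fun (index_down i (index_up i k)) x"
  have hd: "(hermite_deriv i k has_derivative (\<lambda>h. lower_coeff i k * frechet_derivative (hermite_fun (index_down i k)) (at x) h
      - raise_coeff i k * frechet_derivative (hermite_fun (index_up i k)) (at x) h)) (at x)" unfolding hermite_deriv_def[abs_def]
    by (intro has_derivative_diff has_derivative_mult_right) (simp_all add: frechet_derivative_works[symmetric] differentiable_hermite_fun)
  have 1: "frechet_derivative (hermite_deriv i k) (at x) (axis i 1) = ?A + ?B - ?C - ?D"
    unfolding frechet_derivative_eqI[OF hd] frechet_derivative_hermite_fun by (simp add: algebra_simps)
  have 2: "of_real ((x $ i)\<^sup>2) * hermite_fun k x = ?A + ?B + ?C + ?D"
  proof -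
    have "of_real ((x $ i)\<^sup>2) * hermite_fun k x = of_real (x $ i) * (of_real (x $ i) * hermite_fun k x)" by (simp add: power2_eq_square)
    also have "\<dots> = raise_coeff i k * (of_real (x $ i) * hermite_fun (index_up i k) x) + lower_coeff i k * (of_real (x $ i) * hermite_fun (index_down i k) x)"
      unfolding hermite_fun_mult_component[of x i k] by (simp add: algebra_simps)
    also have "\<dots> = ?A + ?B + ?C + ?D" unfolding hermite_fun_mult_component by (simp add: algebra_simps)
    finally show ?thesis .
  qed
  have 3: "?C = of_real (real (k $ i) / 2) * hermite_fun k x" by (rule lower_raise_coeff)
  have 4: "?D = of_real (real (Suc (k $ i)) / 2) * hermite_fun k x" by (simp only: raise_lower_coeff index_down_up)
  have "?A + ?B - ?C - ?D = (?A + ?B + ?C + ?D) - 2 * (?C + ?D)" by simp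
  also have "2 * (?C + ?D) = of_real (2 * real (k $ i) + 1) * hermite_fun k x" unfolding 3 4 by (simp add: field_simps)
  finally show ?thesis unfolding 1 2 .
qed

text \<open>Green's identity moves the oscillator in the \<open>i\<close>-th variable from the
  Hermite function, where it acts as \<open>2 * k $ i + 1\<close>, to \<open>P f\<close>.\<close>

lemma hermite_coeff_step:
  fixes i :: "'n::finite"
  assumes P: "P \<in> diffops"
  shows "\<exists>Q\<in>diffops. \<forall>f\<in>schwartz. \<forall>k. hermite_coeff (Q f) k = of_real (1 + real (k $ i)) * hermite_coeff (P f) k"
proof -
  let ?b = "axis i 1 :: real ^ 'n"
  have b: "?b \<in> Basis" by simp
  obtain P1 where P1: "P1 \<in> diffops" "\<And>f x. f \<in> schwartz \<Longrightarrow> P f differentiable (at x) \<and> frechet_derivative (P f) (at x) ?b = P1 f x"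
    using diffops_derivative[OF P b] unfolding schwartz_def by blast
  obtain P2 where P2: "P2 \<in> diffops" "\<And>f x. f \<in> schwartz \<Longrightarrow> P1 f differentiable (at x) \<and> frechet_derivative (P1 f) (at x) ?b = P2 f x"
    using diffops_derivative[OF P1(1) b] unfolding schwartz_def by blast
  define X where "X = (\<lambda>f x. of_real (x \<bullet> ?b) * (of_real (x \<bullet> ?b) * P f x))"
  have X: "X \<in> diffops" unfolding X_def by (intro diffops.coord P b)
  \<comment> \<open>Half of the oscillator plus one, composed with \<open>P\<close>; its eigenvalue
    is \<open>(2 * k $ i + 1 + 1) / 2\<close>.\<close>
  define Q where "Q = (\<lambda>f x. (1 / 2) * (X f x + ((-1) * P2 f x + P f x)))"
  have Q: "Q \<in> diffops" unfolding Q_def by (intro diffops.scale diffops.add X P2 P)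
  have "hermite_coeff (Q f) k = of_real (1 + real (k $ i)) * hermite_coeff (P f) k" if f: "f \<in> schwartz" for f k
  proof -
    have I: "integrable lborel (\<lambda>x. R f x * h x)" if R: "R \<in> diffops" and h: "h \<in> schwartz" for R h
    proof -
      obtain C where "\<And>x. norm (R f x) \<le> C" using schwartz_bounded[OF f R] by blast
      then show ?thesis using integrable_mult_schwartz[OF diffops_schwartz_measurable[OF R f] _ h diffops_id] by blast
    qed
    note I' = I[OF _ hermite_fun_schwartz[of k]]
    \<comment> \<open>The Wronskian of \<open>P f\<close> and the Hermite function; first-order
      terms cancel in its derivative.\<close>
    let ?\<Psi> = "\<lambda>x. P1 f x * hermite_fun k x - P f x * hermite_deriv i k x"
    let ?D = "\<lambda>x. P2 f x * hermite_fun k x - X f x * hermite_fun k x + of_real (2 * real (k $ i) + 1) * (P f x * hermite_fun k x)"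
    have "(LINT x|lborel. ?D x) = 0"
    proof (rule integral_dir_derivative_eq_zero[where \<Psi> = ?\<Psi> and b = ?b])
      fix x
      have hd: "(?\<Psi> has_derivative (\<lambda>h. (P1 f x * frechet_derivative (hermite_fun k) (at x) h + frechet_derivative (P1 f) (at x) h * hermite_fun k x)
          - (P f x * frechet_derivative (hermite_deriv i k) (at x) h + frechet_derivative (P f) (at x) h * hermite_deriv i k x))) (at x)"
        using P1(2)[OF f, of x] P2(2)[OF f, of x] differentiable_hermite_fun[of k x] hermite_deriv_differentiable[of i k x]
        by (intro has_derivative_diff has_derivative_mult) (simp_all add: frechet_derivative_works)
      then show "?\<Psi> differentiable (at x)" unfolding differentiable_def by blast
      show "frechet_derivative ?\<Psi> (at x) ?b = ?D x" unfolding frechet_derivative_eqI[OF hd] hermite_deriv_deriv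
        using P1(2)[OF f, of x] P2(2)[OF f, of x]
        by (simp add: frechet_derivative_hermite_fun hermite_deriv_def[symmetric] X_def inner_axis algebra_simps power2_eq_square)
    next
      have c: "continuous_on UNIV (R f)" if "R \<in> diffops" for R using diffops_continuous[OF that, of UNIV f] f by (simp add: schwartz_def)
      show "continuous_on UNIV ?D" by (intro continuous_on_add continuous_on_diff continuous_on_mult continuous_on_const c P2 X P
            schwartz_continuous[OF hermite_fun_schwartz])
      show "integrable lborel ?\<Psi>" by (intro Bochner_Integration.integrable_diff I P1 P hermite_fun_schwartz hermite_deriv_schwartz)
      show "integrable lborel ?D" by (intro Bochner_Integration.integrable_diff Bochner_Integration.integrable_add integrable_mult_right I' P2 X P)
    qed
    then have *: "hermite_coeff (P2 f) k - hermite_coeff (X f) k + of_real (2 * real (k $ i) + 1) * hermite_coeff (P f) k = 0"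
      unfolding hermite_coeff_def by (simp add: Bochner_Integration.integral_add Bochner_Integration.integral_diff I'[OF P2(1)] I'[OF X] I'[OF P])
    have "hermite_coeff (Q f) k = (1 / 2) * (hermite_coeff (X f) k + ((-1) * hermite_coeff (P2 f) k + hermite_coeff (P f) k))"
    proof -
      have "Q f x * hermite_fun k x = (1 / 2) * (X f x * hermite_fun k x + ((-1) * (P2 f x * hermite_fun k x) + P f x * hermite_fun k x))" for x
        unfolding Q_def by (simp add: algebra_simps)
      then show ?thesis unfolding hermite_coeff_def by (simp only: integral_mult_right_zero Bochner_Integration.integral_add integrable_mult_right
            Bochner_Integration.integrable_add I'[OF P2(1)] I'[OF X] I'[OF P])
    qed
    moreover from * have "hermite_coeff (X f) k = hermite_coeff (P2 f) k + of_real (2 * real (k $ i) + 1) * hermite_coeff (P f) k"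
      by (simp add: algebra_simps)
    ultimately have "2 * hermite_coeff (Q f) k = 2 * (of_real (1 + real (k $ i)) * hermite_coeff (P f) k)" by (simp add: field_simps)
    then show ?thesis by simp
  qed
  with Q show ?thesis by blast
qed

text \<open>The crude bound has \<open>m = 1\<close> since the sup norm of
  \<open>hermite_fun k\<close> is at most a constant times \<open>weight k\<close>.\<close>

lemma hermite_coeff_decay:
  "\<exists>F C. finite F \<and> F \<subseteq> schwartz_seminorms UNIV \<and> 0 \<le> C \<and>
    (\<forall>f\<in>schwartz. \<forall>k :: nat ^ 'n::finite. norm (hermite_coeff f k) * weight k ^ M \<le> C * (\<Sum>p\<in>F. p f))"
proof (rule spectral_decay[where m = 1])
  show "\<exists>Q\<in>diffops. \<forall>f\<in>schwartz. \<forall>k. hermite_coeff (Q f) k = of_real (1 + real (k $ i)) * hermite_coeff (P f) k"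
    if "P \<in> diffops" for P and i :: 'n using hermite_coeff_step[OF that] .
  fix P :: "(real ^ 'n \<Rightarrow> complex) \<Rightarrow> real ^ 'n \<Rightarrow> complex" assume P: "P \<in> diffops"
  obtain F C where F: "finite F" "F \<subseteq> schwartz_seminorms UNIV" "0 \<le> C"
    "\<And>g x. schwartz_bounds UNIV g \<Longrightarrow> x \<in> UNIV \<Longrightarrow> norm (complex_of_real (poly_weight x) * P g x) \<le> C * (\<Sum>p\<in>F. p g)"
    by (rule diffops_bound[OF diffops_poly_weight[OF P], of UNIV]) (rule that; simp)
  define J where "J = (LINT x|lborel. 1 / poly_weight (x :: real ^ 'n))"
  have J: "0 \<le> J" unfolding J_def by (rule integral_inverse_poly_weight_nonneg)
  have "norm (hermite_coeff (P f) k) \<le> (C * 2 ^ CARD('n) * J) * (\<Sum>p\<in>F. p f) * weight k ^ 1" if f: "f \<in> schwartz" for f k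
  proof -
    have [measurable]: "P f \<in> borel_measurable borel" "hermite_fun k \<in> borel_measurable borel"
      using diffops_schwartz_measurable[OF P f] schwartz_measurable[OF hermite_fun_schwartz] by auto
    have "norm (P f x * hermite_fun k x) \<le> (C * (\<Sum>p\<in>F. p f) * (2 ^ CARD('n) * weight k)) / poly_weight x" for x
    proof -
      have "norm (P f x) \<le> C * (\<Sum>p\<in>F. p f) / poly_weight x"
        using F(4)[of f x] f poly_weight_pos[of x] by (simp add: schwartz_def norm_mult field_simps)
      then have "norm (P f x) * norm (hermite_fun k x) \<le> (C * (\<Sum>p\<in>F. p f) / poly_weight x) * (2 ^ CARD('n) * weight k)"
        by (intro mult_mono hermite_fun_bound) (auto intro: order_trans[OF norm_ge_zero])
      then show ?thesis by (simp add: norm_mult)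
    qed
    then have "norm (hermite_coeff (P f) k) \<le> (C * (\<Sum>p\<in>F. p f) * (2 ^ CARD('n) * weight k)) * J"
      unfolding hermite_coeff_def J_def by (intro integrable_weight_bound(2)) auto
    then show ?thesis by (simp add: mult_ac)
  qed
  then show "\<exists>F C. finite F \<and> F \<subseteq> schwartz_seminorms UNIV \<and> 0 \<le> C \<and>
      (\<forall>f\<in>schwartz. \<forall>k. norm (hermite_coeff (P f) k) \<le> C * (\<Sum>p\<in>F. p f) * weight k ^ 1)"
    using F(1-3) J by (intro exI[of _ F] exI[of _ "C * 2 ^ CARD('n) * J"]) simp
qed

lemma rapid_hermite_coeff:
  assumes "f \<in> schwartz"
  shows "rapid (hermite_coeff f)" unfolding rapid_def
proof
  fix M
  obtain F C where "finite F" "F \<subseteq> schwartz_seminorms UNIV" "0 \<le> C"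
    "\<forall>g\<in>schwartz. \<forall>k :: nat ^ 'a. norm (hermite_coeff g k) * weight k ^ M \<le> C * (\<Sum>p\<in>F. p g)"
    using hermite_coeff_decay[of M] by (elim exE conjE) (rule that)
  with assms show "\<exists>C. \<forall>k. norm (hermite_coeff f k) * weight k ^ M \<le> C" by blast
qed

lemma hermite_fun_orthonormal: "hermite_coeff (hermite_fun j) k = (if j = k then 1 else 0)"
proof -
  have "hermite_coeff (hermite_fun j) k = (LINT x|lborel. (\<Prod>i\<in>UNIV. complex_of_real (hermite_fun1 (j $ i) (x $ i) * hermite_fun1 (k $ i) (x $ i))))"
    unfolding hermite_coeff_def hermite_fun_def by (simp add: prod.distrib)
  also have "\<dots> = (\<Prod>i\<in>UNIV. LINT t|lborel. complex_of_real (hermite_fun1 (j $ i) t * hermite_fun1 (k $ i) t))"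
    by (rule integral_lborel_vec_prod[where f = "\<lambda>i t. complex_of_real (hermite_fun1 (j $ i) t * hermite_fun1 (k $ i) t)"])
      (intro integrable_of_real integrable_hermite_fun1_mult)
  also have "\<dots> = (\<Prod>i\<in>UNIV. if j $ i = k $ i then 1 else 0)"
    unfolding integral_complex_of_real hermite_fun1_orthonormal by (intro prod.cong) auto
  also have "\<dots> = (if j = k then 1 else 0)" by (auto simp: vec_eq_iff intro!: prod_zero)
  finally show ?thesis .
qed

lemma temperedI:
  assumes lin: "\<And>f g a. f \<in> schwartz \<Longrightarrow> g \<in> schwartz \<Longrightarrow> u (\<lambda>x. a * f x + g x) = a * u f + u g"
    and F: "finite F" "F \<subseteq> schwartz_seminorms UNIV" "0 \<le> C" "\<And>f. f \<in> schwartz \<Longrightarrow> norm (u f) \<le> C * (\<Sum>p\<in>F. p f)"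
    and off: "\<And>f. f \<notin> schwartz \<Longrightarrow> u f = 0"
  shows "u \<in> tempered" unfolding tempered_def schwartz_topology_def
  by (intro CollectI conjI ballI allI impI continuous_functionalI[OF seminorm_schwartz lin F] lin off)

lemma distribution_of_tempered:
  assumes f: "f \<in> schwartz"
  shows "distribution_of f \<in> tempered"
proof -
  note p = sup_seminorm and le = norm_le_sup_seminorm
  let ?p = "\<lambda>g. SUP x. weighted_deriv (\<lambda>_. 0) [] g (x :: 'a)"
  have int: "integrable lborel (\<lambda>x. g x * f x)" if g: "g \<in> schwartz" for g
    by (rule integrable_mult_schwartz[OF schwartz_measurable[OF g] le[OF g] f diffops_id])
  obtain D where D: "\<And>x. norm (f x) \<le> D / poly_weight x ^ 1" using schwartz_decay[OF f diffops_id, of 1] by blast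
  have D0: "0 \<le> D" using order_trans[OF norm_ge_zero D[of 0]] poly_weight_pos[of "0 :: 'a"] by (simp add: zero_le_divide_iff)
  define J where "J = (LINT x|lborel. 1 / poly_weight (x :: 'a))"
  have J: "0 \<le> J" unfolding J_def by (rule integral_inverse_poly_weight_nonneg)
  show ?thesis
  proof (rule temperedI[where F = "{?p}" and C = "D * J"])
    fix g h :: "'a \<Rightarrow> complex" and a assume g: "g \<in> schwartz" "h \<in> schwartz"
    have "(LINT x|lborel. f x * (a * g x + h x)) = (LINT x|lborel. a * (g x * f x) + h x * f x)" by (simp add: algebra_simps)
    also have "\<dots> = a * (LINT x|lborel. g x * f x) + (LINT x|lborel. h x * f x)" using int g by simp
    finally show "distribution_of f (\<lambda>x. a * g x + h x) = a * distribution_of f g + distribution_of f h"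
      using g schwartz_lin_comb[OF g, of a] by (simp add: distribution_of_def mult.commute)
  next
    fix g :: "'a \<Rightarrow> complex" assume g: "g \<in> schwartz"
    have [measurable]: "f \<in> borel_measurable borel" "g \<in> borel_measurable borel" using f g by (auto intro: schwartz_measurable)
    have "norm (f x * g x) \<le> (D * ?p g) / poly_weight x" for x
    proof -
      have "norm (f x) * norm (g x) \<le> (D / poly_weight x) * ?p g"
        using D[of x] by (intro mult_mono le[OF g]) (auto intro: order_trans[OF norm_ge_zero])
      then show ?thesis by (simp add: norm_mult)
    qed
    then have "norm (LINT x|lborel. f x * g x) \<le> (D * ?p g) * J" unfolding J_def by (intro integrable_weight_bound(2)) auto
    then show "norm (distribution_of f g) \<le> D * J * (\<Sum>p\<in>{?p}. p g)" using g by (simp add: distribution_of_def mult_ac)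
  qed (use p D0 J in \<open>auto simp: distribution_of_def\<close>)
qed

lemma distribution_of_hermite_fun: "f \<in> schwartz \<Longrightarrow> distribution_of f (hermite_fun k) = hermite_coeff f k"
  by (simp only: distribution_of_def hermite_coeff_def hermite_fun_schwartz if_True)

text \<open>Integration against \<open>hermite_fun k\<close> is a tempered distribution, so
  convergence of the series in \<open>schwartz\<close> already justifies evaluation term by term;
  orthonormality leaves one term.\<close>

lemma hermite_coeff_series:
  assumes a: "rapid a"
  shows "hermite_coeff (hermite_series a) k = a k"
proof -
  have "((\<lambda>j. a j * distribution_of (hermite_fun k) (hermite_fun j)) has_sum distribution_of (hermite_fun k) (hermite_series a)) UNIV"
    by (rule tempered_hermite_series[OF distribution_of_tempered[OF hermite_fun_schwartz] a])
  moreover have "(\<lambda>j. a j * distribution_of (hermite_fun k) (hermite_fun j)) = (\<lambda>j. if j = k then a k else 0)"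
    by (auto simp: distribution_of_hermite_fun[OF hermite_fun_schwartz] hermite_fun_orthonormal)
  moreover have "((\<lambda>j. if j = k then a k else 0) has_sum a k) UNIV"
    using has_sum_cong_neutral[of UNIV "{k}" "\<lambda>j. if j = k then a k else 0" "\<lambda>j. a k" "a k"] has_sum_finite[of "{k}" "\<lambda>j. a k"] by simp
  ultimately have "distribution_of (hermite_fun k) (hermite_series a) = a k" using has_sum_unique by metis
  then show ?thesis using hermite_series_schwartz[OF a] by (simp add: distribution_of_def hermite_coeff_def mult.commute)
qed

text \<open>The regularity step of the whole proof: boundedness, continuity and rapid coefficients
  make \<open>f\<close> a Schwartz function, because it coincides with its Hermite series.\<close>

lemma continuous_eq_hermite_series:
  assumes cont: "continuous_on UNIV f" and bd: "\<And>x. norm (f x) \<le> C"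
    and a: "rapid a" and coeff: "\<And>k. hermite_coeff f k = a k"
  shows "f = hermite_series a"
proof -
  have s: "hermite_series a \<in> schwartz" by (rule hermite_series_schwartz[OF a])
  obtain D where D: "\<And>x. norm (hermite_series a x) \<le> D" using schwartz_bounded[OF s diffops_id] by blast
  have "(\<lambda>x. f x - hermite_series a x) = (\<lambda>x. 0)"
  proof (rule hermite_complete)
    show "continuous_on UNIV (\<lambda>x. f x - hermite_series a x)" by (intro continuous_on_diff cont schwartz_continuous s)
    show "norm (f x - hermite_series a x) \<le> C + D" for x using bd[of x] D[of x] norm_triangle_ineq4[of "f x" "hermite_series a x"] by linarith
    fix k
    have i: "integrable lborel (\<lambda>x. f x * hermite_fun k x)" "integrable lborel (\<lambda>x. hermite_series a x * hermite_fun k x)"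
      using integrable_mult_schwartz[OF borel_measurable_continuous_onI[OF cont] bd hermite_fun_schwartz diffops_id, of k]
        integrable_mult_schwartz[OF schwartz_measurable[OF s] D hermite_fun_schwartz diffops_id, of k] by auto
    have "hermite_coeff (\<lambda>x. f x - hermite_series a x) k = hermite_coeff f k - hermite_coeff (hermite_series a) k"
      unfolding hermite_coeff_def left_diff_distrib by (rule Bochner_Integration.integral_diff[OF i])
    then show "hermite_coeff (\<lambda>x. f x - hermite_series a x) k = 0" by (simp add: coeff hermite_coeff_series[OF a])
  qed
  then show ?thesis by (simp add: fun_eq_iff)
qed

lemma hermite_expansion:
  assumes f: "f \<in> schwartz"
  shows "hermite_series (hermite_coeff f) = f"
proof -
  obtain C where "\<And>x. norm (f x) \<le> C" using schwartz_bounded[OF f diffops_id] by blast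
  from continuous_eq_hermite_series[OF schwartz_continuous[OF f] this rapid_hermite_coeff[OF f] refl]
  show ?thesis by simp
qed

section \<open>Tempered distributions\<close>

lemma tempered_bound:
  assumes "u \<in> tempered"
  shows "\<exists>F C. finite F \<and> F \<subseteq> schwartz_seminorms UNIV \<and> 0 \<le> C \<and> (\<forall>f\<in>schwartz. norm (u f) \<le> C * (\<Sum>p\<in>F. p f))"
proof -
  obtain F C where "finite F" "F \<subseteq> schwartz_seminorms UNIV" "0 \<le> C" "\<And>f. f \<in> schwartz \<Longrightarrow> norm (u f) \<le> C * (\<Sum>p\<in>F. p f)"
    by (rule continuous_functional_bound[OF seminorm_schwartz temperedD[OF assms]]) (assumption+, rule that)
  then show ?thesis by (intro exI[of _ F] exI[of _ C]) simp
qed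

lemma bdd_above_tempered:
  assumes u: "u \<in> tempered" and B: "B \<in> bounded_sets schwartz (schwartz_seminorms UNIV)"
  shows "bdd_above ((\<lambda>\<phi>. norm (u \<phi>)) ` B)"
proof -
  obtain F C where F: "finite F" "F \<subseteq> schwartz_seminorms UNIV" "0 \<le> C" "\<forall>f\<in>schwartz. norm (u f) \<le> C * (\<Sum>p\<in>F. p f)"
    using tempered_bound[OF u] by (elim exE conjE) (rule that)
  show ?thesis by (rule bdd_above_bounded_sets[OF seminorm_schwartz B F(1-3)]) (use F(4) in blast)
qed

lemma tempered_lin_comb:
  assumes u: "u \<in> tempered" and v: "v \<in> tempered"
  shows "(\<lambda>\<phi>. a * u \<phi> + v \<phi>) \<in> tempered"
proof -
  obtain F C where F: "finite F" "F \<subseteq> schwartz_seminorms UNIV" "0 \<le> C" "\<forall>f\<in>schwartz. norm (u f) \<le> C * (\<Sum>p\<in>F. p f)"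
    using tempered_bound[OF u] by (elim exE conjE) (rule that)
  obtain G D where G: "finite G" "G \<subseteq> schwartz_seminorms UNIV" "0 \<le> D" "\<forall>f\<in>schwartz. norm (v f) \<le> D * (\<Sum>p\<in>G. p f)"
    using tempered_bound[OF v] by (elim exE conjE) (rule that)
  show ?thesis
  proof (rule temperedI[where F = "F \<union> G" and C = "norm a * C + D"])
    fix f g :: "'a \<Rightarrow> complex" and c assume "f \<in> schwartz" "g \<in> schwartz"
    then show "a * u (\<lambda>x. c * f x + g x) + v (\<lambda>x. c * f x + g x) = c * (a * u f + v f) + (a * u g + v g)"
      using temperedD(2)[OF u, of f g c] temperedD(2)[OF v, of f g c] by (simp add: algebra_simps)
  next
    fix f :: "'a \<Rightarrow> complex" assume f: "f \<in> schwartz"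
    have nn: "0 \<le> p f" if "p \<in> F \<union> G" for p using that F(2) G(2) f by (intro seminorm_nonneg[OF seminorm_schwartz]) auto
    have "norm (a * u f + v f) \<le> norm a * norm (u f) + norm (v f)" by (metis norm_mult norm_triangle_ineq)
    also have "\<dots> \<le> norm a * (C * (\<Sum>p\<in>F. p f)) + D * (\<Sum>p\<in>G. p f)" using F(4) G(4) f by (intro add_mono mult_left_mono) auto
    also have "\<dots> \<le> norm a * (C * (\<Sum>p\<in>F \<union> G. p f)) + D * (\<Sum>p\<in>F \<union> G. p f)"
      using F(1,3) G(1,3) nn by (intro add_mono mult_left_mono sum_mono2) auto
    finally show "norm (a * u f + v f) \<le> (norm a * C + D) * (\<Sum>p\<in>F \<union> G. p f)" by (simp add: algebra_simps)
  qed (use F G u v in \<open>auto simp: tempered_def\<close>)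
qed

lemma tempered_zero: "(\<lambda>\<phi>. 0) \<in> tempered" by (rule temperedI[where F = "{}" and C = 0]) auto

lemma bounded_setsD: "B \<in> bounded_sets V P \<Longrightarrow> B \<subseteq> V" "B \<in> bounded_sets V P \<Longrightarrow> B \<noteq> {}"
  by (auto simp: bounded_sets_def)

lemma seminorm_tempered:
  "seminorm_space (tempered :: (('a::euclidean_space \<Rightarrow> complex) \<Rightarrow> complex) set) strong_dual_seminorms"
  unfolding seminorm_space_def
proof (intro conjI ballI allI)
  have "{\<lambda>x. 0} \<in> bounded_sets (schwartz :: ('a \<Rightarrow> complex) set) (schwartz_seminorms UNIV)"
    by (simp add: bounded_sets_def schwartz_zero)
  then show "strong_dual_seminorms \<noteq> ({} :: ((('a \<Rightarrow> complex) \<Rightarrow> complex) \<Rightarrow> real) set)"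
    unfolding strong_dual_seminorms_def by blast
next
  fix p :: "(('a \<Rightarrow> complex) \<Rightarrow> complex) \<Rightarrow> real" and u a assume p: "p \<in> strong_dual_seminorms" and u: "u \<in> (tempered :: (('a \<Rightarrow> complex) \<Rightarrow> complex) set)"
  obtain B where B: "p = (\<lambda>u. SUP \<phi>\<in>B. norm (u \<phi>))" "B \<in> bounded_sets schwartz (schwartz_seminorms UNIV)"
    using p by (auto simp: strong_dual_seminorms_def)
  have le: "p (\<lambda>x. c * w x) \<le> norm c * p w" if w: "w \<in> tempered" for c w unfolding B(1)
  proof (rule cSUP_least[OF bounded_setsD(2)[OF B(2)]])
    fix \<phi> assume "\<phi> \<in> B"
    then show "norm (c * w \<phi>) \<le> norm c * (SUP \<phi>\<in>B. norm (w \<phi>))"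
      unfolding norm_mult by (intro mult_left_mono cSUP_upper bdd_above_tempered[OF w B(2)]) auto
  qed
  show "p (\<lambda>x. a * u x) = norm a * p u"
  proof (rule homogeneous_of_le[where p = p and f = u, OF le])
    show V: "(\<lambda>x. c * u x) \<in> tempered" for c using tempered_lin_comb[OF u tempered_zero, of c] by simp
    obtain \<phi> where \<phi>: "\<phi> \<in> B" using bounded_setsD(2)[OF B(2)] by blast
    show "0 \<le> p (\<lambda>x. a * u x)" unfolding B(1)
      by (rule order_trans[OF norm_ge_zero cSUP_upper[OF \<phi> bdd_above_tempered[OF V B(2)]]])
  qed
next
  fix p :: "(('a \<Rightarrow> complex) \<Rightarrow> complex) \<Rightarrow> real" and u v :: "('a \<Rightarrow> complex) \<Rightarrow> complex" assume p: "p \<in> strong_dual_seminorms" and u: "u \<in> (tempered :: (('a \<Rightarrow> complex) \<Rightarrow> complex) set)" and v: "v \<in> tempered"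
  obtain B where B: "p = (\<lambda>u. SUP \<phi>\<in>B. norm (u \<phi>))" "B \<in> bounded_sets schwartz (schwartz_seminorms UNIV)"
    using p by (auto simp: strong_dual_seminorms_def)
  show "p (\<lambda>x. u x + v x) \<le> p u + p v" unfolding B(1)
  proof (rule cSUP_least[OF bounded_setsD(2)[OF B(2)]])
    fix \<phi> assume \<phi>: "\<phi> \<in> B"
    show "norm (u \<phi> + v \<phi>) \<le> (SUP \<phi>\<in>B. norm (u \<phi>)) + (SUP \<phi>\<in>B. norm (v \<phi>))"
      by (rule order_trans[OF norm_triangle_ineq]) (intro add_mono cSUP_upper \<phi> bdd_above_tempered[OF _ B(2)] u v)
  qed
qed (simp_all add: tempered_zero tempered_lin_comb)

lemma topspace_strong_dual: "topspace strong_dual_topology = tempered"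
  unfolding strong_dual_topology_def by (rule topspace_seminorm_space[OF seminorm_tempered])

lemma topspace_schwartz: "topspace schwartz_topology = schwartz"
  unfolding schwartz_topology_def by (rule topspace_seminorm_space[OF seminorm_schwartz])

lemma tempered_hermite_expansion:
  assumes u: "u \<in> tempered" and f: "f \<in> schwartz"
  shows "((\<lambda>k. hermite_coeff f k * u (hermite_fun k)) has_sum u f) UNIV"
  using tempered_hermite_series[OF u rapid_hermite_coeff[OF f]] by (simp add: hermite_expansion[OF f])

lemma hermite_coeff_bounded_set:
  assumes B: "B \<in> bounded_sets schwartz (schwartz_seminorms UNIV)"
  obtains K where "\<And>f k. f \<in> B \<Longrightarrow> norm (hermite_coeff f k) * weight (k :: nat ^ 'n::finite) ^ M \<le> K"
proof -
  obtain F C where F: "finite F" "F \<subseteq> schwartz_seminorms UNIV" "0 \<le> C"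
    "\<forall>f\<in>schwartz. \<forall>k :: nat ^ 'n. norm (hermite_coeff f k) * weight k ^ M \<le> C * (\<Sum>p\<in>F. p f)"
    using hermite_coeff_decay[of M] by (elim exE conjE) (rule that)
  have "bdd_above ((\<lambda>f. C * (\<Sum>p\<in>F. p f)) ` B)" by (rule bdd_above_bounded_sets[OF seminorm_schwartz B F(1-3)]) simp
  then obtain K where "\<And>f. f \<in> B \<Longrightarrow> C * (\<Sum>p\<in>F. p f) \<le> K" unfolding bdd_above_def by blast
  then show ?thesis using F(4) bounded_setsD(1)[OF B] by (intro that[of K]) (meson order_trans subsetD)
qed

text \<open>Weighted Hermite coefficients are bounded uniformly over a bounded set of Schwartz
  functions, so the series for \<open>u \<phi>\<close> has one summable majorant for all \<phi> in
  the set, and its tail bounds the strong dual seminorm of the error.\<close>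

lemma tempered_hermite_sum_limit:
  assumes u: "u \<in> tempered"
  shows "limitin strong_dual_topology (\<lambda>F \<phi>. \<Sum>k\<in>F. u (hermite_fun k) * distribution_of (hermite_fun k) \<phi>) u
    (finite_subsets_at_top (UNIV :: (nat ^ 'n::finite) set))" unfolding strong_dual_topology_def
proof (rule limitin_seminormI[OF pseudometric_seminorm_space[OF seminorm_tempered] u])
  define v where "v F \<phi> = (\<Sum>k\<in>F. u (hermite_fun k) * distribution_of (hermite_fun k) \<phi>)" for F :: "(nat ^ 'n) set" and \<phi>
  have vt: "v F \<in> tempered" if "finite F" for F unfolding v_def[abs_def]
    by (intro seminorm_space_sum[OF seminorm_tempered that] seminorm_space_scale[OF seminorm_tempered]
        distribution_of_tempered hermite_fun_schwartz)
  show "\<forall>\<^sub>F F in finite_subsets_at_top UNIV. v F \<in> tempered" by (rule eventually_finite_subsets_at_top_weakI) (rule vt)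
  fix p assume p: "p \<in> (strong_dual_seminorms :: (((real ^ 'n \<Rightarrow> complex) \<Rightarrow> complex) \<Rightarrow> real) set)"
  obtain B where B: "p = (\<lambda>u. SUP \<phi>\<in>B. norm (u \<phi>))" "B \<in> bounded_sets schwartz (schwartz_seminorms UNIV)"
    using p by (auto simp: strong_dual_seminorms_def)
  obtain D L where D: "0 \<le> D" "\<And>k :: nat ^ 'n. norm (u (hermite_fun k)) \<le> D * weight k ^ L"
    using poly_growthE[OF poly_growth_tempered[OF u]] by blast
  \<comment> \<open>Two powers beyond the growth exponent of \<open>u\<close> leave the summable
    factor \<open>1 / weight k ^ 2\<close>.\<close>
  obtain K where K: "\<And>f k. f \<in> B \<Longrightarrow> norm (hermite_coeff f k) * weight (k :: nat ^ 'n) ^ (L + 2) \<le> K"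
    using hermite_coeff_bounded_set[OF B(2)] by blast
  define G where "G k = D * K * (1 / weight k ^ 2)" for k :: "nat ^ 'n"
  have Gs: "G summable_on UNIV" unfolding G_def by (intro summable_on_cmult_right summable_weight)
  have bd: "norm (hermite_coeff \<phi> k * u (hermite_fun k)) \<le> G k" if "\<phi> \<in> B" for \<phi> k
  proof -
    have pos: "0 < weight k ^ 2" "0 < weight k ^ L" by (intro zero_less_power weight_pos)+
    have "norm (hermite_coeff \<phi> k * u (hermite_fun k)) \<le> norm (hermite_coeff \<phi> k) * (D * weight k ^ L)"
      unfolding norm_mult by (intro mult_left_mono D) simp
    also have "\<dots> = D * (norm (hermite_coeff \<phi> k) * weight k ^ (L + 2)) / weight k ^ 2"
      using weight_pos[of k] by (simp add: power_add field_simps power2_eq_square)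
    also have "\<dots> \<le> D * K / weight k ^ 2" using pos K[OF that, of k] D(1) by (intro divide_right_mono mult_left_mono) auto
    finally show ?thesis by (simp add: G_def)
  qed
  have le: "p (v F - u) \<le> (\<Sum>\<^sub>\<infinity>k. G k) - (\<Sum>k\<in>F. G k)" if F: "finite F" for F unfolding B(1)
  proof (rule cSUP_least[OF bounded_setsD(2)[OF B(2)]])
    fix \<phi> assume \<phi>: "\<phi> \<in> B"
    then have \<phi>s: "\<phi> \<in> schwartz" using bounded_setsD(1)[OF B(2)] by blast
    have "u \<phi> = (\<Sum>\<^sub>\<infinity>k. hermite_coeff \<phi> k * u (hermite_fun k))"
      using tempered_hermite_expansion[OF u \<phi>s] by (simp add: infsumI)
    moreover have "v F \<phi> = (\<Sum>k\<in>F. hermite_coeff \<phi> k * u (hermite_fun k))"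
      unfolding v_def using \<phi>s by (simp add: distribution_of_def hermite_coeff_def mult.commute)
    ultimately show "norm ((v F - u) \<phi>) \<le> (\<Sum>\<^sub>\<infinity>k. G k) - (\<Sum>k\<in>F. G k)"
      using infsum_minus_sum_bound[OF bd[OF \<phi>] Gs F] by (simp add: norm_minus_commute)
  qed
  have "((\<lambda>F. (\<Sum>\<^sub>\<infinity>k. G k) - (\<Sum>k\<in>F. G k)) \<longlongrightarrow> (\<Sum>\<^sub>\<infinity>k. G k) - (\<Sum>\<^sub>\<infinity>k. G k)) (finite_subsets_at_top UNIV)"
    by (intro tendsto_intros infsum_tendsto Gs)
  then have lim: "((\<lambda>F. (\<Sum>\<^sub>\<infinity>k. G k) - (\<Sum>k\<in>F. G k)) \<longlongrightarrow> 0) (finite_subsets_at_top UNIV)" by simp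
  show "((\<lambda>F. p (v F - u)) \<longlongrightarrow> 0) (finite_subsets_at_top UNIV)"
  proof (rule tendsto_sandwich[OF _ _ tendsto_const lim])
    show "\<forall>\<^sub>F F in finite_subsets_at_top UNIV. 0 \<le> p (v F - u)" by (rule eventually_finite_subsets_at_top_weakI)
        (intro seminorm_nonneg[OF seminorm_tempered p] seminorm_space_diff[OF seminorm_tempered] vt u)
    show "\<forall>\<^sub>F F in finite_subsets_at_top UNIV. p (v F - u) \<le> (\<Sum>\<^sub>\<infinity>k. G k) - (\<Sum>k\<in>F. G k)"
      by (rule eventually_finite_subsets_at_top_weakI) (rule le)
  qed
qed

text \<open>The sup norm is one of the defining seminorms, so a limit in the Schwartz topology is
  also a pointwise limit.\<close>

lemma schwartz_limit_unique:
  assumes "limitin schwartz_topology xs f G" "limitin schwartz_topology xs g G" "G \<noteq> bot"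
    and xs: "\<And>n. xs n \<in> schwartz"
  shows "f = g"
proof
  fix x
  note p = sup_seminorm and le = norm_le_sup_seminorm
  let ?p = "\<lambda>g. SUP x. weighted_deriv (\<lambda>_. 0) [] g (x :: 'a)"
  have "((\<lambda>n. xs n x) \<longlongrightarrow> h x) G" if h: "limitin schwartz_topology xs h G" for h
  proof -
    have hs: "h \<in> schwartz" using h topspace_schwartz unfolding limitin_def by blast
    have d: "xs n - h \<in> schwartz" for n using seminorm_space_diff[OF seminorm_schwartz xs hs] .
    have "((\<lambda>n. ?p (xs n - h)) \<longlongrightarrow> 0) G" using h unfolding schwartz_topology_def
    proof (rule limitin_seminormD[OF _ hs p])
      show "?p (h - h) = 0" using seminorm_zero[OF seminorm_schwartz p] by (simp add: fun_diff_def)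
      show "0 \<le> ?p (xs n - h)" for n by (rule seminorm_nonneg[OF seminorm_schwartz p d])
    qed
    then have "((\<lambda>n. xs n x - h x) \<longlongrightarrow> 0) G"
      by (rule Lim_null_comparison[rotated]) (use le[OF d] in \<open>auto intro!: always_eventually\<close>)
    then show ?thesis by (simp add: LIM_zero_iff)
  qed
  from tendsto_unique[OF assms(3) this[OF assms(1)] this[OF assms(2)]] show "f x = g x" .
qed

text \<open>Uniqueness of the extension. Applying \<open>W\<close> to the finite Hermite sums of
  \<open>u\<close> gives the partial sums of the claimed series; by continuity these converge to
  \<open>W u\<close> as well as to the series.\<close>

lemma diagonal_operator_eq_series:
  fixes W :: "((real ^ 'n::finite \<Rightarrow> complex) \<Rightarrow> complex) \<Rightarrow> real ^ 'n \<Rightarrow> complex"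
  assumes W: "W \<in> continuous_linear_maps strong_dual_topology schwartz_topology"
    and diag: "\<And>k. W (distribution_of (hermite_fun k)) = (\<lambda>x. c k * hermite_fun k x)"
    and c: "rapid c" and u: "u \<in> tempered"
  shows "W u = hermite_series (\<lambda>k. c k * u (hermite_fun k))"
proof (rule schwartz_limit_unique)
  define v where "v F \<phi> = (\<Sum>k\<in>F. u (hermite_fun k) * distribution_of (hermite_fun k) \<phi>)" for F :: "(nat ^ 'n) set" and \<phi>
  let ?a = "\<lambda>k. c k * u (hermite_fun k)"
  have a: "rapid ?a" by (rule rapid_mult[OF c poly_growth_tempered[OF u]])
  show "limitin schwartz_topology (\<lambda>F x. \<Sum>k\<in>F. ?a k * hermite_fun k x) (hermite_series ?a) (finite_subsets_at_top UNIV)"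
    by (rule hermite_series_limit[OF a])
  have Wlin: "W (\<lambda>\<phi>. b * f \<phi> + g \<phi>) = (\<lambda>x. b * W f x + W g x)" if "f \<in> tempered" "g \<in> tempered" for b f g
    using W that unfolding continuous_linear_maps_def topspace_strong_dual by blast
  have vt: "v F \<in> tempered" if "finite F" for F unfolding v_def[abs_def]
    by (intro seminorm_space_sum[OF seminorm_tempered that] seminorm_space_scale[OF seminorm_tempered]
        distribution_of_tempered hermite_fun_schwartz)
  have Wv: "W (v F) = (\<lambda>x. \<Sum>k\<in>F. ?a k * hermite_fun k x)" if "finite F" for F using that
  proof induction
    case empty
    have "v {} = (\<lambda>\<phi>. 0)" by (simp add: v_def[abs_def])
    moreover have "W (\<lambda>\<phi>. 0) = (\<lambda>x. 0)" using Wlin[OF tempered_zero tempered_zero, of 1] by (simp add: fun_eq_iff)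
    ultimately show ?case by simp
  next
    case (insert k F)
    have "v (insert k F) = (\<lambda>\<phi>. u (hermite_fun k) * distribution_of (hermite_fun k) \<phi> + v F \<phi>)"
      using insert.hyps by (simp add: v_def[abs_def])
    then show ?case using Wlin[OF distribution_of_tempered[OF hermite_fun_schwartz] vt[OF insert.hyps(1)], of "u (hermite_fun k)" k] insert
      by (simp add: diag mult_ac)
  qed
  have "limitin strong_dual_topology v u (finite_subsets_at_top UNIV)" unfolding v_def[abs_def] by (rule tempered_hermite_sum_limit[OF u])
  then have "limitin schwartz_topology (W \<circ> v) (W u) (finite_subsets_at_top UNIV)"
    using W by (intro continuous_map_limit[of strong_dual_topology]) (auto simp: continuous_linear_maps_def)
  moreover have "\<forall>\<^sub>F F in finite_subsets_at_top UNIV. (W \<circ> v) F = (\<lambda>x. \<Sum>k\<in>F. ?a k * hermite_fun k x)"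
    by (rule eventually_finite_subsets_at_top_weakI) (simp add: Wv)
  ultimately show "limitin schwartz_topology (\<lambda>F x. \<Sum>k\<in>F. ?a k * hermite_fun k x) (W u) (finite_subsets_at_top UNIV)"
    by (rule limitin_transform_eventually[rotated])
  show "finite_subsets_at_top (UNIV :: (nat ^ 'n) set) \<noteq> bot" by (rule finite_subsets_at_top_neq_bot)
  \<comment> \<open>Membership is asked for every index set, not only eventually; over an infinite
    \<open>F\<close> the sum is 0 by convention.\<close>
  show "(\<lambda>x. \<Sum>k\<in>F. ?a k * hermite_fun k x) \<in> schwartz" for F
  proof (cases "finite F")
    case True
    then show ?thesis by (intro seminorm_space_sum[OF seminorm_schwartz] seminorm_space_scale[OF seminorm_schwartz] hermite_fun_schwartz)
  qed (simp add: schwartz_zero)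
qed

text \<open>Bounded sets of this shape make the strong dual seminorms control weighted coefficients
  of a distribution. The index set \<open>I\<close> allows one bounded set for a whole sequence of
  coefficient families.\<close>

lemma bounded_sets_scaled_hermite:
  assumes "I \<noteq> {}" and bd: "\<And>M. \<exists>K. \<forall>i\<in>I. \<forall>k :: nat ^ 'n::finite. norm (c i k) * weight k ^ M \<le> K"
  shows "(\<lambda>(i, k) x. c i k * hermite_fun k x) ` (I \<times> UNIV) \<in> bounded_sets schwartz (schwartz_seminorms UNIV)"
  unfolding bounded_sets_def
proof (intro CollectI conjI ballI)
  show "(\<lambda>(i, k) x. c i k * hermite_fun k x) ` (I \<times> UNIV) \<subseteq> schwartz"
    using seminorm_space_scale[OF seminorm_schwartz hermite_fun_schwartz] by auto
  show "(\<lambda>(i, k) x. c i k * hermite_fun k x) ` (I \<times> UNIV) \<noteq> {}" using assms(1) by simp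
  fix p :: "(real ^ 'n \<Rightarrow> complex) \<Rightarrow> real" assume p: "p \<in> schwartz_seminorms UNIV"
  obtain C M where C: "0 \<le> C" "\<And>k. p (hermite_fun k) \<le> C * weight k ^ M" using hermite_fun_seminorm[OF p] by blast
  obtain K where K: "\<And>i k. i \<in> I \<Longrightarrow> norm (c i k) * weight k ^ M \<le> K" using bd[of M] by blast
  have "p (\<lambda>x. c i k * hermite_fun k x) \<le> C * K" if "i \<in> I" for i k
  proof -
    have "p (\<lambda>x. c i k * hermite_fun k x) = norm (c i k) * p (hermite_fun k)"
      by (rule seminorm_scale[OF seminorm_schwartz p hermite_fun_schwartz])
    also have "\<dots> \<le> norm (c i k) * (C * weight k ^ M)" by (intro mult_left_mono C) simp
    also have "\<dots> = C * (norm (c i k) * weight k ^ M)" by simp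
    also have "\<dots> \<le> C * K" by (intro mult_left_mono K that C)
    finally show ?thesis .
  qed
  then show "bdd_above (p ` (\<lambda>(i, k) x. c i k * hermite_fun k x) ` (I \<times> UNIV))" by (intro bdd_aboveI[of _ "C * K"]) auto
qed

section \<open>Radial symbols\<close>

lemma open_pos_orthant: "open (pos_orthant :: (real ^ 'n::finite) set)"
proof -
  have "open (\<Inter>i\<in>UNIV. {x :: real ^ 'n. 0 < x $ i})" by (intro open_INT finite ballI open_Collect_less continuous_intros)
  moreover have "(\<Inter>i\<in>UNIV. {x :: real ^ 'n. 0 < x $ i}) = pos_orthant" by (auto simp: pos_orthant_def)
  ultimately show ?thesis by simp
qed

lemma convex_pos_orthant: "convex (pos_orthant :: (real ^ 'n::finite) set)" unfolding convex_def pos_orthant_def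
  by (auto simp: add_nonneg_pos add_pos_nonneg) (smt (verit) mult_nonneg_nonneg mult_pos_pos)

lemma pos_orthant_subset: "pos_orthant \<subseteq> closed_orthant" by (auto simp: pos_orthant_def closed_orthant_def less_imp_le)

lemma pos_orthant_nonempty: "(pos_orthant :: (real ^ 'n::finite) set) \<noteq> {}" by (auto simp: pos_orthant_def intro!: exI[of _ "\<chi> i. 1"])

lemma orthant_shift:
  fixes x :: "real ^ 'n::finite"
  assumes "x \<in> closed_orthant" "0 < e"
  shows "x + e *\<^sub>R (\<chi> i. 1) \<in> pos_orthant" using assms by (auto simp: pos_orthant_def closed_orthant_def add_nonneg_pos)

text \<open>An approach from inside by a shift that does not depend on \<open>x\<close>, so
  differences of two points are preserved exactly.\<close>

definition orthant_seq :: "real ^ 'n::finite \<Rightarrow> nat \<Rightarrow> real ^ 'n" where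
  "orthant_seq x n = x + (1 / real (Suc n)) *\<^sub>R (\<chi> i. 1)"

lemma orthant_seq: "x \<in> closed_orthant \<Longrightarrow> orthant_seq x n \<in> pos_orthant" unfolding orthant_seq_def by (rule orthant_shift) auto

lemma orthant_seq_tendsto: "orthant_seq x \<longlonglongrightarrow> x"
proof -
  have "(\<lambda>n. x + (1 / real (Suc n)) *\<^sub>R (\<chi> i. 1)) \<longlonglongrightarrow> x + 0 *\<^sub>R (\<chi> i. 1)"
    by (intro tendsto_intros LIMSEQ_Suc lim_1_over_n)
  then show ?thesis by (simp add: orthant_seq_def[abs_def])
qed

lemma continuous_on_orthant_seq:
  assumes "continuous_on closed_orthant g" "x \<in> closed_orthant"
  shows "(\<lambda>n. g (orthant_seq x n)) \<longlonglongrightarrow> g x" using assms orthant_seq[OF assms(2)] pos_orthant_subset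
  by (intro continuous_on_tendsto_compose[OF assms(1) orthant_seq_tendsto]) (auto intro!: always_eventually)

text \<open>In the open orthant near \<open>x\<close>, the mean value inequality bounds the
  increments of \<open>g\<close> minus its candidate linear part. Shifting both points inside by the
  same vector leaves their difference unchanged, so the estimate survives the limit to the closed
  orthant.\<close>

lemma has_derivative_boundary:
  fixes g :: "real ^ 'n::finite \<Rightarrow> complex" and D :: "real ^ 'n \<Rightarrow> real ^ 'n \<Rightarrow> complex"
  assumes g: "continuous_on closed_orthant g" and D: "\<And>b. b \<in> Basis \<Longrightarrow> continuous_on closed_orthant (D b)"
    and der: "\<And>x. x \<in> pos_orthant \<Longrightarrow> (g has_derivative (\<lambda>h. \<Sum>b\<in>Basis. (h \<bullet> b) *\<^sub>R D b x)) (at x)"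
    and x: "x \<in> closed_orthant"
  shows "(g has_derivative (\<lambda>h. \<Sum>b\<in>Basis. (h \<bullet> b) *\<^sub>R D b x)) (at x within closed_orthant)"
  unfolding has_derivative_within_alt
proof (intro conjI allI impI)
  show "bounded_linear (\<lambda>h. \<Sum>b\<in>Basis. (h \<bullet> b) *\<^sub>R D b x)"
    by (intro bounded_linear_sum bounded_linear_compose[OF bounded_linear_scaleR_left] bounded_linear_inner_left)
  fix e :: real assume e: "0 < e"
  define L where "L z = (\<Sum>b\<in>Basis. (z \<bullet> b) *\<^sub>R D b x)" for z
  \<comment> \<open>The tolerance \<open>e\<close> is shared equally among the coordinate
    directions.\<close>
  define \<eta> where "\<eta> = e / real DIM(real ^ 'n)"
  have \<eta>: "0 < \<eta>" unfolding \<eta>_def using e by (intro divide_pos_pos) (auto simp: DIM_positive)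
  have "\<forall>b\<in>Basis. \<exists>d>0. \<forall>y\<in>closed_orthant. dist y x < d \<longrightarrow> dist (D b y) (D b x) < \<eta>"
    using D x \<eta> unfolding continuous_on_iff by blast
  then obtain d where d: "\<And>b. b \<in> Basis \<Longrightarrow> 0 < d b"
    "\<And>b y. b \<in> Basis \<Longrightarrow> y \<in> closed_orthant \<Longrightarrow> dist y x < d b \<Longrightarrow> dist (D b y) (D b x) < \<eta>" by metis
  define \<delta> where "\<delta> = Min (d ` Basis)"
  have \<delta>: "0 < \<delta>" unfolding \<delta>_def using d(1) by (simp add: nonempty_Basis)
  have \<delta>d: "\<delta> \<le> d b" if "b \<in> Basis" for b unfolding \<delta>_def using that by simp
  have main: "norm (g z - g w - L (z - w)) \<le> e * norm (z - w)"
    if z: "z \<in> pos_orthant \<inter> ball x \<delta>" and w: "w \<in> pos_orthant \<inter> ball x \<delta>" for z w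
  proof -
    have "norm ((g z - L z) - (g w - L w)) \<le> e * norm (z - w)"
    proof (rule differentiable_bound[of "pos_orthant \<inter> ball x \<delta>" "\<lambda>z. g z - L z" "\<lambda>y h. (\<Sum>b\<in>Basis. (h \<bullet> b) *\<^sub>R D b y) - L h"])
      show "convex (pos_orthant \<inter> ball x \<delta>)" by (intro convex_Int convex_pos_orthant convex_ball)
      fix y assume y: "y \<in> pos_orthant \<inter> ball x \<delta>"
      have bl: "bounded_linear L" unfolding L_def
        by (intro bounded_linear_sum bounded_linear_compose[OF bounded_linear_scaleR_left] bounded_linear_inner_left)
      show "((\<lambda>z. g z - L z) has_derivative (\<lambda>h. (\<Sum>b\<in>Basis. (h \<bullet> b) *\<^sub>R D b y) - L h)) (at y within pos_orthant \<inter> ball x \<delta>)"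
        by (intro has_derivative_diff has_derivative_at_withinI[OF der] bounded_linear_imp_has_derivative[OF bl]) (use y in simp)
      show "onorm (\<lambda>h. (\<Sum>b\<in>Basis. (h \<bullet> b) *\<^sub>R D b y) - L h) \<le> e"
      proof (rule onorm_bound)
        fix h :: "real ^ 'n"
        have "(\<Sum>b\<in>Basis. (h \<bullet> b) *\<^sub>R D b y) - L h = (\<Sum>b\<in>Basis. (h \<bullet> b) *\<^sub>R (D b y - D b x))"
          by (simp add: L_def scaleR_diff_right sum_subtractf)
        also have "norm \<dots> \<le> (\<Sum>b\<in>(Basis :: (real ^ 'n) set). norm h * \<eta>)"
        proof (rule sum_norm_le)
          fix b :: "real ^ 'n" assume b: "b \<in> Basis"
          have "dist (D b y) (D b x) < \<eta>" using d(2)[OF b, of y] y pos_orthant_subset \<delta>d[OF b] by (auto simp: dist_commute)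
          then show "norm ((h \<bullet> b) *\<^sub>R (D b y - D b x)) \<le> norm h * \<eta>"
            unfolding norm_scaleR using Basis_le_norm[OF b, of h] by (intro mult_mono) (auto simp: dist_norm)
        qed
        also have "\<dots> = e * norm h" by (simp add: \<eta>_def)
        finally show "norm ((\<Sum>b\<in>Basis. (h \<bullet> b) *\<^sub>R D b y) - L h) \<le> e * norm h" .
      qed (use e in simp)
    qed (use z w in auto)
    moreover have "g z - g w - L (z - w) = (g z - L z) - (g w - L w)" by (simp add: L_def inner_diff_left scaleR_diff_left sum_subtractf)
    ultimately show ?thesis by (simp only:)
  qed
  show "\<exists>d>0. \<forall>y\<in>closed_orthant. norm (y - x) < d \<longrightarrow> norm (g y - g x - (\<Sum>b\<in>Basis. ((y - x) \<bullet> b) *\<^sub>R D b x)) \<le> e * norm (y - x)"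
  proof (intro exI[of _ \<delta>] conjI ballI impI \<delta>)
    fix y assume y: "y \<in> closed_orthant" "norm (y - x) < \<delta>"
    have "(\<lambda>n. norm (g (orthant_seq y n) - g (orthant_seq x n) - L (orthant_seq y n - orthant_seq x n)))
        \<longlonglongrightarrow> norm (g y - g x - L (y - x))"
      unfolding L_def by (intro tendsto_intros continuous_on_orthant_seq g x y orthant_seq_tendsto)
    moreover have "\<forall>\<^sub>F n in sequentially. norm (g (orthant_seq y n) - g (orthant_seq x n) - L (orthant_seq y n - orthant_seq x n)) \<le> e * norm (y - x)"
    proof -
      have "\<forall>\<^sub>F n in sequentially. dist (orthant_seq y n) x < \<delta>"
        using tendsto_dist[OF orthant_seq_tendsto tendsto_const, of y x] y(2) by (intro order_tendstoD(2)) (auto simp: dist_norm)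
      moreover have "\<forall>\<^sub>F n in sequentially. dist (orthant_seq x n) x < \<delta>" using tendstoD[OF orthant_seq_tendsto \<delta>] .
      ultimately show ?thesis
      proof eventually_elim
        case (elim n)
        have "orthant_seq y n - orthant_seq x n = y - x" by (simp add: orthant_seq_def)
        then show ?case using main[of "orthant_seq y n" "orthant_seq x n"] elim orthant_seq[OF y(1)] orthant_seq[OF x] by (simp add: dist_commute)
      qed
    qed
    ultimately have "norm (g y - g x - L (y - x)) \<le> e * norm (y - x)" by (rule tendsto_upperbound) simp
    then show "norm (g y - g x - (\<Sum>b\<in>Basis. ((y - x) \<bullet> b) *\<^sub>R D b x)) \<le> e * norm (y - x)" by (simp add: L_def)
  qed
qed

section \<open>Pulling functions on the orthant back to phase space\<close>

lemma square_moduli_closed_orthant: "square_moduli z \<in> closed_orthant" by (cases z) (simp add: square_moduli_def closed_orthant_def)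

lemma square_moduli_nth: "square_moduli z $ j = (fst z $ j)\<^sup>2 + (snd z $ j)\<^sup>2" by (cases z) (simp add: square_moduli_def)

lemma has_derivative_square_moduli:
  "(square_moduli has_derivative (\<lambda>h. \<chi> j. 2 * (fst z $ j * fst h $ j + snd z $ j * snd h $ j))) (at z within S)"
proof (subst has_derivative_componentwise_within, intro ballI)
  fix b :: "real ^ 'a" assume "b \<in> Basis"
  then obtain j where b: "b = axis j 1" using Basis_vecE by blast
  have "((\<lambda>z. (fst z $ j)\<^sup>2 + (snd z $ j)\<^sup>2) has_derivative (\<lambda>h. 2 * (fst z $ j * fst h $ j + snd z $ j * snd h $ j))) (at z within S)"
    by (auto intro!: derivative_eq_intros bounded_linear_imp_has_derivative bounded_linear_compose[OF bounded_linear_vec_nth]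
        bounded_linear_fst bounded_linear_snd simp: algebra_simps)
  then show "((\<lambda>z. square_moduli z \<bullet> b) has_derivative (\<lambda>h. (\<chi> j. 2 * (fst z $ j * fst h $ j + snd z $ j * snd h $ j)) \<bullet> b)) (at z within S)"
    by (simp add: b inner_axis square_moduli_nth)
qed

text \<open>A simultaneous choice of the boundary extensions of all derivatives, so that chain rules
  can be written with fixed functions \<open>G bs\<close>, also where a squared modulus
  vanishes.\<close>

definition orthant_jets :: "(real ^ 'n::finite \<Rightarrow> complex) \<Rightarrow> ((real ^ 'n) list \<Rightarrow> real ^ 'n \<Rightarrow> complex) \<Rightarrow> bool" where
  "orthant_jets f G \<longleftrightarrow> (\<forall>bs. set bs \<subseteq> Basis \<longrightarrow>
     continuous_on closed_orthant (G bs) \<and> (\<forall>x\<in>pos_orthant. G bs x = partial_derivs bs f x))"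

lemma orthant_jets_exist:
  assumes "f \<in> schwartz_orthant"
  obtains G where "orthant_jets f G"
proof -
  have "\<forall>bs. \<exists>g. set bs \<subseteq> Basis \<longrightarrow> continuous_on closed_orthant g \<and> (\<forall>x\<in>pos_orthant. g x = partial_derivs bs f x)"
    using assms unfolding schwartz_orthant_def by blast
  then obtain G where "\<forall>bs. set bs \<subseteq> Basis \<longrightarrow> continuous_on closed_orthant (G bs) \<and> (\<forall>x\<in>pos_orthant. G bs x = partial_derivs bs f x)"
    by metis
  then show ?thesis using that unfolding orthant_jets_def by blast
qed

lemma linear_eq_sum_Basis:
  fixes f :: "'a::euclidean_space \<Rightarrow> 'b::real_vector"
  assumes "linear f"
  shows "f h = (\<Sum>b\<in>Basis. (h \<bullet> b) *\<^sub>R f b)"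
proof -
  have "f h = f (\<Sum>b\<in>Basis. (h \<bullet> b) *\<^sub>R b)" by (simp add: euclidean_representation)
  also have "\<dots> = (\<Sum>b\<in>Basis. (h \<bullet> b) *\<^sub>R f b)" using assms by (simp add: linear_sum linear_scale)
  finally show ?thesis .
qed

context
  fixes f :: "real ^ 'n::finite \<Rightarrow> complex" and G
  assumes f: "smooth_on pos_orthant f" "schwartz_bounds pos_orthant f" and G: "orthant_jets f G"
begin

lemma jet_has_derivative:
  assumes bs: "set bs \<subseteq> Basis" and x: "x \<in> closed_orthant"
  shows "(G bs has_derivative (\<lambda>h. \<Sum>b\<in>Basis. (h \<bullet> b) *\<^sub>R G (b # bs) x)) (at x within closed_orthant)"
proof (rule has_derivative_boundary[OF _ _ _ x])
  show "continuous_on closed_orthant (G bs)" using G bs by (simp add: orthant_jets_def)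
  show "continuous_on closed_orthant (G (b # bs))" if "b \<in> Basis" for b using G bs that by (simp add: orthant_jets_def)
  fix y :: "real ^ 'n" assume y: "y \<in> pos_orthant"
  define D where "D = frechet_derivative (partial_derivs bs f) (at y)"
  have diff: "partial_derivs bs f differentiable (at y)" by (rule smooth_onD[OF f(1) bs y])
  then have "(partial_derivs bs f has_derivative D) (at y)" by (simp add: D_def frechet_derivative_works)
  then have "(G bs has_derivative D) (at y)"
    by (rule has_derivative_transform_within_open[OF _ open_pos_orthant y]) (use G bs in \<open>simp add: orthant_jets_def\<close>)
  moreover have "D = (\<lambda>h. \<Sum>b\<in>Basis. (h \<bullet> b) *\<^sub>R G (b # bs) y)"
  proof
    fix h
    have "linear D" unfolding D_def by (rule linear_frechet_derivative[OF diff])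
    then have "D h = (\<Sum>b\<in>Basis. (h \<bullet> b) *\<^sub>R D b)" by (rule linear_eq_sum_Basis)
    also have "\<dots> = (\<Sum>b\<in>Basis. (h \<bullet> b) *\<^sub>R G (b # bs) y)"
      using G bs y by (intro sum.cong refl) (simp add: orthant_jets_def D_def)
    finally show "D h = (\<Sum>b\<in>Basis. (h \<bullet> b) *\<^sub>R G (b # bs) y)" .
  qed
  ultimately show "(G bs has_derivative (\<lambda>h. \<Sum>b\<in>Basis. (h \<bullet> b) *\<^sub>R G (b # bs) y)) (at y)" by simp
qed

text \<open>The squared moduli never leave the closed orthant, so differentiability of
  \<open>G bs\<close> within that set is enough for a full derivative on phase space.\<close>

lemma jet_square_moduli_has_derivative:
  assumes bs: "set bs \<subseteq> Basis"
  shows "((\<lambda>z. G bs (square_moduli z)) has_derivative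
    (\<lambda>h. \<Sum>j\<in>UNIV. (2 * (fst z $ j * fst h $ j + snd z $ j * snd h $ j)) *\<^sub>R G (axis j 1 # bs) (square_moduli z))) (at z)"
proof -
  have "(G bs has_derivative (\<lambda>h. \<Sum>b\<in>Basis. (h \<bullet> b) *\<^sub>R G (b # bs) (square_moduli z))) (at (square_moduli z) within range square_moduli)"
    by (rule has_derivative_subset[OF jet_has_derivative[OF bs square_moduli_closed_orthant]])
      (use square_moduli_closed_orthant in auto)
  from has_derivative_in_compose[OF has_derivative_square_moduli this]
  show ?thesis by (simp add: sum_Basis_vec inner_axis)
qed

lemma jet_bound:
  assumes bs: "set bs \<subseteq> Basis"
  shows "\<exists>C. \<forall>x\<in>closed_orthant. poly_weight x ^ M * norm (G bs x) \<le> C"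
proof -
  obtain F C where F: "\<And>g x. schwartz_bounds pos_orthant g \<Longrightarrow> x \<in> pos_orthant \<Longrightarrow>
      norm (complex_of_real (poly_weight x ^ M) * partial_derivs bs g x) \<le> C * (\<Sum>p\<in>F. p g)"
    by (rule diffops_bound[OF diffops_poly_weight_power[OF diffops.deriv[OF bs], of M], of pos_orthant]) (rule that)
  have le: "poly_weight x ^ M * norm (G bs x) \<le> C * (\<Sum>p\<in>F. p f)" if x: "x \<in> pos_orthant" for x
    using F[OF f(2) x] G bs x poly_weight_pos[of x] by (simp add: orthant_jets_def norm_mult norm_power)
  have "poly_weight x ^ M * norm (G bs x) \<le> C * (\<Sum>p\<in>F. p f)" if x: "x \<in> closed_orthant" for x
  proof (rule tendsto_upperbound)
    have "continuous_on closed_orthant (\<lambda>x. poly_weight x ^ M * norm (G bs x))"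
      unfolding poly_weight_def using G bs by (intro continuous_intros) (simp add: orthant_jets_def)
    then show "(\<lambda>n. poly_weight (orthant_seq x n) ^ M * norm (G bs (orthant_seq x n))) \<longlonglongrightarrow> poly_weight x ^ M * norm (G bs x)"
      by (rule continuous_on_orthant_seq[OF _ x])
    show "\<forall>\<^sub>F n in sequentially. poly_weight (orthant_seq x n) ^ M * norm (G bs (orthant_seq x n)) \<le> C * (\<Sum>p\<in>F. p f)"
      by (intro always_eventually allI le orthant_seq x)
  qed simp
  then show ?thesis by blast
qed

text \<open>The class required by \<open>schwartz_closed_class\<close>: by the chain rule,
  differentiating a pulled-back jet yields coordinates times pulled-back jets.\<close>

inductive_set radial_class :: "('n::finite phase \<Rightarrow> complex) set" where
  base: "set bs \<subseteq> Basis \<Longrightarrow> (\<lambda>z. G bs (square_moduli z)) \<in> radial_class"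
| add: "u \<in> radial_class \<Longrightarrow> w \<in> radial_class \<Longrightarrow> (\<lambda>z. u z + w z) \<in> radial_class"
| scale: "u \<in> radial_class \<Longrightarrow> (\<lambda>z. c * u z) \<in> radial_class"
| coord: "u \<in> radial_class \<Longrightarrow> b \<in> Basis \<Longrightarrow> (\<lambda>z. of_real (z \<bullet> b) * u z) \<in> radial_class"

lemma radial_class_sum:
  assumes "finite I" "\<And>i. i \<in> I \<Longrightarrow> u i \<in> radial_class"
  shows "(\<lambda>z. \<Sum>i\<in>I. u i z) \<in> radial_class" using assms
proof induction
  case empty
  show ?case using radial_class.scale[OF radial_class.base[of "[]"], of 0] by simp
next
  case (insert i I)
  then show ?case using radial_class.add[of "u i" "\<lambda>z. \<Sum>i\<in>I. u i z"] by simp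
qed

lemma radial_class_derivative:
  assumes "u \<in> radial_class"
  shows "(\<forall>z. u differentiable (at z)) \<and> (\<forall>c\<in>Basis. \<exists>w\<in>radial_class. \<forall>z. frechet_derivative u (at z) c = w z)"
  using assms
proof induction
  case (base bs)
  let ?g = "\<lambda>j z. G (axis j 1 # bs) (square_moduli z)"
  show ?case
  proof (intro conjI allI ballI)
    fix z show "(\<lambda>z. G bs (square_moduli z)) differentiable (at z)"
      using jet_square_moduli_has_derivative[OF base] unfolding differentiable_def by blast
  next
    fix c :: "'n::finite phase" assume "c \<in> Basis"
    let ?w = "\<lambda>z. \<Sum>j\<in>UNIV. (of_real (2 * fst c $ j) * (of_real (z \<bullet> (axis j 1, 0)) * ?g j z) + of_real (2 * snd c $ j) * (of_real (z \<bullet> (0, axis j 1)) * ?g j z))"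
    have "?w \<in> radial_class" using base by (intro radial_class_sum radial_class.intros) (auto simp: Basis_prod_def)
    moreover have "frechet_derivative (\<lambda>z. G bs (square_moduli z)) (at z) c = ?w z" for z
      unfolding frechet_derivative_eqI[OF jet_square_moduli_has_derivative[OF base]]
      by (intro sum.cong refl) (cases z; simp add: inner_axis scaleR_conv_of_real algebra_simps)
    ultimately show "\<exists>w\<in>radial_class. \<forall>z. frechet_derivative (\<lambda>z. G bs (square_moduli z)) (at z) c = w z"
      by (intro bexI[of _ ?w] allI)
  qed
next
  case (add u w)
  have du: "u differentiable (at z)" for z using add.IH by blast
  have dw: "w differentiable (at z)" for z using add.IH by blast
  show ?case
  proof (intro conjI allI ballI)
    have hd: "((\<lambda>z. u z + w z) has_derivative (\<lambda>h. frechet_derivative u (at z) h + frechet_derivative w (at z) h)) (at z)" for z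
      by (intro has_derivative_add frechet_derivative_works[THEN iffD1] du dw)
    show "(\<lambda>z. u z + w z) differentiable (at z)" for z using hd unfolding differentiable_def by blast
    fix c :: "'n phase" assume c: "c \<in> Basis"
    obtain u' w' where "u' \<in> radial_class" "w' \<in> radial_class" "\<forall>z. frechet_derivative u (at z) c = u' z" "\<forall>z. frechet_derivative w (at z) c = w' z"
      using add.IH c by blast
    then show "\<exists>v\<in>radial_class. \<forall>z. frechet_derivative (\<lambda>z. u z + w z) (at z) c = v z"
      by (intro bexI[OF _ radial_class.add[of u' w']]) (simp_all add: frechet_derivative_eqI[OF hd])
  qed
next
  case (scale u a)
  have du: "u differentiable (at z)" for z using scale.IH by blast
  show ?case
  proof (intro conjI allI ballI)
    have hd: "((\<lambda>z. a * u z) has_derivative (\<lambda>h. a * frechet_derivative u (at z) h)) (at z)" for z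
      by (intro has_derivative_mult_right frechet_derivative_works[THEN iffD1] du)
    show "(\<lambda>z. a * u z) differentiable (at z)" for z using hd unfolding differentiable_def by blast
    fix c :: "'n phase" assume c: "c \<in> Basis"
    obtain u' where "u' \<in> radial_class" "\<forall>z. frechet_derivative u (at z) c = u' z" using scale.IH c by blast
    then show "\<exists>v\<in>radial_class. \<forall>z. frechet_derivative (\<lambda>z. a * u z) (at z) c = v z"
      by (intro bexI[OF _ radial_class.scale[of u' a]]) (simp_all add: frechet_derivative_eqI[OF hd])
  qed
next
  case (coord u b)
  have du: "u differentiable (at z)" for z using coord.IH by blast
  show ?case
  proof (intro conjI allI ballI)
    have hd: "((\<lambda>z. of_real (z \<bullet> b) * u z) has_derivative (\<lambda>h. of_real (z \<bullet> b) * frechet_derivative u (at z) h + of_real (h \<bullet> b) * u z)) (at z)" for z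
      by (intro has_derivative_mult has_derivative_of_real has_derivative_inner_left has_derivative_ident frechet_derivative_works[THEN iffD1] du)
    show "(\<lambda>z. of_real (z \<bullet> b) * u z) differentiable (at z)" for z using hd unfolding differentiable_def by blast
    fix c :: "'n phase" assume c: "c \<in> Basis"
    obtain u' where u': "u' \<in> radial_class" "\<forall>z. frechet_derivative u (at z) c = u' z" using coord.IH c by blast
    have "(\<lambda>z. of_real (z \<bullet> b) * u' z + of_real (c \<bullet> b) * u z) \<in> radial_class"
      by (intro radial_class.add radial_class.coord radial_class.scale u' coord.hyps)
    then show "\<exists>v\<in>radial_class. \<forall>z. frechet_derivative (\<lambda>z. of_real (z \<bullet> b) * u z) (at z) c = v z"
      by (rule bexI[rotated]) (simp add: frechet_derivative_eqI[OF hd] u'(2))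
  qed
qed

text \<open>The estimate of a number by one plus its square is used twice, from the coordinate to
  the squared modulus and from there to the weight. Decay in the squared moduli therefore dominates
  all monomials on phase space.\<close>

lemma coord_le_weight:
  assumes "c \<in> Basis"
  shows "\<bar>z \<bullet> c\<bar> \<le> 2 * poly_weight (square_moduli z :: real ^ 'n)"
proof -
  obtain j where j: "z \<bullet> c = fst z $ j \<or> z \<bullet> c = snd z $ j"
  proof -
    obtain i where "c = (axis i 1, 0) \<or> c = (0, axis i 1)" using assms unfolding Basis_prod_def Basis_vec_eq_image by blast
    then show ?thesis using that[of i] by (cases z) (auto simp: inner_axis)
  qed
  define v where "v = square_moduli z $ j"
  have "(z \<bullet> c)\<^sup>2 \<le> v" using j by (auto simp: v_def square_moduli_nth)
  moreover have "\<bar>z \<bullet> c\<bar> \<le> 1 + (z \<bullet> c)\<^sup>2" using sum_squares_bound[of 1 "\<bar>z \<bullet> c\<bar>"] by simp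
  moreover have "v \<le> 1 + v\<^sup>2" using sum_squares_bound[of 1 v] zero_le_power2[of v] by (simp only: power_one mult_1_right)
  ultimately have "\<bar>z \<bullet> c\<bar> \<le> 1 + (1 + v\<^sup>2)" by (meson add_left_mono order_trans)
  also have "\<dots> \<le> 2 * (1 + v\<^sup>2)" by simp
  also have "1 + v\<^sup>2 \<le> poly_weight (square_moduli z)"
  proof -
    have "(1 + v\<^sup>2) * 1 \<le> (1 + v\<^sup>2) * (\<Prod>b\<in>Basis - {axis j 1}. 1 + (square_moduli z \<bullet> b)\<^sup>2)"
      by (intro mult_left_mono prod_ge_1) auto
    also have "\<dots> = poly_weight (square_moduli z)"
      unfolding poly_weight_def v_def by (subst prod.remove[of Basis "axis j 1"]) (auto simp: inner_axis)
    finally show ?thesis by simp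
  qed
  finally show ?thesis by simp
qed

lemma radial_class_bound:
  assumes "u \<in> radial_class"
  shows "\<exists>C. \<forall>z. poly_weight (square_moduli z :: real ^ 'n) ^ M * norm (u z) \<le> C" using assms
proof (induction arbitrary: M)
  case (base bs)
  then show ?case using jet_bound[OF base, of M] square_moduli_closed_orthant by blast
next
  case (add u w)
  obtain C D where C: "\<And>z. poly_weight (square_moduli z :: real ^ 'n) ^ M * norm (u z) \<le> C"
    "\<And>z. poly_weight (square_moduli z :: real ^ 'n) ^ M * norm (w z) \<le> D" using add.IH by meson
  have "poly_weight (square_moduli z :: real ^ 'n) ^ M * norm (u z + w z) \<le> C + D" for z
  proof -
    have "poly_weight (square_moduli z :: real ^ 'n) ^ M * norm (u z + w z) \<le> poly_weight (square_moduli z) ^ M * (norm (u z) + norm (w z))"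
      by (intro mult_left_mono norm_triangle_ineq zero_le_power less_imp_le[OF poly_weight_pos])
    with C[of z] show ?thesis by (simp add: distrib_left)
  qed
  then show ?case by blast
next
  case (scale u c)
  obtain C where C: "\<And>z. poly_weight (square_moduli z :: real ^ 'n) ^ M * norm (u z) \<le> C" using scale.IH by meson
  have "poly_weight (square_moduli z :: real ^ 'n) ^ M * norm (c * u z) \<le> norm c * C" for z
    using mult_left_mono[OF C[of z], of "norm c"] by (simp add: norm_mult mult_ac)
  then show ?case by blast
next
  case (coord u b)
  obtain C where C: "\<And>z. poly_weight (square_moduli z :: real ^ 'n) ^ Suc M * norm (u z) \<le> C" using coord.IH by meson
  have "poly_weight (square_moduli z :: real ^ 'n) ^ M * norm (of_real (z \<bullet> b) * u z) \<le> 2 * C" for z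
  proof -
    have "poly_weight (square_moduli z :: real ^ 'n) ^ M * norm (of_real (z \<bullet> b) * u z) = poly_weight (square_moduli z :: real ^ 'n) ^ M * norm (u z) * \<bar>z \<bullet> b\<bar>"
      by (simp add: norm_mult)
    also have "\<dots> \<le> poly_weight (square_moduli z :: real ^ 'n) ^ M * norm (u z) * (2 * poly_weight (square_moduli z))"
      by (intro mult_left_mono coord_le_weight coord.hyps mult_nonneg_nonneg zero_le_power less_imp_le[OF poly_weight_pos]) auto
    also have "\<dots> \<le> 2 * C" using C[of z] by (simp add: mult_ac)
    finally show ?thesis .
  qed
  then show ?case by blast
qed

lemma radial_class_schwartz:
  assumes "u \<in> radial_class"
  shows "u \<in> schwartz"
proof (rule schwartz_closed_class[OF assms])
  show "u \<in> radial_class \<Longrightarrow> u differentiable (at z)" for u z using radial_class_derivative by blast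
  show "u \<in> radial_class \<Longrightarrow> b \<in> Basis \<Longrightarrow> \<exists>w\<in>radial_class. \<forall>z. frechet_derivative u (at z) b = w z" for u b
    using radial_class_derivative by blast
  fix u and k :: "'n::finite phase \<Rightarrow> nat" assume u: "u \<in> radial_class"
  define M where "M = (\<Sum>b\<in>Basis. k b)"
  obtain C where C: "\<And>z. poly_weight (square_moduli z :: real ^ 'n) ^ M * norm (u z) \<le> C" using radial_class_bound[OF u] by meson
  have "\<bar>monomial k z\<bar> * norm (u z) \<le> 2 ^ M * C" for z
  proof -
    have "\<bar>monomial k z\<bar> = (\<Prod>b\<in>Basis. \<bar>z \<bullet> b\<bar> ^ k b)" by (simp add: monomial_def abs_prod power_abs)
    also have "\<dots> \<le> (\<Prod>b\<in>Basis. (2 * poly_weight (square_moduli z :: real ^ 'n)) ^ k b)"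
      by (intro prod_mono conjI power_mono coord_le_weight) auto
    also have "\<dots> = (2 * poly_weight (square_moduli z :: real ^ 'n)) ^ M" unfolding M_def by (rule power_sum[symmetric])
    finally have "\<bar>monomial k z\<bar> * norm (u z) \<le> (2 * poly_weight (square_moduli z :: real ^ 'n)) ^ M * norm (u z)"
      by (intro mult_right_mono) auto
    also have "\<dots> = 2 ^ M * (poly_weight (square_moduli z :: real ^ 'n) ^ M * norm (u z))" by (simp add: power_mult_distrib)
    also have "\<dots> \<le> 2 ^ M * C" by (intro mult_left_mono C) auto
    finally show ?thesis .
  qed
  then show "\<exists>c. \<forall>z. \<bar>monomial k z\<bar> * norm (u z) \<le> c" by blast
qed

text \<open>The limit in \<open>orthant_extension\<close> determines a value only where the open
  orthant accumulates; the diagonal shift supplies nearby points different from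
  \<open>x\<close>.\<close>

lemma orthant_extension_eq_jet:
  assumes x: "x \<in> closed_orthant"
  shows "orthant_extension f x = G [] x" unfolding orthant_extension_def
proof (rule tendsto_Lim)
  have "x islimpt pos_orthant" unfolding islimpt_approachable
  proof (intro allI impI)
    fix e :: real assume "0 < e"
    define y where "y = x + (e / (2 * (norm ((\<chi> i. 1) :: real ^ 'n) + 1))) *\<^sub>R ((\<chi> i. 1) :: real ^ 'n)"
    have n: "0 < norm ((\<chi> i. 1) :: real ^ 'n) + 1" by (simp add: add_nonneg_pos)
    have y: "y \<in> pos_orthant" unfolding y_def using n \<open>0 < e\<close> by (intro orthant_shift x) simp
    have "y \<noteq> x"
    proof
      assume "y = x"
      then have "e / (2 * (norm ((\<chi> i. 1) :: real ^ 'n) + 1)) = 0" by (simp add: y_def vec_eq_iff)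
      with n \<open>0 < e\<close> show False by simp
    qed
    moreover have "dist y x < e"
    proof -
      have "dist y x = e / (2 * (norm ((\<chi> i. 1) :: real ^ 'n) + 1)) * norm ((\<chi> i. 1) :: real ^ 'n)"
        using n \<open>0 < e\<close> by (simp add: y_def dist_norm)
      also have "\<dots> < e" using n \<open>0 < e\<close> by (simp add: field_simps) (smt (verit) mult_nonneg_nonneg norm_ge_zero)
      finally show ?thesis .
    qed
    ultimately show "\<exists>x'\<in>pos_orthant. x' \<noteq> x \<and> dist x' x < e" using y by blast
  qed
  then show "at x within pos_orthant \<noteq> bot" by (simp add: trivial_limit_within)
  have "(G [] \<longlongrightarrow> G [] x) (at x within closed_orthant)" using G x by (simp add: orthant_jets_def continuous_on_def)
  then have "(G [] \<longlongrightarrow> G [] x) (at x within pos_orthant)" by (rule tendsto_within_subset[OF _ pos_orthant_subset])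
  then show "(f \<longlongrightarrow> G [] x) (at x within pos_orthant)"
    by (rule Lim_transform_eventually) (use G in \<open>auto simp: eventually_at_filter orthant_jets_def intro!: always_eventually\<close>)
qed

lemma orthant_extension_square_moduli_schwartz:
  "orthant_extension f \<circ> square_moduli \<in> schwartz"
proof -
  have "orthant_extension f \<circ> square_moduli = (\<lambda>z. G [] (square_moduli z))"
    by (auto simp: orthant_extension_eq_jet square_moduli_closed_orthant)
  then show ?thesis using radial_class_schwartz[OF radial_class.base[of "[]"]] by simp
qed

end

section \<open>The dilation by 2\<close>

lemma has_derivative_dilate2:
  fixes g :: "'a::real_normed_vector \<Rightarrow> complex"
  assumes "(g has_derivative D) (at (2 *\<^sub>R x))"
  shows "((\<lambda>x. c * g (2 *\<^sub>R x)) has_derivative (\<lambda>h. c * D (2 *\<^sub>R h))) (at x)"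
proof (rule has_derivative_mult_right)
  have "((\<lambda>x. 2 *\<^sub>R x) has_derivative (\<lambda>h. 2 *\<^sub>R h)) (at x)" by (auto intro!: derivative_eq_intros)
  then show "((\<lambda>x. g (2 *\<^sub>R x)) has_derivative (\<lambda>h. D (2 *\<^sub>R h))) (at x)" using assms by (rule has_derivative_compose)
qed

lemma partial_derivs_dilate2:
  assumes f: "smooth_on pos_orthant f" and bs: "set bs \<subseteq> Basis" and x: "x \<in> pos_orthant"
  shows "partial_derivs bs (dilate2 f) x = 2 ^ length bs * partial_derivs bs f (2 *\<^sub>R x)" using bs x
proof (induction bs arbitrary: x)
  case Nil
  then show ?case by (simp add: dilate2_def)
next
  case (Cons b bs)
  have x2: "2 *\<^sub>R x \<in> pos_orthant" using Cons.prems by (simp add: pos_orthant_def)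
  define D where "D = frechet_derivative (partial_derivs bs f) (at (2 *\<^sub>R x))"
  have diff: "partial_derivs bs f differentiable (at (2 *\<^sub>R x))" using Cons.prems by (intro smooth_onD[OF f _ x2]) auto
  then have D: "(partial_derivs bs f has_derivative D) (at (2 *\<^sub>R x))" by (simp add: D_def frechet_derivative_works)
  have "((\<lambda>x. 2 ^ length bs * partial_derivs bs f (2 *\<^sub>R x)) has_derivative (\<lambda>h. 2 ^ length bs * D (2 *\<^sub>R h))) (at x)"
    by (rule has_derivative_dilate2[OF D])
  then have "frechet_derivative (\<lambda>x. 2 ^ length bs * partial_derivs bs f (2 *\<^sub>R x)) (at x) b = 2 ^ length bs * D (2 *\<^sub>R b)"
    by (simp add: frechet_derivative_eqI)
  moreover have "frechet_derivative (partial_derivs bs (dilate2 f)) (at x) = frechet_derivative (\<lambda>x. 2 ^ length bs * partial_derivs bs f (2 *\<^sub>R x)) (at x)"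
    by (rule frechet_derivative_cong_open(1)[OF open_pos_orthant Cons.prems(2)]) (use Cons in auto)
  moreover have "D (2 *\<^sub>R b) = 2 * D b"
  proof -
    have "D (2 *\<^sub>R b) = 2 *\<^sub>R D b" using linear_scale[OF linear_frechet_derivative[OF diff], of 2 b] unfolding D_def .
    then show ?thesis by (simp add: scaleR_conv_of_real)
  qed
  ultimately show ?case by (simp add: D_def)
qed

lemma dilate2_schwartz_orthant:
  fixes f :: "real ^ 'n::finite \<Rightarrow> complex"
  assumes f: "f \<in> schwartz_orthant"
  shows "dilate2 f \<in> schwartz_orthant" unfolding schwartz_orthant_def
proof (intro CollectI conjI allI impI)
  have fs: "smooth_on pos_orthant f" "schwartz_bounds pos_orthant f" using f by (auto simp: schwartz_orthant_def)
  obtain G where G: "orthant_jets f G" using orthant_jets_exist[OF f] .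
  have x2: "2 *\<^sub>R x \<in> pos_orthant" if "x \<in> pos_orthant" for x :: "real ^ 'n" using that by (simp add: pos_orthant_def)
  show "smooth_on pos_orthant (dilate2 f)" unfolding smooth_on_def
  proof (intro allI impI ballI)
    fix bs :: "(real ^ 'n) list" and x :: "real ^ 'n" assume bs: "set bs \<subseteq> Basis" and x: "x \<in> pos_orthant"
    have "(\<lambda>x. 2 ^ length bs * partial_derivs bs f (2 *\<^sub>R x)) differentiable (at x)"
      using smooth_onD[OF fs(1) bs x2[OF x]] has_derivative_dilate2 unfolding differentiable_def by blast
    then show "partial_derivs bs (dilate2 f) differentiable (at x)"
      using frechet_derivative_cong_open(2)[OF open_pos_orthant x, of "partial_derivs bs (dilate2 f)" "\<lambda>x. 2 ^ length bs * partial_derivs bs f (2 *\<^sub>R x)"]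
        partial_derivs_dilate2[OF fs(1) bs] by simp
  qed
  show "\<exists>g. continuous_on closed_orthant g \<and> (\<forall>x\<in>pos_orthant. g x = partial_derivs bs (dilate2 f) x)" if bs: "set bs \<subseteq> Basis" for bs
  proof (intro exI[of _ "\<lambda>x. 2 ^ length bs * G bs (2 *\<^sub>R x)"] conjI ballI)
    have "continuous_on closed_orthant (G bs)" using G bs by (simp add: orthant_jets_def)
    then have "continuous_on closed_orthant (\<lambda>x. G bs (2 *\<^sub>R x))"
      by (rule continuous_on_compose2[of closed_orthant "G bs" closed_orthant "\<lambda>x. 2 *\<^sub>R x"])
        (auto simp: closed_orthant_def intro!: continuous_on_scaleR continuous_on_const continuous_on_id)
    then show "continuous_on closed_orthant (\<lambda>x. 2 ^ length bs * G bs (2 *\<^sub>R x))" by (intro continuous_on_mult continuous_on_const)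
    fix x :: "real ^ 'n" assume x: "x \<in> pos_orthant"
    show "2 ^ length bs * G bs (2 *\<^sub>R x) = partial_derivs bs (dilate2 f) x"
      using G bs x2[OF x] by (simp add: partial_derivs_dilate2[OF fs(1) bs x] orthant_jets_def)
  qed
  show "schwartz_bounds pos_orthant (dilate2 f)" unfolding schwartz_bounds_def
  proof (intro allI impI)
    fix k and bs :: "(real ^ 'n) list" assume bs: "set bs \<subseteq> Basis"
    obtain C where C: "\<And>x. x \<in> pos_orthant \<Longrightarrow> weighted_deriv k bs f x \<le> C"
      using fs(2) bs unfolding schwartz_bounds_def bdd_above_def by (meson imageI)
    have "weighted_deriv k bs (dilate2 f) x \<le> 2 ^ length bs * C" if x: "x \<in> pos_orthant" for x
    proof -
      have "\<bar>monomial k x\<bar> \<le> \<bar>monomial k (2 *\<^sub>R x)\<bar>"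
        unfolding monomial_def abs_prod power_abs by (intro prod_mono conjI power_mono) auto
      then have "weighted_deriv k bs (dilate2 f) x \<le> \<bar>monomial k (2 *\<^sub>R x)\<bar> * (2 ^ length bs * norm (partial_derivs bs f (2 *\<^sub>R x)))"
        unfolding weighted_deriv_def partial_derivs_dilate2[OF fs(1) bs x] norm_mult by (intro mult_mono) (auto simp: norm_power)
      also have "\<dots> = 2 ^ length bs * weighted_deriv k bs f (2 *\<^sub>R x)" by (simp add: weighted_deriv_def)
      also have "\<dots> \<le> 2 ^ length bs * C" by (intro mult_left_mono C x2 x) simp
      finally show ?thesis .
    qed
    then show "bdd_above (weighted_deriv k bs (dilate2 f) ` pos_orthant)" by (rule bdd_aboveI2)
  qed
qed

lemma radial_symbol_schwartz:
  assumes "\<sigma> \<in> schwartz_orthant"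
  shows "radial_symbol \<sigma> \<in> schwartz"
proof -
  have d: "dilate2 \<sigma> \<in> schwartz_orthant" by (rule dilate2_schwartz_orthant[OF assms])
  obtain G where "orthant_jets (dilate2 \<sigma>) G" using orthant_jets_exist[OF d] .
  then show ?thesis unfolding radial_symbol_def using d by (intro orthant_extension_square_moduli_schwartz) (auto simp: schwartz_orthant_def)
qed

section \<open>Wigner functions and Laguerre polynomials\<close>

abbreviation wave :: "real \<Rightarrow> real \<Rightarrow> complex" where
  "wave p \<xi> \<equiv> exp (\<i> * of_real (p * \<xi>))"

abbreviation hermite_pair :: "nat \<Rightarrow> nat \<Rightarrow> real \<Rightarrow> real \<Rightarrow> real" where
  "hermite_pair k m x p \<equiv> hermite_fun1 k (x - p / 2) * hermite_fun1 m (x + p / 2)"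

text \<open>The cross-Wigner function of h_k and h_m in one degree of freedom, unnormalised; the
  powers of \<open>2 * pi\<close> stay with the operator.\<close>

definition wigner1 :: "nat \<Rightarrow> nat \<Rightarrow> real \<times> real \<Rightarrow> complex" where
  "wigner1 k m z = (LINT p|lborel. wave p (snd z) *
     of_real (hermite_pair k m (fst z) p))"

lemma integrable_hermite_pair:
  fixes x \<xi> :: real
  shows "integrable lborel (\<lambda>p. wave p \<xi> * complex_of_real (hermite_pair k m x p))"
proof -
  obtain C where C: "\<And>t. \<bar>hermite_fun1 k t\<bar> \<le> C / (1 + t\<^sup>2) ^ 1" using hermite_fun1_decay by blast
  have C0: "0 \<le> C" using C[of 0] by simp
  have "integrable lborel (\<lambda>p. 1 / (1 + (x - p / 2)\<^sup>2))"
    using integrable_scale_shift_real[of "- (1 / 2)", OF _ integrable_inverse_1_plus_square', of x] by simp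
  then have I: "integrable lborel (\<lambda>p. C * (2 * (1 + real m)) * (1 / (1 + (x - p / 2)\<^sup>2)))" by (rule integrable_mult_right)
  show ?thesis
  proof (rule Bochner_Integration.integrable_bound[OF I])
    show "AE p in lborel. norm (wave p \<xi> * complex_of_real (hermite_pair k m x p))
        \<le> norm (C * (2 * (1 + real m)) * (1 / (1 + (x - p / 2)\<^sup>2)))"
    proof (rule AE_I2)
      fix p :: real
      have "norm (wave p \<xi> * complex_of_real (hermite_pair k m x p))
          = \<bar>hermite_fun1 k (x - p / 2)\<bar> * \<bar>hermite_fun1 m (x + p / 2)\<bar>"
        unfolding norm_mult norm_exp_i_times norm_of_real by (simp add: abs_mult)
      also have "\<dots> \<le> (C / (1 + (x - p / 2)\<^sup>2) ^ 1) * (2 * (1 + real m))" by (rule mult_mono[OF C hermite_fun1_bound]) (use C0 in auto)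
      also have "\<dots> = C * (2 * (1 + real m)) * (1 / (1 + (x - p / 2)\<^sup>2))" by simp
      finally show "norm (wave p \<xi> * complex_of_real (hermite_pair k m x p))
          \<le> norm (C * (2 * (1 + real m)) * (1 / (1 + (x - p / 2)\<^sup>2)))" by (rule order_trans) (simp only: real_norm_def abs_ge_self)
    qed
  qed measurable
qed

text \<open>Four terms because each ladder identity below raises and lowers either of the two
  indices.\<close>

lemma wigner1_lin:
  assumes "\<And>s t. a1 * (hermite_fun1 k1 s * hermite_fun1 m1 t) + a2 * (hermite_fun1 k2 s * hermite_fun1 m2 t)
    + (a3 * (hermite_fun1 k3 s * hermite_fun1 m3 t) + a4 * (hermite_fun1 k4 s * hermite_fun1 m4 t)) = g s t"
  shows "of_real a1 * wigner1 k1 m1 z + of_real a2 * wigner1 k2 m2 z + (of_real a3 * wigner1 k3 m3 z + of_real a4 * wigner1 k4 m4 z)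
    = (LINT p|lborel. wave p (snd z) * of_real (g (fst z - p / 2) (fst z + p / 2)))"
proof -
  have "wave p (snd z) * complex_of_real (g (fst z - p / 2) (fst z + p / 2))
    = of_real a1 * (wave p (snd z) * of_real (hermite_pair k1 m1 (fst z) p))
    + of_real a2 * (wave p (snd z) * of_real (hermite_pair k2 m2 (fst z) p))
    + (of_real a3 * (wave p (snd z) * of_real (hermite_pair k3 m3 (fst z) p))
    + of_real a4 * (wave p (snd z) * of_real (hermite_pair k4 m4 (fst z) p)))" for p
    unfolding assms[symmetric] of_real_add of_real_mult by (simp only: algebra_simps)
  then show ?thesis unfolding wigner1_def by (simp only: integral_mult_right_zero Bochner_Integration.integral_add Bochner_Integration.integrable_add
        integrable_mult_right integrable_hermite_pair)
qed

text \<open>The position is half the sum of the two arguments at which the Hermite functions are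
  taken, so it acts as the average of the multiplication operators on the two factors.\<close>

lemma wigner1_position:
  "of_real (fst z) * wigner1 k m z = (1 / 2) *
    (of_real (sqrt (real (Suc k) / 2)) * wigner1 (Suc k) m z + of_real (sqrt (real k / 2)) * wigner1 (k - 1) m z +
     (of_real (sqrt (real (Suc m) / 2)) * wigner1 k (Suc m) z + of_real (sqrt (real m / 2)) * wigner1 k (m - 1) z))"
proof -
  have "of_real (sqrt (real (Suc k) / 2)) * wigner1 (Suc k) m z + of_real (sqrt (real k / 2)) * wigner1 (k - 1) m z +
     (of_real (sqrt (real (Suc m) / 2)) * wigner1 k (Suc m) z + of_real (sqrt (real m / 2)) * wigner1 k (m - 1) z)
    = (LINT p|lborel. wave p (snd z) *
        of_real ((\<lambda>s t. (s + t) * (hermite_fun1 k s * hermite_fun1 m t)) (fst z - p / 2) (fst z + p / 2)))"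
  proof (rule wigner1_lin)
    fix s t
    have "(s + t) * (hermite_fun1 k s * hermite_fun1 m t) = (s * hermite_fun1 k s) * hermite_fun1 m t + (t * hermite_fun1 m t) * hermite_fun1 k s"
      by (simp only: algebra_simps)
    then show "sqrt (real (Suc k) / 2) * (hermite_fun1 (Suc k) s * hermite_fun1 m t) + sqrt (real k / 2) * (hermite_fun1 (k - 1) s * hermite_fun1 m t)
      + (sqrt (real (Suc m) / 2) * (hermite_fun1 k s * hermite_fun1 (Suc m) t) + sqrt (real m / 2) * (hermite_fun1 k s * hermite_fun1 (m - 1) t))
      = (s + t) * (hermite_fun1 k s * hermite_fun1 m t)" unfolding hermite_fun1_mult by (simp only: algebra_simps)
  qed
  also have "\<dots> = (LINT p|lborel. of_real (2 * fst z) * (wave p (snd z) *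
        of_real (hermite_pair k m (fst z) p)))"
    by (intro Bochner_Integration.integral_cong refl) (simp add: algebra_simps)
  also have "\<dots> = of_real (2 * fst z) * wigner1 k m z" unfolding wigner1_def by (rule integral_mult_right_zero)
  finally show ?thesis by simp
qed

text \<open>Integration by parts in the integration variable.\<close>

lemma wigner1_momentum:
  "\<i> * of_real (snd z) * wigner1 k m z = (1 / 2) *
    (of_real (- sqrt (real (Suc k) / 2)) * wigner1 (Suc k) m z + of_real (sqrt (real k / 2)) * wigner1 (k - 1) m z +
     (of_real (sqrt (real (Suc m) / 2)) * wigner1 k (Suc m) z + of_real (- sqrt (real m / 2)) * wigner1 k (m - 1) z))"
proof -
  define x \<xi> where "x = fst z" and "\<xi> = snd z"
  define d where "d j t = sqrt (real j / 2) * hermite_fun1 (j - 1) t - sqrt (real (Suc j) / 2) * hermite_fun1 (Suc j) t" for j t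
  define g where "g s t = d k s * hermite_fun1 m t - hermite_fun1 k s * d m t" for s t
  define \<Psi> where "\<Psi> p = wave p \<xi> * complex_of_real (hermite_pair k m x p)" for p
  \<comment> \<open>The derivative of \<Psi>: the first part comes from the wave; in the second the
    arguments move by one half in opposite directions, whence the difference in \<open>g\<close> and
    the factor one half.\<close>
  define D where "D p = \<i> * of_real \<xi> * \<Psi> p - (1 / 2) * (wave p \<xi> * of_real (g (x - p / 2) (x + p / 2)))" for p
  have lin: "of_real (- sqrt (real (Suc k) / 2)) * wigner1 (Suc k) m z + of_real (sqrt (real k / 2)) * wigner1 (k - 1) m z +
     (of_real (sqrt (real (Suc m) / 2)) * wigner1 k (Suc m) z + of_real (- sqrt (real m / 2)) * wigner1 k (m - 1) z)
     = (LINT p|lborel. wave p (snd z) * of_real (g (fst z - p / 2) (fst z + p / 2)))"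
    by (rule wigner1_lin) (simp add: g_def d_def algebra_simps)
  have gi: "integrable lborel (\<lambda>p. wave p \<xi> * complex_of_real (g (x - p / 2) (x + p / 2)))"
  proof -
    have "wave p \<xi> * complex_of_real (g (x - p / 2) (x + p / 2))
      = of_real (- sqrt (real (Suc k) / 2)) * (wave p \<xi> * of_real (hermite_pair (Suc k) m x p))
      + of_real (sqrt (real k / 2)) * (wave p \<xi> * of_real (hermite_pair (k - 1) m x p))
      + (of_real (sqrt (real (Suc m) / 2)) * (wave p \<xi> * of_real (hermite_pair k (Suc m) x p))
      + of_real (- sqrt (real m / 2)) * (wave p \<xi> * of_real (hermite_pair k (m - 1) x p)))" for p
      by (simp add: g_def d_def algebra_simps)
    then show ?thesis by (simp only:) (intro Bochner_Integration.integrable_add integrable_mult_right integrable_hermite_pair)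
  qed
  have \<Psi>i: "integrable lborel \<Psi>" unfolding \<Psi>_def by (rule integrable_hermite_pair)
  have "(LINT p|lborel. D p) = 0"
  proof (rule integral_dir_derivative_eq_zero[where \<Psi> = \<Psi> and b = "1::real"])
    have hd: "(\<Psi> has_vector_derivative D p) (at p)" for p
    proof -
      have e: "((\<lambda>p. wave p \<xi>) has_vector_derivative \<i> * of_real \<xi> * wave p \<xi>) (at p)"
      proof -
        have "((\<lambda>w. exp (\<i> * of_real \<xi> * w)) has_field_derivative \<i> * of_real \<xi> * exp (\<i> * of_real \<xi> * of_real p)) (at (of_real p))"
          by (auto intro!: derivative_eq_intros)
        from field_vector_diff_chain_at[OF has_vector_derivative_of_real[OF DERIV_ident] this]
        show ?thesis by (simp add: o_def mult_ac)
      qed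
      have "((\<lambda>p. hermite_pair k m x p) has_field_derivative - (1 / 2) * g (x - p / 2) (x + p / 2)) (at p)"
      proof -
        have 1: "((\<lambda>p. hermite_fun1 k (x - p / 2)) has_field_derivative d k (x - p / 2) * (- (1 / 2))) (at p)"
          unfolding d_def by (rule DERIV_chain2[OF hermite_fun1_deriv]) (auto intro!: derivative_eq_intros)
        have 2: "((\<lambda>p. hermite_fun1 m (x + p / 2)) has_field_derivative d m (x + p / 2) * (1 / 2)) (at p)"
          unfolding d_def by (rule DERIV_chain2[OF hermite_fun1_deriv]) (auto intro!: derivative_eq_intros)
        show ?thesis by (rule DERIV_cong[OF DERIV_mult[OF 1 2]]) (simp add: g_def algebra_simps)
      qed
      then have "((\<lambda>p. complex_of_real (hermite_pair k m x p)) has_vector_derivative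
          of_real (- (1 / 2) * g (x - p / 2) (x + p / 2))) (at p)" by (rule has_vector_derivative_of_real)
      from has_vector_derivative_mult[OF e this]
      show ?thesis unfolding \<Psi>_def[abs_def] D_def by (simp add: \<Psi>_def algebra_simps)
    qed
    then have hd': "(\<Psi> has_derivative (\<lambda>h. h *\<^sub>R D p)) (at p)" for p by (simp add: has_vector_derivative_def)
    show "\<Psi> differentiable (at p)" for p using hd' unfolding differentiable_def by blast
    show "frechet_derivative \<Psi> (at p) 1 = D p" for p using frechet_derivative_eqI[OF hd'] by simp
    show "continuous_on UNIV D" unfolding D_def \<Psi>_def g_def d_def by (intro continuous_intros) auto
    show "integrable lborel \<Psi>" by (rule \<Psi>i)
    show "integrable lborel D" unfolding D_def by (intro Bochner_Integration.integrable_diff integrable_mult_right \<Psi>i gi)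
  qed
  then have "\<i> * of_real \<xi> * (LINT p|lborel. \<Psi> p) = (1 / 2) * (LINT p|lborel. wave p \<xi> * of_real (g (x - p / 2) (x + p / 2)))"
    unfolding D_def by (simp only: integral_mult_right_zero Bochner_Integration.integral_diff integrable_mult_right \<Psi>i gi right_minus_eq)
  then show ?thesis unfolding lin unfolding wigner1_def \<Psi>_def x_def \<xi>_def .
qed

abbreviation cpair :: "real \<times> real \<Rightarrow> complex" where
  "cpair z \<equiv> Complex (fst z) (snd z)"

lemma cpair_eq: "cpair z = of_real (fst z) + \<i> * of_real (snd z)" by (simp add: complex_eq_iff)

lemma cnj_cpair_eq: "cnj (cpair z) = of_real (fst z) - \<i> * of_real (snd z)" by (simp add: complex_eq_iff)

text \<open>In position plus \<i> times momentum half of the ladder terms cancel: only lowering of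
  \<open>k\<close> and raising of \<open>m\<close> remain. The conjugate combination exchanges the
  roles of the two indices.\<close>

lemma wigner1_up_right:
  "cpair z * wigner1 k m z = of_real (sqrt (real k / 2)) * wigner1 (k - 1) m z + of_real (sqrt (real (Suc m) / 2)) * wigner1 k (Suc m) z"
  unfolding cpair_eq distrib_right wigner1_position wigner1_momentum by (simp add: algebra_simps)

lemma wigner1_up_left:
  "cnj (cpair z) * wigner1 k m z = of_real (sqrt (real (Suc k) / 2)) * wigner1 (Suc k) m z + of_real (sqrt (real m / 2)) * wigner1 k (m - 1) z"
  unfolding cnj_cpair_eq left_diff_distrib wigner1_position wigner1_momentum by (simp add: algebra_simps)

text \<open>The product of the two ground states separates into a Gaussian in \<open>x\<close> and
  one in \<open>p\<close>, and the integral over \<open>p\<close> is the characteristic function of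
  the standard normal law at \<open>sqrt 2 * \<xi>\<close>.\<close>

lemma wigner1_00: "wigner1 0 0 z = of_real (2 * exp (- ((fst z)\<^sup>2 + (snd z)\<^sup>2)))"
proof -
  define x \<xi> where "x = fst z" and "\<xi> = snd z"
  have h: "hermite_pair 0 0 x p = exp (- (x\<^sup>2)) / sqrt pi * exp (- (p\<^sup>2) / 4)" for p
  proof -
    have "hermite_pair 0 0 x p = (exp (- ((x - p / 2)\<^sup>2) / 2) * exp (- ((x + p / 2)\<^sup>2) / 2)) / (hermite_norm 0 * hermite_norm 0)"
      by (simp add: hermite_fun1_eq)
    also have "exp (- ((x - p / 2)\<^sup>2) / 2) * exp (- ((x + p / 2)\<^sup>2) / 2) = exp (- (x\<^sup>2)) * exp (- (p\<^sup>2) / 4)"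
      unfolding exp_add[symmetric] by (simp add: power2_eq_square field_simps)
    also have "hermite_norm 0 * hermite_norm 0 = sqrt pi" by (simp add: hermite_norm_def)
    finally show ?thesis by simp
  qed
  have char: "(LINT s|lborel. std_normal_density s *\<^sub>R exp (\<i> * of_real (t * s))) = of_real (exp (- (t\<^sup>2) / 2))" for t
  proof -
    have "char std_normal_distribution t = of_real (exp (- (t\<^sup>2) / 2))" by (simp add: char_std_normal_distribution)
    then show ?thesis unfolding char_def by (subst (asm) integral_density) auto
  qed
  \<comment> \<open>The integrand after the substitution \<open>p = sqrt 2 * s\<close>.\<close>
  define F where "F s = std_normal_density s *\<^sub>R exp (\<i> * complex_of_real (sqrt 2 * \<xi> * s))" for s
  have Fi: "integrable lborel F"
  proof (rule Bochner_Integration.integrable_bound)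
    show "integrable lborel std_normal_density" by (rule integrable_normal_density) simp
    show "AE s in lborel. norm (F s) \<le> norm (std_normal_density s)" by (simp add: F_def)
    show "F \<in> borel_measurable lborel" unfolding F_def by measurable
  qed
  have sc: "(LINT s|lborel. F s) = (1 / sqrt 2) *\<^sub>R (LINT p|lborel. F ((1 / sqrt 2) * p))"
    using integral_scale_shift[of "1 / sqrt 2" F 0] Fi by simp
  have F: "F ((1 / sqrt 2) * p) = of_real (1 / sqrt (2 * pi)) * (wave p \<xi> * of_real (exp (- (p\<^sup>2) / 4)))" for p
  proof -
    have "(1 / sqrt 2 * p)\<^sup>2 / 2 = p\<^sup>2 / 4" by (simp add: power_mult_distrib power_divide)
    moreover have "sqrt 2 * \<xi> * (1 / sqrt 2 * p) = p * \<xi>" by simp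
    ultimately show ?thesis unfolding F_def std_normal_density_def by (simp add: scaleR_conv_of_real mult_ac)
  qed
  have "wigner1 0 0 z = (LINT p|lborel. of_real (exp (- (x\<^sup>2)) / sqrt pi) * (wave p \<xi> * of_real (exp (- (p\<^sup>2) / 4))))"
    unfolding wigner1_def x_def[symmetric] \<xi>_def[symmetric] h by (simp only: of_real_mult mult_ac)
  also have "\<dots> = of_real (exp (- (x\<^sup>2)) / sqrt pi) * (LINT p|lborel. wave p \<xi> * of_real (exp (- (p\<^sup>2) / 4)))"
    by (rule integral_mult_right_zero)
  also have "(LINT p|lborel. wave p \<xi> * of_real (exp (- (p\<^sup>2) / 4))) = of_real (2 * sqrt pi * exp (- (\<xi>\<^sup>2)))"
  proof -
    let ?I = "LINT p|lborel. wave p \<xi> * complex_of_real (exp (- (p\<^sup>2) / 4))"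
    have "(LINT s|lborel. F s) = of_real (exp (- ((sqrt 2 * \<xi>)\<^sup>2) / 2))" unfolding F_def by (rule char)
    also have "- ((sqrt 2 * \<xi>)\<^sup>2) / 2 = - (\<xi>\<^sup>2)" by (simp add: power_mult_distrib)
    finally have "of_real (exp (- (\<xi>\<^sup>2))) = (1 / sqrt 2) *\<^sub>R (of_real (1 / sqrt (2 * pi)) * ?I)"
      unfolding sc F by (simp only: integral_mult_right_zero)
    also have "\<dots> = of_real (1 / sqrt 2 * (1 / sqrt (2 * pi))) * ?I" by (simp add: scaleR_conv_of_real)
    also have "1 / sqrt 2 * (1 / sqrt (2 * pi)) = 1 / (2 * sqrt pi)" by (simp add: real_sqrt_mult)
    finally show ?thesis by (simp add: field_simps)
  qed
  also have "of_real (exp (- (x\<^sup>2)) / sqrt pi) * complex_of_real (2 * sqrt pi * exp (- (\<xi>\<^sup>2))) = of_real (2 * (exp (- (x\<^sup>2)) * exp (- (\<xi>\<^sup>2))))"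
  proof -
    have "exp (- (x\<^sup>2)) / sqrt pi * (2 * sqrt pi * exp (- (\<xi>\<^sup>2))) = 2 * (exp (- (x\<^sup>2)) * exp (- (\<xi>\<^sup>2)))" by simp
    then show ?thesis by (simp only: of_real_mult[symmetric])
  qed
  also have "exp (- (x\<^sup>2)) * exp (- (\<xi>\<^sup>2)) = exp (- ((fst z)\<^sup>2 + (snd z)\<^sup>2))"
    unfolding exp_add[symmetric] x_def \<xi>_def by simp
  finally show ?thesis .
qed

text \<open>Raising \<open>m\<close> multiplies by the complex coordinate and contributes a factor
  \<open>c\<close>; raising \<open>k\<close> multiplies by its conjugate and contributes the inverse
  of \<open>c\<close>, written here without division. The starting function
  \<open>wigner1 0 0\<close> is rotation invariant.\<close>

lemma wigner1_rotate:
  assumes "cpair w = c * cpair z" "cmod c = 1"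
  shows "wigner1 k m w * c ^ k = c ^ m * wigner1 k m z"
proof -
  have cc: "c * cnj c = 1" using complex_norm_square[of c] assms(2) by simp
  have norm_eq: "(fst w)\<^sup>2 + (snd w)\<^sup>2 = (fst z)\<^sup>2 + (snd z)\<^sup>2"
  proof -
    have "(cmod (cpair w))\<^sup>2 = (cmod (cpair z))\<^sup>2" using assms by (simp add: norm_mult)
    then show ?thesis by (simp add: cmod_power2)
  qed
  have pos: "sqrt (real (Suc j) / 2) \<noteq> 0" for j by simp
  \<comment> \<open>For \<open>k = 0\<close> the lowering term in the ladder identity vanishes, so
    the functions with index \<open>m\<close> arise from the radial one by multiplication
    alone.\<close>
  have z0: "wigner1 0 m w = c ^ m * wigner1 0 m z" for m
  proof (induction m)
    case 0
    show ?case by (simp add: wigner1_00 norm_eq)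
  next
    case (Suc m)
    have "of_real (sqrt (real (Suc m) / 2)) * wigner1 0 (Suc m) w = cpair w * wigner1 0 m w" using wigner1_up_right[of w 0 m] by simp
    also have "\<dots> = c ^ Suc m * (cpair z * wigner1 0 m z)" unfolding assms(1) Suc by simp
    also have "\<dots> = of_real (sqrt (real (Suc m) / 2)) * (c ^ Suc m * wigner1 0 (Suc m) z)" using wigner1_up_right[of z 0 m] by simp
    finally show ?case using pos[of m] by simp
  qed
  show ?thesis
  proof (induction k arbitrary: m)
    case 0
    then show ?case using z0 by simp
  next
    case (Suc k)
    have cj: "cnj (cpair w) * c = cnj (cpair z)" unfolding assms(1) using cc by (simp add: mult_ac)
    have low: "of_real (sqrt (real m / 2)) * wigner1 k (m - 1) w * c ^ Suc k = of_real (sqrt (real m / 2)) * (c ^ m * wigner1 k (m - 1) z)"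
    proof (cases m)
      case (Suc m')
      have "wigner1 k m' w * c ^ Suc k = c * (wigner1 k m' w * c ^ k)" by simp
      also have "\<dots> = c ^ Suc m' * wigner1 k m' z" unfolding Suc.IH by simp
      finally show ?thesis using Suc by (simp only: diff_Suc_1 mult.assoc)
    qed simp
    have "of_real (sqrt (real (Suc k) / 2)) * (wigner1 (Suc k) m w * c ^ Suc k)
        = (cnj (cpair w) * c) * (wigner1 k m w * c ^ k) - of_real (sqrt (real m / 2)) * wigner1 k (m - 1) w * c ^ Suc k"
      using wigner1_up_left[of w k m] by (simp add: algebra_simps)
    also have "\<dots> = c ^ m * (cnj (cpair z) * wigner1 k m z - of_real (sqrt (real m / 2)) * wigner1 k (m - 1) z)"
      unfolding cj low Suc.IH by (simp add: algebra_simps)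
    also have "\<dots> = of_real (sqrt (real (Suc k) / 2)) * (c ^ m * wigner1 (Suc k) m z)"
      using wigner1_up_left[of z k m] by (simp add: algebra_simps)
    finally show ?case using pos[of k] by simp
  qed
qed

section \<open>Laguerre polynomials and the diagonal Wigner functions\<close>

primrec laguerre_iter :: "nat \<Rightarrow> nat \<Rightarrow> real poly" where
  "laguerre_iter k 0 = monom 1 k"
| "laguerre_iter k (Suc m) = pderiv (laguerre_iter k m) - laguerre_iter k m"

lemma iter_deriv_laguerre:
  "(deriv ^^ m) (\<lambda>s::real. exp (- s) * s ^ k) = (\<lambda>s. exp (- s) * poly (laguerre_iter k m) s)"
proof (induction m)
  case 0
  show ?case by (simp add: poly_monom)
next
  case (Suc m)
  have "((\<lambda>s. exp (- s) * poly (laguerre_iter k m) s) has_field_derivative exp (- s) * poly (laguerre_iter k (Suc m)) s) (at s)" for s :: real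
    by (auto intro!: derivative_eq_intros simp: algebra_simps)
  then have "deriv (\<lambda>s. exp (- s) * poly (laguerre_iter k m) s) = (\<lambda>s. exp (- s) * poly (laguerre_iter k (Suc m)) s)"
    by (intro ext DERIV_imp_deriv)
  with Suc show ?case by simp
qed

lemma Suc_mult_divide_fact: "real (Suc i) * (a / fact (Suc i)) = (a :: real) / fact i" by (simp add: fact_Suc[of i] field_simps del: of_nat_Suc)

text \<open>The Leibniz formula read on coefficients; the induction step is Pascal's rule for
  \<open>m choose (k - i)\<close>.\<close>

lemma coeff_laguerre_iter:
  "coeff (laguerre_iter k m) i = (if i \<le> k then (- 1) ^ (m + (k - i)) * real (m choose (k - i)) * fact k / fact i else 0)"
proof (induction m arbitrary: i)
  case 0
  show ?case by (cases "i = k") (auto simp: coeff_monom binomial_eq_0)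
next
  case (Suc m)
  show ?case
  proof (cases "i < k")
    case True
    define l where "l = k - Suc i"
    have l: "k - i = Suc l" using True by (simp add: l_def)
    have "coeff (laguerre_iter k (Suc m)) i = real (Suc i) * ((- 1) ^ (m + l) * real (m choose l) * fact k / fact (Suc i))
        - (- 1) ^ (m + Suc l) * real (m choose Suc l) * fact k / fact i" using True by (simp add: coeff_pderiv Suc l_def[symmetric] l del: fact_Suc)
    also have "real (Suc i) * ((- 1) ^ (m + l) * real (m choose l) * fact k / fact (Suc i)) = (- 1) ^ (m + l) * real (m choose l) * fact k / fact i"
      by (rule Suc_mult_divide_fact)
    also have "(- 1) ^ (m + l) * real (m choose l) * fact k / fact i - (- 1) ^ (m + Suc l) * real (m choose Suc l) * fact k / fact i
        = (- 1) ^ (Suc m + Suc l) * real (Suc m choose Suc l) * fact k / fact i" by (simp add: field_simps)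
    finally show ?thesis using True l by simp
  next
    case False
    then show ?thesis by (cases "i = k") (auto simp: coeff_pderiv Suc)
  qed
qed

definition lag_poly :: "nat \<Rightarrow> real poly" where
  "lag_poly k = smult (1 / fact k) (laguerre_iter k k)"

lemma laguerre_poly_eq: "laguerre_poly k t = poly (lag_poly k) t"
proof -
  have "exp t * exp (- t) = 1" by (simp flip: exp_add)
  then show ?thesis by (simp add: laguerre_poly_def iter_deriv_laguerre lag_poly_def)
qed

lemma coeff_laguerre: "coeff (lag_poly k) i = (- 1) ^ i * real (k choose i) / fact i"
proof (cases "i \<le> k")
  case True
  have "(- 1 :: real) ^ (k + (k - i)) = (- 1) ^ i"
  proof -
    have "k + (k - i) + i = 2 * k" using True by simp
    then have "(- 1 :: real) ^ (k + (k - i)) * (- 1) ^ i = 1" by (simp flip: power_add)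
    then show ?thesis by (cases "even i") auto
  qed
  with True show ?thesis by (simp add: lag_poly_def coeff_laguerre_iter binomial_symmetric[symmetric])
qed (simp add: lag_poly_def coeff_laguerre_iter binomial_eq_0)

lemma choose_Suc_real: "real (Suc i) * real (k choose Suc i) = (real k - real i) * real (k choose i)"
proof (cases "i \<le> k")
  case True
  have "Suc i * (k choose Suc i) = (k - i) * (k choose i)" using binomial_absorption[of i k] binomial_absorb_comp[of k i] by simp
  then have "real (Suc i * (k choose Suc i)) = real ((k - i) * (k choose i))" by (simp only:)
  then show ?thesis using True by (simp only: of_nat_mult of_nat_diff)
qed (simp add: binomial_eq_0)

text \<open>Comparing coefficients, the equation is the two-term recursion \<open>rec\<close>, which
  is the absorption identity for binomial coefficients.\<close>

lemma laguerre_ode: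
  "t * poly (pderiv (pderiv (lag_poly k))) t + (1 - t) * poly (pderiv (lag_poly k)) t + real k * poly (lag_poly k) t = 0"
proof -
  let ?L = "lag_poly k"
  have "[:0, 1:] * pderiv (pderiv ?L) + [:1, -1:] * pderiv ?L + smult (real k) ?L = 0"
  proof (rule poly_eqI)
    fix i
    have "real (Suc i) * (real (Suc i) * coeff ?L (Suc i)) = real (Suc i) * ((- 1) ^ Suc i * ((real k - real i) * real (k choose i)) / fact (Suc i))"
      unfolding coeff_laguerre choose_Suc_real[symmetric] by (simp only: mult_ac times_divide_eq_right)
    also have "\<dots> = (real i - real k) * coeff ?L i" unfolding coeff_laguerre Suc_mult_divide_fact by (simp add: algebra_simps)
    finally have rec: "real (Suc i) * (real (Suc i) * coeff ?L (Suc i)) = (real i - real k) * coeff ?L i" .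
    show "coeff ([:0, 1:] * pderiv (pderiv ?L) + [:1, -1:] * pderiv ?L + smult (real k) ?L) i = coeff 0 i"
    proof (cases i)
      case 0
      then show ?thesis using rec by (simp add: coeff_pderiv)
    next
      case (Suc j)
      have "real i * (real (Suc i) * coeff ?L (Suc i)) + real (Suc i) * coeff ?L (Suc i) = real (Suc i) * (real (Suc i) * coeff ?L (Suc i))"
        by (simp add: algebra_simps)
      with rec Suc show ?thesis by (simp add: coeff_pderiv algebra_simps)
    qed
  qed
  then have "poly ([:0, 1:] * pderiv (pderiv ?L) + [:1, -1:] * pderiv ?L + smult (real k) ?L) t = 0" by simp
  then show ?thesis by (simp add: algebra_simps)
qed

text \<open>On coefficients this reduces to a linear relation between binomial coefficients, which
  follows from Pascal's rule and absorption.\<close>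

lemma laguerre_three_term:
  "real (Suc k) * poly (lag_poly (Suc k)) t
    = (real (2 * k + 1) - t) * poly (lag_poly k) t - real k * poly (lag_poly (k - 1)) t"
proof -
  let ?L = lag_poly
  have "smult (real (Suc k)) (?L (Suc k)) = smult (real (2 * k + 1)) (?L k) - pCons 0 (?L k) - smult (real k) (?L (k - 1))"
  proof (rule poly_eqI)
    fix i
    show "coeff (smult (real (Suc k)) (?L (Suc k))) i = coeff (smult (real (2 * k + 1)) (?L k) - pCons 0 (?L k) - smult (real k) (?L (k - 1))) i"
    proof (cases i)
      case 0
      then show ?thesis by (simp add: coeff_laguerre)
    next
      case (Suc j)
      let ?c = "\<lambda>n i. real (n choose i)" and ?s = "(- 1) ^ Suc j / fact (Suc j) :: real"
      have absorb: "real k * ?c (k - 1) (Suc j) = (real k - real (Suc j)) * ?c k (Suc j)"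
      proof (cases "Suc j \<le> k")
        case True
        have "real ((k - Suc j) * (k choose Suc j)) = real (k * ((k - 1) choose Suc j))" by (simp only: binomial_absorb_comp)
        then show ?thesis using True by (simp only: of_nat_mult of_nat_diff)
      qed (simp add: binomial_eq_0)
      have "real (Suc k) * ?c (Suc k) (Suc j) = real (2 * k + 1) * ?c k (Suc j) + real (Suc j) * ?c k j - real k * ?c (k - 1) (Suc j)"
        unfolding absorb using choose_Suc_real[of j k] by (simp add: algebra_simps)
      then have "?s * (real (Suc k) * ?c (Suc k) (Suc j)) = ?s * (real (2 * k + 1) * ?c k (Suc j) + real (Suc j) * ?c k j - real k * ?c (k - 1) (Suc j))"
        by (simp only:)
      moreover have "coeff (?L n) (Suc j) = ?s * ?c n (Suc j)" for n by (simp only: coeff_laguerre times_divide_eq_left)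
      moreover have "coeff (?L k) j = - (?s * (real (Suc j) * ?c k j))"
        unfolding coeff_laguerre Suc_mult_divide_fact[symmetric, of _ j] by (simp only: power_Suc) simp
      ultimately show ?thesis unfolding Suc by (simp only: coeff_smult coeff_diff coeff_pCons_Suc) (simp only: algebra_simps)
    qed
  qed
  from arg_cong[OF this, of "\<lambda>p. poly p t"] show ?thesis by (simp only: poly_smult poly_diff poly_pCons) (simp add: algebra_simps)
qed

text \<open>The squared modulus is the complex coordinate times its conjugate. The first raises
  \<open>m\<close> or lowers \<open>k\<close>, the second does the reverse, so the product leads
  back to diagonal functions.\<close>

lemma wigner1_three_term:
  "of_real (2 * ((fst z)\<^sup>2 + (snd z)\<^sup>2)) * wigner1 k k z
    = of_nat (Suc k) * wigner1 (Suc k) (Suc k) z + of_nat (2 * k + 1) * wigner1 k k z + of_nat k * wigner1 (k - 1) (k - 1) z"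
proof -
  define a where "a j = complex_of_real (sqrt (real j / 2))" for j
  have aa: "2 * (a j * (a j * w)) = of_nat j * w" for j w
  proof -
    have q: "a j * a j = of_real (real j / 2)" unfolding a_def of_real_mult[symmetric] by simp
    have e: "2 * (a j * a j) = of_nat j" unfolding q by simp
    have "2 * (a j * (a j * w)) = 2 * (a j * a j) * w" by (simp only: mult_ac)
    then show ?thesis unfolding e .
  qed
  \<comment> \<open>For \<open>k = 0\<close> both sides vanish with \<open>a 0\<close>; otherwise
    this is the ladder identity at index \<open>k - 1\<close>.\<close>
  have low: "a k * (cnj (cpair z) * wigner1 (k - 1) k z) = a k * (a k * wigner1 k k z + a k * wigner1 (k - 1) (k - 1) z)"
    by (cases k) (simp_all add: a_def wigner1_up_left del: of_nat_Suc)
  have "complex_of_real (2 * ((fst z)\<^sup>2 + (snd z)\<^sup>2)) = 2 * (cnj (cpair z) * cpair z)" by (simp add: complex_eq_iff power2_eq_square)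
  then have "of_real (2 * ((fst z)\<^sup>2 + (snd z)\<^sup>2)) * wigner1 k k z = 2 * (cnj (cpair z) * (cpair z * wigner1 k k z))"
    by (simp only: mult.assoc)
  also have "\<dots> = 2 * (a k * (cnj (cpair z) * wigner1 (k - 1) k z) + a (Suc k) * (cnj (cpair z) * wigner1 k (Suc k) z))"
    unfolding wigner1_up_right a_def by (simp only: algebra_simps)
  also have "cnj (cpair z) * wigner1 k (Suc k) z = a (Suc k) * wigner1 (Suc k) (Suc k) z + a (Suc k) * wigner1 k k z"
    unfolding wigner1_up_left a_def by simp
  finally show ?thesis unfolding low distrib_left aa by (simp add: algebra_simps)
qed

definition laguerre_profile :: "nat \<Rightarrow> real \<Rightarrow> real" where
  "laguerre_profile k r = exp (- r) * poly (lag_poly k) (2 * r)"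

text \<open>With the alternating sign factored out, the recurrence for the diagonal Wigner functions
  is the Laguerre recurrence at argument \<open>2 * r\<close>, and the initial value is
  \<open>2 * exp (- r)\<close>.\<close>

lemma wigner1_diag: "wigner1 k k z = of_real (2 * (- 1) ^ k * laguerre_profile k ((fst z)\<^sup>2 + (snd z)\<^sup>2))"
proof (induction k rule: less_induct)
  case (less k)
  define r where "r = (fst z)\<^sup>2 + (snd z)\<^sup>2"
  show ?case
  proof (cases k)
    case 0
    then show ?thesis by (simp add: wigner1_00 laguerre_profile_def lag_poly_def poly_monom)
  next
    case (Suc n)
    have "of_nat (Suc n) * wigner1 (Suc n) (Suc n) z
        = of_real (2 * r) * wigner1 n n z - of_nat (2 * n + 1) * wigner1 n n z - of_nat n * wigner1 (n - 1) (n - 1) z"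
      unfolding r_def wigner1_three_term by simp
    also have "\<dots> = of_real ((2 * r - real (2 * n + 1)) * (2 * (- 1) ^ n * laguerre_profile n r) - real n * (2 * (- 1) ^ (n - 1) * laguerre_profile (n - 1) r))"
      using less[of n] less[of "n - 1"] Suc by (simp add: r_def algebra_simps)
    also have "(2 * r - real (2 * n + 1)) * (2 * (- 1) ^ n * laguerre_profile n r) - real n * (2 * (- 1) ^ (n - 1) * laguerre_profile (n - 1) r)
        = 2 * (- 1) ^ Suc n * exp (- r) * (real (Suc n) * poly (lag_poly (Suc n)) (2 * r))"
      unfolding laguerre_three_term laguerre_profile_def by (cases n) (simp_all add: algebra_simps)
    finally have "of_nat (Suc n) * wigner1 (Suc n) (Suc n) z = of_nat (Suc n) * of_real (2 * (- 1) ^ Suc n * laguerre_profile (Suc n) r)"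
      by (simp add: laguerre_profile_def mult_ac del: of_nat_Suc)
    then show ?thesis unfolding Suc r_def by (simp only: mult_cancel_left of_nat_eq_0_iff nat.distinct simp_thms)
  qed
qed

text \<open>The product of the two factors is at most half the sum of their squares; each square has
  integral 2 because halving the variable doubles the unit mass.\<close>

lemma norm_wigner1_diag_le: "norm (wigner1 k k z) \<le> 2"
proof -
  define x where "x = fst z"
  have i: "integrable lborel (\<lambda>t. (hermite_fun1 k t)\<^sup>2)" and n: "(LINT t|lborel. (hermite_fun1 k t)\<^sup>2) = 1"
    using integrable_hermite_fun1_mult[of k k] hermite_fun1_orthonormal[of k k] by (simp_all add: power2_eq_square)
  have sc: "integrable lborel (\<lambda>p. (hermite_fun1 k (x + c * p))\<^sup>2)" "(LINT p|lborel. (hermite_fun1 k (x + c * p))\<^sup>2) = 2"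
    if c: "c = 1 / 2 \<or> c = - (1 / 2)" for c
  proof -
    have c': "c \<noteq> 0" "\<bar>c\<bar> = 1 / 2" using c by auto
    show "integrable lborel (\<lambda>p. (hermite_fun1 k (x + c * p))\<^sup>2)" using integrable_scale_shift_real[OF c'(1) i, of x] by simp
    show "(LINT p|lborel. (hermite_fun1 k (x + c * p))\<^sup>2) = 2" using integral_scale_shift_real[OF c'(1) i, of x] unfolding n c'(2) by simp
  qed
  have s1: "integrable lborel (\<lambda>p. (hermite_fun1 k (x - p / 2))\<^sup>2)" "(LINT p|lborel. (hermite_fun1 k (x - p / 2))\<^sup>2) = 2"
    using sc[of "- (1 / 2)"] by simp_all
  have s2: "integrable lborel (\<lambda>p. (hermite_fun1 k (x + p / 2))\<^sup>2)" "(LINT p|lborel. (hermite_fun1 k (x + p / 2))\<^sup>2) = 2"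
    using sc[of "1 / 2"] by simp_all
  have "norm (wigner1 k k z) \<le> (LINT p|lborel. norm (wave p (snd z) * of_real (hermite_pair k k x p)))"
    unfolding wigner1_def x_def by (rule integral_norm_bound)
  also have "\<dots> \<le> (LINT p|lborel. (1 / 2) * (hermite_fun1 k (x - p / 2))\<^sup>2 + (1 / 2) * (hermite_fun1 k (x + p / 2))\<^sup>2)"
  proof (rule integral_mono)
    show "integrable lborel (\<lambda>p. norm (wave p (snd z) * of_real (hermite_pair k k x p)))"
      by (intro integrable_norm integrable_hermite_pair)
    show "integrable lborel (\<lambda>p. (1 / 2) * (hermite_fun1 k (x - p / 2))\<^sup>2 + (1 / 2) * (hermite_fun1 k (x + p / 2))\<^sup>2)"
      by (intro Bochner_Integration.integrable_add integrable_mult_right s1 s2)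
    fix p :: real
    have "norm (wave p (snd z) * complex_of_real (hermite_pair k k x p)) = \<bar>hermite_fun1 k (x - p / 2)\<bar> * \<bar>hermite_fun1 k (x + p / 2)\<bar>"
      unfolding norm_mult norm_exp_i_times norm_of_real by (simp add: abs_mult)
    then show "norm (wave p (snd z) * complex_of_real (hermite_pair k k x p))
        \<le> (1 / 2) * (hermite_fun1 k (x - p / 2))\<^sup>2 + (1 / 2) * (hermite_fun1 k (x + p / 2))\<^sup>2"
      using sum_squares_bound[of "\<bar>hermite_fun1 k (x - p / 2)\<bar>" "\<bar>hermite_fun1 k (x + p / 2)\<bar>"] by simp
  qed
  also have "\<dots> = 2" by (subst Bochner_Integration.integral_add) (auto intro!: integrable_mult_right s1 s2 simp: s1(2) s2(2))
  finally show ?thesis .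
qed

text \<open>The classical uniform bound for Laguerre functions, read off from the Wigner bound at a
  phase-space point of squared modulus \<open>r\<close>.\<close>

lemma laguerre_profile_bound: "0 \<le> r \<Longrightarrow> \<bar>laguerre_profile k r\<bar> \<le> 1"
  using norm_wigner1_diag_le[of k "(sqrt r, 0)"] unfolding wigner1_diag norm_of_real by (simp add: abs_mult power_abs)

section \<open>Laguerre coefficients\<close>

lemma exp_poly_bounded:
  "\<exists>C. \<forall>r\<ge>0. \<bar>exp (- r) * poly q r\<bar> \<le> (C :: real)"
proof (intro exI allI impI)
  fix r :: real assume r: "0 \<le> r"
  have "\<bar>poly q r\<bar> \<le> (\<Sum>i\<le>degree q. \<bar>coeff q i\<bar> * (real i ^ i * exp r))" unfolding poly_altdef using r
    by (intro order_trans[OF sum_abs] sum_mono) (auto simp: abs_mult power_abs intro!: mult_left_mono power_le_exp)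
  also have "\<dots> = exp r * (\<Sum>i\<le>degree q. \<bar>coeff q i\<bar> * real i ^ i)" by (simp add: sum_distrib_left mult_ac)
  finally have "exp (- r) * \<bar>poly q r\<bar> \<le> exp (- r) * (exp r * (\<Sum>i\<le>degree q. \<bar>coeff q i\<bar> * real i ^ i))"
    by (intro mult_left_mono) auto
  also have "\<dots> = (\<Sum>i\<le>degree q. \<bar>coeff q i\<bar> * real i ^ i)" unfolding mult.assoc[symmetric] exp_add[symmetric] by simp
  finally show "\<bar>exp (- r) * poly q r\<bar> \<le> (\<Sum>i\<le>degree q. \<bar>coeff q i\<bar> * real i ^ i)" by (simp add: abs_mult)
qed

text \<open>The first two derivatives of \<open>laguerre_profile\<close>, each kept as
  \<open>exp (- r)\<close> times one polynomial in \<open>r\<close>; for the first derivative this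
  is the form in which \<open>exp_poly_bounded\<close> gives its boundedness.\<close>

definition laguerre_profile' :: "nat \<Rightarrow> real \<Rightarrow> real" where
  "laguerre_profile' k r = exp (- r) * poly (2 * pcompose (pderiv (lag_poly k)) [:0, 2:] - pcompose (lag_poly k) [:0, 2:]) r"

definition laguerre_profile'' :: "nat \<Rightarrow> real \<Rightarrow> real" where
  "laguerre_profile'' k r = exp (- r) * poly (4 * pcompose (pderiv (pderiv (lag_poly k))) [:0, 2:]
     - 4 * pcompose (pderiv (lag_poly k)) [:0, 2:] + pcompose (lag_poly k) [:0, 2:]) r"

lemma laguerre_profile_deriv:
  "(laguerre_profile k has_field_derivative laguerre_profile' k r) (at r)"
proof -
  have "((\<lambda>r. exp (- r) * poly (lag_poly k) (2 * r)) has_field_derivative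
      (- exp (- r)) * poly (lag_poly k) (2 * r) + (poly (pderiv (lag_poly k)) (2 * r) * 2) * exp (- r)) (at r)"
    by (intro DERIV_mult DERIV_chain2[OF poly_DERIV]) (auto intro!: derivative_eq_intros)
  then show ?thesis unfolding laguerre_profile_def[abs_def] by (rule DERIV_cong) (simp add: laguerre_profile'_def poly_pcompose algebra_simps)
qed

lemma laguerre_profile'_deriv:
  "(laguerre_profile' k has_field_derivative laguerre_profile'' k r) (at r)"
proof -
  have "laguerre_profile' k = (\<lambda>r. exp (- r) * (2 * poly (pderiv (lag_poly k)) (2 * r) - poly (lag_poly k) (2 * r)))"
    by (simp add: fun_eq_iff laguerre_profile'_def poly_pcompose mult.commute)
  moreover have "((\<lambda>r. exp (- r) * (2 * poly (pderiv (lag_poly k)) (2 * r) - poly (lag_poly k) (2 * r))) has_field_derivative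
      (- exp (- r)) * (2 * poly (pderiv (lag_poly k)) (2 * r) - poly (lag_poly k) (2 * r))
      + (2 * (poly (pderiv (pderiv (lag_poly k))) (2 * r) * 2) - poly (pderiv (lag_poly k)) (2 * r) * 2) * exp (- r)) (at r)"
    by (intro DERIV_mult DERIV_diff DERIV_cmult DERIV_chain2[OF poly_DERIV]) (auto intro!: derivative_eq_intros)
  ultimately show ?thesis by (simp only:) (rule DERIV_cong, assumption, simp add: laguerre_profile''_def poly_pcompose algebra_simps)
qed

text \<open>The Laguerre equation at \<open>2 * r\<close> with the exponential absorbed. The left
  side is the derivative of \<open>r * laguerre_profile' k r\<close>, a symmetric form suited to
  integration by parts along dilations.\<close>

lemma laguerre_profile_ode:
  "laguerre_profile' k r + r * laguerre_profile'' k r = r * laguerre_profile k r - (2 * real k + 1) * laguerre_profile k r"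
proof -
  let ?L = "poly (lag_poly k) (2 * r)" and ?M = "poly (pderiv (lag_poly k)) (2 * r)"
    and ?N = "poly (pderiv (pderiv (lag_poly k))) (2 * r)"
  have "laguerre_profile' k r + r * laguerre_profile'' k r = exp (- r) * (2 * (2 * r * ?N + (1 - 2 * r) * ?M) + r * ?L - ?L)"
    by (simp add: laguerre_profile'_def laguerre_profile''_def poly_pcompose algebra_simps)
  also have "2 * r * ?N + (1 - 2 * r) * ?M = - real k * ?L" using laguerre_ode[of "2 * r" k] by simp
  finally show ?thesis by (simp add: laguerre_profile_def algebra_simps)
qed

text \<open>Only the \<open>i\<close>-th factor is exchanged; with \<open>g\<close> the profile or
  one of its two derivatives this describes the partial derivatives of the product in one
  direction.\<close>

definition laguerre_tensor :: "(nat \<Rightarrow> real \<Rightarrow> real) \<Rightarrow> 'n \<Rightarrow> nat ^ 'n::finite \<Rightarrow> real ^ 'n \<Rightarrow> complex" where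
  "laguerre_tensor g i k x = of_real (\<Prod>l\<in>UNIV. (if l = i then g else laguerre_profile) (k $ l) (x $ l))"

definition laguerre_product :: "nat ^ 'n::finite \<Rightarrow> real ^ 'n \<Rightarrow> complex" where
  "laguerre_product k x = of_real (\<Prod>l\<in>UNIV. laguerre_profile (k $ l) (x $ l))"

lemma laguerre_tensor_eq:
  "laguerre_tensor g i k x = of_real (g (k $ i) (x $ i)) * of_real (\<Prod>l\<in>UNIV - {i}. laguerre_profile (k $ l) (x $ l))"
proof -
  have "(\<Prod>l\<in>UNIV. (if l = i then g else laguerre_profile) (k $ l) (x $ l))
    = g (k $ i) (x $ i) * (\<Prod>l\<in>UNIV - {i}. (if l = i then g else laguerre_profile) (k $ l) (x $ l))" by (subst prod.remove[of _ i]) auto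
  also have "(\<Prod>l\<in>UNIV - {i}. (if l = i then g else laguerre_profile) (k $ l) (x $ l)) = (\<Prod>l\<in>UNIV - {i}. laguerre_profile (k $ l) (x $ l))"
    by (intro prod.cong) auto
  finally show ?thesis by (simp add: laguerre_tensor_def)
qed

lemma laguerre_tensor_profile: "laguerre_tensor laguerre_profile i k = laguerre_product k"
  by (simp add: fun_eq_iff laguerre_tensor_def laguerre_product_def)

lemma laguerre_tensor_ode:
  "laguerre_tensor laguerre_profile' i k x + of_real (x $ i) * laguerre_tensor laguerre_profile'' i k x
    = of_real (x $ i) * laguerre_product k x - of_real (2 * real (k $ i) + 1) * laguerre_product k x"
  (is "?l = ?r")
proof -
  let ?P = "complex_of_real (\<Prod>l\<in>UNIV - {i}. laguerre_profile (k $ l) (x $ l))"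
  have "?l = of_real (laguerre_profile' (k $ i) (x $ i) + x $ i * laguerre_profile'' (k $ i) (x $ i)) * ?P"
    unfolding laguerre_tensor_eq by (simp add: algebra_simps)
  also have "\<dots> = ?r" unfolding laguerre_profile_ode laguerre_tensor_profile[symmetric, of k i] laguerre_tensor_eq by (simp add: algebra_simps)
  finally show ?thesis .
qed

lemma laguerre_tensor_derivative:
  fixes i :: "'n::finite"
  assumes g: "\<And>j r. (g j has_field_derivative g' j r) (at r)"
  shows "laguerre_tensor g i k differentiable (at x)"
    "frechet_derivative (laguerre_tensor g i k) (at x) (axis i 1) = laguerre_tensor g' i k x"
proof -
  define h where "h l = (if l = i then g else laguerre_profile)" for l
  define h' where "h' l = (if l = i then g' else laguerre_profile')" for l
  have h: "(h l j has_field_derivative h' l j r) (at r)" for l j r using g laguerre_profile_deriv by (auto simp: h_def h'_def)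
  have "((\<lambda>x. h l (k $ l) (x $ l)) has_derivative (\<lambda>y. h' l (k $ l) (x $ l) * (y $ l))) (at x)" for l and x :: "real ^ 'n"
    using has_derivative_compose[OF bounded_linear_imp_has_derivative[OF bounded_linear_vec_nth] h[unfolded has_field_derivative_def, of l "k $ l" "x $ l"], where s = UNIV] by simp
  then have "((\<lambda>x. \<Prod>l\<in>UNIV. h l (k $ l) (x $ l)) has_derivative
      (\<lambda>y. \<Sum>j\<in>UNIV. (h' j (k $ j) (x $ j) * (y $ j)) * (\<Prod>l\<in>UNIV - {j}. h l (k $ l) (x $ l)))) (at x)"
    by (intro has_derivative_prod)
  from has_derivative_of_real[OF this, where 'a = complex]
  have hd: "(laguerre_tensor g i k has_derivative
      (\<lambda>y. of_real (\<Sum>j\<in>UNIV. (h' j (k $ j) (x $ j) * (y $ j)) * (\<Prod>l\<in>UNIV - {j}. h l (k $ l) (x $ l))))) (at x)"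
    unfolding laguerre_tensor_def[abs_def] h_def[symmetric] .
  then show "laguerre_tensor g i k differentiable (at x)" unfolding differentiable_def by blast
  have "(\<Sum>j\<in>UNIV. (h' j (k $ j) (x $ j) * ((axis i 1 :: real ^ 'n) $ j)) * (\<Prod>l\<in>UNIV - {j}. h l (k $ l) (x $ l)))
      = (\<Sum>j\<in>UNIV. if j = i then h' i (k $ i) (x $ i) * (\<Prod>l\<in>UNIV - {i}. h l (k $ l) (x $ l)) else 0)"
    by (intro sum.cong refl) (auto simp: axis_def)
  also have "\<dots> = g' (k $ i) (x $ i) * (\<Prod>l\<in>UNIV - {i}. laguerre_profile (k $ l) (x $ l))"
  proof -
    have "(\<Prod>l\<in>UNIV - {i}. h l (k $ l) (x $ l)) = (\<Prod>l\<in>UNIV - {i}. laguerre_profile (k $ l) (x $ l))"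
      by (intro prod.cong) (auto simp: h_def)
    then show ?thesis by (simp add: h'_def)
  qed
  finally show "frechet_derivative (laguerre_tensor g i k) (at x) (axis i 1) = laguerre_tensor g' i k x"
    unfolding frechet_derivative_eqI[OF hd] laguerre_tensor_eq by (simp only: of_real_mult)
qed

lemma laguerre_tensor_bounded:
  assumes "\<And>j. \<exists>C. \<forall>r\<ge>0. \<bar>g j r\<bar> \<le> C"
  shows "\<exists>C. \<forall>x\<in>pos_orthant. norm (laguerre_tensor g i k x) \<le> C"
proof -
  obtain C where C: "\<forall>r\<ge>0. \<bar>g (k $ i) r\<bar> \<le> C" using assms by blast
  have "norm (laguerre_tensor g i k x) \<le> C * 1" if x: "x \<in> pos_orthant" for x
  proof -
    have x0: "0 \<le> x $ l" for l using x by (auto simp: pos_orthant_def less_imp_le)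
    have "norm (laguerre_tensor g i k x) = \<bar>g (k $ i) (x $ i)\<bar> * (\<Prod>l\<in>UNIV - {i}. \<bar>laguerre_profile (k $ l) (x $ l)\<bar>)"
      unfolding laguerre_tensor_eq norm_mult norm_of_real abs_prod ..
    also have "\<dots> \<le> C * 1" using C x0[of i] by (intro mult_mono prod_le_1 prod_nonneg) (auto intro: laguerre_profile_bound x0)
    finally show ?thesis .
  qed
  then show ?thesis by blast
qed

lemma norm_laguerre_product_le: "x \<in> pos_orthant \<Longrightarrow> norm (laguerre_product k x) \<le> 1"
  unfolding laguerre_product_def norm_of_real abs_prod by (intro prod_le_1) (auto intro!: laguerre_profile_bound simp: pos_orthant_def less_imp_le)

text \<open>For \<open>u = dilate2 \<sigma>\<close> this is the eigenvalue of the Weyl operator with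
  symbol \<open>radial_symbol \<sigma>\<close> on \<open>hermite_fun k\<close>, as
  \<open>weyl_radial_hermite\<close> shows.\<close>

definition radial_coeff :: "nat ^ 'n::finite \<Rightarrow> (real ^ 'n \<Rightarrow> complex) \<Rightarrow> complex" where
  "radial_coeff k u = (- 1) ^ (\<Sum>l\<in>UNIV. k $ l) * (LINT x:pos_orthant|lborel. u x * laguerre_product k x)"

lemma orthant_integral_bound:
  fixes h :: "real ^ 'n::finite \<Rightarrow> complex"
  assumes "continuous_on pos_orthant u" "\<And>x. x \<in> pos_orthant \<Longrightarrow> norm (u x) \<le> D / poly_weight x" "0 \<le> D"
    and "continuous_on pos_orthant h" "\<And>x. x \<in> pos_orthant \<Longrightarrow> norm (h x) \<le> C"
  shows "set_integrable lborel pos_orthant (\<lambda>x. u x * h x)"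
    "norm (LINT x:pos_orthant|lborel. u x * h x) \<le> D * C * (LINT x|lborel. 1 / poly_weight (x :: real ^ 'n))"
proof -
  let ?f = "\<lambda>x. indicator pos_orthant x *\<^sub>R (u x * h x)"
  have C: "0 \<le> C" using pos_orthant_nonempty assms(5) order_trans[OF norm_ge_zero] by blast
  have m: "?f \<in> borel_measurable borel"
    by (rule borel_measurable_continuous_on_indicator) (auto intro!: borel_open open_pos_orthant continuous_on_mult assms)
  have b: "norm (?f x) \<le> D * C / poly_weight x" for x
  proof (cases "x \<in> pos_orthant")
    case True
    have "norm (u x) * norm (h x) \<le> D / poly_weight x * C"
      using assms(2,5)[OF True] by (intro mult_mono) (auto intro: order_trans[OF norm_ge_zero])
    with True show ?thesis by (simp add: norm_mult)
  qed (use C assms(3) poly_weight_pos[of x] in simp)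
  show "set_integrable lborel pos_orthant (\<lambda>x. u x * h x)" unfolding set_integrable_def by (rule integrable_weight_bound(1)[OF m b])
  show "norm (LINT x:pos_orthant|lborel. u x * h x) \<le> D * C * (LINT x|lborel. 1 / poly_weight (x :: real ^ 'n))"
    unfolding set_lebesgue_integral_def by (rule integrable_weight_bound(2)[OF m b])
qed

text \<open>The conditions of \<open>schwartz_orthant\<close> on the open orthant, where all
  coefficient integrals live; differences of symbols are taken in this set.\<close>

definition orthant_smooth :: "(real ^ 'n::finite \<Rightarrow> complex) set" where
  "orthant_smooth = {f. smooth_on pos_orthant f \<and> schwartz_bounds pos_orthant f}"

lemma orthant_decay:
  assumes P: "P \<in> diffops"
  shows "\<exists>F C. finite F \<and> F \<subseteq> schwartz_seminorms pos_orthant \<and> 0 \<le> C \<and>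
    (\<forall>f\<in>orthant_smooth. \<forall>x\<in>pos_orthant. norm (P f x) \<le> C * (\<Sum>p\<in>F. p f) / poly_weight x)"
proof -
  obtain F C where F: "finite F" "F \<subseteq> schwartz_seminorms pos_orthant" "0 \<le> C"
    "\<And>g x. schwartz_bounds pos_orthant g \<Longrightarrow> x \<in> pos_orthant \<Longrightarrow> norm (complex_of_real (poly_weight x) * P g x) \<le> C * (\<Sum>p\<in>F. p g)"
    by (rule diffops_bound[OF diffops_poly_weight[OF P], of pos_orthant]) (rule that; assumption)
  have "norm (P f x) \<le> C * (\<Sum>p\<in>F. p f) / poly_weight x" if "f \<in> orthant_smooth" "x \<in> pos_orthant" for f x
    using F(4)[of f x] that poly_weight_pos[of x] by (simp add: orthant_smooth_def norm_mult field_simps)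
  with F(1-3) show ?thesis by (intro exI[of _ F] exI[of _ C]) simp
qed

lemma orthant_integrable:
  fixes h :: "real ^ 'n::finite \<Rightarrow> complex"
  assumes "P \<in> diffops" "f \<in> orthant_smooth" "continuous_on pos_orthant h" "\<exists>C. \<forall>x\<in>pos_orthant. norm (h x) \<le> C"
  shows "set_integrable lborel pos_orthant (\<lambda>x. P f x * h x)"
proof -
  obtain F C where F: "finite F" "F \<subseteq> schwartz_seminorms pos_orthant" "0 \<le> C"
    "\<forall>f\<in>orthant_smooth. \<forall>x\<in>pos_orthant. norm (P f x) \<le> C * (\<Sum>p\<in>F. p f) / poly_weight x"
    using orthant_decay[OF assms(1)] by (elim exE conjE) (rule that)
  obtain K where K: "\<And>x. x \<in> pos_orthant \<Longrightarrow> norm (h x) \<le> K" using assms(4) by blast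
  have c: "continuous_on pos_orthant (P f)" by (rule diffops_continuous[OF assms(1)]) (use assms(2) in \<open>simp add: orthant_smooth_def\<close>)
  have b: "norm (P f x) \<le> \<bar>C * (\<Sum>p\<in>F. p f)\<bar> / poly_weight x" if "x \<in> pos_orthant" for x
    using F(4) assms(2) that poly_weight_pos[of x] abs_ge_self[of "C * (\<Sum>p\<in>F. p f)"] by (meson divide_right_mono less_imp_le order_trans)
  show ?thesis by (rule orthant_integral_bound(1)[OF c b abs_ge_zero assms(3) K])
qed

lemma laguerre_tensor_continuous:
  assumes "\<And>j r. (g j has_field_derivative g' j r) (at r)"
  shows "continuous_on pos_orthant (laguerre_tensor g i k)" by (intro continuous_at_imp_continuous_on ballI differentiable_imp_continuous_within
      laguerre_tensor_derivative(1)[where g = g and g' = g', OF assms])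

lemma laguerre_product_continuous: "continuous_on pos_orthant (laguerre_product k)"
  using laguerre_tensor_continuous[where g = laguerre_profile and g' = laguerre_profile', OF laguerre_profile_deriv] unfolding laguerre_tensor_profile .

text \<open>Green's identity for the degenerate operator of \<open>laguerre_profile_ode\<close> in
  the \<open>i\<close>-th variable: the derivative of the coordinate times the Wronskian
  \<open>?\<Psi>\<close> integrates to 0 by the dilation flow, which moves the factor
  \<open>2 * k $ i + 1\<close> onto \<open>P f\<close>.\<close>

lemma radial_coeff_step:
  fixes i :: "'n::finite"
  assumes P: "P \<in> diffops"
  shows "\<exists>Q\<in>diffops. \<forall>f\<in>orthant_smooth. \<forall>k. radial_coeff k (Q f) = of_real (1 + real (k $ i)) * radial_coeff k (P f)"
proof -
  let ?b = "axis i 1 :: real ^ 'n" and ?O = "pos_orthant :: (real ^ 'n) set"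
  have b: "?b \<in> Basis" by simp
  obtain P1 where P1: "P1 \<in> diffops" "\<And>f x. f \<in> orthant_smooth \<Longrightarrow> x \<in> ?O \<Longrightarrow> P f differentiable (at x) \<and> frechet_derivative (P f) (at x) ?b = P1 f x"
    using diffops_derivative[OF P b] unfolding orthant_smooth_def by blast
  obtain P2 where P2: "P2 \<in> diffops" "\<And>f x. f \<in> orthant_smooth \<Longrightarrow> x \<in> ?O \<Longrightarrow> P1 f differentiable (at x) \<and> frechet_derivative (P1 f) (at x) ?b = P2 f x"
    using diffops_derivative[OF P1(1) b] unfolding orthant_smooth_def by blast
  define X0 where "X0 = (\<lambda>f x. of_real (x \<bullet> ?b) * P f x)"
  define X2 where "X2 = (\<lambda>f x. of_real (x \<bullet> ?b) * P2 f x)"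
  have X: "X0 \<in> diffops" "X2 \<in> diffops" unfolding X0_def X2_def by (intro diffops.coord P P2 b)+
  \<comment> \<open>Half of the degenerate Laguerre operator plus one, composed with
    \<open>P\<close>; the eigenvalue is \<open>(2 * k $ i + 1 + 1) / 2\<close>.\<close>
  define Q where "Q = (\<lambda>f x. (1 / 2) * (X0 f x + ((-1) * X2 f x + ((-1) * P1 f x + P f x))))"
  have Q: "Q \<in> diffops" unfolding Q_def by (intro diffops.scale diffops.add X P1 P)
  have "radial_coeff k (Q f) = of_real (1 + real (k $ i)) * radial_coeff k (P f)" if f: "f \<in> orthant_smooth" for f k
  proof -
    have lagb: "\<exists>C. \<forall>x\<in>?O. norm (laguerre_product k x) \<le> C" using norm_laguerre_product_le by blast
    note I = orthant_integrable[OF _ f laguerre_product_continuous lagb]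
    have b1: "\<exists>C. \<forall>x\<in>?O. norm (laguerre_tensor laguerre_profile' i k x) \<le> C"
      by (rule laguerre_tensor_bounded) (unfold laguerre_profile'_def, rule exp_poly_bounded)
    have I1: "set_integrable lborel ?O (\<lambda>x. P f x * laguerre_tensor laguerre_profile' i k x)"
      by (rule orthant_integrable[OF P f laguerre_tensor_continuous[where g = laguerre_profile' and g' = laguerre_profile'', OF laguerre_profile'_deriv] b1])
    let ?\<Psi> = "\<lambda>x. P1 f x * laguerre_product k x - P f x * laguerre_tensor laguerre_profile' i k x"
    let ?D = "\<lambda>x. P1 f x * laguerre_product k x + X2 f x * laguerre_product k x - X0 f x * laguerre_product k x
      + of_real (2 * real (k $ i) + 1) * (P f x * laguerre_product k x)"
    have "(LINT x:?O|lborel. ?D x) = 0"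
    proof (rule integral_scaling_derivative_eq_zero[where \<Psi> = ?\<Psi> and b = ?b])
      show "open ?O" by (rule open_pos_orthant)
      show "x + ((exp s - 1) * (x \<bullet> ?b)) *\<^sub>R ?b \<in> ?O \<longleftrightarrow> x \<in> ?O" for s x
      proof -
        have "(x + ((exp s - 1) * (x \<bullet> ?b)) *\<^sub>R ?b) $ j = (if j = i then exp s * x $ j else x $ j)" for j
          by (simp add: inner_axis) (simp add: axis_def algebra_simps)
        then show ?thesis unfolding pos_orthant_def by (simp add: zero_less_mult_iff) (metis exp_gt_zero)
      qed
      fix x assume x: "x \<in> ?O"
      note d0 = laguerre_tensor_derivative[where g = laguerre_profile and g' = laguerre_profile', OF laguerre_profile_deriv, of i k x, unfolded laguerre_tensor_profile]
      note d1 = laguerre_tensor_derivative[where g = laguerre_profile' and g' = laguerre_profile'', OF laguerre_profile'_deriv, of i k x]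
      have hd: "(?\<Psi> has_derivative (\<lambda>h. (P1 f x * frechet_derivative (laguerre_product k) (at x) h + frechet_derivative (P1 f) (at x) h * laguerre_product k x)
          - (P f x * frechet_derivative (laguerre_tensor laguerre_profile' i k) (at x) h + frechet_derivative (P f) (at x) h * laguerre_tensor laguerre_profile' i k x))) (at x)"
        using P1(2)[OF f x] P2(2)[OF f x] d0(1) d1(1) by (intro has_derivative_diff has_derivative_mult) (simp_all add: frechet_derivative_works)
      then show "?\<Psi> differentiable (at x)" unfolding differentiable_def by blast
      have fd: "frechet_derivative ?\<Psi> (at x) ?b = P2 f x * laguerre_product k x - P f x * laguerre_tensor laguerre_profile'' i k x"
        unfolding frechet_derivative_eqI[OF hd] d0(2) d1(2) using P1(2)[OF f x] P2(2)[OF f x] by simp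
      have xi: "x \<bullet> ?b = x $ i" by (simp add: inner_axis)
      have "?D x = P1 f x * laguerre_product k x + of_real (x $ i) * P2 f x * laguerre_product k x
          - P f x * (laguerre_tensor laguerre_profile' i k x + of_real (x $ i) * laguerre_tensor laguerre_profile'' i k x)"
        unfolding laguerre_tensor_ode X0_def X2_def xi by (simp add: algebra_simps)
      also have "\<dots> = ?\<Psi> x + of_real (x $ i) * (P2 f x * laguerre_product k x - P f x * laguerre_tensor laguerre_profile'' i k x)"
        by (simp add: algebra_simps)
      finally show "?D x = ?\<Psi> x + of_real (x \<bullet> ?b) * frechet_derivative ?\<Psi> (at x) ?b" unfolding fd xi .
    next
      have c: "continuous_on ?O (R f)" if "R \<in> diffops" for R using diffops_continuous[OF that, of ?O f] f by (simp add: orthant_smooth_def)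
      show "continuous_on ?O ?D"
        by (intro continuous_on_add continuous_on_diff continuous_on_mult continuous_on_const c P1 X P laguerre_product_continuous)
      show "set_integrable lborel ?O ?\<Psi>" by (intro set_integral_diff I P1 I1)
      show "set_integrable lborel ?O ?D" by (intro set_integral_diff set_integral_add set_integrable_mult_right I P1 X P)
    qed simp
    then have *: "(LINT x:?O|lborel. P1 f x * laguerre_product k x) + (LINT x:?O|lborel. X2 f x * laguerre_product k x)
        - (LINT x:?O|lborel. X0 f x * laguerre_product k x) + of_real (2 * real (k $ i) + 1) * (LINT x:?O|lborel. P f x * laguerre_product k x) = 0"
      by (simp only: set_integral_diff set_integral_add set_integrable_mult_right set_integral_mult_right I P1 X P)
    have "(LINT x:?O|lborel. Q f x * laguerre_product k x) = (1 / 2) * ((LINT x:?O|lborel. X0 f x * laguerre_product k x)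
        + ((-1) * (LINT x:?O|lborel. X2 f x * laguerre_product k x) + ((-1) * (LINT x:?O|lborel. P1 f x * laguerre_product k x)
        + (LINT x:?O|lborel. P f x * laguerre_product k x))))"
    proof -
      have "Q f x * laguerre_product k x = (1 / 2) * (X0 f x * laguerre_product k x + ((-1) * (X2 f x * laguerre_product k x)
          + ((-1) * (P1 f x * laguerre_product k x) + P f x * laguerre_product k x)))" for x unfolding Q_def by (simp add: algebra_simps)
      then show ?thesis by (simp only: set_integral_add set_integrable_mult_right set_integral_mult_right I P1 X P)
    qed
    moreover have "q = of_real (1 + n) * d"
      if e: "a + b - c + of_real (2 * n + 1) * d = 0" "q = (1 / 2) * (c + ((-1) * b + ((-1) * a + d)))" for a b c d q :: complex and n :: real
    proof -
      have c: "c = a + b + of_real (2 * n + 1) * d" using e(1) by (simp add: algebra_simps)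
      have "2 * q = 2 * (of_real (1 + n) * d)" unfolding e(2) c by (simp add: algebra_simps)
      then show ?thesis by simp
    qed
    ultimately have "(LINT x:?O|lborel. Q f x * laguerre_product k x) = of_real (1 + real (k $ i)) * (LINT x:?O|lborel. P f x * laguerre_product k x)"
      using * by blast
    then show ?thesis unfolding radial_coeff_def by (simp only: mult_ac)
  qed
  with Q show ?thesis by blast
qed

text \<open>Here \<open>m = 0\<close> is possible because products of Laguerre profiles are bounded
  by 1, uniformly in \<open>k\<close>.\<close>

lemma radial_coeff_decay:
  "\<exists>F C. finite F \<and> F \<subseteq> schwartz_seminorms pos_orthant \<and> 0 \<le> C \<and>
    (\<forall>f\<in>orthant_smooth. \<forall>k :: nat ^ 'n::finite. norm (radial_coeff k f) * weight k ^ M \<le> C * (\<Sum>p\<in>F. p f))"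
proof (rule spectral_decay[where m = 0])
  show "\<exists>Q\<in>diffops. \<forall>f\<in>orthant_smooth. \<forall>k. radial_coeff k (Q f) = of_real (1 + real (k $ i)) * radial_coeff k (P f)"
    if "P \<in> diffops" for P and i :: 'n using radial_coeff_step[OF that] .
  fix P :: "(real ^ 'n \<Rightarrow> complex) \<Rightarrow> real ^ 'n \<Rightarrow> complex" assume P: "P \<in> diffops"
  obtain F C where F: "finite F" "F \<subseteq> schwartz_seminorms pos_orthant" "0 \<le> C"
    "\<forall>f\<in>orthant_smooth. \<forall>x\<in>pos_orthant. norm (P f x) \<le> C * (\<Sum>p\<in>F. p f) / poly_weight x"
    using orthant_decay[OF P] by (elim exE conjE) (rule that)
  define J where "J = (LINT x|lborel. 1 / poly_weight (x :: real ^ 'n))"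
  have J: "0 \<le> J" unfolding J_def by (rule integral_inverse_poly_weight_nonneg)
  have "norm (radial_coeff k (P f)) \<le> (C * J) * (\<Sum>p\<in>F. p f) * weight k ^ 0" if f: "f \<in> orthant_smooth" for f k
  proof -
    have c: "continuous_on pos_orthant (P f)" by (rule diffops_continuous[OF P]) (use f in \<open>simp add: orthant_smooth_def\<close>)
    obtain x :: "real ^ 'n" where x: "x \<in> pos_orthant" using pos_orthant_nonempty by blast
    have bd: "norm (P f x) \<le> (C * (\<Sum>p\<in>F. p f)) / poly_weight x" if "x \<in> pos_orthant" for x using F(4) f that by blast
    have "0 \<le> (C * (\<Sum>p\<in>F. p f)) / poly_weight x" using bd[OF x] order_trans[OF norm_ge_zero] by blast
    then have D0: "0 \<le> C * (\<Sum>p\<in>F. p f)" using poly_weight_pos[of x] by (simp add: zero_le_divide_iff)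
    have "norm (LINT x:pos_orthant|lborel. P f x * laguerre_product k x) \<le> C * (\<Sum>p\<in>F. p f) * 1 * J"
      unfolding J_def by (rule orthant_integral_bound(2)[OF c bd D0 laguerre_product_continuous norm_laguerre_product_le])
    then show ?thesis by (simp add: radial_coeff_def norm_mult norm_power mult_ac)
  qed
  then show "\<exists>F C. finite F \<and> F \<subseteq> schwartz_seminorms pos_orthant \<and> 0 \<le> C \<and>
      (\<forall>f\<in>orthant_smooth. \<forall>k. norm (radial_coeff k (P f)) \<le> C * (\<Sum>p\<in>F. p f) * weight k ^ 0)"
    using F(1-3) J by (intro exI[of _ F] exI[of _ "C * J"]) simp
qed

lemma rapid_radial_coeff:
  assumes "f \<in> orthant_smooth"
  shows "rapid (\<lambda>k. radial_coeff k f)" unfolding rapid_def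
proof
  fix M
  obtain F C where "finite F" "F \<subseteq> schwartz_seminorms pos_orthant" "0 \<le> C"
    "\<forall>g\<in>orthant_smooth. \<forall>k :: nat ^ 'a. norm (radial_coeff k g) * weight k ^ M \<le> C * (\<Sum>p\<in>F. p g)"
    using radial_coeff_decay[of M] by (elim exE conjE) (rule that)
  with assms show "\<exists>C. \<forall>k. norm (radial_coeff k f) * weight k ^ M \<le> C" by blast
qed

lemma schwartz_orthant_smooth: "f \<in> schwartz_orthant \<Longrightarrow> f \<in> orthant_smooth"
  by (simp add: schwartz_orthant_def orthant_smooth_def)

lemma orthant_smooth_diff:
  assumes "f \<in> orthant_smooth" "g \<in> orthant_smooth"
  shows "(\<lambda>x. f x - g x) \<in> orthant_smooth"
  using smooth_on_lin_comb[OF open_pos_orthant, of g f "-1"] schwartz_bounds_lin_comb[OF open_pos_orthant, of g f "-1"] assms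
  by (simp add: orthant_smooth_def)

lemma radial_coeff_diff:
  assumes "f \<in> orthant_smooth" "g \<in> orthant_smooth"
  shows "radial_coeff k (\<lambda>x. f x - g x) = radial_coeff k f - radial_coeff k g"
proof -
  have lagb: "\<exists>C. \<forall>x\<in>pos_orthant. norm (laguerre_product k x) \<le> C" using norm_laguerre_product_le by blast
  note I = orthant_integrable[OF diffops_id _ laguerre_product_continuous lagb]
  show ?thesis unfolding radial_coeff_def left_diff_distrib set_integral_diff(2)[OF I[OF assms(1)] I[OF assms(2)]] by (simp only: right_diff_distrib)
qed

text \<open>The substitution \<rho> = 2r turns Laguerre functions into products of profiles; its
  Jacobian cancels the power of 2 in \<open>laguerre_coeff\<close>.\<close>

lemma laguerre_coeff_eq_radial_coeff:
  fixes f :: "real ^ 'n::finite \<Rightarrow> complex"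
  assumes f: "f \<in> schwartz_orthant"
  shows "of_real ((2 * pi) powr (- (real CARD('n) / 2))) * laguerre_coeff f k = radial_coeff k (dilate2 f)"
proof -
  let ?g = "\<lambda>x. indicator pos_orthant x *\<^sub>R (f x * laguerre_fun k x)"
  have eq: "laguerre_fun k (2 *\<^sub>R x) = laguerre_product k x" for x
    by (simp add: laguerre_fun_def laguerre_product_def laguerre_profile_def laguerre_poly_eq mult.commute)
  have i: "indicator pos_orthant (2 *\<^sub>R x :: real ^ 'n) = (indicator pos_orthant x :: real)" for x by (simp add: indicator_def pos_orthant_def)
  have g2: "?g (0 + 2 *\<^sub>R x) = indicator pos_orthant x *\<^sub>R (dilate2 f x * laguerre_product k x)" for x by (simp add: eq i dilate2_def)
  have lagb: "\<exists>C. \<forall>x\<in>pos_orthant. norm (laguerre_product k x) \<le> C" using norm_laguerre_product_le by blast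
  have "integrable lborel (\<lambda>x. ?g (0 + 2 *\<^sub>R x))"
    unfolding g2 using orthant_integrable[OF diffops_id schwartz_orthant_smooth[OF dilate2_schwartz_orthant[OF f]] laguerre_product_continuous lagb]
    by (simp add: set_integrable_def)
  from integrable_scale_shift[of "1 / 2", OF _ this, of 0] have gi: "integrable lborel ?g" by simp
  have "(LINT x|lborel. ?g x) = \<bar>2\<bar> ^ DIM(real ^ 'n) *\<^sub>R (LINT x|lborel. ?g (0 + 2 *\<^sub>R x))"
    by (rule integral_scale_shift[OF _ gi]) simp
  then have int: "(LINT x:pos_orthant|lborel. f x * laguerre_fun k x) = 2 ^ CARD('n) * (LINT x:pos_orthant|lborel. dilate2 f x * laguerre_product k x)"
    unfolding set_lebesgue_integral_def g2 by (simp add: scaleR_conv_of_real)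
  have "(2 * pi) powr (- (real CARD('n) / 2)) * (2 * pi) powr (real CARD('n) / 2) = 1" by (simp flip: powr_add)
  then have c: "complex_of_real ((2 * pi) powr (- (real CARD('n) / 2))) * of_real ((2 * pi) powr (real CARD('n) / 2)) = 1"
    by (simp only: of_real_mult[symmetric] of_real_1)
  let ?L = "LINT x:pos_orthant|lborel. dilate2 f x * laguerre_product k x"
  have "of_real ((2 * pi) powr (- (real CARD('n) / 2))) * laguerre_coeff f k
    = (of_real ((2 * pi) powr (- (real CARD('n) / 2))) * of_real ((2 * pi) powr (real CARD('n) / 2))) * ((- 1) ^ (\<Sum>l\<in>UNIV. k $ l) * ?L)"
    unfolding laguerre_coeff_def int by simp
  then show ?thesis unfolding c radial_coeff_def by simp
qed

section \<open>Integrals over phase space\<close>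

definition lborel_preserving :: "('a::euclidean_space \<Rightarrow> 'a) \<Rightarrow> bool" where
  "lborel_preserving T \<longleftrightarrow> T \<in> borel_measurable borel \<and> distr lborel borel T = lborel"

lemma lborel_preserving_compose:
  assumes "lborel_preserving S" "lborel_preserving T"
  shows "lborel_preserving (\<lambda>x. S (T x))"
proof -
  have [measurable]: "S \<in> borel_measurable borel" "T \<in> borel_measurable borel" using assms by (auto simp: lborel_preserving_def)
  have "distr lborel borel (\<lambda>x. S (T x)) = distr (distr lborel borel T) borel S" by (subst distr_distr) (auto simp: o_def)
  then show ?thesis using assms by (simp add: lborel_preserving_def)
qed

lemma lborel_preserving_integral:
  fixes f :: "'a::euclidean_space \<Rightarrow> complex"
  assumes T: "lborel_preserving T" and f: "f \<in> borel_measurable borel"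
  shows "(LINT x|lborel. f (T x)) = (LINT x|lborel. f x)"
    and "integrable lborel (\<lambda>x. f (T x)) \<longleftrightarrow> integrable lborel f"
proof -
  have [measurable]: "T \<in> borel_measurable borel" using T by (simp add: lborel_preserving_def)
  have "(LINT x|distr lborel borel T. f x) = (LINT x|lborel. f (T x))" using f by (intro integral_distr) auto
  then show "(LINT x|lborel. f (T x)) = (LINT x|lborel. f x)" using T by (simp add: lborel_preserving_def)
  have "integrable (distr lborel borel T) f \<longleftrightarrow> integrable lborel (\<lambda>x. f (T x))" using f by (intro integrable_distr_eq) auto
  then show "integrable lborel (\<lambda>x. f (T x)) \<longleftrightarrow> integrable lborel f" using T by (simp add: lborel_preserving_def)
qed

lemma lborel_preservingI:
  assumes [measurable]: "T \<in> borel_measurable borel"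
    and "\<And>A. A \<in> sets borel \<Longrightarrow> (\<integral>\<^sup>+ x. indicator A (T x) \<partial>lborel) = (\<integral>\<^sup>+ x. indicator A x \<partial>lborel)"
  shows "lborel_preserving T" unfolding lborel_preserving_def
proof (intro conjI assms(1) measure_eqI)
  fix A assume "A \<in> sets (distr lborel borel T)"
  then have A: "A \<in> sets borel" by simp
  have "emeasure (distr lborel borel T) A = (\<integral>\<^sup>+ x. indicator A x \<partial>distr lborel borel T)" using A by simp
  also have "\<dots> = (\<integral>\<^sup>+ x. indicator A (T x) \<partial>lborel)" using A by (intro nn_integral_distr) auto
  also have "\<dots> = emeasure lborel A" unfolding assms(2)[OF A] using A by simp
  finally show "emeasure (distr lborel borel T) A = emeasure lborel A" .
qed simp

lemma nn_integral_translate: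
  fixes f :: "'a::euclidean_space \<Rightarrow> ennreal"
  assumes "f \<in> borel_measurable borel"
  shows "(\<integral>\<^sup>+ x. f (x + c) \<partial>lborel) = (\<integral>\<^sup>+ x. f x \<partial>lborel)"
proof -
  have "(\<integral>\<^sup>+ x. f x \<partial>distr lborel borel ((+) c)) = (\<integral>\<^sup>+ x. f (c + x) \<partial>lborel)"
    using assms by (intro nn_integral_distr) auto
  then show ?thesis unfolding lborel_distr_plus by (simp add: add.commute)
qed

text \<open>For fixed second component the map is a translation, so Tonelli applied to indicator
  functions reduces the claim to translation invariance.\<close>

lemma lborel_preserving_shear_fst:
  fixes L :: "'b::euclidean_space \<Rightarrow> 'a::euclidean_space"
  assumes [measurable]: "L \<in> borel_measurable borel"
  shows "lborel_preserving (\<lambda>z. (fst z + L (snd z), snd z))"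
proof (rule lborel_preservingI)
  show "(\<lambda>z. (fst z + L (snd z), snd z)) \<in> borel_measurable borel" by (auto simp flip: borel_prod)
  fix A :: "('a \<times> 'b) set" assume A: "A \<in> sets borel"
  then have A' [measurable]: "A \<in> sets (borel \<Otimes>\<^sub>M borel)" unfolding borel_prod .
  have "(\<integral>\<^sup>+ z. indicator A (fst z + L (snd z), snd z) \<partial>(lborel :: ('a \<times> 'b) measure))
      = (\<integral>\<^sup>+ y. \<integral>\<^sup>+ x. indicator A (x + L y, y) \<partial>lborel \<partial>lborel)"
    unfolding lborel_prod[symmetric] by (subst lborel_pair.nn_integral_snd[symmetric]) auto
  also have "\<dots> = (\<integral>\<^sup>+ y. \<integral>\<^sup>+ x. indicator A (x, y) \<partial>lborel \<partial>lborel)"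
    by (intro nn_integral_cong nn_integral_translate[where f = "\<lambda>x. indicator A (x, y)" for y]) measurable
  also have "\<dots> = (\<integral>\<^sup>+ z. indicator A z \<partial>(lborel :: ('a \<times> 'b) measure))"
    unfolding lborel_prod[symmetric] by (subst lborel_pair.nn_integral_snd) auto
  finally show "(\<integral>\<^sup>+ z. indicator A (fst z + L (snd z), snd z) \<partial>(lborel :: ('a \<times> 'b) measure)) = (\<integral>\<^sup>+ z. indicator A z \<partial>lborel)" .
qed

lemma lborel_preserving_shear_snd:
  fixes L :: "'a::euclidean_space \<Rightarrow> 'b::euclidean_space"
  assumes [measurable]: "L \<in> borel_measurable borel"
  shows "lborel_preserving (\<lambda>z. (fst z, snd z + L (fst z)))"
proof (rule lborel_preservingI)
  show "(\<lambda>z. (fst z, snd z + L (fst z))) \<in> borel_measurable borel" by (auto simp flip: borel_prod)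
  fix A :: "('a \<times> 'b) set" assume A: "A \<in> sets borel"
  then have A' [measurable]: "A \<in> sets (borel \<Otimes>\<^sub>M borel)" unfolding borel_prod .
  have "(\<integral>\<^sup>+ z. indicator A (fst z, snd z + L (fst z)) \<partial>(lborel :: ('a \<times> 'b) measure))
      = (\<integral>\<^sup>+ x. \<integral>\<^sup>+ y. indicator A (x, y + L x) \<partial>lborel \<partial>lborel)"
    unfolding lborel_prod[symmetric] by (subst lborel.nn_integral_fst[symmetric]) auto
  also have "\<dots> = (\<integral>\<^sup>+ x. \<integral>\<^sup>+ y. indicator A (x, y) \<partial>lborel \<partial>lborel)"
    by (intro nn_integral_cong nn_integral_translate[where f = "\<lambda>y. indicator A (x, y)" for x]) measurable
  also have "\<dots> = (\<integral>\<^sup>+ z. indicator A z \<partial>(lborel :: ('a \<times> 'b) measure))"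
    unfolding lborel_prod[symmetric] by (subst lborel.nn_integral_fst) auto
  finally show "(\<integral>\<^sup>+ z. indicator A (fst z, snd z + L (fst z)) \<partial>(lborel :: ('a \<times> 'b) measure)) = (\<integral>\<^sup>+ z. indicator A z \<partial>lborel)" .
qed

abbreviation phase_coord :: "'n \<Rightarrow> 'n::finite phase \<Rightarrow> real \<times> real" where
  "phase_coord j z \<equiv> (fst z $ j, snd z $ j)"

text \<open>A plane rotation is a product of three shears.\<close>

lemma coordinate_rotation:
  fixes i :: "'n::finite" and c s :: real
  assumes cs: "c\<^sup>2 + s\<^sup>2 = 1" and c: "c \<noteq> - 1"
  shows "\<exists>T. lborel_preserving T \<and> (\<forall>z. phase_coord i (T z) = (c * fst z $ i - s * snd z $ i, s * fst z $ i + c * snd z $ i)) \<and>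
    (\<forall>j z. j \<noteq> i \<longrightarrow> phase_coord j (T z) = phase_coord j z)"
proof -
  \<comment> \<open>The tangent of half the rotation angle. The outer shears have slope
    \<open>- a\<close>, the middle one slope \<open>s\<close>; the angle \<pi> is excluded by the
    hypothesis on \<open>c\<close>.\<close>
  define a where "a = s / (1 + c)"
  have c1: "1 + c \<noteq> 0" using c by (simp add: add_eq_0_iff)
  have "s * s = (1 - c) * (1 + c)" using cs by (simp add: power2_eq_square algebra_simps)
  then have "a * s = (1 - c) * (1 + c) / (1 + c)" by (simp add: a_def)
  then have as: "a * s = 1 - c" using c1 by simp
  have ac: "a * (1 + c) = s" using c1 by (simp add: a_def)
  define S where "S = (\<lambda>z :: 'n phase. (fst z + axis i (- a * snd z $ i), snd z))"
  define U where "U = (\<lambda>z :: 'n phase. (fst z, snd z + axis i (s * fst z $ i)))"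
  have ax: "(\<lambda>x :: real ^ 'n. axis i (r * x $ i) :: real ^ 'n) \<in> borel_measurable borel" for r
  proof -
    have "(\<lambda>x :: real ^ 'n. axis i (r * x $ i) :: real ^ 'n) = (\<lambda>x. (r * x $ i) *\<^sub>R axis i 1)"
      by (auto simp: vec_eq_iff axis_def)
    then show ?thesis by simp
  qed
  have pS: "lborel_preserving S" unfolding S_def using lborel_preserving_shear_fst[OF ax[of "- a"]] by simp
  have pU: "lborel_preserving U" unfolding U_def using lborel_preserving_shear_snd[OF ax[of s]] by simp
  have 1: "lborel_preserving (\<lambda>z. S (U (S z)))" by (rule lborel_preserving_compose[OF pS lborel_preserving_compose[OF pU pS]])
  have 2: "phase_coord j (S (U (S z))) = phase_coord j z" if "j \<noteq> i" for j z using that by (simp add: S_def U_def axis_def)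
  have "phase_coord i (S (U (S z))) = (c * fst z $ i - s * snd z $ i, s * fst z $ i + c * snd z $ i)" for z
  proof -
    let ?x = "fst z $ i" and ?y = "snd z $ i"
    have y: "?y + s * (?x - a * ?y) = s * ?x + c * ?y" using arg_cong[OF as, of "\<lambda>r. r * ?y"] by (simp add: algebra_simps)
    have "?x - a * ?y - a * (s * ?x + c * ?y) = ?x - (a * s) * ?x - (a * (1 + c)) * ?y" by (simp add: algebra_simps)
    then have x: "?x - a * ?y - a * (s * ?x + c * ?y) = c * ?x - s * ?y" unfolding as ac by (simp add: algebra_simps)
    show ?thesis using x y by (simp add: S_def U_def axis_def)
  qed
  with 1 2 show ?thesis by blast
qed

section \<open>Wigner functions of Hermite functions integrated against radial symbols\<close>

definition wigner_product :: "nat ^ 'n::finite \<Rightarrow> nat ^ 'n \<Rightarrow> 'n phase \<Rightarrow> complex" where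
  "wigner_product k m z = (\<Prod>i\<in>UNIV. wigner1 (k $ i) (m $ i) (phase_coord i z))"

text \<open>In a plane where the indices differ, a rotation leaves the measure and the radial factor
  unchanged but multiplies the Wigner function by a phase, so the integral equals itself times that
  phase.\<close>

lemma wigner_product_off_diagonal:
  fixes G :: "real ^ 'n::finite \<Rightarrow> complex"
  assumes km: "k \<noteq> m" and m: "(\<lambda>z. G (square_moduli z) * wigner_product k m z) \<in> borel_measurable borel"
  shows "(LINT z|lborel. G (square_moduli z) * wigner_product k m z) = 0"
proof -
  obtain i where i: "k $ i \<noteq> m $ i" using km by (auto simp: vec_eq_iff)
  define d where "d = nat \<bar>int (k $ i) - int (m $ i)\<bar>"
  have d: "0 < d" "k $ i = m $ i + d \<or> m $ i = k $ i + d" using i by (auto simp: d_def)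
  \<comment> \<open>With this angle the \<open>d\<close>-th power of the rotation factor is \<i>, a
    phase different from 1, and the angle stays below \<pi> as the decomposition into shears
    demands.\<close>
  define \<theta> where "\<theta> = pi / (2 * real d)"
  have \<theta>: "0 < \<theta>" "\<theta> < pi" using d(1) by (auto simp: \<theta>_def field_simps)
  have "cos \<theta> \<noteq> - 1" using \<theta> cos_monotone_0_pi[of \<theta> pi] by auto
  then obtain T where T: "lborel_preserving T"
      "\<And>z. phase_coord i (T z) = (cos \<theta> * fst z $ i - sin \<theta> * snd z $ i, sin \<theta> * fst z $ i + cos \<theta> * snd z $ i)"
      "\<And>j z. j \<noteq> i \<Longrightarrow> phase_coord j (T z) = phase_coord j z"
    using coordinate_rotation[of "cos \<theta>" "sin \<theta>" i] by auto
  have ci: "cis \<theta> ^ d = \<i>"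
  proof -
    have "cis \<theta> ^ d = cis (real d * \<theta>)" by (rule Complex.DeMoivre)
    also have "real d * \<theta> = pi / 2" using d(1) by (simp add: \<theta>_def)
    finally show ?thesis by simp
  qed
  have rot: "cpair (phase_coord i (T z)) = cis \<theta> * cpair (phase_coord i z)" for z unfolding T(2) by (simp add: complex_eq_iff)
  have sm: "square_moduli (T z) = square_moduli z" for z
  proof -
    have "square_moduli (T z) $ j = square_moduli z $ j" for j
    proof (cases "j = i")
      case True
      have "(cmod (cpair (phase_coord i (T z))))\<^sup>2 = (cmod (cpair (phase_coord i z)))\<^sup>2" unfolding rot by (simp add: norm_mult)
      then show ?thesis unfolding square_moduli_nth True by (simp add: cmod_power2)
    next
      case False
      then show ?thesis using T(3)[OF False, of z] by (simp add: square_moduli_nth)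
    qed
    then show ?thesis by (simp add: vec_eq_iff)
  qed
  have wp: "wigner_product k m (T z) * cis \<theta> ^ (k $ i) = cis \<theta> ^ (m $ i) * wigner_product k m z" for z
  proof -
    have split: "wigner_product k m z = wigner1 (k $ i) (m $ i) (phase_coord i z) * (\<Prod>j\<in>UNIV - {i}. wigner1 (k $ j) (m $ j) (phase_coord j z))" for z
      unfolding wigner_product_def by (subst prod.remove[of _ i]) auto
    have "(\<Prod>j\<in>UNIV - {i}. wigner1 (k $ j) (m $ j) (phase_coord j (T z))) = (\<Prod>j\<in>UNIV - {i}. wigner1 (k $ j) (m $ j) (phase_coord j z))"
      using T(3) by (intro prod.cong refl) simp
    then show ?thesis unfolding split using wigner1_rotate[OF rot[of z], of "k $ i" "m $ i"] by (simp add: mult_ac)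
  qed
  let ?I = "LINT z|lborel. G (square_moduli z) * wigner_product k m z"
  have "?I * cis \<theta> ^ (k $ i) = (LINT z|lborel. G (square_moduli (T z)) * wigner_product k m (T z)) * cis \<theta> ^ (k $ i)"
    using lborel_preserving_integral(1)[OF T(1) m] by simp
  also have "\<dots> = (LINT z|lborel. G (square_moduli (T z)) * wigner_product k m (T z) * cis \<theta> ^ (k $ i))"
    by (rule integral_mult_left_zero[symmetric])
  also have "\<dots> = (LINT z|lborel. cis \<theta> ^ (m $ i) * (G (square_moduli z) * wigner_product k m z))"
    unfolding mult.assoc wp sm by (simp only: mult.left_commute)
  also have "\<dots> = cis \<theta> ^ (m $ i) * ?I" by (rule integral_mult_right_zero)
  finally have e: "?I * cis \<theta> ^ (k $ i) = cis \<theta> ^ (m $ i) * ?I" .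
  have nz: "cis \<theta> ^ j \<noteq> 0" for j by simp
  \<comment> \<open>After cancelling the smaller power, both signs of the index difference lead to
    the same equation.\<close>
  have "\<i> * ?I = ?I" using d(2)
  proof
    assume k: "k $ i = m $ i + d"
    show ?thesis using e nz[of "m $ i"] unfolding k power_add ci by (simp add: mult_ac)
  next
    assume k: "m $ i = k $ i + d"
    show ?thesis using e nz[of "k $ i"] unfolding k power_add ci by (simp add: mult_ac)
  qed
  then have "(\<i> - 1) * ?I = 0" by (simp add: algebra_simps)
  then show ?thesis by (simp add: complex_eq_iff)
qed

section \<open>Phase-space measure, plane by plane, and its image under the squared moduli\<close>

definition phase_vec :: "('n \<Rightarrow> real \<times> real) \<Rightarrow> 'n::finite phase" where
  "phase_vec f = (\<chi> i. fst (f i), \<chi> i. snd (f i))"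

lemma phase_vec_measurable [measurable]: "(phase_vec :: ('n::finite \<Rightarrow> _) \<Rightarrow> _) \<in> PiM UNIV (\<lambda>_. lborel) \<rightarrow>\<^sub>M borel"
proof -
  have 1: "(\<lambda>f. (\<chi> i. h (f i)) :: real ^ 'n) \<in> borel_measurable (PiM UNIV (\<lambda>_. lborel))"
    if [measurable]: "h \<in> borel_measurable borel" for h :: "real \<times> real \<Rightarrow> real"
  proof (subst borel_measurable_euclidean_space, intro ballI)
    fix b :: "real ^ 'n" assume "b \<in> Basis"
    then obtain j where b: "b = axis j 1" by (rule Basis_vecE)
    have "(\<lambda>f. h (f j)) \<in> borel_measurable (PiM UNIV (\<lambda>_ :: 'n. lborel))" by measurable
    then show "(\<lambda>f. (\<chi> i. h (f i)) \<bullet> b) \<in> borel_measurable (PiM UNIV (\<lambda>_. lborel))" unfolding b inner_axis by simp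
  qed
  have "(\<lambda>f. ((\<chi> i. fst (f i)) :: real ^ 'n, (\<chi> i. snd (f i)) :: real ^ 'n)) \<in> borel_measurable (PiM UNIV (\<lambda>_. lborel))"
    by (rule borel_measurable_Pair[OF 1 1]; intro borel_measurable_continuous_onI continuous_intros)
  then show ?thesis unfolding phase_vec_def[abs_def] .
qed

lemma emeasure_phase_vec:
  fixes A :: "'n::finite \<Rightarrow> (real \<times> real) set"
  assumes A: "\<And>i. A i \<in> sets borel" and S: "S \<in> sets borel" "\<And>f. phase_vec f \<in> S \<longleftrightarrow> (\<forall>i. f i \<in> A i)"
  shows "emeasure (distr (PiM UNIV (\<lambda>_. lborel)) borel phase_vec) S = (\<Prod>i\<in>UNIV. emeasure lborel (A i))"
proof -
  interpret product_sigma_finite "\<lambda>_ :: 'n. lborel :: (real \<times> real) measure" by standard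
  have "emeasure (distr (PiM UNIV (\<lambda>_. lborel)) borel phase_vec) S
      = emeasure (PiM UNIV (\<lambda>_. lborel)) (phase_vec -` S \<inter> space (PiM UNIV (\<lambda>_. lborel)))"
    by (rule emeasure_distr) (use S in auto)
  also have "phase_vec -` S \<inter> space (PiM UNIV (\<lambda>_. lborel :: (real \<times> real) measure)) = Pi\<^sub>E UNIV A"
  proof -
    have "phase_vec -` S \<inter> space (PiM UNIV (\<lambda>_. lborel :: (real \<times> real) measure)) = {f. \<forall>i. f i \<in> A i}"
      using S(2) by (simp add: space_PiM vimage_def)
    also have "\<dots> = Pi\<^sub>E UNIV A" by (auto simp: PiE_def Pi_def extensional_def)
    finally show ?thesis .
  qed
  also have "emeasure (PiM UNIV (\<lambda>_. lborel)) \<dots> = (\<Prod>i\<in>UNIV. emeasure lborel (A i))" using A by (intro emeasure_PiM) auto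
  finally show ?thesis .
qed

text \<open>Regrouping the coordinates into planes makes Lebesgue measure a product of planar ones,
  so conditions imposed on each plane separately have a product measure. It suffices to compare
  boxes.\<close>

lemma lborel_phase_space:
  "(lborel :: 'n::finite phase measure) = distr (PiM UNIV (\<lambda>_. lborel)) borel phase_vec"
proof (rule lborel_eqI)
  fix l u :: "'n phase"
  assume le: "\<And>b. b \<in> Basis \<Longrightarrow> l \<bullet> b \<le> u \<bullet> b"
  have le1: "fst l $ i \<le> fst u $ i" "snd l $ i \<le> snd u $ i" for i
    using le[of "(axis i 1, 0)"] le[of "(0, axis i 1)"] by (auto simp: Basis_prod_def inner_prod_def inner_axis)
  have "emeasure (distr (PiM UNIV (\<lambda>_. lborel)) borel phase_vec) (box l u) = (\<Prod>i\<in>UNIV. emeasure lborel (box (phase_coord i l) (phase_coord i u)))"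
  proof (rule emeasure_phase_vec)
    fix f :: "'n \<Rightarrow> real \<times> real"
    show "phase_vec f \<in> box l u \<longleftrightarrow> (\<forall>i. f i \<in> box (phase_coord i l) (phase_coord i u))"
      by (auto simp: mem_box Basis_prod_def Basis_vec_eq_image phase_vec_def inner_prod_def inner_axis ball_Un)
  qed auto
  also have "\<dots> = (\<Prod>i\<in>UNIV. ennreal ((fst u $ i - fst l $ i) * (snd u $ i - snd l $ i)))"
  proof (intro prod.cong refl)
    fix i
    have "emeasure lborel (box (phase_coord i l) (phase_coord i u)) = (\<Prod>b\<in>Basis. (phase_coord i u - phase_coord i l) \<bullet> b)"
      using le1[of i] by (intro emeasure_lborel_box) (auto simp: Basis_prod_def inner_prod_def)
    also have "(\<Prod>b\<in>Basis. (phase_coord i u - phase_coord i l) \<bullet> b) = (fst u $ i - fst l $ i) * (snd u $ i - snd l $ i)"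
      by (simp add: Basis_prod_def inner_prod_def)
    finally show "emeasure lborel (box (phase_coord i l) (phase_coord i u)) = ennreal ((fst u $ i - fst l $ i) * (snd u $ i - snd l $ i))" .
  qed
  also have "\<dots> = ennreal (\<Prod>i\<in>UNIV. (fst u $ i - fst l $ i) * (snd u $ i - snd l $ i))" using le1 by (intro prod_ennreal) simp
  also have "(\<Prod>i\<in>UNIV. (fst u $ i - fst l $ i) * (snd u $ i - snd l $ i)) = (\<Prod>b\<in>Basis. (u - l) \<bullet> b)"
  proof -
    have "(\<Prod>b\<in>Basis. (u - l) \<bullet> b) = (\<Prod>b\<in>Basis. (fst u - fst l) \<bullet> b) * (\<Prod>b\<in>Basis. (snd u - snd l) \<bullet> b)"
      unfolding Basis_prod_def by (subst prod.union_disjoint) (auto simp: prod.reindex inj_on_def inner_prod_def dest: nonzero_Basis)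
    then show ?thesis unfolding prod_Basis_vec by (simp add: inner_axis prod.distrib)
  qed
  finally show "emeasure (distr (PiM UNIV (\<lambda>_. lborel)) borel phase_vec) (box l u) = (\<Prod>b\<in>Basis. (u - l) \<bullet> b)" .
qed simp

lemma square_moduli_measurable [measurable]: "square_moduli \<in> borel_measurable borel"
  by (intro borel_measurable_continuous_onI continuous_at_imp_continuous_on ballI
      has_derivative_continuous[OF has_derivative_square_moduli])

lemma emeasure_disc:
  "emeasure lborel {z :: real \<times> real. (fst z)\<^sup>2 + (snd z)\<^sup>2 \<le> r} = ennreal (pi * max 0 r)"
proof (cases "0 \<le> r")
  case True
  have "{z :: real \<times> real. (fst z)\<^sup>2 + (snd z)\<^sup>2 \<le> r} = cball 0 (sqrt r)" using True by (auto simp: norm_prod_def)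
  moreover have "emeasure lborel (cball (0 :: real \<times> real) (sqrt r)) = ennreal (measure lborel (cball (0 :: real \<times> real) (sqrt r)))"
    using emeasure_bounded_finite[OF bounded_cball, of "0 :: real \<times> real" "sqrt r"] by (intro emeasure_eq_ennreal_measure) simp
  moreover have "measure lborel (cball (0 :: real \<times> real) (sqrt r)) = pi * r" using True by (subst content_cball) (auto simp: unit_ball_vol_2)
  ultimately show ?thesis using True by (simp add: max_def)
next
  case False
  have e: "{z :: real \<times> real. (fst z)\<^sup>2 + (snd z)\<^sup>2 \<le> r} = {}"
  proof -
    have "\<not> (fst z)\<^sup>2 + (snd z)\<^sup>2 \<le> r" for z :: "real \<times> real"
      using False zero_le_power2[of "fst z"] zero_le_power2[of "snd z"] by linarith
    then show ?thesis by simp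
  qed
  show ?thesis unfolding e using False by (simp add: max_def)
qed

text \<open>The area of a disc is \<pi> times its squared radius, hence linear in the squared
  modulus. The two measures agree on the lower sets \<open>{..r}\<close>, which are stable under
  intersection and generate the Borel sets; \<open>max 0\<close> covers negative bounds.\<close>

lemma distr_square_moduli:
  "distr lborel borel (square_moduli :: 'n::finite phase \<Rightarrow> _)
    = density lborel (\<lambda>x. ennreal (pi ^ CARD('n) * indicator pos_orthant x))"
proof (rule measure_eqI_generator_eq[where E = "range (\<lambda>a. {..a :: real ^ 'n})" and \<Omega> = UNIV and A = "\<lambda>j. {.. \<chi> i. real j}"])
  show "Int_stable (range (\<lambda>a. {..a :: real ^ 'n}))"
  proof -
    have "{..a} \<inter> {..b} \<in> range (\<lambda>a. {..a :: real ^ 'n})" for a b by (rule range_eqI[of _ _ "inf a b"]) auto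
    then show ?thesis by (auto simp: Int_stable_def)
  qed
  have sb: "sets borel = sigma_sets UNIV (range (\<lambda>a. {..a :: real ^ 'n}))" by (subst borel_eq_atMost) simp
  then show "sets (distr lborel borel (square_moduli :: 'n phase \<Rightarrow> _)) = sigma_sets UNIV (range (\<lambda>a. {..a}))"
    "sets (density lborel (\<lambda>x. ennreal (pi ^ CARD('n) * indicator pos_orthant x))) = sigma_sets UNIV (range (\<lambda>a. {..a :: real ^ 'n}))"
    by simp_all
  have L: "emeasure (distr lborel borel square_moduli) {..r} = ennreal (\<Prod>i\<in>UNIV. pi * max 0 (r $ i))" for r :: "real ^ 'n"
  proof -
    have ms: "square_moduli -` {..r} \<in> sets borel" using measurable_sets[OF square_moduli_measurable, of "{..r}"] by simp
    have "emeasure (distr lborel borel square_moduli) {..r} = emeasure lborel (square_moduli -` {..r})" by (subst emeasure_distr) auto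
    also have "\<dots> = (\<Prod>i\<in>UNIV. emeasure lborel {z :: real \<times> real. (fst z)\<^sup>2 + (snd z)\<^sup>2 \<le> r $ i})"
      unfolding lborel_phase_space
    proof (rule emeasure_phase_vec)
      show "{z :: real \<times> real. (fst z)\<^sup>2 + (snd z)\<^sup>2 \<le> r $ i} \<in> sets borel" for i
        by (intro borel_closed closed_Collect_le continuous_intros)
    qed (use ms in \<open>auto simp: less_eq_vec_def square_moduli_nth phase_vec_def\<close>)
    finally show ?thesis unfolding emeasure_disc by (simp add: prod_ennreal)
  qed
  have R: "emeasure (density lborel (\<lambda>x. ennreal (pi ^ CARD('n) * indicator pos_orthant x))) {..r} = ennreal (\<Prod>i\<in>UNIV. pi * max 0 (r $ i))" for r :: "real ^ 'n"
  proof -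
    have po [measurable]: "pos_orthant \<in> sets (borel :: (real ^ 'n) measure)" by (intro borel_open open_pos_orthant)
    have "emeasure (density lborel (\<lambda>x. ennreal (pi ^ CARD('n) * indicator pos_orthant x))) {..r}
        = (\<integral>\<^sup>+ x. ennreal (pi ^ CARD('n)) * indicator (pos_orthant \<inter> {..r}) x \<partial>lborel)"
      by (subst emeasure_density) (auto intro!: nn_integral_cong simp: ennreal_mult indicator_def)
    also have "\<dots> = ennreal (pi ^ CARD('n)) * emeasure lborel (pos_orthant \<inter> {..r})" by (subst nn_integral_cmult_indicator) auto
    also have "emeasure lborel (pos_orthant \<inter> {..r}) = ennreal (\<Prod>i\<in>UNIV. max 0 (r $ i))"
    proof (cases "\<forall>i. 0 \<le> r $ i")
      case True
      have b: "b \<in> Basis \<Longrightarrow> 0 \<bullet> b \<le> r \<bullet> b" for b using True by (auto elim!: Basis_vecE simp: inner_axis)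
      have v: "(\<Prod>b\<in>Basis. (r - 0) \<bullet> b) = (\<Prod>i\<in>UNIV. max 0 (r $ i))"
        unfolding prod_Basis_vec using True by (intro prod.cong refl) (simp add: inner_axis max_def)
      \<comment> \<open>The set lies between an open and a closed box of the same volume.\<close>
      have s1: "box 0 r \<subseteq> pos_orthant \<inter> {..r}"
        by (auto simp: mem_box Basis_vec_eq_image inner_axis pos_orthant_def less_eq_vec_def less_imp_le)
      have s2: "pos_orthant \<inter> {..r} \<subseteq> cbox 0 r"
        by (auto simp: mem_box Basis_vec_eq_image inner_axis pos_orthant_def less_eq_vec_def less_imp_le)
      have "emeasure lborel (pos_orthant \<inter> {..r}) \<le> ennreal (\<Prod>i\<in>UNIV. max 0 (r $ i))"
        using emeasure_mono[OF s2, of lborel] emeasure_lborel_cbox[OF b] unfolding v by simp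
      moreover have "ennreal (\<Prod>i\<in>UNIV. max 0 (r $ i)) \<le> emeasure lborel (pos_orthant \<inter> {..r})"
        using emeasure_mono[OF s1, of lborel] emeasure_lborel_box[OF b] unfolding v by simp
      ultimately show ?thesis by (rule antisym)
    next
      case False
      then obtain i where i: "r $ i < 0" by (auto simp: not_le)
      have "pos_orthant \<inter> {..r} = {}"
      proof -
        have False if "x \<in> pos_orthant" "x \<le> r" for x
        proof -
          have "0 < x $ i" using that(1) by (simp add: pos_orthant_def)
          moreover have "x $ i \<le> r $ i" using that(2) by (simp add: less_eq_vec_def)
          ultimately show False using i by linarith
        qed
        then show ?thesis by auto
      qed
      moreover have "(\<Prod>i\<in>UNIV. max 0 (r $ i)) = 0" using i by (intro prod_zero bexI[of _ i]) auto
      ultimately show ?thesis by (simp only: emeasure_empty ennreal_0)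
    qed
    finally show ?thesis by (simp add: prod.distrib ennreal_mult[symmetric] prod_nonneg)
  qed
  show "emeasure (distr lborel borel square_moduli) X = emeasure (density lborel (\<lambda>x. ennreal (pi ^ CARD('n) * indicator pos_orthant x))) X"
    if "X \<in> range (\<lambda>a. {..a :: real ^ 'n})" for X using that L R by auto
  show "emeasure (distr lborel borel (square_moduli :: 'n phase \<Rightarrow> _)) {.. \<chi> i. real j} \<noteq> \<infinity>" for j
    unfolding L by simp
  show "(\<Union>j. {.. \<chi> i. real j}) = (UNIV :: (real ^ 'n) set)"
  proof (intro equalityI subset_UNIV subsetI)
    fix x :: "real ^ 'n"
    obtain j where j: "Max (range (\<lambda>i. x $ i)) \<le> real j" using real_arch_simple by blast
    have "x $ i \<le> real j" for i using j Max_ge[of "range (\<lambda>i. x $ i)" "x $ i"] by simp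
    then show "x \<in> (\<Union>j. {.. \<chi> i. real j})" by (auto simp: less_eq_vec_def)
  qed
qed auto

lemma integral_square_moduli:
  fixes H :: "real ^ 'n::finite \<Rightarrow> complex"
  assumes [measurable]: "H \<in> borel_measurable borel"
  shows "(LINT z|lborel. H (square_moduli z)) = of_real (pi ^ CARD('n)) * (LINT x:pos_orthant|lborel. H x)"
proof -
  have [measurable]: "pos_orthant \<in> sets (borel :: (real ^ 'n) measure)" by (intro borel_open open_pos_orthant)
  have "(LINT z|lborel. H (square_moduli z)) = (LINT x|distr lborel borel square_moduli. H x)" by (rule integral_distr[symmetric]) auto
  also have "\<dots> = (LINT x|lborel. (pi ^ CARD('n) * indicator pos_orthant x) *\<^sub>R H x)"
    unfolding distr_square_moduli by (rule integral_density) auto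
  also have "\<dots> = (LINT x|lborel. of_real (pi ^ CARD('n)) * (indicator pos_orthant x *\<^sub>R H x))"
    by (simp add: scaleR_conv_of_real mult.assoc)
  also have "\<dots> = of_real (pi ^ CARD('n)) * (LINT x:pos_orthant|lborel. H x)"
    unfolding set_lebesgue_integral_def by (rule integral_mult_right_zero)
  finally show ?thesis .
qed

lemma wigner_product_diagonal:
  "wigner_product k k z = (- 1) ^ (\<Sum>i\<in>UNIV. k $ i) * 2 ^ CARD('n) * laguerre_product (k :: nat ^ 'n::finite) (square_moduli z)"
  unfolding wigner_product_def wigner1_diag laguerre_product_def by (simp add: prod.distrib power_sum square_moduli_nth mult_ac)

lemma closed_closed_orthant: "closed (closed_orthant :: (real ^ 'n::finite) set)"
proof -
  have "closed (\<Inter>i\<in>UNIV. {x :: real ^ 'n. 0 \<le> x $ i})" by (intro closed_INT ballI closed_Collect_le continuous_intros)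
  moreover have "(\<Inter>i\<in>UNIV. {x :: real ^ 'n. 0 \<le> x $ i}) = closed_orthant" by (auto simp: closed_orthant_def)
  ultimately show ?thesis by simp
qed

lemma continuous_on_laguerre_product: "continuous_on UNIV (laguerre_product k)"
  unfolding laguerre_product_def laguerre_profile_def by (intro continuous_intros)

text \<open>The \<open>2 ^ n\<close> of the diagonal Wigner functions and the \<open>pi ^ n\<close>
  of the image measure combine to \<open>(2 * pi) ^ n\<close>, the inverse of the normalisation of
  \<open>weyl\<close>.\<close>

lemma radial_symbol_integral:
  fixes k m :: "nat ^ 'n::finite"
  assumes f: "f \<in> schwartz_orthant" and w: "wigner_product k m \<in> borel_measurable borel"
  shows "(LINT z|lborel. radial_symbol f z * wigner_product k m z)
    = (if k = m then of_real ((2 * pi) ^ CARD('n)) * radial_coeff k (dilate2 f) else 0)"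
proof -
  let ?u = "orthant_extension (dilate2 f)"
  have rs: "radial_symbol f z = ?u (square_moduli z)" for z by (simp add: radial_symbol_def)
  have [measurable]: "radial_symbol f \<in> borel_measurable borel" by (rule schwartz_measurable[OF radial_symbol_schwartz[OF f]])
  show ?thesis
  proof (cases "k = m")
    case False
    have "(\<lambda>z. ?u (square_moduli z) * wigner_product k m z) \<in> borel_measurable borel" using w unfolding rs[symmetric] by measurable
    from wigner_product_off_diagonal[OF False this] show ?thesis using False by (simp add: rs)
  next
    case True
    obtain G where G: "orthant_jets (dilate2 f) G" using orthant_jets_exist[OF dilate2_schwartz_orthant[OF f]] .
    \<comment> \<open>A Borel function on the whole space that agrees with the symbol times the
      Laguerre product on the closed orthant, boundary included, as the push-forward formula
      requires.\<close>
    define H where "H x = indicator closed_orthant x *\<^sub>R (G [] x * laguerre_product k x)" for x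
    have [measurable]: "H \<in> borel_measurable borel" unfolding H_def using G continuous_on_subset[OF continuous_on_laguerre_product subset_UNIV]
      by (intro borel_measurable_continuous_on_indicator continuous_on_mult borel_closed closed_closed_orthant) (auto simp: orthant_jets_def)
    have uH: "?u (square_moduli z) * laguerre_product k (square_moduli z) = H (square_moduli z)" for z
      using orthant_extension_eq_jet[OF _ _ G square_moduli_closed_orthant, of z]
        dilate2_schwartz_orthant[OF f] by (simp add: H_def square_moduli_closed_orthant schwartz_orthant_def)
    have "(LINT z|lborel. radial_symbol f z * wigner_product k k z)
        = (LINT z|lborel. ((- 1) ^ (\<Sum>i\<in>UNIV. k $ i) * 2 ^ CARD('n)) * H (square_moduli z))"
      unfolding rs wigner_product_diagonal uH[symmetric] by (simp only: mult_ac)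
    also have "\<dots> = ((- 1) ^ (\<Sum>i\<in>UNIV. k $ i) * 2 ^ CARD('n)) * (of_real (pi ^ CARD('n)) * (LINT x:pos_orthant|lborel. H x))"
      by (simp only: integral_mult_right_zero integral_square_moduli[OF \<open>H \<in> borel_measurable borel\<close>])
    also have "(LINT x:pos_orthant|lborel. H x) = (LINT x:pos_orthant|lborel. dilate2 f x * laguerre_product k x)"
      using G pos_orthant_subset by (intro set_lebesgue_integral_cong) (auto simp: H_def orthant_jets_def intro!: borel_open open_pos_orthant)
    finally show ?thesis using True by (simp add: radial_coeff_def power_mult_distrib mult_ac)
  qed
qed

section \<open>Weyl operators\<close>

lemma poly_weight_Pair:
  "poly_weight (x :: 'a::euclidean_space, y :: 'b::euclidean_space) = poly_weight x * poly_weight y" unfolding poly_weight_def Basis_prod_def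
  by (subst prod.union_disjoint) (auto simp: prod.reindex inj_on_def inner_prod_def dest: nonzero_Basis)

lemma schwartz_weight_bound:
  assumes "f \<in> schwartz"
  obtains C where "0 < C" "\<And>x. norm (f x) \<le> C / poly_weight x"
  using schwartz_decay[OF assms diffops_id, of 1] by (auto simp only: power_one_right)

text \<open>If \<open>f\<close> is not integrable, neither is its reflection, and both integrals
  have the default value 0. So reflections may be applied to every slice without an integrability
  check.\<close>

lemma integral_reflect:
  fixes f :: "'a::euclidean_space \<Rightarrow> complex"
  shows "(LINT x|lborel. f (- x)) = (LINT x|lborel. f x)"
proof (cases "integrable lborel f")
  case True
  then show ?thesis using integral_scale_shift[of "-1" f 0] by simp
next
  case False
  have "\<not> integrable lborel (\<lambda>x. f (- x))" using integrable_scale_shift[of "-1" "\<lambda>x. f (- x)" 0] False by auto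
  with False show ?thesis by (simp add: not_integrable_integral_eq)
qed

definition wigner :: "(real ^ 'n::finite \<Rightarrow> complex) \<Rightarrow> (real ^ 'n \<Rightarrow> complex) \<Rightarrow> 'n phase \<Rightarrow> complex" where
  "wigner f g z = (LINT p|lborel. exp (\<i> * of_real (p \<bullet> snd z)) * (f (fst z - (1 / 2) *\<^sub>R p) * g (fst z + (1 / 2) *\<^sub>R p)))"

lemma wigner_reflect: "wigner f g (q, - \<xi>) = wigner g f (q, \<xi>)"
proof -
  have "wigner f g (q, - \<xi>) = (LINT p|lborel. exp (\<i> * of_real ((- p) \<bullet> (- \<xi>))) * (f (q - (1 / 2) *\<^sub>R (- p)) * g (q + (1 / 2) *\<^sub>R (- p))))"
    unfolding wigner_def fst_conv snd_conv by (rule integral_reflect[symmetric])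
  then show ?thesis by (simp add: wigner_def mult_ac)
qed

lemma wigner_hermite: "wigner (hermite_fun k) (hermite_fun m) = wigner_product k (m :: nat ^ 'n::finite)"
proof
  fix z :: "'n phase"
  let ?h = "\<lambda>i p. exp (\<i> * of_real (p * snd z $ i)) * complex_of_real (hermite_fun1 (k $ i) (fst z $ i - p / 2) * hermite_fun1 (m $ i) (fst z $ i + p / 2))"
  have "exp (\<i> * of_real (p \<bullet> snd z)) * (hermite_fun k (fst z - (1 / 2) *\<^sub>R p) * hermite_fun m (fst z + (1 / 2) *\<^sub>R p)) = (\<Prod>i\<in>UNIV. ?h i (p $ i))" for p
  proof -
    have "exp (\<i> * complex_of_real (p \<bullet> snd z)) = (\<Prod>i\<in>UNIV. exp (\<i> * of_real (p $ i * snd z $ i)))"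
      by (simp add: inner_vec_def sum_distrib_left exp_sum)
    then show ?thesis unfolding hermite_fun_def of_real_prod prod.distrib[symmetric] of_real_mult[symmetric] by (simp add: prod.distrib)
  qed
  then have "wigner (hermite_fun k) (hermite_fun m) z = (LINT p|lborel. (\<Prod>i\<in>UNIV. ?h i (p $ i)))" by (simp only: wigner_def)
  also have "\<dots> = (\<Prod>i\<in>UNIV. LINT p|lborel. ?h i p)" by (rule integral_lborel_vec_prod) (rule integrable_hermite_pair)
  finally show "wigner (hermite_fun k) (hermite_fun m) z = wigner_product k m z" by (simp add: wigner_product_def wigner1_def)
qed

context
  fixes f g :: "real ^ 'n::finite \<Rightarrow> complex"
  assumes f: "f \<in> schwartz" and g: "g \<in> schwartz"
begin

lemma wigner_measurable: "wigner f g \<in> borel_measurable borel"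
proof -
  have [continuous_intros]: "continuous_on UNIV (\<lambda>x. f (h x))" "continuous_on UNIV (\<lambda>x. g (h x))"
    if "continuous_on UNIV h" for h :: "'n::finite phase \<times> (real ^ 'n) \<Rightarrow> real ^ 'n"
    using continuous_on_compose2[OF schwartz_continuous[OF f] that] continuous_on_compose2[OF schwartz_continuous[OF g] that] by auto
  have "(\<lambda>w :: 'n phase \<times> (real ^ 'n). exp (\<i> * of_real (snd w \<bullet> snd (fst w))) *
      (f (fst (fst w) - (1 / 2) *\<^sub>R snd w) * g (fst (fst w) + (1 / 2) *\<^sub>R snd w))) \<in> borel_measurable borel"
    by (intro borel_measurable_continuous_onI continuous_intros)
  moreover have S: "sets (borel \<Otimes>\<^sub>M (lborel :: (real ^ 'n) measure)) = sets (borel :: ('n phase \<times> (real ^ 'n)) measure)"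
    using sets_pair_measure_cong[OF refl[of "sets (borel :: 'n phase measure)"] sets_lborel] unfolding borel_prod .
  ultimately have "(\<lambda>(z, p). exp (\<i> * of_real (p \<bullet> snd z)) * (f (fst z - (1 / 2) *\<^sub>R p) * g (fst z + (1 / 2) *\<^sub>R p))) \<in> borel_measurable (borel \<Otimes>\<^sub>M lborel)"
    unfolding case_prod_unfold measurable_cong_sets[OF S refl] by simp
  then show ?thesis unfolding wigner_def[abs_def] by (rule lborel.borel_measurable_lebesgue_integral)
qed

text \<open>The sup norm of \<open>f\<close> times the integral of the norm of \<open>g\<close>; the
  factor \<open>2 ^ CARD('n)\<close> is the Jacobian of halving the variable.\<close>

lemma wigner_bounded: "\<exists>C. \<forall>z. norm (wigner f g z) \<le> C"
proof -
  obtain C where C: "\<And>x. norm (f x) \<le> C" using schwartz_bounded[OF f diffops_id] by blast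
  have C0: "0 \<le> C" using C order_trans[OF norm_ge_zero] by blast
  have gi: "integrable lborel (\<lambda>x. norm (g x))"
    using integrable_mult_schwartz[of "\<lambda>_. 1" 1 g "\<lambda>f. f"] g diffops_id by (intro integrable_norm) simp
  have "norm (wigner f g z) \<le> C * (2 ^ CARD('n) * (LINT x|lborel. norm (g x)))" for z
  proof -
    have si': "integrable lborel (\<lambda>p. norm (g (fst z + (1 / 2) *\<^sub>R p)))" by (rule integrable_scale_shift_real[OF _ gi]) simp
    have I: "(LINT p|lborel. norm (g (fst z + (1 / 2) *\<^sub>R p))) = 2 ^ CARD('n) * (LINT x|lborel. norm (g x))"
      using integral_scale_shift_real[OF _ gi, of "1 / 2" "fst z"] by (simp add: power_divide)
    have "norm (wigner f g z) \<le> (LINT p|lborel. C * norm (g (fst z + (1 / 2) *\<^sub>R p)))" unfolding wigner_def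
    proof (rule Bochner_Integration.integral_norm_bound_integral)
      show "integrable lborel (\<lambda>p. C * norm (g (fst z + (1 / 2) *\<^sub>R p)))" by (rule integrable_mult_right[OF si'])
      show le: "norm (exp (\<i> * of_real (p \<bullet> snd z)) * (f (fst z - (1 / 2) *\<^sub>R p) * g (fst z + (1 / 2) *\<^sub>R p))) \<le> C * norm (g (fst z + (1 / 2) *\<^sub>R p))" for p
        unfolding norm_mult norm_exp_i_times using C by (simp add: mult_right_mono)
      have [continuous_intros]: "continuous_on UNIV (\<lambda>x. f (h x))" "continuous_on UNIV (\<lambda>x. g (h x))"
        if "continuous_on UNIV h" for h :: "real ^ 'n \<Rightarrow> real ^ 'n"
        using continuous_on_compose2[OF schwartz_continuous[OF f] that] continuous_on_compose2[OF schwartz_continuous[OF g] that] by auto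
      have "(\<lambda>p. exp (\<i> * of_real (p \<bullet> snd z)) * (f (fst z - (1 / 2) *\<^sub>R p) * g (fst z + (1 / 2) *\<^sub>R p))) \<in> borel_measurable borel"
        by (intro borel_measurable_continuous_onI continuous_intros)
      then show "integrable lborel (\<lambda>p. exp (\<i> * of_real (p \<bullet> snd z)) * (f (fst z - (1 / 2) *\<^sub>R p) * g (fst z + (1 / 2) *\<^sub>R p)))"
        using C0 by (intro Bochner_Integration.integrable_bound[OF integrable_mult_right[OF si', of C]] AE_I2 order_trans[OF le]) auto
    qed
    also have "\<dots> = C * (2 ^ CARD('n) * (LINT x|lborel. norm (g x)))" unfolding I[symmetric] by (rule integral_mult_right_zero)
    finally show ?thesis .
  qed
  then show ?thesis by blast
qed

lemma wigner_integrable: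
  assumes "\<tau> \<in> schwartz"
  shows "integrable lborel (\<lambda>z. \<tau> z * wigner f g z)"
proof -
  obtain C where "\<And>z. norm (wigner f g z) \<le> C" using wigner_bounded by blast
  from integrable_mult_schwartz[OF wigner_measurable this assms diffops_id]
  show ?thesis by (simp add: mult.commute)
qed

end

section \<open>The Weyl kernel and its pairing with Wigner functions\<close>

definition weyl_kernel :: "('n::finite phase \<Rightarrow> complex) \<Rightarrow> (real ^ 'n \<Rightarrow> complex) \<Rightarrow> real ^ 'n \<Rightarrow> real ^ 'n \<Rightarrow> real ^ 'n \<Rightarrow> complex" where
  "weyl_kernel \<tau> f x \<xi> y = exp (\<i> * complex_of_real ((x - y) \<bullet> \<xi>)) * \<tau> ((1 / 2) *\<^sub>R (x + y), \<xi>) * f y"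

lemma weyl_eq_kernel: "weyl \<tau> f x = of_real (1 / (2 * pi) ^ CARD('n)) * (LINT \<xi>|lborel. LINT y|lborel. weyl_kernel \<tau> f x \<xi> (y :: real ^ 'n::finite))"
  by (simp only: weyl_def weyl_kernel_def)

context
  fixes \<tau> :: "'n::finite phase \<Rightarrow> complex" and f :: "real ^ 'n \<Rightarrow> complex"
  assumes \<tau>: "\<tau> \<in> schwartz" and f: "f \<in> schwartz"
begin

lemma weyl_kernel_continuous:
  fixes a b c :: "'z::topological_space \<Rightarrow> real ^ 'n"
  assumes "continuous_on UNIV a" "continuous_on UNIV b" "continuous_on UNIV c"
  shows "continuous_on UNIV (\<lambda>w. weyl_kernel \<tau> f (a w) (b w) (c w))"
proof -
  have "continuous_on UNIV (\<lambda>w. \<tau> ((1 / 2) *\<^sub>R (a w + c w), b w))"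
    by (rule continuous_on_compose2[OF schwartz_continuous[OF \<tau>]]) (auto intro!: continuous_intros assms)
  moreover have "continuous_on UNIV (\<lambda>w. f (c w))" by (rule continuous_on_compose2[OF schwartz_continuous[OF f] assms(3)]) auto
  ultimately show ?thesis unfolding weyl_kernel_def by (intro continuous_intros assms)
qed

text \<open>Decay in \<xi> comes from the symbol and decay in \<open>y\<close> from
  \<open>f\<close>. The majorant is free of \<open>x\<close>, so it yields integrability,
  boundedness and, by dominated convergence, continuity of \<open>weyl \<tau> f\<close>.\<close>

lemma weyl_kernel_bound: "\<exists>C\<ge>0. \<forall>x \<xi> y. norm (weyl_kernel \<tau> f x \<xi> y) \<le> C / poly_weight (\<xi>, y)"
proof -
  obtain C where C: "0 < C" "\<And>z. norm (\<tau> z) \<le> C / poly_weight z" by (rule schwartz_weight_bound[OF \<tau>]) (rule that)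
  obtain D where D: "0 < D" "\<And>x. norm (f x) \<le> D / poly_weight x" by (rule schwartz_weight_bound[OF f]) (rule that)
  have "norm (weyl_kernel \<tau> f x \<xi> y) \<le> (C * D) / poly_weight (\<xi>, y)" for x \<xi> y
  proof -
    have "norm (\<tau> ((1 / 2) *\<^sub>R (x + y), \<xi>)) \<le> C / (poly_weight ((1 / 2) *\<^sub>R (x + y)) * poly_weight \<xi>)"
      using C(2) unfolding poly_weight_Pair[symmetric] .
    also have "\<dots> \<le> C / (1 * poly_weight \<xi>)"
      using C(1) poly_weight_ge_1 poly_weight_pos by (intro divide_left_mono mult_right_mono mult_pos_pos) (auto simp: less_imp_le)
    finally have "norm (\<tau> ((1 / 2) *\<^sub>R (x + y), \<xi>)) * norm (f y) \<le> (C / (1 * poly_weight \<xi>)) * (D / poly_weight y)"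
      using D(2) by (intro mult_mono) (auto intro: order_trans[OF norm_ge_zero])
    then show ?thesis by (simp add: weyl_kernel_def norm_mult poly_weight_Pair)
  qed
  then show ?thesis using C(1) D(1) by (intro exI[of _ "C * D"]) simp
qed

lemma weyl_kernel_integrable: "integrable lborel (\<lambda>w. weyl_kernel \<tau> f x (fst w) (snd w))"
proof -
  obtain C where C: "\<And>x \<xi> y. norm (weyl_kernel \<tau> f x \<xi> y) \<le> C / poly_weight (\<xi>, y)" using weyl_kernel_bound by blast
  have "norm (weyl_kernel \<tau> f x (fst w) (snd w)) \<le> C / poly_weight w" for w using C[of x "fst w" "snd w"] by simp
  then show ?thesis by (rule integrable_weight_bound(1)[rotated]) (intro borel_measurable_continuous_onI weyl_kernel_continuous continuous_intros)
qed

lemma weyl_eq: "weyl \<tau> f x = of_real (1 / (2 * pi) ^ CARD('n)) * (LINT w|lborel. weyl_kernel \<tau> f x (fst w) (snd w))"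
  using lborel_pair.integral_fst'[of "\<lambda>w. weyl_kernel \<tau> f x (fst w) (snd w)"] weyl_kernel_integrable[of x]
  unfolding weyl_eq_kernel by (simp add: lborel_prod)

lemma weyl_continuous: "continuous_on UNIV (weyl \<tau> f)"
proof (intro continuous_at_imp_continuous_on ballI continuous_at_sequentiallyI)
  fix u :: "nat \<Rightarrow> real ^ 'n" and x assume u: "u \<longlonglongrightarrow> x"
  obtain C where C: "\<And>x \<xi> y. norm (weyl_kernel \<tau> f x \<xi> y) \<le> C / poly_weight (\<xi>, y)" using weyl_kernel_bound by blast
  have "(\<lambda>n. LINT w|lborel. weyl_kernel \<tau> f (u n) (fst w) (snd w)) \<longlonglongrightarrow> (LINT w|lborel. weyl_kernel \<tau> f x (fst w) (snd w))"
  proof (rule integral_dominated_convergence[where w = "\<lambda>w. C * (1 / poly_weight w)"])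
    show "(\<lambda>w. weyl_kernel \<tau> f x (fst w) (snd w)) \<in> borel_measurable lborel" by (rule borel_measurable_integrable[OF weyl_kernel_integrable])
    show "(\<lambda>w. weyl_kernel \<tau> f (u n) (fst w) (snd w)) \<in> borel_measurable lborel" for n by (rule borel_measurable_integrable[OF weyl_kernel_integrable])
    show "integrable lborel (\<lambda>w :: 'n::finite phase. C * (1 / poly_weight w))" by (intro integrable_mult_right integrable_inverse_poly_weight)
    have c: "continuous_on UNIV (\<lambda>x. weyl_kernel \<tau> f x (fst w) (snd w))" for w by (intro weyl_kernel_continuous continuous_intros)
    show "AE w in lborel. (\<lambda>n. weyl_kernel \<tau> f (u n) (fst w) (snd w)) \<longlonglongrightarrow> weyl_kernel \<tau> f x (fst w) (snd w)"
      by (intro AE_I2 continuous_on_tendsto_compose[OF c u]) auto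
    show "AE w in lborel. norm (weyl_kernel \<tau> f (u n) (fst w) (snd w)) \<le> C * (1 / poly_weight w)" for n
      using C[of "u n" "fst w" "snd w" for w] by (intro AE_I2) simp
  qed
  then show "(\<lambda>n. weyl \<tau> f (u n)) \<longlonglongrightarrow> weyl \<tau> f x" unfolding weyl_eq by (rule tendsto_mult_left)
qed

lemma weyl_bounded: "\<exists>C. \<forall>x. norm (weyl \<tau> f x) \<le> C"
proof -
  obtain C where C: "\<And>x \<xi> y. norm (weyl_kernel \<tau> f x \<xi> y) \<le> C / poly_weight (\<xi>, y)" using weyl_kernel_bound by blast
  have "norm (LINT w|lborel. weyl_kernel \<tau> f x (fst w) (snd w)) \<le> C * (LINT w|lborel. 1 / poly_weight (w :: 'n::finite phase))" for x
  proof (rule integrable_weight_bound(2))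
    show "(\<lambda>w. weyl_kernel \<tau> f x (fst w) (snd w)) \<in> borel_measurable borel"
      by (intro borel_measurable_continuous_onI weyl_kernel_continuous continuous_intros)
    show "norm (weyl_kernel \<tau> f x (fst w) (snd w)) \<le> C / poly_weight w" for w using C[of x "fst w" "snd w"] by simp
  qed
  then have "norm (weyl \<tau> f x) \<le> norm (complex_of_real (1 / (2 * pi) ^ CARD('n))) * (C * (LINT w|lborel. 1 / poly_weight (w :: 'n phase)))" for x
    unfolding weyl_eq norm_mult by (intro mult_left_mono) auto
  then show ?thesis by blast
qed

text \<open>At fixed \<xi> the variables \<open>x\<close>, \<open>y\<close> are replaced by their
  midpoint and difference. Multiplying by \<open>g\<close> supplies the decay in \<open>x\<close>
  that makes the triple integral absolutely convergent and licenses the changes of order.\<close>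

lemma weyl_pairing:
  assumes g: "g \<in> schwartz"
  shows "(LINT x|lborel. weyl \<tau> f x * g x) = of_real (1 / (2 * pi) ^ CARD('n)) * (LINT z|lborel. \<tau> z * wigner f g z)"
proof -
  let ?c = "complex_of_real (1 / (2 * pi) ^ CARD('n))"
  define F where "F x \<xi> y = weyl_kernel \<tau> f x \<xi> y * g x" for x \<xi> y
  obtain C where C: "0 \<le> C" "\<And>x \<xi> y. norm (weyl_kernel \<tau> f x \<xi> y) \<le> C / poly_weight (\<xi>, y)" using weyl_kernel_bound by blast
  obtain D where D: "0 < D" "\<And>x. norm (g x) \<le> D / poly_weight x" by (rule schwartz_weight_bound[OF g]) (rule that)
  have Fc: "continuous_on UNIV (\<lambda>w. F (a w) (b w) (c w))"
    if "continuous_on UNIV a" "continuous_on UNIV b" "continuous_on UNIV c" for a b c :: "'z::topological_space \<Rightarrow> real ^ 'n"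
    unfolding F_def using continuous_on_compose2[OF schwartz_continuous[OF g] that(1)] by (intro continuous_on_mult weyl_kernel_continuous that) auto
  have Fb: "norm (F x \<xi> y) \<le> (C * D) / poly_weight ((x, \<xi>), y)" for x \<xi> y
  proof -
    have "norm (F x \<xi> y) \<le> (C / poly_weight (\<xi>, y)) * (D / poly_weight x)"
      unfolding F_def norm_mult using C(2) D(2) by (intro mult_mono) (auto intro: order_trans[OF norm_ge_zero])
    then show ?thesis by (simp add: poly_weight_Pair mult_ac)
  qed
  have F3: "integrable lborel (\<lambda>w :: 'n::finite phase \<times> (real ^ 'n). F (fst (fst w)) (snd (fst w)) (snd w))"
  proof (rule integrable_weight_bound(1))
    show "(\<lambda>w :: 'n phase \<times> (real ^ 'n). F (fst (fst w)) (snd (fst w)) (snd w)) \<in> borel_measurable borel"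
      by (intro borel_measurable_continuous_onI Fc continuous_intros)
    show "norm (F (fst (fst w)) (snd (fst w)) (snd w)) \<le> (C * D) / poly_weight w" for w using Fb[of "fst (fst w)" "snd (fst w)" "snd w"] by simp
  qed
  have F2: "integrable lborel (\<lambda>z. LINT y|lborel. F (fst z) (snd z) y)"
    using lborel_pair.integrable_fst'[of "\<lambda>w. F (fst (fst w)) (snd (fst w)) (snd w)"] F3 by (simp add: lborel_prod)
  have inner: "(LINT x|lborel. LINT y|lborel. F x \<xi> y) = (LINT q|lborel. \<tau> (q, \<xi>) * wigner f g (q, \<xi>))" for \<xi>
  proof -
    \<comment> \<open>The first component of \<open>w\<close> is \<open>y\<close> and the second is
      \<open>x\<close>, which fixes the signs in \<open>S\<close>.\<close>
    define H where "H w = F (snd w) \<xi> (fst w)" for w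
    have Hm: "H \<in> borel_measurable borel" unfolding H_def by (intro borel_measurable_continuous_onI Fc continuous_intros)
    have Hi: "integrable lborel H"
    proof (rule integrable_weight_bound(1)[OF Hm])
      fix w :: "'n phase"
      have "norm (H w) \<le> (C * D) / poly_weight ((snd w, \<xi>), fst w)" unfolding H_def by (rule Fb)
      also have "poly_weight ((snd w, \<xi>), fst w) = poly_weight \<xi> * poly_weight w" by (cases w) (simp add: poly_weight_Pair mult_ac)
      also have "(C * D) / (poly_weight \<xi> * poly_weight w) \<le> (C * D) / (1 * poly_weight w)"
        using C(1) D(1) poly_weight_ge_1[of \<xi>] poly_weight_pos[of w] poly_weight_pos[of \<xi>] by (intro divide_left_mono mult_right_mono) auto
      finally show "norm (H w) \<le> (C * D) / poly_weight w" by simp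
    qed
    \<comment> \<open>Midpoint \<open>q\<close> and difference \<open>p\<close> are sent to
      \<open>(q - p/2, q + p/2)\<close>; as a product of two shears this preserves Lebesgue
      measure.\<close>
    define S where "S = (\<lambda>w :: 'n phase. (fst w - (1 / 2) *\<^sub>R snd w, fst w + (1 / 2) *\<^sub>R snd w))"
    have "lborel_preserving (\<lambda>w :: 'n phase. (\<lambda>w. (fst w, snd w + (\<lambda>y. y) (fst w))) ((\<lambda>w. (fst w + (\<lambda>p. (- (1 / 2)) *\<^sub>R p) (snd w), snd w)) w))"
      by (rule lborel_preserving_compose[OF lborel_preserving_shear_snd lborel_preserving_shear_fst]) auto
    also have "(\<lambda>w :: 'n phase. (\<lambda>w. (fst w, snd w + (\<lambda>y. y) (fst w))) ((\<lambda>w. (fst w + (\<lambda>p. (- (1 / 2)) *\<^sub>R p) (snd w), snd w)) w)) = S"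
    proof
      have "p + (q + (- (1 / 2)) *\<^sub>R p) = q + (1 / 2) *\<^sub>R p" for p q :: "real ^ 'n" by (simp add: vec_eq_iff)
      then show "(\<lambda>w. (fst w, snd w + (\<lambda>y. y) (fst w))) ((\<lambda>w. (fst w + (\<lambda>p. (- (1 / 2)) *\<^sub>R p) (snd w), snd w)) w) = S w" for w
        by (simp add: S_def)
    qed
    finally have S: "lborel_preserving S" .
    have HSi: "integrable lborel (\<lambda>w. H (S w))" using lborel_preserving_integral(2)[OF S Hm] Hi by simp
    have HS: "H (S (q, p)) = \<tau> (q, \<xi>) * (exp (\<i> * of_real (p \<bullet> \<xi>)) * (f (q - (1 / 2) *\<^sub>R p) * g (q + (1 / 2) *\<^sub>R p)))" for q p
    proof -
      have "(q + (1 / 2) *\<^sub>R p) - (q - (1 / 2) *\<^sub>R p) = p" "(1 / 2) *\<^sub>R ((q + (1 / 2) *\<^sub>R p) + (q - (1 / 2) *\<^sub>R p)) = q"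
        by (simp_all add: vec_eq_iff)
      then show ?thesis by (simp add: H_def S_def F_def weyl_kernel_def mult_ac)
    qed
    have "(LINT x|lborel. LINT y|lborel. F x \<xi> y) = (LINT x|lborel. LINT y|lborel. H (y, x))" by (simp add: H_def)
    also have "\<dots> = (LINT w|lborel. H w)" using lborel_pair.integral_snd[of "\<lambda>y x. H (y, x)"] Hi by (simp add: lborel_prod)
    also have "\<dots> = (LINT w|lborel. H (S w))" by (rule lborel_preserving_integral(1)[OF S Hm, symmetric])
    also have "\<dots> = (LINT q|lborel. LINT p|lborel. H (S (q, p)))"
      using lborel_pair.integral_fst'[of "\<lambda>w. H (S w)"] HSi by (simp add: lborel_prod)
    also have "\<dots> = (LINT q|lborel. \<tau> (q, \<xi>) * wigner f g (q, \<xi>))"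
      unfolding HS wigner_def fst_conv snd_conv by (simp only: integral_mult_right_zero)
    finally show ?thesis .
  qed
  have "(LINT x|lborel. weyl \<tau> f x * g x) = (LINT x|lborel. ?c * (LINT \<xi>|lborel. LINT y|lborel. F x \<xi> y))"
    unfolding weyl_eq_kernel F_def by (simp only: integral_mult_left_zero mult.assoc)
  also have "\<dots> = ?c * (LINT x|lborel. LINT \<xi>|lborel. LINT y|lborel. F x \<xi> y)" by (rule integral_mult_right_zero)
  also have "(LINT x|lborel. LINT \<xi>|lborel. LINT y|lborel. F x \<xi> y) = (LINT \<xi>|lborel. LINT x|lborel. LINT y|lborel. F x \<xi> y)"
  proof -
    have "integrable (lborel \<Otimes>\<^sub>M lborel) (\<lambda>(x, \<xi>). LINT y|lborel. F x \<xi> y)"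
      using F2 unfolding lborel_prod case_prod_unfold .
    from lborel_pair.Fubini_integral[OF this] show ?thesis by (rule sym)
  qed
  also have "\<dots> = (LINT \<xi>|lborel. LINT q|lborel. \<tau> (q, \<xi>) * wigner f g (q, \<xi>))" unfolding inner ..
  also have "\<dots> = (LINT z|lborel. \<tau> z * wigner f g z)"
    using lborel_pair.integral_snd[of "\<lambda>q \<xi>. \<tau> (q, \<xi>) * wigner f g (q, \<xi>)"] wigner_integrable[OF f g \<tau>]
    by (simp add: lborel_prod case_prod_unfold)
  finally show ?thesis .
qed

end

text \<open>Reversing the momentum exchanges the two functions in the Wigner transform, so evenness
  of the symbol in \<xi> makes the operator symmetric for the bilinear pairing.\<close>

lemma weyl_symmetric:
  fixes \<tau> :: "'n::finite phase \<Rightarrow> complex"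
  assumes \<tau>: "\<tau> \<in> schwartz" and even: "\<And>q \<xi>. \<tau> (q, - \<xi>) = \<tau> (q, \<xi>)" and f: "f \<in> schwartz" and g: "g \<in> schwartz"
  shows "(LINT x|lborel. weyl \<tau> f x * g x) = (LINT x|lborel. weyl \<tau> g x * f x)"
proof -
  have "(LINT z|lborel. \<tau> z * wigner f g z) = (LINT q|lborel. LINT \<xi>|lborel. \<tau> (q, \<xi>) * wigner f g (q, \<xi>))"
    using lborel_pair.integral_fst'[of "\<lambda>z. \<tau> z * wigner f g z"] wigner_integrable[OF f g \<tau>] by (simp add: lborel_prod)
  also have "\<dots> = (LINT q|lborel. LINT \<xi>|lborel. \<tau> (q, - \<xi>) * wigner f g (q, - \<xi>))"
    by (intro Bochner_Integration.integral_cong refl integral_reflect[symmetric])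
  also have "\<dots> = (LINT q|lborel. LINT \<xi>|lborel. \<tau> (q, \<xi>) * wigner g f (q, \<xi>))" unfolding even wigner_reflect ..
  also have "\<dots> = (LINT z|lborel. \<tau> z * wigner g f z)"
    using lborel_pair.integral_fst'[of "\<lambda>z. \<tau> z * wigner g f z"] wigner_integrable[OF g f \<tau>] by (simp add: lborel_prod)
  finally show ?thesis unfolding weyl_pairing[OF \<tau> f g] weyl_pairing[OF \<tau> g f] by simp
qed

text \<open>The Wigner integrals give all Hermite coefficients of the left side; only the
  \<open>m\<close>-th can be nonzero, and completeness for bounded continuous functions identifies
  the function.\<close>

lemma weyl_radial_hermite:
  fixes f :: "real ^ 'n::finite \<Rightarrow> complex"
  assumes f: "f \<in> schwartz_orthant"
  shows "weyl (radial_symbol f) (hermite_fun m) = (\<lambda>x. radial_coeff m (dilate2 f) * hermite_fun m x)"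
proof -
  let ?\<tau> = "radial_symbol f" and ?a = "\<lambda>k. if k = m then radial_coeff m (dilate2 f) else 0"
  note \<tau> = radial_symbol_schwartz[OF f] and h = hermite_fun_schwartz
  have "hermite_coeff (weyl ?\<tau> (hermite_fun m)) k = ?a k" for k
  proof -
    have "hermite_coeff (weyl ?\<tau> (hermite_fun m)) k = of_real (1 / (2 * pi) ^ CARD('n)) * (LINT z|lborel. ?\<tau> z * wigner_product m k z)"
      unfolding hermite_coeff_def weyl_pairing[OF \<tau> h h] wigner_hermite ..
    also have "wigner_product m k \<in> borel_measurable borel" using wigner_measurable[OF h h, of m k] unfolding wigner_hermite .
    from radial_symbol_integral[OF f this]
    have "of_real (1 / (2 * pi) ^ CARD('n)) * (LINT z|lborel. ?\<tau> z * wigner_product m k z) = ?a k"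
      by (auto simp: mult.assoc[symmetric] simp flip: of_real_mult)
    finally show ?thesis .
  qed
  moreover obtain C where "\<And>x. norm (weyl ?\<tau> (hermite_fun m) x) \<le> C" using weyl_bounded[OF \<tau> h] by blast
  moreover have "rapid ?a" by (rule rapid_finite[of "{m}"]) auto
  ultimately have "weyl ?\<tau> (hermite_fun m) = hermite_series ?a" using continuous_eq_hermite_series[OF weyl_continuous[OF \<tau> h]] by blast
  also have "\<dots> = (\<lambda>x. radial_coeff m (dilate2 f) * hermite_fun m x)"
  proof
    fix x
    have "hermite_series ?a x = (\<Sum>\<^sub>\<infinity>k\<in>{m}. radial_coeff m (dilate2 f) * hermite_fun k x)"
      unfolding hermite_series_def by (rule infsum_cong_neutral) auto
    then show "hermite_series ?a x = radial_coeff m (dilate2 f) * hermite_fun m x" by simp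
  qed
  finally show ?thesis .
qed

text \<open>Symmetry moves the operator onto \<open>hermite_fun k\<close>, where it acts as a
  scalar. This yields the coefficients for an arbitrary Schwartz function without applying
  \<open>weyl\<close> to a series term by term.\<close>

lemma weyl_radial:
  fixes f :: "real ^ 'n::finite \<Rightarrow> complex"
  assumes f: "f \<in> schwartz_orthant" and g: "g \<in> schwartz"
  shows "weyl (radial_symbol f) g = hermite_series (\<lambda>k. radial_coeff k (dilate2 f) * hermite_coeff g k)"
proof -
  let ?\<tau> = "radial_symbol f"
  note \<tau> = radial_symbol_schwartz[OF f]
  have even: "?\<tau> (q, - \<xi>) = ?\<tau> (q, \<xi>)" for q \<xi> by (simp add: radial_symbol_def square_moduli_def)
  have "hermite_coeff (weyl ?\<tau> g) k = radial_coeff k (dilate2 f) * hermite_coeff g k" for k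
  proof -
    have "hermite_coeff (weyl ?\<tau> g) k = (LINT x|lborel. weyl ?\<tau> (hermite_fun k) x * g x)"
      unfolding hermite_coeff_def by (rule weyl_symmetric[OF \<tau> even g hermite_fun_schwartz])
    also have "\<dots> = (LINT x|lborel. radial_coeff k (dilate2 f) * (g x * hermite_fun k x))"
      unfolding weyl_radial_hermite[OF f] by (simp add: mult_ac)
    finally show ?thesis unfolding hermite_coeff_def by (simp only: integral_mult_right_zero)
  qed
  moreover obtain C where "\<And>x. norm (weyl ?\<tau> g x) \<le> C" using weyl_bounded[OF \<tau> g] by blast
  moreover have "rapid (\<lambda>k. radial_coeff k (dilate2 f) * hermite_coeff g k)"
  proof (rule rapid_mult)
    show "rapid (\<lambda>k. radial_coeff k (dilate2 f))"
      by (intro rapid_radial_coeff schwartz_orthant_smooth dilate2_schwartz_orthant f)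
    obtain C where "\<And>k. norm (hermite_coeff g k) * weight k ^ 0 \<le> C"
      using rapid_hermite_coeff[OF g] unfolding rapid_def by blast
    then show "poly_growth (hermite_coeff g)" unfolding poly_growth_def by (intro exI[of _ C] exI[of _ 0]) simp
  qed
  ultimately show ?thesis using continuous_eq_hermite_series[OF weyl_continuous[OF \<tau> g]] by blast
qed

section \<open>Convergence of diagonal operators\<close>

lemma seminorm_diff_bounded:
  assumes V: "seminorm_space V P" and p: "p \<in> P" and fg: "f \<in> V" "g \<in> V"
  shows "p (f - g) \<le> p f + p g"
proof -
  have "p (\<lambda>x. f x + (- 1) * g x) \<le> p f + p (\<lambda>x. (- 1) * g x)"
    by (rule seminorm_add[OF V p fg(1) seminorm_space_scale[OF V fg(2)]])
  also have "p (\<lambda>x. (- 1) * g x) = p g" using seminorm_scale[OF V p fg(2), of "- 1"] by simp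
  finally show ?thesis by (simp add: fun_diff_def)
qed

lemma zero_in_bounded_sets:
  assumes "seminorm_space V P"
  shows "{\<lambda>x. 0} \<in> bounded_sets V P" using seminorm_space_zero[OF assms] by (simp add: bounded_sets_def)

lemma continuous_linear_maps_image:
  assumes "T \<in> continuous_linear_maps X Y" "u \<in> topspace X"
  shows "T u \<in> topspace Y" using assms by (auto simp: continuous_linear_maps_def continuous_map_def)

section \<open>Seminorms of uniform convergence on bounded sets\<close>

context
  fixes V :: "('x \<Rightarrow> complex) set" and P and W :: "('y \<Rightarrow> complex) set" and Q
  assumes V: "seminorm_space V P" and W: "seminorm_space W Q"
begin

lemma continuous_linear_maps_seminorm_image:
  assumes "T \<in> continuous_linear_maps (seminorm_topology V P) (seminorm_topology W Q)" "u \<in> V"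
  shows "T u \<in> W"
  using continuous_linear_maps_image[OF assms(1)] assms(2) by (simp add: topspace_seminorm_space[OF V] topspace_seminorm_space[OF W])

text \<open>Real suprema carry information only for sets bounded above; here continuity of both
  operators bounds the seminorm on a bounded set.\<close>

lemma bdd_above_operator_diff:
  assumes S: "S \<in> continuous_linear_maps (seminorm_topology V P) (seminorm_topology W Q)"
    and T: "T \<in> continuous_linear_maps (seminorm_topology V P) (seminorm_topology W Q)"
    and B: "B \<in> bounded_sets V P" and q: "q \<in> Q"
  shows "bdd_above ((\<lambda>u. q ((S - T) u)) ` B)"
proof -
  obtain F C where F: "finite F" "F \<subseteq> P" "0 \<le> C" "\<And>f. f \<in> V \<Longrightarrow> q (S f) \<le> C * (\<Sum>p\<in>F. p f)"
    by (rule continuous_linear_map_bound[OF V W q S]) (rule that)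
  obtain G D where G: "finite G" "G \<subseteq> P" "0 \<le> D" "\<And>f. f \<in> V \<Longrightarrow> q (T f) \<le> D * (\<Sum>p\<in>G. p f)"
    by (rule continuous_linear_map_bound[OF V W q T]) (rule that)
  obtain K L where KL: "\<And>u. u \<in> B \<Longrightarrow> q (S u) \<le> K" "\<And>u. u \<in> B \<Longrightarrow> q (T u) \<le> L"
    using bdd_above_bounded_sets[OF V B F] bdd_above_bounded_sets[OF V B G] unfolding bdd_above_def by auto
  show ?thesis
  proof (rule bdd_aboveI2)
    fix u assume u: "u \<in> B"
    then have uV: "u \<in> V" using bounded_setsD(1)[OF B] by blast
    have "q (S u - T u) \<le> q (S u) + q (T u)"
      by (rule seminorm_diff_bounded[OF W q continuous_linear_maps_seminorm_image[OF S uV] continuous_linear_maps_seminorm_image[OF T uV]])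
    with KL[OF u] show "q ((S - T) u) \<le> K + L" by simp
  qed
qed

lemma pseudometric_family_operators:
  "pseudometric_family (continuous_linear_maps (seminorm_topology V P) (seminorm_topology W Q))
     {\<lambda>T. SUP u\<in>B. q (T u) | B q. B \<in> bounded_sets V P \<and> q \<in> Q}"
proof -
  let ?L = "continuous_linear_maps (seminorm_topology V P) (seminorm_topology W Q)"
  note pm = pseudometric_seminorm_space[OF W, unfolded pseudometric_family_def]
  obtain q0 where q0: "q0 \<in> Q" using pm by blast
  have 1: "(SUP u\<in>B. q ((S - S) u)) = 0" if B: "B \<in> bounded_sets V P" and q: "q \<in> Q" for B q and S :: "('x \<Rightarrow> complex) \<Rightarrow> 'y \<Rightarrow> complex"
  proof -
    have "(S - S) u = (\<lambda>x. 0)" for u by (simp add: fun_eq_iff)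
    then have "q ((S - S) u) = 0" for u using seminorm_zero[OF W q] by simp
    then show ?thesis using bounded_setsD(2)[OF B] by simp
  qed
  have 2: "(SUP u\<in>B. q ((R - T) u)) \<le> (SUP u\<in>B. q ((R - S) u)) + (SUP u\<in>B. q ((S - T) u))"
    if B: "B \<in> bounded_sets V P" and q: "q \<in> Q" and RST: "R \<in> ?L" "S \<in> ?L" "T \<in> ?L" for B q R S T
  proof (rule cSUP_least[OF bounded_setsD(2)[OF B]])
    fix u assume u: "u \<in> B"
    then have uV: "u \<in> V" using bounded_setsD(1)[OF B] by blast
    have "q (R u - T u) \<le> q (R u - S u) + q (S u - T u)" using pm q RST[THEN continuous_linear_maps_seminorm_image, OF uV] by blast
    moreover have "q ((R - S) u) \<le> (SUP u\<in>B. q ((R - S) u))" by (rule cSUP_upper[OF u bdd_above_operator_diff[OF RST(1,2) B q]])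
    moreover have "q ((S - T) u) \<le> (SUP u\<in>B. q ((S - T) u))" by (rule cSUP_upper[OF u bdd_above_operator_diff[OF RST(2,3) B q]])
    ultimately show "q ((R - T) u) \<le> (SUP u\<in>B. q ((R - S) u)) + (SUP u\<in>B. q ((S - T) u))" by simp
  qed
  show ?thesis unfolding pseudometric_family_def
  proof (intro conjI ballI)
    show "{\<lambda>T. SUP u\<in>B. q (T u) | B q. B \<in> bounded_sets V P \<and> q \<in> Q} \<noteq> {}"
      using zero_in_bounded_sets[OF V] q0 by blast
  qed (auto simp only: mem_Collect_eq 1 intro!: 2)
qed

end

lemma schwartz_seminorm_zero:
  assumes "p \<in> schwartz_seminorms \<Omega>" "\<Omega> \<noteq> {}"
  shows "p (\<lambda>x. 0) = 0"
proof -
  obtain k bs where "p = (\<lambda>f. SUP x\<in>\<Omega>. weighted_deriv k bs f x)" using assms(1) unfolding schwartz_seminorms_def by blast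
  then show ?thesis using cSUP_const[OF assms(2), of "0 :: real"] by (simp add: weighted_deriv_def partial_derivs_zero)
qed

text \<open>Two powers of the weight pay for the summation, so a uniform bound on weighted
  coefficients suffices. This matches the strong dual seminorms, which are suprema.\<close>

lemma hermite_series_bound:
  fixes p :: "(real ^ 'n::finite \<Rightarrow> complex) \<Rightarrow> real"
  assumes "p \<in> schwartz_seminorms UNIV"
  shows "\<exists>C M. 0 \<le> C \<and> (\<forall>a K. rapid a \<longrightarrow> (\<forall>k. norm (a k) * weight k ^ (M + 2) \<le> K) \<longrightarrow> p (hermite_series a) \<le> C * K)"
proof -
  obtain C M where C: "0 \<le> C" "\<And>a. rapid a \<Longrightarrow> p (hermite_series a) \<le> C * weighted_sum a M"
    by (rule hermite_series_seminorm[OF assms]) (rule that)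
  define S where "S = (\<Sum>\<^sub>\<infinity>k :: nat ^ 'n. 1 / weight k ^ 2)"
  have S: "0 \<le> S" unfolding S_def by (rule infsum_nonneg) (simp add: weight_pos less_imp_le)
  have "p (hermite_series a) \<le> C * S * K" if a: "rapid a" and K: "\<And>k. norm (a k) * weight k ^ (M + 2) \<le> K" for a K
  proof -
    have "weighted_sum a M \<le> (\<Sum>\<^sub>\<infinity>k :: nat ^ 'n. K * (1 / weight k ^ 2))"
    proof (rule infsum_mono)
      show "(\<lambda>k. K * (1 / weight k ^ 2)) summable_on (UNIV :: (nat ^ 'n) set)" by (intro summable_on_cmult_right summable_weight)
      show "norm (a k) * weight k ^ M \<le> K * (1 / weight k ^ 2)" for k
        using K[of k] weight_pos[of k] by (simp add: field_simps power_add power2_eq_square)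
    qed (rule rapid_summable[OF a])
    also have "\<dots> = K * S" unfolding S_def by (rule infsum_cmult_right) (rule summable_weight)
    finally have "C * weighted_sum a M \<le> C * (K * S)" using C(1) by (rule mult_left_mono)
    with C(2)[OF a] show ?thesis by (simp add: mult_ac)
  qed
  then show ?thesis using C(1) S by (intro exI[of _ "C * S"] exI[of _ M]) simp
qed

lemma tempered_scale_hermite:
  assumes "u \<in> tempered"
  shows "u (\<lambda>x. c * hermite_fun k x) = c * u (hermite_fun k)"
  using tempered_sum[OF assms, of "{k}" hermite_fun "\<lambda>_. c"] by (simp add: hermite_fun_schwartz)

lemma tempered_seminorm_upper:
  assumes "u \<in> tempered" "B \<in> bounded_sets schwartz (schwartz_seminorms UNIV)" "\<phi> \<in> B"
  shows "norm (u \<phi>) \<le> (SUP \<phi>\<in>B. norm (u \<phi>))" by (rule cSUP_upper[OF assms(3) bdd_above_tempered[OF assms(1,2)]])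

definition diagonal_operator :: "(nat ^ 'n::finite \<Rightarrow> complex) \<Rightarrow> ((real ^ 'n \<Rightarrow> complex) \<Rightarrow> complex) \<Rightarrow> real ^ 'n \<Rightarrow> complex" where
  "diagonal_operator c u = hermite_series (\<lambda>k. c k * u (hermite_fun k))"

text \<open>Since \<open>c\<close> is rapid, the functions
  \<open>c k * weight k ^ (M + 2) * hermite_fun k\<close> form a bounded set of Schwartz functions.
  The strong dual seminorm attached to it is exactly a bound for the weighted coefficients of the
  image of \<open>u\<close>.\<close>

lemma diagonal_operator_continuous:
  fixes c :: "nat ^ 'n::finite \<Rightarrow> complex"
  assumes c: "rapid c"
  shows "diagonal_operator c \<in> continuous_linear_maps strong_dual_topology schwartz_topology"
  unfolding strong_dual_topology_def schwartz_topology_def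
proof (rule continuous_linear_mapI[OF seminorm_tempered seminorm_schwartz])
  have r: "rapid (\<lambda>k. c k * u (hermite_fun k))" if "u \<in> tempered" for u
    by (rule rapid_mult[OF c poly_growth_tempered[OF that]])
  fix u v :: "(real ^ 'n \<Rightarrow> complex) \<Rightarrow> complex" and a assume u: "u \<in> tempered"
  show "diagonal_operator c u \<in> schwartz" unfolding diagonal_operator_def by (rule hermite_series_schwartz[OF r[OF u]])
  assume v: "v \<in> tempered"
  show "diagonal_operator c (\<lambda>x. a * u x + v x) = (\<lambda>y. a * diagonal_operator c u y + diagonal_operator c v y)"
    unfolding diagonal_operator_def using hermite_series_lin_comb[OF r[OF u] r[OF v], of a] by (simp add: fun_eq_iff algebra_simps)
next
  have r: "rapid (\<lambda>k. c k * u (hermite_fun k))" if "u \<in> tempered" for u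
    by (rule rapid_mult[OF c poly_growth_tempered[OF that]])
  fix q :: "(real ^ 'n \<Rightarrow> complex) \<Rightarrow> real" assume q: "q \<in> schwartz_seminorms UNIV"
  obtain C M where C: "0 \<le> C" "\<forall>a K. rapid a \<longrightarrow> (\<forall>k. norm (a k) * weight k ^ (M + 2) \<le> K) \<longrightarrow> q (hermite_series a) \<le> C * K"
    using hermite_series_bound[OF q] by (elim exE conjE) (rule that)
  \<comment> \<open>A constant family over the one-element type, to fit the indexed form of
    \<open>bounded_sets_scaled_hermite\<close>.\<close>
  define d where "d = (\<lambda>(_ :: unit) k. c k * of_real (weight k ^ (M + 2)))"
  define B where "B = (\<lambda>(i, k) x. d i k * hermite_fun k x) ` (UNIV \<times> UNIV)"
  have B: "B \<in> bounded_sets schwartz (schwartz_seminorms UNIV)" unfolding B_def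
  proof (rule bounded_sets_scaled_hermite)
    fix N
    obtain K where K: "\<And>k. norm (c k) * weight k ^ (M + 2 + N) \<le> K" using c unfolding rapid_def by meson
    have "norm (d i k) * weight k ^ N \<le> K" for i k
    proof -
      have "norm (d i k) = norm (c k) * weight k ^ (M + 2)" unfolding d_def norm_mult norm_of_real using weight_pos[of k] by simp
      then show ?thesis using K[of k] unfolding power_add[of _ "M + 2" N] by (simp only: mult.assoc)
    qed
    then show "\<exists>K. \<forall>i\<in>UNIV. \<forall>k. norm (d i k) * weight k ^ N \<le> K" by blast
  qed simp
  let ?p = "\<lambda>u :: (real ^ 'n \<Rightarrow> complex) \<Rightarrow> complex. SUP \<phi>\<in>B. norm (u \<phi>)"
  have p: "?p \<in> strong_dual_seminorms" using B unfolding strong_dual_seminorms_def by blast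
  have "q (diagonal_operator c u) \<le> C * (\<Sum>p\<in>{?p}. p u)" if u: "u \<in> tempered" for u
  proof -
    have "norm (c k * u (hermite_fun k)) * weight k ^ (M + 2) \<le> ?p u" for k
    proof -
      have "norm (c k * u (hermite_fun k)) * weight k ^ (M + 2) = norm (u (\<lambda>x. d () k * hermite_fun k x))"
        unfolding tempered_scale_hermite[OF u] d_def norm_mult norm_of_real using weight_pos[of k] by simp
      also have "\<dots> \<le> ?p u" by (rule tempered_seminorm_upper[OF u B]) (force simp: B_def)
      finally show ?thesis .
    qed
    then show ?thesis using C(2) r[OF u] by (simp add: diagonal_operator_def)
  qed
  with p C(1) show "\<exists>F C. finite F \<and> F \<subseteq> strong_dual_seminorms \<and> 0 \<le> C \<and> (\<forall>u\<in>tempered. q (diagonal_operator c u) \<le> C * (\<Sum>p\<in>F. p u))"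
    by (intro exI[of _ "{?p}"] exI[of _ C]) simp
qed

lemma bounded_distributions_bound:
  assumes B: "B \<in> bounded_sets tempered strong_dual_seminorms" and D: "D \<in> bounded_sets schwartz (schwartz_seminorms UNIV)"
  shows "\<exists>K\<ge>0. \<forall>u\<in>B. \<forall>\<phi>\<in>D. norm (u \<phi>) \<le> K"
proof -
  have "(\<lambda>u. SUP \<phi>\<in>D. norm (u \<phi>)) \<in> strong_dual_seminorms" using D unfolding strong_dual_seminorms_def by blast
  moreover have "\<forall>p\<in>strong_dual_seminorms. bdd_above (p ` B)" using B by (simp add: bounded_sets_def)
  ultimately have "bdd_above ((\<lambda>u. SUP \<phi>\<in>D. norm (u \<phi>)) ` B)" by (rule bspec[rotated])
  then obtain K where K: "\<And>u. u \<in> B \<Longrightarrow> (SUP \<phi>\<in>D. norm (u \<phi>)) \<le> K" unfolding bdd_above_def by auto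
  have "norm (u \<phi>) \<le> max 0 K" if "u \<in> B" "\<phi> \<in> D" for u \<phi>
    using order_trans[OF tempered_seminorm_upper[OF _ D that(2)] K[OF that(1)]] that(1) bounded_setsD(1)[OF B] by fastforce
  then show ?thesis by (intro exI[of _ "max 0 K"]) auto
qed

text \<open>Splitting \<open>norm (\<delta> j k)\<close> into two square roots lets one factor rescale \<open>hermite_fun k\<close> into a
  bounded set that does not depend on \<open>j\<close>, while the other one tends to zero.\<close>

lemma diagonal_operator_limit:
  fixes c :: "nat ^ 'n::finite \<Rightarrow> complex" and cs :: "nat \<Rightarrow> nat ^ 'n \<Rightarrow> complex"
  assumes c: "rapid c" and cs: "\<And>j. rapid (cs j)"
    and lim: "\<And>M. \<exists>\<epsilon>. \<epsilon> \<longlonglongrightarrow> 0 \<and> (\<forall>j k. norm (cs j k - c k) * weight k ^ M \<le> \<epsilon> j)"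
    and W: "W \<in> continuous_linear_maps strong_dual_topology schwartz_topology" "\<And>u. u \<in> tempered \<Longrightarrow> W u = diagonal_operator c u"
    and Ws: "\<And>j. Ws j \<in> continuous_linear_maps strong_dual_topology schwartz_topology" "\<And>j u. u \<in> tempered \<Longrightarrow> Ws j u = diagonal_operator (cs j) u"
  shows "limitin dual_to_schwartz_topology Ws W sequentially" unfolding dual_to_schwartz_topology_def strong_operator_topology_def
proof (rule limitin_seminormI[OF pseudometric_family_operators[OF seminorm_tempered seminorm_schwartz]])
  show "W \<in> continuous_linear_maps (seminorm_topology tempered strong_dual_seminorms) (seminorm_topology schwartz (schwartz_seminorms UNIV))"
    using W(1) unfolding strong_dual_topology_def schwartz_topology_def .
  show "\<forall>\<^sub>F j in sequentially. Ws j \<in> continuous_linear_maps (seminorm_topology tempered strong_dual_seminorms) (seminorm_topology schwartz (schwartz_seminorms UNIV))"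
    using Ws(1) unfolding strong_dual_topology_def schwartz_topology_def by simp
  fix r :: "(((real ^ 'n \<Rightarrow> complex) \<Rightarrow> complex) \<Rightarrow> real ^ 'n \<Rightarrow> complex) \<Rightarrow> real"
  assume "r \<in> {\<lambda>T. SUP u\<in>B. q (T u) | B q. B \<in> bounded_sets tempered strong_dual_seminorms \<and> q \<in> schwartz_seminorms UNIV}"
  then obtain B q where r: "r = (\<lambda>T. SUP u\<in>B. q (T u))" and B: "B \<in> bounded_sets tempered strong_dual_seminorms"
    and q: "q \<in> schwartz_seminorms UNIV" by blast
  define \<delta> where "\<delta> j k = cs j k - c k" for j k
  define d where "d j k = complex_of_real (sqrt (norm (\<delta> j k)))" for j k
  define D where "D = (\<lambda>(j, k) x. d j k * hermite_fun k x) ` (UNIV \<times> UNIV)"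
  have D: "D \<in> bounded_sets schwartz (schwartz_seminorms UNIV)" unfolding D_def
  proof (rule bounded_sets_scaled_hermite)
    fix N
    \<comment> \<open>The exponent is doubled because only the square root of the coefficient
      difference enters \<open>d\<close>.\<close>
    obtain \<epsilon> where \<epsilon>: "\<epsilon> \<longlonglongrightarrow> 0" "\<And>j k. norm (\<delta> j k) * weight k ^ (2 * N) \<le> \<epsilon> j" using lim unfolding \<delta>_def by blast
    obtain K where K: "\<And>j. norm (\<epsilon> j) \<le> K" using convergent_imp_Bseq[OF convergentI[OF \<epsilon>(1)]] unfolding Bseq_def by blast
    have "norm (d j k) * weight k ^ N \<le> sqrt K" for j k
    proof -
      have "norm (d j k) * weight k ^ N = sqrt (norm (\<delta> j k) * weight k ^ (2 * N))"
        unfolding d_def real_sqrt_mult power_even_eq using weight_pos[of k] by simp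
      also have "\<dots> \<le> sqrt K" using \<epsilon>(2)[of j k] K[of j] by (intro real_sqrt_le_mono) simp
      finally show ?thesis .
    qed
    then show "\<exists>K. \<forall>j\<in>UNIV. \<forall>k. norm (d j k) * weight k ^ N \<le> K" by blast
  qed simp
  obtain K where K: "0 \<le> K" "\<And>u \<phi>. u \<in> B \<Longrightarrow> \<phi> \<in> D \<Longrightarrow> norm (u \<phi>) \<le> K"
    using bounded_distributions_bound[OF B D] by blast
  obtain C M where C: "0 \<le> C" "\<forall>a K. rapid a \<longrightarrow> (\<forall>k. norm (a k) * weight k ^ (M + 2) \<le> K) \<longrightarrow> q (hermite_series a) \<le> C * K"
    using hermite_series_bound[OF q] by (elim exE conjE) (rule that)
  \<comment> \<open>Again twice the needed exponent: the remaining square root has to absorb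
    \<open>weight k ^ (M + 2)\<close> and still tend to zero with \<open>j\<close>.\<close>
  obtain \<epsilon> where \<epsilon>: "\<epsilon> \<longlonglongrightarrow> 0" "\<And>j k. norm (\<delta> j k) * weight k ^ (2 * (M + 2)) \<le> \<epsilon> j" using lim unfolding \<delta>_def by blast
  have le: "0 \<le> q ((Ws j - W) u)" "q ((Ws j - W) u) \<le> C * (K * sqrt (\<epsilon> j))" if uB: "u \<in> B" for j u
  proof -
    have u: "u \<in> tempered" using bounded_setsD(1)[OF B] uB by blast
    have ru: "rapid (\<lambda>k. a k * u (hermite_fun k))" if "rapid a" for a
      by (rule rapid_mult[OF that poly_growth_tempered[OF u]])
    have eq: "(Ws j - W) u = hermite_series (\<lambda>k. \<delta> j k * u (hermite_fun k))"
    proof -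
      have "(Ws j - W) u = hermite_series (\<lambda>k. cs j k * u (hermite_fun k)) - hermite_series (\<lambda>k. c k * u (hermite_fun k))"
        by (simp add: Ws(2)[OF u] W(2)[OF u] diagonal_operator_def)
      then show ?thesis unfolding hermite_series_diff[OF ru[OF cs] ru[OF c]] \<delta>_def by (simp only: left_diff_distrib)
    qed
    have r\<delta>: "rapid (\<lambda>k. \<delta> j k * u (hermite_fun k))"
    proof (rule ru, unfold rapid_def, intro allI)
      fix N
      show "\<exists>C. \<forall>k. norm (\<delta> j k) * weight k ^ N \<le> C" using lim[of N] unfolding \<delta>_def by blast
    qed
    show "0 \<le> q ((Ws j - W) u)" unfolding eq by (rule seminorm_nonneg[OF seminorm_schwartz q hermite_series_schwartz[OF r\<delta>]])
    have "norm (\<delta> j k * u (hermite_fun k)) * weight k ^ (M + 2) \<le> K * sqrt (\<epsilon> j)" for k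
    proof -
      have m: "(\<lambda>x. d j k * hermite_fun k x) \<in> D" unfolding D_def by (rule image_eqI[of _ _ "(j, k)"]) auto
      have "norm (d j k * u (hermite_fun k)) \<le> K" unfolding tempered_scale_hermite[OF u, symmetric] by (rule K(2)[OF uB m])
      then have b: "sqrt (norm (\<delta> j k)) * norm (u (hermite_fun k)) \<le> K" by (simp add: d_def norm_mult)
      have "norm (\<delta> j k * u (hermite_fun k)) * weight k ^ (M + 2)
          = (sqrt (norm (\<delta> j k)) * norm (u (hermite_fun k))) * (sqrt (norm (\<delta> j k)) * weight k ^ (M + 2))"
      proof -
        have s: "sqrt (norm (\<delta> j k)) * sqrt (norm (\<delta> j k)) = norm (\<delta> j k)" by simp
        show ?thesis unfolding norm_mult by (subst s[symmetric]) (simp only: mult_ac)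
      qed
      also have "sqrt (norm (\<delta> j k)) * weight k ^ (M + 2) = sqrt (norm (\<delta> j k) * weight k ^ (2 * (M + 2)))"
        unfolding real_sqrt_mult power_even_eq using weight_pos[of k] by simp
      also have "(sqrt (norm (\<delta> j k)) * norm (u (hermite_fun k))) * \<dots> \<le> K * sqrt (\<epsilon> j)"
        using b \<epsilon>(2)[of j k] K(1) weight_pos[of k] by (intro mult_mono real_sqrt_le_mono) (simp_all add: less_imp_le)
      finally show ?thesis .
    qed
    then show "q ((Ws j - W) u) \<le> C * (K * sqrt (\<epsilon> j))" unfolding eq using C(2) r\<delta> by blast
  qed
  obtain u0 where u0: "u0 \<in> B" using bounded_setsD(2)[OF B] by blast
  have le1: "(SUP u\<in>B. q ((Ws j - W) u)) \<le> C * (K * sqrt (\<epsilon> j))" for j by (rule cSUP_least[OF bounded_setsD(2)[OF B]]) (rule le(2))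
  have le0: "0 \<le> (SUP u\<in>B. q ((Ws j - W) u))" for j
  proof (rule order_trans[OF le(1)[OF u0]])
    show "q ((Ws j - W) u0) \<le> (SUP u\<in>B. q ((Ws j - W) u))"
      by (intro cSUP_upper u0 bdd_aboveI2[where M = "C * (K * sqrt (\<epsilon> j))"] le(2))
  qed
  have "(\<lambda>j. C * (K * sqrt (\<epsilon> j))) \<longlonglongrightarrow> C * (K * sqrt 0)" by (intro tendsto_intros \<epsilon>(1))
  then have "(\<lambda>j. C * (K * sqrt (\<epsilon> j))) \<longlonglongrightarrow> 0" by simp
  from tendsto_sandwich[OF always_eventually[OF allI[OF le0]] always_eventually[OF allI[OF le1]] tendsto_const this]
  show "(\<lambda>j. r (Ws j - W)) \<longlonglongrightarrow> 0" unfolding r .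
qed

text \<open>Existence and uniqueness of the extension, the latter as an equality on
  \<open>tempered\<close>, where alone \<open>weyl_extension\<close> determines the
  operator.\<close>

lemma weyl_extension_radial:
  fixes f :: "real ^ 'n::finite \<Rightarrow> complex"
  assumes f: "f \<in> schwartz_orthant"
  shows "weyl_extension (radial_symbol f) (diagonal_operator (\<lambda>k. radial_coeff k (dilate2 f)))"
    and "weyl_extension (radial_symbol f) W \<Longrightarrow> u \<in> tempered \<Longrightarrow> W u = diagonal_operator (\<lambda>k. radial_coeff k (dilate2 f)) u"
proof -
  have c: "rapid (\<lambda>k. radial_coeff k (dilate2 f))"
    by (intro rapid_radial_coeff schwartz_orthant_smooth dilate2_schwartz_orthant f)
  show "weyl_extension (radial_symbol f) (diagonal_operator (\<lambda>k. radial_coeff k (dilate2 f)))" unfolding weyl_extension_def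
  proof (intro conjI ballI)
    fix g :: "real ^ 'n \<Rightarrow> complex" assume "g \<in> schwartz"
    then show "diagonal_operator (\<lambda>k. radial_coeff k (dilate2 f)) (distribution_of g) = weyl (radial_symbol f) g"
      by (simp add: diagonal_operator_def weyl_radial[OF f] distribution_of_hermite_fun)
  qed (rule diagonal_operator_continuous[OF c])
  assume W: "weyl_extension (radial_symbol f) W" and u: "u \<in> tempered"
  have "W (distribution_of (hermite_fun k)) = (\<lambda>x. radial_coeff k (dilate2 f) * hermite_fun k x)" for k
    using W weyl_radial_hermite[OF f] hermite_fun_schwartz unfolding weyl_extension_def by metis
  from diagonal_operator_eq_series[OF _ this c u] W
  show "W u = diagonal_operator (\<lambda>k. radial_coeff k (dilate2 f)) u" unfolding weyl_extension_def diagonal_operator_def by blast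
qed

text \<open>The decay estimate is linear in finitely many seminorms, so applied to the difference it
  bounds the weighted eigenvalue differences by one null sequence, uniformly in
  \<open>k\<close>.\<close>

lemma radial_coeff_limit:
  fixes F :: "real ^ 'n::finite \<Rightarrow> complex"
  assumes F: "F \<in> schwartz_orthant" and Fs: "\<And>j :: nat. Fs j \<in> schwartz_orthant"
    and lim: "limitin schwartz_orthant_topology Fs F sequentially"
  shows "\<exists>\<epsilon>. \<epsilon> \<longlonglongrightarrow> 0 \<and> (\<forall>j k. norm (radial_coeff k (Fs j) - radial_coeff k F) * weight k ^ M \<le> \<epsilon> j)"
proof -
  obtain P C where P: "finite P" "P \<subseteq> schwartz_seminorms pos_orthant" "0 \<le> C"
    "\<forall>f\<in>orthant_smooth. \<forall>k :: nat ^ 'n. norm (radial_coeff k f) * weight k ^ M \<le> C * (\<Sum>p\<in>P. p f)"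
    using radial_coeff_decay[of M] by (elim exE conjE) (rule that)
  have d: "Fs j - F \<in> orthant_smooth" for j
    using orthant_smooth_diff[OF Fs[THEN schwartz_orthant_smooth] F[THEN schwartz_orthant_smooth]] by (simp add: fun_diff_def)
  have "(\<lambda>j. p (Fs j - F)) \<longlonglongrightarrow> 0" if p: "p \<in> P" for p
  proof (rule limitin_seminormD[OF lim[unfolded schwartz_orthant_topology_def] F])
    show p': "p \<in> schwartz_seminorms pos_orthant" using p P(2) by blast
    show "p (F - F) = 0" using schwartz_seminorm_zero[OF p' pos_orthant_nonempty] by (simp add: fun_diff_def)
    show "0 \<le> p (Fs j - F)" for j using schwartz_seminorm_nonneg[OF _ p' pos_orthant_nonempty] d[of j] by (simp add: orthant_smooth_def)
  qed
  then have "(\<lambda>j. C * (\<Sum>p\<in>P. p (Fs j - F))) \<longlonglongrightarrow> 0" by (intro tendsto_mult_right_zero tendsto_null_sum)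
  moreover have "norm (radial_coeff k (Fs j) - radial_coeff k F) * weight k ^ M \<le> C * (\<Sum>p\<in>P. p (Fs j - F))" for j k
  proof -
    have "radial_coeff k (Fs j - F) = radial_coeff k (Fs j) - radial_coeff k F"
      using radial_coeff_diff[OF Fs[THEN schwartz_orthant_smooth] F[THEN schwartz_orthant_smooth], of k j] by (simp add: fun_diff_def)
    moreover have "norm (radial_coeff k (Fs j - F)) * weight k ^ M \<le> C * (\<Sum>p\<in>P. p (Fs j - F))" using P(4) d[of j] by blast
    ultimately show ?thesis by simp
  qed
  ultimately show ?thesis by blast
qed

text \<open>The formula and the convergence are asserted for every extension, which makes them
  independent of a choice; on \<open>tempered\<close> all extensions coincide by
  \<open>weyl_extension_radial\<close>.\<close>

theorem theorem7p4:
  fixes \<sigma> :: "real ^ 'n::finite \<Rightarrow> complex"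
  assumes "\<sigma> \<in> schwartz_orthant"
  shows "radial_symbol \<sigma> \<in> schwartz
    \<and> (\<exists>W. weyl_extension (radial_symbol \<sigma>) W)
    \<and> (\<forall>W. weyl_extension (radial_symbol \<sigma>) W \<longrightarrow>
        (\<forall>f\<in>tempered. \<forall>g\<in>tempered.
           (\<lambda>k. f (hermite_fun k) * g (hermite_fun k) * laguerre_coeff \<sigma> k) summable_on UNIV
           \<and> g (W f) = complex_of_real ((2 * pi) powr (- (real CARD('n) / 2))) *
               (\<Sum>\<^sub>\<infinity>k. f (hermite_fun k) * g (hermite_fun k) * laguerre_coeff \<sigma> k))
        \<and> (\<forall>\<sigma>s Ws. (\<forall>j. \<sigma>s j \<in> schwartz_orthant)
             \<and> (\<forall>j. weyl_extension (radial_symbol (\<sigma>s j)) (Ws j))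
             \<and> limitin schwartz_orthant_topology (\<lambda>j. dilate2 (\<sigma>s j)) (dilate2 \<sigma>) sequentially
           \<longrightarrow> limitin dual_to_schwartz_topology Ws W sequentially))"
proof (intro conjI allI impI ballI)
  show "radial_symbol \<sigma> \<in> schwartz" by (rule radial_symbol_schwartz[OF assms])
  show "\<exists>W. weyl_extension (radial_symbol \<sigma>) W" using weyl_extension_radial(1)[OF assms] by blast
  fix W assume W: "weyl_extension (radial_symbol \<sigma>) W"
  have c: "rapid (\<lambda>k. radial_coeff k (dilate2 f))" if "f \<in> schwartz_orthant" for f :: "real ^ 'n \<Rightarrow> complex"
    by (intro rapid_radial_coeff schwartz_orthant_smooth dilate2_schwartz_orthant that)
  {
    fix f g :: "(real ^ 'n \<Rightarrow> complex) \<Rightarrow> complex" assume f: "f \<in> tempered" and g: "g \<in> tempered"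
    let ?s = "complex_of_real ((2 * pi) powr (- (real CARD('n) / 2)))"
    let ?t = "\<lambda>k. f (hermite_fun k) * g (hermite_fun k) * laguerre_coeff \<sigma> k"
    have s: "?s \<noteq> 0" by simp
    have "rapid (\<lambda>k. radial_coeff k (dilate2 \<sigma>) * f (hermite_fun k))"
      by (rule rapid_mult[OF c[OF assms] poly_growth_tempered[OF f]])
    from tempered_hermite_series[OF g this]
    have "((\<lambda>k. ?s * ?t k) has_sum g (W f)) UNIV"
      unfolding weyl_extension_radial(2)[OF assms W f] diagonal_operator_def laguerre_coeff_eq_radial_coeff[OF assms, symmetric]
      by (simp only: mult_ac)
    \<comment> \<open>The series is known with the normalising factor inside each term; dividing by
      this nonzero factor gives summability of the series as stated.\<close>
    from has_sum_cmult_right[OF this, of "inverse ?s"]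
    have t: "(?t has_sum (inverse ?s * g (W f))) UNIV" using s by (simp only: mult.assoc[symmetric] left_inverse mult_1_left not_False_eq_True)
    then show "?t summable_on UNIV" by (rule has_sum_imp_summable)
    show "g (W f) = ?s * (\<Sum>\<^sub>\<infinity>k. ?t k)" unfolding infsumI[OF t] mult.assoc[symmetric] right_inverse[OF s] by simp
  next
    fix \<sigma>s Ws
    assume H: "(\<forall>j. \<sigma>s j \<in> schwartz_orthant) \<and> (\<forall>j. weyl_extension (radial_symbol (\<sigma>s j)) (Ws j))
      \<and> limitin schwartz_orthant_topology (\<lambda>j. dilate2 (\<sigma>s j)) (dilate2 \<sigma>) sequentially"
    then have Ws: "weyl_extension (radial_symbol (\<sigma>s j)) (Ws j)" and \<sigma>s: "\<sigma>s j \<in> schwartz_orthant" for j by auto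
    show "limitin dual_to_schwartz_topology Ws W sequentially"
    proof (rule diagonal_operator_limit[OF c[OF assms] c[OF \<sigma>s] radial_coeff_limit])
      show "W u = diagonal_operator (\<lambda>k. radial_coeff k (dilate2 \<sigma>)) u" if "u \<in> tempered" for u
        by (rule weyl_extension_radial(2)[OF assms W that])
      show "Ws j u = diagonal_operator (\<lambda>k. radial_coeff k (dilate2 (\<sigma>s j))) u" if "u \<in> tempered" for j u
        by (rule weyl_extension_radial(2)[OF \<sigma>s Ws that])
    qed (use W Ws H dilate2_schwartz_orthant[OF assms] dilate2_schwartz_orthant[OF \<sigma>s] in \<open>auto simp: weyl_extension_def\<close>)
  }
qed

end
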